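(* Let $\mathcal{A}$ be a locally noetherian Grothendieck category that is locally stable, and let $\delta$ be an abstract local cohomology functor on $\mathcal{D}^+(\mathcal{A})$. Then there exists an open subset $W$ of $\mathrm{ASpec}\,\mathcal{A}$ such that $\delta=\mathbf{R}\Gamma_W$ (equality meaning isomorphism of functors).
   Context: A nonzero object $H$ of $\mathcal{A}$ is monoform if for every nonzero subobject $N$ of $H$, no nonzero subobject of $H$ is isomorphic to a subobject of $H/N$. Two monoform objects are atom-equivalent if they have isomorphic nonzero subobjects (this is an equivalence relation); the class of $H$ is denoted $\overline{H}$ and called an atom; $\mathrm{ASpec}\,\mathcal{A}$ is the set of atoms. For an object $M$, $\mathrm{ASupp}(M)$ is the set of atoms $\alpha$ such that some $H\in\alpha$ is a subquotient of $M$. A subset $\Phi\subseteq\mathrm{ASpec}\,\mathcal{A}$ is open if for every $\alpha\in\Phi$ there is $H\in\alpha$ with $\mathrm{ASupp}(H)\subseteq\Phi$. For an open subset $W$, $\Gamma_W(M)$ is the largest subobject of $M$ with $\mathrm{ASupp}(\Gamma_W(M))\subseteq W$; $\Gamma_W$ is a left exact radical functor and $\mathbf{R}\Gamma_W:\mathcal{D}^+(\mathcal{A})\to\mathcal{D}^+(\mathcal{A})$ is its right derived functor. A localizing subcategory is a Serre subcategory whose quotient functor has a right adjoint; $\mathcal{A}$ is locally stable if every localizing subcategory of $\mathcal{A}$ is closed under injective envelopes taken in $\mathcal{A}$. $\mathcal{D}^+(\mathcal{A})$ is the derived category of left bounded complexes of objects of $\mathcal{A}$. A triangle functor is an additive functor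 commuting with the shift $[1]$ up to isomorphism and preserving triangles. For a triangle functor $\delta:\mathcal{T}\to\mathcal{T}$ with $\mathcal{T}=\mathcal{D}^+(\mathcal{A})$, $\mathrm{Im}(\delta)$ is the full subcategory of objects isomorphic to $\delta(X)$ for some $X$, and $\mathrm{Ker}(\delta)$ is the full subcategory of objects $X$ with $\delta(X)\cong0$. $\delta$ is an abstract local cohomology functor if: (1) the natural embedding $i:\mathrm{Im}(\delta)\to\mathcal{T}$ has a right adjoint $\rho:\mathcal{T}\to\mathrm{Im}(\delta)$ and $\delta\cong i\circ\rho$ (hence, by a theorem of Miyachi, $(\mathrm{Im}(\delta),\mathrm{Ker}(\delta))$ is a stable t-structure on $\mathcal{T}$, i.e. a pair $(\mathcal{U},\mathcal{V})$ of full triangulated subcategories with $\mathrm{Hom}_{\mathcal{T}}(U,V)=0$ for all $U\in\mathcal{U}$, $V\in\mathcal{V}$, and such that every $X$ fits in a triangle $U\to X\to V\to U[1]$ with $U\in\mathcal{U}$, $V\in\mathcal{V}$); (2) every indecomposable injective object of $\mathcal{A}$ (viewed as a complex in degree $0$) belongs either to $\mathrm{Im}(\delta)$ or to $\mathrm{Ker}(\delta)$. *)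

theory Defs
  imports "HOL-Algebra.Group"
begin

unbundle cardinal_syntax

section \<open>Universes\<close>

text \<open>
  Categories are taken relative to a fixed Grothendieck universe, given by its cardinal
  \<open>\<kappa>\<close>, a strongly inaccessible cardinal; a set of any type is small if its cardinality is
  below \<open>\<kappa>\<close>.  Every small cardinal is realized by a subset of \<open>Field \<kappa>\<close>, so that
  index sets and index categories may be taken over the underlying type of \<open>\<kappa>\<close>.
\<close>

definition universe_cardinal :: "'u rel \<Rightarrow> bool" where
  "universe_cardinal \<kappa> \<longleftrightarrow>
     Card_order \<kappa> \<and> natLeq <o \<kappa> \<and> regularCard \<kappa> \<and>
     (\<forall>X \<subseteq> Field \<kappa>. |X| <o \<kappa> \<longrightarrow> |Pow X| <o \<kappa>)"

definition small :: "'u rel \<Rightarrow> 'a set \<Rightarrow> bool" where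
  "small \<kappa> X \<longleftrightarrow> |X| <o \<kappa>"


section \<open>Categories and functors\<close>

record ('o, 'm) cat =
  Obj :: "'o set"
  Arr :: "'m set"
  Dom :: "'m \<Rightarrow> 'o"
  Cod :: "'m \<Rightarrow> 'o"
  Idt :: "'o \<Rightarrow> 'm"
  Cmp :: "'m \<Rightarrow> 'm \<Rightarrow> 'm"  (infixl "\<cdot>\<index>" 70)

definition Hom :: "('o, 'm, 'z) cat_scheme \<Rightarrow> 'o \<Rightarrow> 'o \<Rightarrow> 'm set" where
  "Hom C X Y = {f \<in> Arr C. Dom C f = X \<and> Cod C f = Y}"

locale category =
  fixes C :: "('o, 'm, 'z) cat_scheme" (structure)
  assumes Dom_Obj: "f \<in> Arr C \<Longrightarrow> Dom C f \<in> Obj C"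
    and Cod_Obj: "f \<in> Arr C \<Longrightarrow> Cod C f \<in> Obj C"
    and Idt_Hom: "X \<in> Obj C \<Longrightarrow> Idt C X \<in> Hom C X X"
    and Cmp_Hom: "f \<in> Hom C X Y \<Longrightarrow> g \<in> Hom C Y Z \<Longrightarrow> g \<cdot> f \<in> Hom C X Z"
    and Cmp_Idt: "f \<in> Hom C X Y \<Longrightarrow> f \<cdot> Idt C X = f"
    and Idt_Cmp: "f \<in> Hom C X Y \<Longrightarrow> Idt C Y \<cdot> f = f"
    and Cmp_assoc: "f \<in> Hom C X Y \<Longrightarrow> g \<in> Hom C Y Z \<Longrightarrow> h \<in> Hom C Z V \<Longrightarrow>
                    h \<cdot> (g \<cdot> f) = (h \<cdot> g) \<cdot> f"

definition is_iso :: "('o, 'm, 'z) cat_scheme \<Rightarrow> 'm \<Rightarrow> bool" where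
  "is_iso C f \<longleftrightarrow> f \<in> Arr C \<and>
     (\<exists>g \<in> Hom C (Cod C f) (Dom C f).
        g \<cdot>\<^bsub>C\<^esub> f = Idt C (Dom C f) \<and> f \<cdot>\<^bsub>C\<^esub> g = Idt C (Cod C f))"

definition isomorphic :: "('o, 'm, 'z) cat_scheme \<Rightarrow> 'o \<Rightarrow> 'o \<Rightarrow> bool" where
  "isomorphic C X Y \<longleftrightarrow> (\<exists>f \<in> Hom C X Y. is_iso C f)"

definition is_mono :: "('o, 'm, 'z) cat_scheme \<Rightarrow> 'm \<Rightarrow> bool" where
  "is_mono C f \<longleftrightarrow> f \<in> Arr C \<and>
     (\<forall>X \<in> Obj C. \<forall>g \<in> Hom C X (Dom C f). \<forall>h \<in> Hom C X (Dom C f).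
        f \<cdot>\<^bsub>C\<^esub> g = f \<cdot>\<^bsub>C\<^esub> h \<longrightarrow> g = h)"

definition is_epi :: "('o, 'm, 'z) cat_scheme \<Rightarrow> 'm \<Rightarrow> bool" where
  "is_epi C f \<longleftrightarrow> f \<in> Arr C \<and>
     (\<forall>Y \<in> Obj C. \<forall>g \<in> Hom C (Cod C f) Y. \<forall>h \<in> Hom C (Cod C f) Y.
        g \<cdot>\<^bsub>C\<^esub> f = h \<cdot>\<^bsub>C\<^esub> f \<longrightarrow> g = h)"

definition is_zero :: "('o, 'm, 'z) cat_scheme \<Rightarrow> 'o \<Rightarrow> bool" where
  "is_zero C Z \<longleftrightarrow> Z \<in> Obj C \<and>
     (\<forall>X \<in> Obj C. (\<exists>!f. f \<in> Hom C X Z) \<and> (\<exists>!f. f \<in> Hom C Z X))"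

definition is_coproduct ::
  "('o, 'm, 'z) cat_scheme \<Rightarrow> 'i set \<Rightarrow> ('i \<Rightarrow> 'o) \<Rightarrow> 'o \<Rightarrow> ('i \<Rightarrow> 'm) \<Rightarrow> bool" where
  "is_coproduct C I X P \<iota> \<longleftrightarrow> P \<in> Obj C \<and> (\<forall>i \<in> I. \<iota> i \<in> Hom C (X i) P) \<and>
     (\<forall>Q \<in> Obj C. \<forall>f. (\<forall>i \<in> I. f i \<in> Hom C (X i) Q) \<longrightarrow>
        (\<exists>!h. h \<in> Hom C P Q \<and> (\<forall>i \<in> I. h \<cdot>\<^bsub>C\<^esub> \<iota> i = f i)))"

definition is_generating_set :: "('o, 'm, 'z) cat_scheme \<Rightarrow> 'o set \<Rightarrow> bool" where
  "is_generating_set C \<G> \<longleftrightarrow> \<G> \<subseteq> Obj C \<and>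
     (\<forall>X \<in> Obj C. \<forall>Y \<in> Obj C. \<forall>f \<in> Hom C X Y. \<forall>g \<in> Hom C X Y. f \<noteq> g \<longrightarrow>
        (\<exists>G \<in> \<G>. \<exists>h \<in> Hom C G X. f \<cdot>\<^bsub>C\<^esub> h \<noteq> g \<cdot>\<^bsub>C\<^esub> h))"

definition full_subcat :: "('o, 'm, 'z) cat_scheme \<Rightarrow> 'o set \<Rightarrow> ('o, 'm, 'z) cat_scheme" where
  "full_subcat C P =
     C\<lparr>Obj := Obj C \<inter> P, Arr := {f \<in> Arr C. Dom C f \<in> P \<and> Cod C f \<in> P}\<rparr>"

text \<open>
  Values of a functor (or of a transformation) outside the objects and arrows of its source
  category are irrelevant.
\<close>

record ('o1, 'm1, 'o2, 'm2) cfunctor =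
  FO :: "'o1 \<Rightarrow> 'o2"
  FA :: "'m1 \<Rightarrow> 'm2"

definition is_functor :: "('o1, 'm1, 'z1) cat_scheme \<Rightarrow> ('o2, 'm2, 'z2) cat_scheme \<Rightarrow>
    ('o1, 'm1, 'o2, 'm2) cfunctor \<Rightarrow> bool" where
  "is_functor C D F \<longleftrightarrow>
     (\<forall>X \<in> Obj C. FO F X \<in> Obj D) \<and>
     (\<forall>f \<in> Arr C. FA F f \<in> Hom D (FO F (Dom C f)) (FO F (Cod C f))) \<and>
     (\<forall>X \<in> Obj C. FA F (Idt C X) = Idt D (FO F X)) \<and>
     (\<forall>f \<in> Arr C. \<forall>g \<in> Arr C. Cod C f = Dom C g \<longrightarrow>
        FA F (g \<cdot>\<^bsub>C\<^esub> f) = FA F g \<cdot>\<^bsub>D\<^esub> FA F f)"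

definition fcomp :: "('o2, 'm2, 'o3, 'm3) cfunctor \<Rightarrow> ('o1, 'm1, 'o2, 'm2) cfunctor \<Rightarrow>
    ('o1, 'm1, 'o3, 'm3) cfunctor"  (infixl "\<circ>\<^sub>F" 55) where
  "G \<circ>\<^sub>F F = \<lparr>FO = FO G \<circ> FO F, FA = FA G \<circ> FA F\<rparr>"

definition fincl :: "('o, 'm, 'o, 'm) cfunctor" where
  "fincl = \<lparr>FO = id, FA = id\<rparr>"

definition is_nat_trans :: "('o1, 'm1, 'z1) cat_scheme \<Rightarrow> ('o2, 'm2, 'z2) cat_scheme \<Rightarrow>
    ('o1, 'm1, 'o2, 'm2) cfunctor \<Rightarrow> ('o1, 'm1, 'o2, 'm2) cfunctor \<Rightarrow> ('o1 \<Rightarrow> 'm2) \<Rightarrow> bool" where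
  "is_nat_trans C D F G \<eta> \<longleftrightarrow>
     (\<forall>X \<in> Obj C. \<eta> X \<in> Hom D (FO F X) (FO G X)) \<and>
     (\<forall>f \<in> Arr C. \<eta> (Cod C f) \<cdot>\<^bsub>D\<^esub> FA F f = FA G f \<cdot>\<^bsub>D\<^esub> \<eta> (Dom C f))"

definition is_nat_iso :: "('o1, 'm1, 'z1) cat_scheme \<Rightarrow> ('o2, 'm2, 'z2) cat_scheme \<Rightarrow>
    ('o1, 'm1, 'o2, 'm2) cfunctor \<Rightarrow> ('o1, 'm1, 'o2, 'm2) cfunctor \<Rightarrow> ('o1 \<Rightarrow> 'm2) \<Rightarrow> bool" where
  "is_nat_iso C D F G \<eta> \<longleftrightarrow> is_nat_trans C D F G \<eta> \<and> (\<forall>X \<in> Obj C. is_iso D (\<eta> X))"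

definition nat_isomorphic :: "('o1, 'm1, 'z1) cat_scheme \<Rightarrow> ('o2, 'm2, 'z2) cat_scheme \<Rightarrow>
    ('o1, 'm1, 'o2, 'm2) cfunctor \<Rightarrow> ('o1, 'm1, 'o2, 'm2) cfunctor \<Rightarrow> bool" where
  "nat_isomorphic C D F G \<longleftrightarrow> (\<exists>\<eta>. is_nat_iso C D F G \<eta>)"

definition is_right_adjoint :: "('o1, 'm1, 'z1) cat_scheme \<Rightarrow> ('o2, 'm2, 'z2) cat_scheme \<Rightarrow>
    ('o1, 'm1, 'o2, 'm2) cfunctor \<Rightarrow> ('o2, 'm2, 'o1, 'm1) cfunctor \<Rightarrow> bool" where
  "is_right_adjoint C D F G \<longleftrightarrow> is_functor C D F \<and> is_functor D C G \<and>
     (\<exists>\<Phi>. (\<forall>X \<in> Obj C. \<forall>Y \<in> Obj D.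
             bij_betw (\<Phi> X Y) (Hom D (FO F X) Y) (Hom C X (FO G Y))) \<and>
          (\<forall>f \<in> Arr C. \<forall>g \<in> Arr D. \<forall>h \<in> Hom D (FO F (Cod C f)) (Dom D g).
             \<Phi> (Dom C f) (Cod D g) (g \<cdot>\<^bsub>D\<^esub> h \<cdot>\<^bsub>D\<^esub> FA F f) =
             FA G g \<cdot>\<^bsub>C\<^esub> \<Phi> (Cod C f) (Dom D g) h \<cdot>\<^bsub>C\<^esub> f))"

definition is_cocone :: "('j, 'k, 'y) cat_scheme \<Rightarrow> ('o, 'm, 'z) cat_scheme \<Rightarrow>
    ('j, 'k, 'o, 'm) cfunctor \<Rightarrow> 'o \<Rightarrow> ('j \<Rightarrow> 'm) \<Rightarrow> bool" where
  "is_cocone J C F L ls \<longleftrightarrow> L \<in> Obj C \<and> (\<forall>j \<in> Obj J. ls j \<in> Hom C (FO F j) L) \<and>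
     (\<forall>u \<in> Arr J. ls (Cod J u) \<cdot>\<^bsub>C\<^esub> FA F u = ls (Dom J u))"

definition is_colimit :: "('j, 'k, 'y) cat_scheme \<Rightarrow> ('o, 'm, 'z) cat_scheme \<Rightarrow>
    ('j, 'k, 'o, 'm) cfunctor \<Rightarrow> 'o \<Rightarrow> ('j \<Rightarrow> 'm) \<Rightarrow> bool" where
  "is_colimit J C F L ls \<longleftrightarrow> is_cocone J C F L ls \<and>
     (\<forall>M ms. is_cocone J C F M ms \<longrightarrow>
        (\<exists>!h. h \<in> Hom C L M \<and> (\<forall>j \<in> Obj J. h \<cdot>\<^bsub>C\<^esub> ls j = ms j)))"

definition is_filtered :: "('j, 'k, 'y) cat_scheme \<Rightarrow> bool" where
  "is_filtered J \<longleftrightarrow> category J \<and> Obj J \<noteq> {} \<and>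
     (\<forall>i \<in> Obj J. \<forall>j \<in> Obj J. \<exists>k \<in> Obj J. Hom J i k \<noteq> {} \<and> Hom J j k \<noteq> {}) \<and>
     (\<forall>i \<in> Obj J. \<forall>j \<in> Obj J. \<forall>u \<in> Hom J i j. \<forall>v \<in> Hom J i j.
        \<exists>k \<in> Obj J. \<exists>w \<in> Hom J j k. w \<cdot>\<^bsub>J\<^esub> u = w \<cdot>\<^bsub>J\<^esub> v)"


section \<open>Abelian categories\<close>

record ('o, 'm) acat = "('o, 'm) cat" +
  Add :: "'m \<Rightarrow> 'm \<Rightarrow> 'm"  (infixl "\<boxplus>\<index>" 65)
  Zer :: "'o \<Rightarrow> 'o \<Rightarrow> 'm"

definition hom_group :: "('o, 'm, 'z) acat_scheme \<Rightarrow> 'o \<Rightarrow> 'o \<Rightarrow> 'm monoid" where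
  "hom_group C X Y = \<lparr>carrier = Hom C X Y, mult = Add C, one = Zer C X Y\<rparr>"

definition Neg :: "('o, 'm, 'z) acat_scheme \<Rightarrow> 'm \<Rightarrow> 'm" where
  "Neg C f = inv\<^bsub>hom_group C (Dom C f) (Cod C f)\<^esub> f"

locale preadditive = category C for C :: "('o, 'm, 'z) acat_scheme" (structure) +
  assumes hom_comm_group: "X \<in> Obj C \<Longrightarrow> Y \<in> Obj C \<Longrightarrow> comm_group (hom_group C X Y)"
    and Cmp_Add: "f \<in> Hom C X Y \<Longrightarrow> f' \<in> Hom C X Y \<Longrightarrow> g \<in> Hom C Y Z \<Longrightarrow>
                  g \<cdot> (f \<boxplus> f') = (g \<cdot> f) \<boxplus> (g \<cdot> f')"
    and Add_Cmp: "f \<in> Hom C X Y \<Longrightarrow> g \<in> Hom C Y Z \<Longrightarrow> g' \<in> Hom C Y Z \<Longrightarrow>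
                  (g \<boxplus> g') \<cdot> f = (g \<cdot> f) \<boxplus> (g' \<cdot> f)"

definition is_biproduct :: "('o, 'm, 'z) acat_scheme \<Rightarrow> 'o \<Rightarrow> 'o \<Rightarrow> 'o \<Rightarrow>
    'm \<Rightarrow> 'm \<Rightarrow> 'm \<Rightarrow> 'm \<Rightarrow> bool" where
  "is_biproduct C X Y B i j p q \<longleftrightarrow> B \<in> Obj C \<and>
     i \<in> Hom C X B \<and> j \<in> Hom C Y B \<and> p \<in> Hom C B X \<and> q \<in> Hom C B Y \<and>
     p \<cdot>\<^bsub>C\<^esub> i = Idt C X \<and> q \<cdot>\<^bsub>C\<^esub> j = Idt C Y \<and>
     q \<cdot>\<^bsub>C\<^esub> i = Zer C X Y \<and> p \<cdot>\<^bsub>C\<^esub> j = Zer C Y X \<and>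
     (i \<cdot>\<^bsub>C\<^esub> p) \<boxplus>\<^bsub>C\<^esub> (j \<cdot>\<^bsub>C\<^esub> q) = Idt C B"

definition is_kernel :: "('o, 'm, 'z) acat_scheme \<Rightarrow> 'm \<Rightarrow> 'm \<Rightarrow> bool" where
  "is_kernel C k f \<longleftrightarrow> k \<in> Arr C \<and> f \<in> Arr C \<and> Cod C k = Dom C f \<and>
     f \<cdot>\<^bsub>C\<^esub> k = Zer C (Dom C k) (Cod C f) \<and>
     (\<forall>X \<in> Obj C. \<forall>g \<in> Hom C X (Dom C f). f \<cdot>\<^bsub>C\<^esub> g = Zer C X (Cod C f) \<longrightarrow>
        (\<exists>!h. h \<in> Hom C X (Dom C k) \<and> k \<cdot>\<^bsub>C\<^esub> h = g))"

definition is_cokernel :: "('o, 'm, 'z) acat_scheme \<Rightarrow> 'm \<Rightarrow> 'm \<Rightarrow> bool" where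
  "is_cokernel C q f \<longleftrightarrow> q \<in> Arr C \<and> f \<in> Arr C \<and> Dom C q = Cod C f \<and>
     q \<cdot>\<^bsub>C\<^esub> f = Zer C (Dom C f) (Cod C q) \<and>
     (\<forall>Y \<in> Obj C. \<forall>g \<in> Hom C (Cod C f) Y. g \<cdot>\<^bsub>C\<^esub> f = Zer C (Dom C f) Y \<longrightarrow>
        (\<exists>!h. h \<in> Hom C (Cod C q) Y \<and> h \<cdot>\<^bsub>C\<^esub> q = g))"

locale abelian_category = preadditive C for C :: "('o, 'm, 'z) acat_scheme" (structure) +
  assumes ex_zero: "\<exists>Z. is_zero C Z"
    and ex_biproduct: "X \<in> Obj C \<Longrightarrow> Y \<in> Obj C \<Longrightarrow> \<exists>B i j p q. is_biproduct C X Y B i j p q"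
    and ex_kernel: "f \<in> Arr C \<Longrightarrow> \<exists>k. is_kernel C k f"
    and ex_cokernel: "f \<in> Arr C \<Longrightarrow> \<exists>q. is_cokernel C q f"
    and mono_is_kernel: "is_mono C f \<Longrightarrow> \<exists>g. is_kernel C f g"
    and epi_is_cokernel: "is_epi C f \<Longrightarrow> \<exists>g. is_cokernel C f g"

definition short_exact :: "('o, 'm, 'z) acat_scheme \<Rightarrow> 'm \<Rightarrow> 'm \<Rightarrow> bool" where
  "short_exact C f g \<longleftrightarrow> is_mono C f \<and> is_epi C g \<and> is_kernel C f g"

definition is_additive :: "('o1, 'm1, 'z1) acat_scheme \<Rightarrow> ('o2, 'm2, 'z2) acat_scheme \<Rightarrow>
    ('o1, 'm1, 'o2, 'm2) cfunctor \<Rightarrow> bool" where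
  "is_additive C D F \<longleftrightarrow> is_functor C D F \<and>
     (\<forall>X \<in> Obj C. \<forall>Y \<in> Obj C. \<forall>f \<in> Hom C X Y. \<forall>g \<in> Hom C X Y.
        FA F (f \<boxplus>\<^bsub>C\<^esub> g) = FA F f \<boxplus>\<^bsub>D\<^esub> FA F g)"


section \<open>Grothendieck categories\<close>

definition has_small_coproducts :: "'u rel \<Rightarrow> ('o, 'm, 'z) cat_scheme \<Rightarrow> bool" where
  "has_small_coproducts \<kappa> A \<longleftrightarrow>
     (\<forall>(I :: 'u set) X. small \<kappa> I \<and> (\<forall>i \<in> I. X i \<in> Obj A) \<longrightarrow> (\<exists>P \<iota>. is_coproduct A I X P \<iota>))"

definition filtered_colimits_exact :: "'u rel \<Rightarrow> ('o, 'm, 'z) acat_scheme \<Rightarrow> bool" where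
  "filtered_colimits_exact \<kappa> A \<longleftrightarrow>
     (\<forall>(J :: ('u, 'u) cat) F G H \<alpha> \<beta> L M N ls ms ns u v.
        is_filtered J \<and> small \<kappa> (Obj J) \<and> small \<kappa> (Arr J) \<and>
        is_functor J A F \<and> is_functor J A G \<and> is_functor J A H \<and>
        is_nat_trans J A F G \<alpha> \<and> is_nat_trans J A G H \<beta> \<and>
        (\<forall>j \<in> Obj J. short_exact A (\<alpha> j) (\<beta> j)) \<and>
        is_colimit J A F L ls \<and> is_colimit J A G M ms \<and> is_colimit J A H N ns \<and>
        u \<in> Hom A L M \<and> (\<forall>j \<in> Obj J. u \<cdot>\<^bsub>A\<^esub> ls j = ms j \<cdot>\<^bsub>A\<^esub> \<alpha> j) \<and>
        v \<in> Hom A M N \<and> (\<forall>j \<in> Obj J. v \<cdot>\<^bsub>A\<^esub> ms j = ns j \<cdot>\<^bsub>A\<^esub> \<beta> j)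
        \<longrightarrow> short_exact A u v)"

definition grothendieck_category :: "'u rel \<Rightarrow> ('o, 'm, 'z) acat_scheme \<Rightarrow> bool" where
  "grothendieck_category \<kappa> A \<longleftrightarrow>
     abelian_category A \<and>
     (\<forall>X \<in> Obj A. \<forall>Y \<in> Obj A. small \<kappa> (Hom A X Y)) \<and>
     has_small_coproducts \<kappa> A \<and>
     filtered_colimits_exact \<kappa> A \<and>
     (\<exists>G. is_generating_set A {G})"

text \<open>Subobjects are represented by monomorphisms, ordered by factorization.\<close>

definition factors_through :: "('o, 'm, 'z) cat_scheme \<Rightarrow> 'm \<Rightarrow> 'm \<Rightarrow> bool" where
  "factors_through C i j \<longleftrightarrow> (\<exists>h \<in> Hom C (Dom C i) (Dom C j). j \<cdot>\<^bsub>C\<^esub> h = i)"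

definition is_noetherian :: "('o, 'm, 'z) cat_scheme \<Rightarrow> 'o \<Rightarrow> bool" where
  "is_noetherian C M \<longleftrightarrow> M \<in> Obj C \<and>
     (\<forall>s :: nat \<Rightarrow> 'm.
        (\<forall>n. is_mono C (s n) \<and> Cod C (s n) = M \<and> factors_through C (s n) (s (Suc n))) \<longrightarrow>
        (\<exists>N. \<forall>n \<ge> N. factors_through C (s n) (s N)))"

definition locally_noetherian :: "'u rel \<Rightarrow> ('o, 'm, 'z) cat_scheme \<Rightarrow> bool" where
  "locally_noetherian \<kappa> C \<longleftrightarrow>
     (\<exists>\<G>. small \<kappa> \<G> \<and> is_generating_set C \<G> \<and> (\<forall>G \<in> \<G>. is_noetherian C G))"

definition is_injective :: "('o, 'm, 'z) cat_scheme \<Rightarrow> 'o \<Rightarrow> bool" where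
  "is_injective C E \<longleftrightarrow> E \<in> Obj C \<and>
     (\<forall>m. is_mono C m \<longrightarrow> (\<forall>f \<in> Hom C (Dom C m) E. \<exists>g \<in> Hom C (Cod C m) E. g \<cdot>\<^bsub>C\<^esub> m = f))"

definition is_essential_mono :: "('o, 'm, 'z) cat_scheme \<Rightarrow> 'm \<Rightarrow> bool" where
  "is_essential_mono C m \<longleftrightarrow> is_mono C m \<and>
     (\<forall>n. is_mono C n \<and> Cod C n = Cod C m \<and> \<not> is_zero C (Dom C n) \<longrightarrow>
        (\<exists>l. is_mono C l \<and> Cod C l = Cod C m \<and> \<not> is_zero C (Dom C l) \<and>
             factors_through C l m \<and> factors_through C l n))"

definition is_injective_envelope :: "('o, 'm, 'z) cat_scheme \<Rightarrow> 'm \<Rightarrow> bool" where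
  "is_injective_envelope C m \<longleftrightarrow> is_essential_mono C m \<and> is_injective C (Cod C m)"

definition is_indecomposable :: "('o, 'm, 'z) acat_scheme \<Rightarrow> 'o \<Rightarrow> bool" where
  "is_indecomposable C E \<longleftrightarrow> E \<in> Obj C \<and> \<not> is_zero C E \<and>
     (\<forall>X \<in> Obj C. \<forall>Y \<in> Obj C. \<forall>i j p q.
        is_biproduct C X Y E i j p q \<longrightarrow> is_zero C X \<or> is_zero C Y)"


section \<open>Categories of fractions\<close>

text \<open>
  The localization of \<open>C\<close> at a class \<open>S\<close> admitting a calculus of left fractions.  An arrow from
  \<open>X\<close> to \<open>Y\<close> is an equivalence class of roofs \<open>(f, s)\<close> with \<open>f : X \<rightarrow> Z\<close> and \<open>s : Y \<rightarrow> Z\<close> in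
  \<open>S\<close>, which stands for \<open>s\<^sup>-\<^sup>1 f\<close>.
\<close>

definition roofs :: "('o, 'm, 'z) acat_scheme \<Rightarrow> 'm set \<Rightarrow> ('m \<times> 'm) set" where
  "roofs C S = {(f, s). f \<in> Arr C \<and> s \<in> Arr C \<and> s \<in> S \<and> Cod C f = Cod C s}"

definition roof_rel :: "('o, 'm, 'z) acat_scheme \<Rightarrow> 'm set \<Rightarrow> ('m \<times> 'm) rel" where
  "roof_rel C S = {((f, s), (f', s')). (f, s) \<in> roofs C S \<and> (f', s') \<in> roofs C S \<and>
     Dom C f = Dom C f' \<and> Dom C s = Dom C s' \<and>
     (\<exists>Z \<in> Obj C. \<exists>u \<in> Hom C (Cod C f) Z. \<exists>v \<in> Hom C (Cod C f') Z.
        u \<cdot>\<^bsub>C\<^esub> f = v \<cdot>\<^bsub>C\<^esub> f' \<and> u \<cdot>\<^bsub>C\<^esub> s = v \<cdot>\<^bsub>C\<^esub> s' \<and> u \<cdot>\<^bsub>C\<^esub> s \<in> S)}"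

definition frac_cat :: "('o, 'm, 'z) acat_scheme \<Rightarrow> 'm set \<Rightarrow> ('o, ('m \<times> 'm) set) acat" where
  "frac_cat C S =
     \<lparr>Obj = Obj C,
      Arr = roofs C S // roof_rel C S,
      Dom = (\<lambda>a. Dom C (fst (SOME r. r \<in> a))),
      Cod = (\<lambda>a. Dom C (snd (SOME r. r \<in> a))),
      Idt = (\<lambda>X. roof_rel C S `` {(Idt C X, Idt C X)}),
      Cmp = (\<lambda>b a. roof_rel C S ``
        {(g' \<cdot>\<^bsub>C\<^esub> f, s' \<cdot>\<^bsub>C\<^esub> t) | f s g t g' s'.
           (f, s) \<in> a \<and> (g, t) \<in> b \<and>
           g' \<in> Arr C \<and> Dom C g' = Cod C s \<and> s' \<in> S \<and> s' \<in> Arr C \<and> Dom C s' = Cod C g \<and>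
           Cod C g' = Cod C s' \<and> g' \<cdot>\<^bsub>C\<^esub> s = s' \<cdot>\<^bsub>C\<^esub> g}),
      Add = (\<lambda>a b. roof_rel C S `` {(f \<boxplus>\<^bsub>C\<^esub> g, s) | f g s. (f, s) \<in> a \<and> (g, s) \<in> b}),
      Zer = (\<lambda>X Y. roof_rel C S `` {(Zer C X Y, Idt C Y)})\<rparr>"

definition frac_loc :: "('o, 'm, 'z) acat_scheme \<Rightarrow> 'm set \<Rightarrow> ('o, 'm, 'o, ('m \<times> 'm) set) cfunctor" where
  "frac_loc C S = \<lparr>FO = id, FA = (\<lambda>f. roof_rel C S `` {(f, Idt C (Cod C f))})\<rparr>"

text \<open>The functor induced on categories of fractions by a functor that maps \<open>S\<close> into \<open>T\<close>.\<close>

definition frac_functor :: "('o2, 'm2, 'z2) acat_scheme \<Rightarrow> 'm2 set \<Rightarrow> ('o1, 'm1, 'o2, 'm2) cfunctor \<Rightarrow>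
    ('o1, ('m1 \<times> 'm1) set, 'o2, ('m2 \<times> 'm2) set) cfunctor" where
  "frac_functor D T F = \<lparr>FO = FO F, FA = (\<lambda>a. roof_rel D T `` (map_prod (FA F) (FA F) ` a))\<rparr>"

text \<open>The quotient of \<open>C\<close> by a congruence \<open>R\<close> on its arrows, and the functors it induces.\<close>

definition quot_cat :: "('o, 'm, 'z) acat_scheme \<Rightarrow> 'm rel \<Rightarrow> ('o, 'm set) acat" where
  "quot_cat C R =
     \<lparr>Obj = Obj C,
      Arr = Arr C // R,
      Dom = (\<lambda>a. Dom C (SOME f. f \<in> a)),
      Cod = (\<lambda>a. Cod C (SOME f. f \<in> a)),
      Idt = (\<lambda>X. R `` {Idt C X}),
      Cmp = (\<lambda>b a. R `` {g \<cdot>\<^bsub>C\<^esub> f | f g. f \<in> a \<and> g \<in> b}),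
      Add = (\<lambda>a b. R `` {f \<boxplus>\<^bsub>C\<^esub> g | f g. f \<in> a \<and> g \<in> b}),
      Zer = (\<lambda>X Y. R `` {Zer C X Y})\<rparr>"

definition quot_functor :: "'m2 rel \<Rightarrow> ('o1, 'm1, 'o2, 'm2) cfunctor \<Rightarrow>
    ('o1, 'm1 set, 'o2, 'm2 set) cfunctor" where
  "quot_functor R F = \<lparr>FO = FO F, FA = (\<lambda>a. R `` (FA F ` a))\<rparr>"


section \<open>Localizing subcategories\<close>

definition is_serre :: "('o, 'm, 'z) acat_scheme \<Rightarrow> 'o set \<Rightarrow> bool" where
  "is_serre A S \<longleftrightarrow> S \<subseteq> Obj A \<and> S \<noteq> {} \<and>
     (\<forall>f g. short_exact A f g \<longrightarrow> (Cod A f \<in> S \<longleftrightarrow> Dom A f \<in> S \<and> Cod A g \<in> S))"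

text \<open>
  The arrows with kernel and cokernel in the Serre subcategory \<open>S\<close> admit a calculus of fractions,
  and the quotient category is the category of fractions at this class.
\<close>

definition serre_isos :: "('o, 'm, 'z) acat_scheme \<Rightarrow> 'o set \<Rightarrow> 'm set" where
  "serre_isos A S = {f \<in> Arr A. (\<exists>k. is_kernel A k f \<and> Dom A k \<in> S) \<and>
                                (\<exists>q. is_cokernel A q f \<and> Cod A q \<in> S)}"

abbreviation serre_quotient :: "('o, 'm, 'z) acat_scheme \<Rightarrow> 'o set \<Rightarrow> ('o, ('m \<times> 'm) set) acat" where
  "serre_quotient A S \<equiv> frac_cat A (serre_isos A S)"

definition is_localizing :: "('o, 'm, 'z) acat_scheme \<Rightarrow> 'o set \<Rightarrow> bool" where
  "is_localizing A S \<longleftrightarrow> is_serre A S \<and>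
     (\<exists>G. is_right_adjoint A (serre_quotient A S) (frac_loc A (serre_isos A S)) G)"

definition locally_stable :: "('o, 'm, 'z) acat_scheme \<Rightarrow> bool" where
  "locally_stable A \<longleftrightarrow>
     (\<forall>S. is_localizing A S \<longrightarrow>
        (\<forall>m. is_injective_envelope A m \<and> Dom A m \<in> S \<longrightarrow> Cod A m \<in> S))"


section \<open>The atom spectrum\<close>

definition is_monoform :: "('o, 'm, 'z) acat_scheme \<Rightarrow> 'o \<Rightarrow> bool" where
  "is_monoform A H \<longleftrightarrow> H \<in> Obj A \<and> \<not> is_zero A H \<and>
     (\<forall>i q. is_mono A i \<and> Cod A i = H \<and> \<not> is_zero A (Dom A i) \<and> is_cokernel A q i \<longrightarrow>
        \<not> (\<exists>j k. is_mono A j \<and> Cod A j = H \<and> \<not> is_zero A (Dom A j) \<and>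
                 is_mono A k \<and> Cod A k = Cod A q \<and> isomorphic A (Dom A j) (Dom A k)))"

definition atom_equiv :: "('o, 'm, 'z) acat_scheme \<Rightarrow> 'o rel" where
  "atom_equiv A = {(H, H'). is_monoform A H \<and> is_monoform A H' \<and>
     (\<exists>i j. is_mono A i \<and> Cod A i = H \<and> is_mono A j \<and> Cod A j = H' \<and>
            \<not> is_zero A (Dom A i) \<and> isomorphic A (Dom A i) (Dom A j))}"

definition ASpec :: "('o, 'm, 'z) acat_scheme \<Rightarrow> 'o set set" where
  "ASpec A = {H. is_monoform A H} // atom_equiv A"

definition is_subquotient :: "('o, 'm, 'z) cat_scheme \<Rightarrow> 'o \<Rightarrow> 'o \<Rightarrow> bool" where
  "is_subquotient A H M \<longleftrightarrow>
     (\<exists>i e. is_mono A i \<and> Cod A i = M \<and> is_epi A e \<and> Dom A e = Dom A i \<and> Cod A e = H)"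

definition ASupp :: "('o, 'm, 'z) acat_scheme \<Rightarrow> 'o \<Rightarrow> 'o set set" where
  "ASupp A M = {\<alpha> \<in> ASpec A. \<exists>H \<in> \<alpha>. is_subquotient A H M}"

definition is_open_atoms :: "('o, 'm, 'z) acat_scheme \<Rightarrow> 'o set set \<Rightarrow> bool" where
  "is_open_atoms A \<Phi> \<longleftrightarrow> \<Phi> \<subseteq> ASpec A \<and> (\<forall>\<alpha> \<in> \<Phi>. \<exists>H \<in> \<alpha>. ASupp A H \<subseteq> \<Phi>)"

text \<open>
  \<open>\<Gamma>\<^sub>W(M)\<close> is a subobject of \<open>M\<close>, determined up to isomorphism; a representing monomorphism
  is chosen for each \<open>M\<close>, and \<open>\<Gamma>\<^sub>W\<close> acts on arrows by restriction.
\<close>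

definition is_largest_supported ::
  "('o, 'm, 'z) acat_scheme \<Rightarrow> 'o set set \<Rightarrow> 'o \<Rightarrow> 'm \<Rightarrow> bool" where
  "is_largest_supported A W M i \<longleftrightarrow>
     is_mono A i \<and> Cod A i = M \<and> ASupp A (Dom A i) \<subseteq> W \<and>
     (\<forall>j. is_mono A j \<and> Cod A j = M \<and> ASupp A (Dom A j) \<subseteq> W \<longrightarrow> factors_through A j i)"

definition Gamma_incl :: "('o, 'm, 'z) acat_scheme \<Rightarrow> 'o set set \<Rightarrow> 'o \<Rightarrow> 'm" where
  "Gamma_incl A W M = (SOME i. is_largest_supported A W M i)"

definition Gamma :: "('o, 'm, 'z) acat_scheme \<Rightarrow> 'o set set \<Rightarrow> ('o, 'm, 'o, 'm) cfunctor" where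
  "Gamma A W =
     \<lparr>FO = (\<lambda>M. Dom A (Gamma_incl A W M)),
      FA = (\<lambda>f. THE g. g \<in> Hom A (Dom A (Gamma_incl A W (Dom A f)))
                                 (Dom A (Gamma_incl A W (Cod A f))) \<and>
                     Gamma_incl A W (Cod A f) \<cdot>\<^bsub>A\<^esub> g = f \<cdot>\<^bsub>A\<^esub> Gamma_incl A W (Dom A f))\<rparr>"


section \<open>Complexes and the derived category\<close>

record ('o, 'm) cplx =
  ob :: "int \<Rightarrow> 'o"
  df :: "int \<Rightarrow> 'm"

definition is_lb_complex :: "('o, 'm, 'z) acat_scheme \<Rightarrow> ('o, 'm) cplx \<Rightarrow> bool" where
  "is_lb_complex A X \<longleftrightarrow>
     (\<forall>n. ob X n \<in> Obj A \<and> df X n \<in> Hom A (ob X n) (ob X (n + 1)) \<and>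
          df X (n + 1) \<cdot>\<^bsub>A\<^esub> df X n = Zer A (ob X n) (ob X (n + 1 + 1))) \<and>
     (\<exists>N. \<forall>n < N. is_zero A (ob X n))"

type_synonym ('o, 'm) chmap = "('o, 'm) cplx \<times> ('o, 'm) cplx \<times> (int \<Rightarrow> 'm)"

definition Ch :: "('o, 'm, 'z) acat_scheme \<Rightarrow> (('o, 'm) cplx, ('o, 'm) chmap) acat" where
  "Ch A =
     \<lparr>Obj = {X. is_lb_complex A X},
      Arr = {(X, Y, f). is_lb_complex A X \<and> is_lb_complex A Y \<and>
               (\<forall>n. f n \<in> Hom A (ob X n) (ob Y n) \<and>
                    f (n + 1) \<cdot>\<^bsub>A\<^esub> df X n = df Y n \<cdot>\<^bsub>A\<^esub> f n)},
      Dom = (\<lambda>(X, Y, f). X),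
      Cod = (\<lambda>(X, Y, f). Y),
      Idt = (\<lambda>X. (X, X, \<lambda>n. Idt A (ob X n))),
      Cmp = (\<lambda>(Y', Z, g) (X, Y, f). (X, Z, \<lambda>n. g n \<cdot>\<^bsub>A\<^esub> f n)),
      Add = (\<lambda>(X, Y, f) (X', Y', g). (X, Y, \<lambda>n. f n \<boxplus>\<^bsub>A\<^esub> g n)),
      Zer = (\<lambda>X Y. (X, Y, \<lambda>n. Zer A (ob X n) (ob Y n)))\<rparr>"

definition homotopy_rel :: "('o, 'm, 'z) acat_scheme \<Rightarrow> ('o, 'm) chmap rel" where
  "homotopy_rel A = {((X, Y, f), (X', Y', g)).
     (X, Y, f) \<in> Arr (Ch A) \<and> (X', Y', g) \<in> Arr (Ch A) \<and> X = X' \<and> Y = Y' \<and>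
     (\<exists>h. \<forall>n. h n \<in> Hom A (ob X n) (ob Y (n - 1)) \<and>
        f n = g n \<boxplus>\<^bsub>A\<^esub> ((df Y (n - 1) \<cdot>\<^bsub>A\<^esub> h n) \<boxplus>\<^bsub>A\<^esub> (h (n + 1) \<cdot>\<^bsub>A\<^esub> df X n)))}"

definition Kplus :: "('o, 'm, 'z) acat_scheme \<Rightarrow> (('o, 'm) cplx, ('o, 'm) chmap set) acat" where
  "Kplus A = quot_cat (Ch A) (homotopy_rel A)"

text \<open>
  \<open>k\<close> is a kernel of the differential in degree \<open>n\<close> (the cocycles), \<open>b\<close> is the corestriction to
  it of the differential in degree \<open>n - 1\<close>, and the target of the cokernel \<open>q\<close> of \<open>b\<close> is the
  \<open>n\<close>-th cohomology object.
\<close>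

definition is_cohomology ::
  "('o, 'm, 'z) acat_scheme \<Rightarrow> ('o, 'm) cplx \<Rightarrow> int \<Rightarrow> 'm \<Rightarrow> 'm \<Rightarrow> bool" where
  "is_cohomology A X n k q \<longleftrightarrow> is_kernel A k (df X n) \<and>
     (\<exists>b \<in> Hom A (ob X (n - 1)) (Dom A k). k \<cdot>\<^bsub>A\<^esub> b = df X (n - 1) \<and> is_cokernel A q b)"

definition is_quasi_iso :: "('o, 'm, 'z) acat_scheme \<Rightarrow> ('o, 'm) chmap \<Rightarrow> bool" where
  "is_quasi_iso A \<phi> \<longleftrightarrow> \<phi> \<in> Arr (Ch A) \<and>
     (case \<phi> of (X, Y, f) \<Rightarrow>
        \<forall>n k q k' q' z h.
          is_cohomology A X n k q \<and> is_cohomology A Y n k' q' \<and>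
          z \<in> Hom A (Dom A k) (Dom A k') \<and> k' \<cdot>\<^bsub>A\<^esub> z = f n \<cdot>\<^bsub>A\<^esub> k \<and>
          h \<in> Hom A (Cod A q) (Cod A q') \<and> h \<cdot>\<^bsub>A\<^esub> q = q' \<cdot>\<^bsub>A\<^esub> z
          \<longrightarrow> is_iso A h)"

definition qis :: "('o, 'm, 'z) acat_scheme \<Rightarrow> ('o, 'm) chmap set set" where
  "qis A = {a \<in> Arr (Kplus A). \<exists>\<phi> \<in> a. is_quasi_iso A \<phi>}"

type_synonym ('o, 'm) darr = "(('o, 'm) chmap set \<times> ('o, 'm) chmap set) set"

type_synonym ('o, 'm) dfunctor =
  "(('o, 'm) cplx, ('o, 'm) darr, ('o, 'm) cplx, ('o, 'm) darr) cfunctor"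

definition Dplus :: "('o, 'm, 'z) acat_scheme \<Rightarrow> (('o, 'm) cplx, ('o, 'm) darr) acat" where
  "Dplus A = frac_cat (Kplus A) (qis A)"

definition Dloc :: "('o, 'm, 'z) acat_scheme \<Rightarrow>
    (('o, 'm) cplx, ('o, 'm) chmap set, ('o, 'm) cplx, ('o, 'm) darr) cfunctor" where
  "Dloc A = frac_loc (Kplus A) (qis A)"

definition Dmap :: "('o, 'm, 'z) acat_scheme \<Rightarrow> ('o, 'm) chmap \<Rightarrow> ('o, 'm) darr" where
  "Dmap A \<phi> = FA (Dloc A) (homotopy_rel A `` {\<phi>})"

definition zero_object :: "('o, 'm, 'z) cat_scheme \<Rightarrow> 'o" where
  "zero_object A = (SOME Z. is_zero A Z)"

definition in_degree_0 :: "('o, 'm, 'z) acat_scheme \<Rightarrow> 'o \<Rightarrow> ('o, 'm) cplx" where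
  "in_degree_0 A M =
     (let X = (\<lambda>n. if n = 0 then M else zero_object A)
      in \<lparr>ob = X, df = (\<lambda>n. Zer A (X n) (X (n + 1)))\<rparr>)"


section \<open>Triangulated structure\<close>

definition shift_cplx :: "('o, 'm, 'z) acat_scheme \<Rightarrow> ('o, 'm) cplx \<Rightarrow> ('o, 'm) cplx" where
  "shift_cplx A X = \<lparr>ob = (\<lambda>n. ob X (n + 1)), df = (\<lambda>n. Neg A (df X (n + 1)))\<rparr>"

definition Ch_shift :: "('o, 'm, 'z) acat_scheme \<Rightarrow>
    (('o, 'm) cplx, ('o, 'm) chmap, ('o, 'm) cplx, ('o, 'm) chmap) cfunctor" where
  "Ch_shift A =
     \<lparr>FO = shift_cplx A,
      FA = (\<lambda>(X, Y, f). (shift_cplx A X, shift_cplx A Y, \<lambda>n. f (n + 1)))\<rparr>"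

definition Dshift :: "('o, 'm, 'z) acat_scheme \<Rightarrow> ('o, 'm) dfunctor" where
  "Dshift A = frac_functor (Kplus A) (qis A) (quot_functor (homotopy_rel A) (Ch_shift A))"

text \<open>
  \<open>C\<close> is a mapping cone of the chain map \<open>f : X \<rightarrow> Y\<close>, that is \<open>C\<^sup>n = X\<^sup>n\<^sup>+\<^sup>1 \<oplus> Y\<^sup>n\<close> with
  \<open>d(x, y) = (- d x, f x + d y)\<close>; here \<open>i\<close>, \<open>p\<close> and \<open>j\<close>, \<open>q\<close> are the injections and projections
  of the first and the second summand.
\<close>

definition is_cone :: "('o, 'm, 'z) acat_scheme \<Rightarrow> ('o, 'm) chmap \<Rightarrow> ('o, 'm) cplx \<Rightarrow>
    (int \<Rightarrow> 'm) \<Rightarrow> (int \<Rightarrow> 'm) \<Rightarrow> (int \<Rightarrow> 'm) \<Rightarrow> (int \<Rightarrow> 'm) \<Rightarrow> bool" where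
  "is_cone A \<phi> C i j p q \<longleftrightarrow> \<phi> \<in> Arr (Ch A) \<and> is_lb_complex A C \<and>
     (case \<phi> of (X, Y, f) \<Rightarrow>
        \<forall>n. is_biproduct A (ob X (n + 1)) (ob Y n) (ob C n) (i n) (j n) (p n) (q n) \<and>
            df C n \<cdot>\<^bsub>A\<^esub> i n =
              (i (n + 1) \<cdot>\<^bsub>A\<^esub> Neg A (df X (n + 1))) \<boxplus>\<^bsub>A\<^esub> (j (n + 1) \<cdot>\<^bsub>A\<^esub> f (n + 1)) \<and>
            df C n \<cdot>\<^bsub>A\<^esub> j n = j (n + 1) \<cdot>\<^bsub>A\<^esub> df Y n)"

text \<open>
  A triangle \<open>X \<rightarrow> Y \<rightarrow> Z \<rightarrow> X[1]\<close> is given by its three arrows.  It is distinguished if it is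
  isomorphic in the derived category to \<open>X \<rightarrow> Y \<rightarrow> Cone f \<rightarrow> X[1]\<close> for a chain map \<open>f\<close>.
\<close>

definition is_cone_triangle ::
  "('o, 'm, 'z) acat_scheme \<Rightarrow> ('o, 'm) darr \<Rightarrow> ('o, 'm) darr \<Rightarrow> ('o, 'm) darr \<Rightarrow> bool" where
  "is_cone_triangle A u v w \<longleftrightarrow>
     (\<exists>X Y f C i j p q. is_cone A (X, Y, f) C i j p q \<and>
        u = Dmap A (X, Y, f) \<and> v = Dmap A (Y, C, j) \<and> w = Dmap A (C, shift_cplx A X, p))"

definition is_dist_triangle ::
  "('o, 'm, 'z) acat_scheme \<Rightarrow> ('o, 'm) darr \<Rightarrow> ('o, 'm) darr \<Rightarrow> ('o, 'm) darr \<Rightarrow> bool" where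
  "is_dist_triangle A u v w \<longleftrightarrow>
     (let D = Dplus A in
      u \<in> Arr D \<and> v \<in> Arr D \<and> w \<in> Arr D \<and>
      Cod D u = Dom D v \<and> Cod D v = Dom D w \<and> Cod D w = FO (Dshift A) (Dom D u) \<and>
      (\<exists>u' v' w' a b c. is_cone_triangle A u' v' w' \<and>
         a \<in> Hom D (Dom D u) (Dom D u') \<and> is_iso D a \<and>
         b \<in> Hom D (Dom D v) (Dom D v') \<and> is_iso D b \<and>
         c \<in> Hom D (Dom D w) (Dom D w') \<and> is_iso D c \<and>
         b \<cdot>\<^bsub>D\<^esub> u = u' \<cdot>\<^bsub>D\<^esub> a \<and> c \<cdot>\<^bsub>D\<^esub> v = v' \<cdot>\<^bsub>D\<^esub> b \<and>
         FA (Dshift A) a \<cdot>\<^bsub>D\<^esub> w = w' \<cdot>\<^bsub>D\<^esub> c))"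

definition is_triangle_functor :: "('o, 'm, 'z) acat_scheme \<Rightarrow> ('o, 'm) dfunctor \<Rightarrow> bool" where
  "is_triangle_functor A \<delta> \<longleftrightarrow>
     is_additive (Dplus A) (Dplus A) \<delta> \<and>
     (\<exists>\<theta>. is_nat_iso (Dplus A) (Dplus A) (\<delta> \<circ>\<^sub>F Dshift A) (Dshift A \<circ>\<^sub>F \<delta>) \<theta> \<and>
          (\<forall>u v w. is_dist_triangle A u v w \<longrightarrow>
             is_dist_triangle A (FA \<delta> u) (FA \<delta> v)
               (\<theta> (Dom (Dplus A) u) \<cdot>\<^bsub>Dplus A\<^esub> FA \<delta> w)))"


section \<open>Right derived functors\<close>

definition Ch_functor :: "('o, 'm, 'o, 'm) cfunctor \<Rightarrow>
    (('o, 'm) cplx, ('o, 'm) chmap, ('o, 'm) cplx, ('o, 'm) chmap) cfunctor" where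
  "Ch_functor F =
     (let FX = (\<lambda>X. \<lparr>ob = FO F \<circ> ob X, df = FA F \<circ> df X\<rparr>)
      in \<lparr>FO = FX, FA = (\<lambda>(X, Y, f). (FX X, FX Y, FA F \<circ> f))\<rparr>)"

definition Kplus_functor :: "('o, 'm, 'z) acat_scheme \<Rightarrow> ('o, 'm, 'o, 'm) cfunctor \<Rightarrow>
    (('o, 'm) cplx, ('o, 'm) chmap set, ('o, 'm) cplx, ('o, 'm) chmap set) cfunctor" where
  "Kplus_functor A F = quot_functor (homotopy_rel A) (Ch_functor F)"

text \<open>
  \<open>R\<close> is a right derived functor of the additive functor \<open>F\<close>: with \<open>Q\<close> the localization functor
  from the homotopy category, there is a transformation \<open>\<xi> : Q \<circ> F \<rightarrow> R \<circ> Q\<close> that is initial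
  among the transformations \<open>Q \<circ> F \<rightarrow> G \<circ> Q\<close> with \<open>G\<close> a triangle functor.  Uniqueness of
  \<open>\<eta>\<close> can only be required on objects of the derived category.
\<close>

definition is_right_derived ::
  "('o, 'm, 'z) acat_scheme \<Rightarrow> ('o, 'm, 'o, 'm) cfunctor \<Rightarrow> ('o, 'm) dfunctor \<Rightarrow> bool" where
  "is_right_derived A F R \<longleftrightarrow> is_additive A A F \<and> is_triangle_functor A R \<and>
     (let K = Kplus A; D = Dplus A; Q = Dloc A; QF = Q \<circ>\<^sub>F Kplus_functor A F in
      \<exists>\<xi>. is_nat_trans K D QF (R \<circ>\<^sub>F Q) \<xi> \<and>
        (\<forall>G \<zeta>. is_triangle_functor A G \<and> is_nat_trans K D QF (G \<circ>\<^sub>F Q) \<zeta> \<longrightarrow>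
           (\<exists>\<eta>. is_nat_trans D D R G \<eta> \<and> (\<forall>X \<in> Obj K. \<zeta> X = \<eta> X \<cdot>\<^bsub>D\<^esub> \<xi> X) \<and>
              (\<forall>\<eta>'. is_nat_trans D D R G \<eta>' \<and> (\<forall>X \<in> Obj K. \<zeta> X = \<eta>' X \<cdot>\<^bsub>D\<^esub> \<xi> X) \<longrightarrow>
                 (\<forall>X \<in> Obj D. \<eta>' X = \<eta> X)))))"


section \<open>Abstract local cohomology functors\<close>

definition Im_obj :: "('o, 'm, 'z) acat_scheme \<Rightarrow> ('o, 'm) dfunctor \<Rightarrow> ('o, 'm) cplx set" where
  "Im_obj A \<delta> = {Y \<in> Obj (Dplus A). \<exists>X \<in> Obj (Dplus A). isomorphic (Dplus A) Y (FO \<delta> X)}"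

definition Ker_obj :: "('o, 'm, 'z) acat_scheme \<Rightarrow> ('o, 'm) dfunctor \<Rightarrow> ('o, 'm) cplx set" where
  "Ker_obj A \<delta> = {X \<in> Obj (Dplus A). is_zero (Dplus A) (FO \<delta> X)}"

definition abstract_local_cohomology ::
  "('o, 'm, 'z) acat_scheme \<Rightarrow> ('o, 'm) dfunctor \<Rightarrow> bool" where
  "abstract_local_cohomology A \<delta> \<longleftrightarrow>
     is_triangle_functor A \<delta> \<and>
     (\<exists>\<rho>. is_right_adjoint (full_subcat (Dplus A) (Im_obj A \<delta>)) (Dplus A) fincl \<rho> \<and>
          nat_isomorphic (Dplus A) (Dplus A) \<delta> (fincl \<circ>\<^sub>F \<rho>)) \<and>
     (\<forall>E. is_injective A E \<and> is_indecomposable A E \<longrightarrow>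
          in_degree_0 A E \<in> Im_obj A \<delta> \<union> Ker_obj A \<delta>)"

end

theory Submission
 imports Defs
begin

text \<open>
 \<open>W\<close> is the set of atoms in the support of the torsion class cogenerated by the injectives killed by \<open>\<delta>\<close>.
 By local stability and the second axiom,
 \<open>\<delta>\<close> fixes torsion injectives and kills torsion-free ones. A way-out argument extends
 this to bounded below complexes of injectives: \<open>\<delta>\<close> has bounded amplitude because otherwise a countable coproduct
 of shifted complexes would have an unbounded image. Hence the counit of \<open>\<delta>\<close> at an injective resolution
 \<open>I\<close> is the inclusion of \<open>\<Gamma>\<^sub>W I\<close>.
\<close>

text \<open>The second axiom speaks of indecomposable injectives only, and \<open>\<delta>\<close>
  is not assumed to commute with coproducts, so a torsion injective cannot be handled by splitting
  it into indecomposables. Instead a maximal injective subobject on which the counit is mono is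
  shown to be everything by adjoining an indecomposable hull. Noetherian generators make directed
  unions of injectives injective and supply monoform subobjects. Local stability says something
  about localizing subcategories, so the torsion class must be given a quotient functor with right
  adjoint. One construction serves this and the derived category: if every object maps by an arrow
  to be inverted into a local object, the arrows of the category of fractions are ordinary arrows
  into local objects. These are the closed torsion-free objects in one case, bounded below complexes
  of injectives in the other. Quasi-isomorphisms are treated by exactness of the cone under arrows
  into injectives, which replaces long exact cohomology sequences. Since \<open>\<delta>\<close> is
  itself the candidate for the derived functor, what remains is its universal property.\<close>

no_notation times (infixl "*" 70) and map_add (infixl "++" 100)
notation Cmp (infixl "*\<index>" 70) and Add (infixl "++\<index>" 65) and iff (infixr "<->" 25)

lemma Hom_iff [simp]: "f : Hom C X Y <-> f : Arr C & Dom C f = X & Cod C f = Y"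
 by (auto simp: Hom_def)

context category begin

abbreviation "obj X == X : Obj C"
abbreviation "arr f == f : Arr C"
abbreviation dom where "dom == Dom C"
abbreviation cod where "cod == Cod C"
abbreviation idt where "idt == Idt C"
abbreviation hom where "hom == Hom C"
abbreviation mono where "mono == is_mono C"
abbreviation epi where "epi == is_epi C"
abbreviation zero where "zero == is_zero C"
abbreviation inject where "inject == is_injective C"

declare Dom_Obj [simp] Cod_Obj [simp]

lemma Idt_simps [simp]:
 assumes "obj X"
 shows "arr (idt X)" "dom (idt X) = X" "cod (idt X) = X"
 using Idt_Hom[OF assms] by auto

lemma Cmp_simps [simp]:
 assumes "arr f" "arr g" "dom g = cod f"
 shows "arr (g*f)" "dom (g*f) = dom f" "cod (g*f) = cod g"
 using Cmp_Hom[of f "dom f" "cod f" g "cod g"] assms by auto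

lemma Cmp_Idt_right [simp]: "arr f ==> dom f = X ==> f*idt X = f"
 using Cmp_Idt[of f X "cod f"] by simp

lemma Cmp_Idt_left [simp]: "arr f ==> cod f = X ==> idt X*f = f"
 using Idt_Cmp[of f "dom f" X] by simp

lemma Cmp_assoc_simp [simp]:
 "arr f ==> arr g ==> arr h ==> dom g = cod f ==> dom h = cod g ==>
  (h*g)*f = h*(g*f)"
 using Cmp_assoc[of f "dom f" "cod f" g "cod g" h "cod h"] by simp

lemma Cmp_reassoc:
 "a*b = c*d ==> arr x ==> arr a ==> arr b ==> arr c ==> arr d ==>
  dom a = cod b ==> dom c = cod d ==> dom b = cod x ==>
  a*(b*x) = c*(d*x)"
 by (metis Cmp_assoc_simp Cmp_simps(2))

lemma is_isoI:
 assumes "arr f" "arr g" "dom g = cod f" "cod g = dom f"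
  "g*f = idt (dom f)" "f*g = idt (cod f)"
 shows "is_iso C f"
 using assms unfolding is_iso_def by auto

lemma is_isoE:
 assumes "is_iso C f"
 obtains g where "arr f" "arr g" "dom g = cod f" "cod g = dom f"
  "g*f = idt (dom f)" "f*g = idt (cod f)" "is_iso C g"
proof -
 obtain g where g: "arr f" "arr g" "dom g = cod f" "cod g = dom f"
  "g*f = idt (dom f)" "f*g = idt (cod f)"
  using assms unfolding is_iso_def by auto
 have "is_iso C g" using g by (intro is_isoI[of g f]) auto
 with g that show ?thesis by blast
qed

lemma is_iso_Cmp:
 assumes "is_iso C f" "is_iso C g" "dom g = cod f"
 shows "is_iso C (g*f)"
proof -
 from assms(1) obtain f' where f: "arr f" "arr f'" "dom f' = cod f" "cod f' = dom f"
  "f'*f = idt (dom f)" "f*f' = idt (cod f)" by (rule is_isoE) blast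
 from assms(2) obtain g' where g: "arr g" "arr g'" "dom g' = cod g" "cod g' = dom g"
  "g'*g = idt (dom g)" "g*g' = idt (cod g)" by (rule is_isoE) blast
 have 1: "g'*(g*f) = f"
  using Cmp_assoc_simp[of f g g'] f g assms(3) by (metis Cmp_Idt_left)
 have 2: "f*(f'*g') = g'"
  using Cmp_assoc_simp[of g' f' f] f g assms(3) by (metis Cmp_Idt_left)
 show ?thesis
  by (rule is_isoI[of _ "f'*g'"]) (use f g assms(3) 1 2 in auto)
qed

lemma is_iso_Idt: "obj X ==> is_iso C (idt X)"
 by (rule is_isoI[of _ "idt X"]) auto

lemma iso_mono_cancel:
 assumes "is_iso C f" "arr x" "arr y" "cod x = dom f" "cod y = dom f" "f*x = f*y"
 shows "x = y"
proof -
 from assms(1) obtain f' where f: "arr f" "arr f'" "dom f' = cod f" "cod f' = dom f"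
  "f'*f = idt (dom f)" by (rule is_isoE) blast
 have "f'*(f*x) = x" "f'*(f*y) = y"
  using Cmp_assoc_simp[of x f f'] Cmp_assoc_simp[of y f f'] f assms by auto
 with assms show ?thesis by metis
qed

lemma iso_epi_cancel:
 assumes "is_iso C f" "arr x" "arr y" "dom x = cod f" "dom y = cod f" "x*f = y*f"
 shows "x = y"
proof -
 from assms(1) obtain f' where f: "arr f" "arr f'" "dom f' = cod f" "cod f' = dom f"
  "f*f' = idt (cod f)" by (rule is_isoE) blast
 have "(x*f)*f' = x" "(y*f)*f' = y"
  using f assms(2-5) by (simp_all del: assms)
 with assms show ?thesis by metis
qed

lemma isomorphic_sym: "isomorphic C X Y ==> isomorphic C Y X"
 unfolding isomorphic_def by (metis Hom_iff is_isoE)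

lemma isomorphic_trans: "isomorphic C X Y ==> isomorphic C Y Z ==> isomorphic C X Z"
 unfolding isomorphic_def by (smt (verit) Hom_iff is_iso_Cmp Cmp_simps)

lemma isomorphic_refl: "obj X ==> isomorphic C X X"
 unfolding isomorphic_def using is_iso_Idt by force

end

lemma is_functor_simps:
 assumes "is_functor C D F"
 shows "X : Obj C ==> FO F X : Obj D"
  "f : Arr C ==> FA F f : Arr D"
  "f : Arr C ==> Dom D (FA F f) = FO F (Dom C f)"
  "f : Arr C ==> Cod D (FA F f) = FO F (Cod C f)"
  "X : Obj C ==> FA F (Idt C X) = Idt D (FO F X)"
  "f : Arr C ==> g : Arr C ==> Dom C g = Cod C f ==> FA F (Cmp C g f) = Cmp D (FA F g) (FA F f)"
 using assms unfolding is_functor_def by auto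

lemma functor_iso:
 assumes "category C" "category D" "is_functor C D F" "is_iso C f"
 shows "is_iso D (FA F f)"
proof -
 interpret C: category C by fact
 interpret D: category D by fact
 note F = is_functor_simps[OF assms(3)]
 from assms(4) obtain g where g: "f : Arr C" "g : Arr C" "Dom C g = Cod C f" "Cod C g = Dom C f"
  "Cmp C g f = Idt C (Dom C f)" "Cmp C f g = Idt C (Cod C f)" by (rule C.is_isoE) blast
 show ?thesis
  by (rule D.is_isoI[of _ "FA F g"]) (use g F(6)[of f g, symmetric] F(6)[of g f, symmetric] in "simp_all add: F")
qed

section \<open>Categories of fractions with enough local objects\<close>

text \<open>Such objects see the arrows of \<open>S\<close> as isomorphisms. They become the closed
  torsion-free objects for a Serre quotient and the complexes of injectives for the derived
  category.\<close>

definition is_local :: "('o, 'm, 'z) cat_scheme => 'm set => 'o => bool" where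
 "is_local C S Z <-> Z : Obj C &
   (ALL s : S. ALL f : Hom C (Dom C s) Z. EX! g. g : Hom C (Cod C s) Z & g \<cdot>\<^bsub>C\<^esub> s = f)"

text \<open>The Ore conditions are replaced by \<open>enough_local\<close>: a diagram of fractions
  can always be completed at a local target, where extensions along \<open>S\<close> exist and are
  unique.\<close>

locale fractions = category C for C :: "('o, 'm, 'z) acat_scheme" (structure) +
 fixes S :: "'m set"
 assumes S_Arr: "s : S ==> s : Arr C"
  and S_Idt: "X : Obj C ==> Idt C X : S"
  and S_Cmp: "s : S ==> t : S ==> Dom C t = Cod C s ==> t*s : S"
  and enough_local: "X : Obj C ==> EX l : S. Dom C l = X & is_local C S (Cod C l)"
begin

definition ext :: "'m => 'm => 'm" where
 "ext s f = (THE g. g : hom (cod s) (cod f) & g*s = f)"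

definition lmap :: "'o => 'm" where
 "lmap X = (SOME l. l : S & dom l = X & is_local C S (cod l))"

abbreviation lobj :: "'o => 'o" where "lobj X == cod (lmap X)"

text \<open>The roof \<open>s\<^sup>-\<^sup>1 f\<close> from \<open>X\<close> to \<open>Y\<close> is encoded by the arrow from \<open>X\<close> to the chosen local
 object of \<open>Y\<close> that it induces; two roofs are equivalent iff these arrows agree.\<close>

definition nf :: "'m \<times> 'm => 'm" where
 "nf r = ext (snd r) (lmap (dom (snd r)))*fst r"

lemma lmap [simp]:
 assumes "obj X"
 shows "lmap X : S" "arr (lmap X)" "dom (lmap X) = X" "is_local C S (lobj X)"
proof -
 have "EX l. l : S & dom l = X & is_local C S (cod l)" using enough_local[OF assms] by auto
 from someI_ex[OF this] show "lmap X : S" "dom (lmap X) = X" "is_local C S (lobj X)"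
  unfolding lmap_def by auto
 thus "arr (lmap X)" by (simp add: S_Arr)
qed

lemma ext [simp]:
 assumes "s : S" "arr f" "dom f = dom s" "is_local C S (cod f)"
 shows "arr (ext s f)" "dom (ext s f) = cod s" "cod (ext s f) = cod f" "ext s f*s = f"
proof -
 have "EX! g. g : hom (cod s) (cod f) & g*s = f"
  using assms unfolding is_local_def by (metis Hom_iff)
 from theI'[OF this] show "arr (ext s f)" "dom (ext s f) = cod s" "cod (ext s f) = cod f"
  "ext s f*s = f" unfolding ext_def by auto
qed

lemma local_unique:
 assumes "s : S" "arr g" "arr h" "dom g = cod s" "dom h = cod s"
  "cod g = Z" "cod h = Z" "is_local C S Z" "g*s = h*s"
 shows "g = h"
proof -
 have "EX! k. k : hom (cod s) Z & k*s = g*s"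
  using assms S_Arr[OF assms(1)] unfolding is_local_def by (metis Hom_iff Cmp_simps)
 thus ?thesis using assms by auto
qed

lemma ext_eq:
 assumes "s : S" "arr g" "dom g = cod s" "g*s = f" "is_local C S (cod g)"
 shows "ext s f = g"
proof -
 have f: "arr f" "dom f = dom s" "cod f = cod g" using assms S_Arr[OF assms(1)] by auto
 show ?thesis
  by (rule local_unique[OF assms(1), where Z="cod g"]) (use assms f in auto)
qed

lemma roofs_iff:
 "(f, s) : roofs C S <-> arr f & s : S & cod f = cod s"
 unfolding roofs_def using S_Arr by auto

lemma nf_simps [simp]:
 assumes "(f, s) : roofs C S"
 shows "arr (nf (f, s))" "dom (nf (f, s)) = dom f" "cod (nf (f, s)) = lobj (dom s)"
 using assms S_Arr[of s] unfolding roofs_iff nf_def by auto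

text \<open>A common refinement of two roofs extends to the chosen local object, so both induce the
  same arrow there. Conversely the local object itself is a common refinement of roofs with equal
  normal form.\<close>

lemma roof_rel_iff:
 "(r, r') : roof_rel C S <-> r : roofs C S & r' : roofs C S &
   dom (fst r) = dom (fst r') & dom (snd r) = dom (snd r') & nf r = nf r'"
proof -
 obtain f s f' s' where r: "r = (f, s)" "r' = (f', s')" by fastforce
 show ?thesis
 proof (cases "(f, s) : roofs C S & (f', s') : roofs C S & dom f = dom f' & dom s = dom s'")
  case False
  thus ?thesis unfolding r roof_rel_def by auto
 next
  case True
  hence [simp]: "arr f" "s : S" "arr s" "arr f'" "s' : S" "arr s'"
   "cod f = cod s" "cod f' = cod s'" "dom f' = dom f" "dom s' = dom s"
   by (auto simp: roofs_iff S_Arr)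
  let ?l = "lmap (dom s)"
  show ?thesis
  proof
   assume "(r, r') : roof_rel C S"
   then obtain u v where uv: "arr u" "arr v" "dom u = cod s" "dom v = cod s'"
    "cod v = cod u" "u*f = v*f'" "u*s = v*s'" "u*s : S"
    unfolding roof_rel_def r by auto
   define w where "w = ext (u*s) ?l"
   have w: "arr w" "dom w = cod u" "cod w = cod ?l" "w*(u*s) = ?l"
    using uv by (auto simp: w_def)
   have e1: "ext s ?l = w*u" by (rule ext_eq) (use uv w in auto)
   have e2: "ext s' ?l = w*v" by (rule ext_eq) (use uv w in auto)
   have "nf r = nf r'" unfolding nf_def r using uv w by (simp add: e1 e2)
   with True r show "r : roofs C S & r' : roofs C S &
     dom (fst r) = dom (fst r') & dom (snd r) = dom (snd r') & nf r = nf r'" by simp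
  next
   assume "r : roofs C S & r' : roofs C S &
     dom (fst r) = dom (fst r') & dom (snd r) = dom (snd r') & nf r = nf r'"
   hence "ext s ?l*f = ext s' ?l*f'" by (simp add: nf_def r)
   moreover have "ext s ?l*s = ext s' ?l*s'" by simp
   moreover have "ext s ?l : hom (cod f) (cod ?l)" "ext s' ?l : hom (cod f') (cod ?l)"
    "obj (cod ?l)" "ext s ?l*s : S" by simp_all
   ultimately show "(r, r') : roof_rel C S"
    unfolding roof_rel_def r using True by blast
  qed
 qed
qed

text \<open>An arrow from \<open>X\<close> to \<open>Y\<close> of the category of fractions, given
  by its normal form. Any \<open>g\<close> into the local object of \<open>Y\<close> occurs, by the
  roof \<open>(g, lmap Y)\<close>.\<close>

definition mk :: "'o => 'o => 'm => ('m \<times> 'm) set" where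
 "mk X Y g = {r : roofs C S. dom (fst r) = X & dom (snd r) = Y & nf r = g}"

lemma class_eq_mk:
 "(f, s) : roofs C S ==> roof_rel C S `` {(f, s)} = mk (dom f) (dom s) (nf (f, s))"
 by (auto simp: mk_def roof_rel_iff)

lemma mk_mem:
 assumes "obj Y" "g : hom X (lobj Y)"
 shows "(g, lmap Y) : mk X Y g"
proof -
 have "ext (lmap Y) (lmap Y) = idt (lobj Y)" by (rule ext_eq) (use assms in auto)
 thus ?thesis using assms by (auto simp: mk_def roofs_iff nf_def)
qed

lemma mk_class:
 assumes "obj Y" "g : hom X (lobj Y)"
 shows "mk X Y g = roof_rel C S `` {(g, lmap Y)}"
proof -
 have "(g, lmap Y) : mk X Y g" by (rule mk_mem) (use assms in auto)
 hence "(g, lmap Y) : roofs C S" "nf (g, lmap Y) = g" by (auto simp: mk_def)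
 thus ?thesis using class_eq_mk[of g "lmap Y"] assms by simp
qed

abbreviation "FC == frac_cat C S"
abbreviation fcmp (infixl "**" 70) where "f**g == Cmp FC f g"

lemma Obj_FC [simp]: "Obj FC = Obj C" by (simp add: frac_cat_def)

lemma mk_Arr [simp]:
 assumes "obj Y" "arr g" "dom g = X" "cod g = lobj Y"
 shows "mk X Y g : Arr FC"
 unfolding frac_cat_def using mk_class[of Y g X] mk_mem[of Y g X] assms
 by (auto simp: mk_def intro!: quotientI)

lemma mk_Dom_Cod [simp]:
 assumes "obj Y" "arr g" "dom g = X" "cod g = lobj Y"
 shows "Dom FC (mk X Y g) = X" "Cod FC (mk X Y g) = Y"
proof -
 have "(g, lmap Y) : mk X Y g" by (rule mk_mem) (use assms in auto)
 hence "(SOME r. r : mk X Y g) : mk X Y g" by (rule someI)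
 thus "Dom FC (mk X Y g) = X" "Cod FC (mk X Y g) = Y"
  unfolding frac_cat_def by (auto simp: mk_def)
qed

lemma FC_ArrE:
 assumes "a : Arr FC"
 obtains g where "a = mk (Dom FC a) (Cod FC a) g" "obj (Dom FC a)" "obj (Cod FC a)"
  "arr g" "dom g = Dom FC a" "cod g = lobj (Cod FC a)"
proof -
 from assms obtain f s where r: "(f, s) : roofs C S" "a = roof_rel C S `` {(f, s)}"
  unfolding frac_cat_def by (auto elim!: quotientE)
 hence a: "a = mk (dom f) (dom s) (nf (f, s))" by (simp add: class_eq_mk)
 have s: "arr f" "arr s" using r by (auto simp: roofs_iff S_Arr)
 have D: "Dom FC a = dom f" "Cod FC a = dom s"
  unfolding a using r(1) s by simp_all
 show ?thesis
  by (rule that[of "nf (f, s)"], unfold D, rule a) (use r(1) s in auto)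
qed

lemma mk_inj:
 assumes "mk X Y g = mk X Y h" "obj Y" "g : hom X (lobj Y)"
 shows "g = h"
 using mk_mem[OF assms(2,3)] assms(1) by (auto simp: mk_def)

text \<open>Composition in \<open>frac_cat\<close> saturates the set of roofs obtained from all
  completions; this reduces its evaluation to one member and a common normal form.\<close>

lemma Image_roof_rel:
 assumes "R <= mk X Y g" "r : R"
 shows "roof_rel C S `` R = mk X Y g"
proof -
 have "roof_rel C S `` R <= mk X Y g"
 proof
  fix r' assume "r' : roof_rel C S `` R"
  then obtain q where "q : mk X Y g" "(q, r') : roof_rel C S" using assms(1) by blast
  thus "r' : mk X Y g" by (auto simp: mk_def roof_rel_iff)
 qed
 moreover have "r' : roof_rel C S `` R" if "r' : mk X Y g" for r'
 proof -
  have "r : mk X Y g" using assms by blast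
  hence "(r, r') : roof_rel C S" using that by (auto simp: mk_def roof_rel_iff)
  thus ?thesis using assms(2) by blast
 qed
 ultimately show ?thesis by blast
qed

text \<open>Normal forms compose as in the Kleisli category of the reflection onto local objects:
  the second arrow is first extended over the local object of \<open>Y\<close>. Every completion of
  the middle square gives this same normal form.\<close>

lemma Cmp_FC [simp]:
 assumes [simp]: "obj X" "obj Y" "obj Z"
  and [simp]: "arr g" "dom g = X" "cod g = lobj Y"
  and [simp]: "arr h" "dom h = Y" "cod h = lobj Z"
 shows "mk Y Z h**mk X Y g = mk X Z (ext (lmap Y) h*g)"
proof -
 let ?R = "{(g'*f, s'*t) | f s k t g' s'.
      (f, s) : mk X Y g & (k, t) : mk Y Z h &
      g' : Arr C & dom g' = cod s & s' : S & arr s' & dom s' = cod k &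
      cod g' = cod s' & g'*s = s'*k}"
 let ?g = "ext (lmap Y) h*g"
 have sub: "?R <= mk X Z ?g"
 proof clarify
  fix f s k t g' s'
  assume a: "(f, s) : mk X Y g" "(k, t) : mk Y Z h" and
   [simp]: "arr g'" "dom g' = cod s" "s' : S" "arr s'" "dom s' = cod k"
      "cod g' = cod s'" and e: "g'*s = s'*k"
  from a have [simp]: "arr f" "s : S" "arr s" "cod f = cod s" "dom f = X" "dom s = Y"
   "arr k" "t : S" "arr t" "cod k = cod t" "dom k = Y" "dom t = Z"
   and n: "nf (f, s) = g" "nf (k, t) = h"
   by (auto simp: mk_def roofs_iff S_Arr)
  have [simp]: "s'*t : S" by (rule S_Cmp) auto
  define w where "w = ext (s'*t) (lmap Z)"
  have w [simp]: "arr w" "dom w = cod s'" "cod w = lobj Z" and wl: "w*(s'*t) = lmap Z"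
   by (auto simp: w_def)
  have e1: "ext t (lmap Z) = w*s'" by (rule ext_eq) (use wl in auto)
  have h: "h = w*(s'*k)" using n(2) by (simp add: nf_def e1)
  have e2: "ext s h = w*g'" by (rule ext_eq) (use h e in auto)
  have e3: "ext s h = ext (lmap Y) h*ext s (lmap Y)"
   by (rule ext_eq) auto
  have "nf (g'*f, s'*t) = (w*g')*f" by (simp add: nf_def w_def)
  also have "... = ext (lmap Y) h*nf (f, s)" unfolding e2[symmetric] e3 nf_def by simp
  finally show "(g'*f, s'*t) : mk X Z ?g"
   by (simp add: mk_def roofs_iff n)
 qed
 \<comment> \<open>At least one completion exists: for the roofs \<open>(g, lmap Y)\<close> and
   \<open>(h, lmap Z)\<close> the square is closed by the extension of \<open>h\<close> and an
   identity.\<close>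
 have "(ext (lmap Y) h*g, idt (lobj Z)*lmap Z) : ?R"
  by (rule CollectI, rule exI[of _ g], rule exI[of _ "lmap Y"], rule exI[of _ h],
    rule exI[of _ "lmap Z"], rule exI[of _ "ext (lmap Y) h"], rule exI[of _ "idt (lobj Z)"])
   (use mk_mem[of Y g X] mk_mem[of Z h Y] S_Idt[of "lobj Z"] in simp)
 from Image_roof_rel[OF sub this] have "roof_rel C S `` ?R = mk X Z ?g" .
 thus ?thesis by (simp add: frac_cat_def)
qed

lemma Idt_FC:
 assumes [simp]: "obj X"
 shows "Idt FC X = mk X X (lmap X)"
proof -
 have "ext (idt X) (lmap X) = lmap X" by (rule ext_eq) (auto simp: S_Idt)
 thus ?thesis
  unfolding frac_cat_def using class_eq_mk[of "idt X" "idt X"] by (simp add: roofs_iff S_Idt nf_def)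
qed

lemma ext_lmap_lmap [simp]: "obj X ==> ext (lmap X) (lmap X) = idt (lobj X)"
 by (rule ext_eq) auto

lemma category_FC: "category FC"
proof
 fix a assume "a : Arr FC"
 thus "Dom FC a : Obj FC" "Cod FC a : Obj FC" by (auto elim!: FC_ArrE)
next
 fix X assume "X : Obj FC"
 thus "Idt FC X : Hom FC X X" by (auto simp: Idt_FC)
next
 fix a b X Y Z assume a: "a : Hom FC X Y" and b: "b : Hom FC Y Z"
 from a obtain g where g: "a = mk X Y g" "obj X" "obj Y" "arr g" "dom g = X" "cod g = lobj Y"
  by (auto elim: FC_ArrE)
 from b obtain h where h: "b = mk Y Z h" "obj Z" "arr h" "dom h = Y" "cod h = lobj Z"
  by (auto elim: FC_ArrE)
 show "b**a : Hom FC X Z" using g h by simp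
next
 fix a X Y assume a: "a : Hom FC X Y"
 from a obtain g where g: "a = mk X Y g" "obj X" "obj Y" "arr g" "dom g = X" "cod g = lobj Y"
  by (auto elim: FC_ArrE)
 show "a**Idt FC X = a" "Idt FC Y**a = a" using g by (simp_all add: Idt_FC)
next
 fix a b c X Y Z V assume a: "a : Hom FC X Y" and b: "b : Hom FC Y Z" and c: "c : Hom FC Z V"
 from a obtain g where g: "a = mk X Y g" "obj X" "obj Y" "arr g" "dom g = X" "cod g = lobj Y"
  by (auto elim: FC_ArrE)
 from b obtain h where h: "b = mk Y Z h" "obj Z" "arr h" "dom h = Y" "cod h = lobj Z"
  by (auto elim: FC_ArrE)
 from c obtain k where k: "c = mk Z V k" "obj V" "arr k" "dom k = Z" "cod k = lobj V"
  by (auto elim: FC_ArrE)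
 have "ext (lmap Y) (ext (lmap Z) k*h) = ext (lmap Z) k*ext (lmap Y) h"
  by (rule ext_eq) (use g h k in auto)
 thus "c**(b**a) = c**b**a" using g h k by simp
qed

abbreviation "L == frac_loc C S"

lemma FO_L [simp]: "FO L X = X" by (simp add: frac_loc_def)

lemma FA_L:
 assumes [simp]: "arr f"
 shows "FA L f = mk (dom f) (cod f) (lmap (cod f)*f)"
proof -
 have "ext (idt (cod f)) (lmap (cod f)) = lmap (cod f)" by (rule ext_eq) (auto simp: S_Idt)
 thus ?thesis
  unfolding frac_loc_def using class_eq_mk[of f "idt (cod f)"] by (simp add: roofs_iff S_Idt nf_def)
qed

lemma functor_L: "is_functor C FC L"
proof -
 have "FA L (g*f) = FA L g**FA L f" if [simp]: "arr f" "arr g" "dom g = cod f" for f g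
 proof -
  have "ext (lmap (cod f)) (lmap (cod g)*g)*(lmap (cod f)*f) =
     (ext (lmap (cod f)) (lmap (cod g)*g)*lmap (cod f))*f"
   by (subst Cmp_assoc_simp) auto
  thus ?thesis by (simp add: FA_L)
 qed
 thus ?thesis unfolding is_functor_def by (auto simp: FA_L Idt_FC)
qed

text \<open>The inverse of \<open>s\<close> is given by the extension along \<open>s\<close> of the
  local map of its domain.\<close>

lemma L_iso:
 assumes s: "s : S"
 shows "is_iso FC (FA L s)"
proof -
 have [simp]: "arr s" using s by (rule S_Arr)
 interpret FC: category FC by (rule category_FC)
 let ?X = "dom s" and ?Y = "cod s"
 let ?t = "mk ?Y ?X (ext s (lmap ?X))"
 have 1: "ext (lmap ?Y) (ext s (lmap ?X))*(lmap ?Y*s) = (ext (lmap ?Y) (ext s (lmap ?X))*lmap ?Y)*s"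
  using s by (subst Cmp_assoc_simp) auto
 have 2: "ext (lmap ?X) (lmap ?Y*s)*ext s (lmap ?X) = lmap ?Y"
  by (rule local_unique[OF s, where Z = "lobj ?Y"]) (use s in auto)
 show ?thesis
  by (rule FC.is_isoI[of _ ?t]) (use s 1 2 in "auto simp: FA_L Idt_FC")
qed

definition fnf :: "('m \<times> 'm) set => 'm" where
 "fnf a = (THE g. g : hom (Dom FC a) (lobj (Cod FC a)) & a = mk (Dom FC a) (Cod FC a) g)"

lemma fnf_mk [simp]:
 "obj Y ==> arr g ==> dom g = X ==> cod g = lobj Y ==> fnf (mk X Y g) = g"
 unfolding fnf_def by (rule the_equality) (use mk_inj[of X Y g] in auto)

lemma fnf_Hom:
 assumes "a : Arr FC"
 shows "arr (fnf a)" "dom (fnf a) = Dom FC a" "cod (fnf a) = lobj (Cod FC a)"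
proof -
 obtain X Y g where "a = mk X Y g" "obj Y" "arr g" "dom g = X" "cod g = lobj Y"
  using FC_ArrE[OF assms] by metis
 thus "arr (fnf a)" "dom (fnf a) = Dom FC a" "cod (fnf a) = lobj (Cod FC a)" by auto
qed

lemma mk_fnf: "a : Arr FC ==> mk (Dom FC a) (Cod FC a) (fnf a) = a"
 by (erule FC_ArrE) (metis fnf_mk)

lemma FC_Arr_Obj: "a : Arr FC ==> obj (Dom FC a) & obj (Cod FC a)"
 by (erule FC_ArrE) auto

text \<open>For local \<open>Y\<close> the map \<open>lmap Y\<close> is already invertible: the
  extension \<open>r\<close> of the identity is a left inverse, and a right inverse by uniqueness of
  extensions. Normal forms are then arrows into \<open>Y\<close> itself.\<close>

lemma L_bij:
 assumes Y: "is_local C S Y" and X: "obj X"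
 shows "bij_betw (FA L) (hom X Y) (Hom FC X Y)"
proof -
 have [simp]: "obj Y" using Y by (simp add: is_local_def)
 define r where "r = ext (lmap Y) (idt Y)"
 have r [simp]: "arr r" "dom r = lobj Y" "cod r = Y" "r*lmap Y = idt Y"
  using Y by (auto simp: r_def)
 have lr: "lmap Y*r = idt (lobj Y)"
  by (rule local_unique[of "lmap Y" _ _ "lobj Y"]) auto
 show ?thesis
 proof (rule bij_betwI[where g = "%a. r*fnf a"])
  show "FA L : hom X Y \<rightarrow> Hom FC X Y" using X by (auto simp: FA_L)
  show "(%a. r*fnf a) : Hom FC X Y \<rightarrow> hom X Y" by (auto simp: fnf_Hom)
  fix f assume f: "f : hom X Y"
  have "r*(lmap Y*f) = (r*lmap Y)*f" using f by (subst Cmp_assoc_simp) auto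
  thus "r*fnf (FA L f) = f" using f by (simp add: FA_L)
 next
  fix a assume "a : Hom FC X Y"
  then obtain g where g: "a = mk X Y g" "arr g" "dom g = X" "cod g = lobj Y"
   by (auto elim: FC_ArrE)
  have "lmap Y*(r*g) = (lmap Y*r)*g" using g by (subst Cmp_assoc_simp) auto
  thus "FA L (r*fnf a) = a" using g by (simp add: FA_L lr)
 qed
qed

text \<open>The right adjoint takes the chosen local object; the adjunction bijection is the passage
  to the normal form.\<close>

lemma right_adjoint_L: "EX G. is_right_adjoint C FC L G"
proof -
 let ?G = "\<lparr>FO = lobj, FA = (%a. ext (lmap (Dom FC a)) (fnf a))\<rparr>"
 have G: "is_functor FC C ?G"
  unfolding is_functor_def
 proof (intro conjI ballI impI)
  fix a assume "a : Arr FC"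
  thus "FA ?G a : hom (FO ?G (Dom FC a)) (FO ?G (Cod FC a))"
   using FC_Arr_Obj[of a] by (auto simp: fnf_Hom)
 next
  fix a b assume ab: "a : Arr FC" "b : Arr FC" "Cod FC a = Dom FC b"
  from ab obtain g where g: "a = mk (Dom FC a) (Cod FC a) g" and [simp]: "obj (Dom FC a)" "obj (Cod FC a)"
   "arr g" "dom g = Dom FC a" "cod g = lobj (Cod FC a)" by (elim FC_ArrE)
  from ab obtain h where h: "b = mk (Cod FC a) (Cod FC b) h" and [simp]: "obj (Cod FC b)"
   "arr h" "dom h = Cod FC a" "cod h = lobj (Cod FC b)" by (metis FC_ArrE)
  let ?X = "Dom FC a" and ?Y = "Cod FC a" and ?Z = "Cod FC b"
  have n [simp]: "fnf a = g" "fnf b = h" by (subst g, simp, subst h, simp)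
  have c: "b**a = mk ?X ?Z (ext (lmap ?Y) h*g)" by (subst g, subst h) simp
  have "ext (lmap ?X) (ext (lmap ?Y) h*g) = ext (lmap ?Y) h*ext (lmap ?X) g"
   by (rule ext_eq) auto
  thus "FA ?G (b**a) = FA ?G b*FA ?G a" by (simp add: c ab(3)[symmetric])
 qed (auto simp: Idt_FC)
 have bij: "bij_betw fnf (Hom FC X Y) (hom X (lobj Y))" if "obj X" "obj Y" for X Y
  by (rule bij_betwI[where g = "mk X Y"]) (use that mk_fnf in "auto simp: fnf_Hom")
 have nat: "fnf (k**h**FA L f) = FA ?G k*fnf h*f"
  if f: "arr f" and k: "k : Arr FC" and h: "h : Hom FC (cod f) (Dom FC k)" for f k h
 proof -
  from k obtain u where u: "k = mk (Dom FC k) (Cod FC k) u" and [simp]: "obj (Dom FC k)" "obj (Cod FC k)"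
   "arr u" "dom u = Dom FC k" "cod u = lobj (Cod FC k)" by (elim FC_ArrE)
  from h obtain v where v: "h = mk (cod f) (Dom FC k) v" and [simp]:
   "arr v" "dom v = cod f" "cod v = lobj (Dom FC k)" by (metis FC_ArrE Hom_iff)
  have [simp]: "arr f" by fact
  let ?Y = "cod f" and ?Z = "Dom FC k"
  have n [simp]: "fnf h = v" "fnf k = u" by (simp add: v) (subst u, simp)
  have 1: "ext (lmap ?Y) (ext (lmap ?Z) u*v)*(lmap ?Y*f) = (ext (lmap ?Z) u*v)*f"
   using Cmp_assoc_simp[of f "lmap ?Y" "ext (lmap ?Y) (ext (lmap ?Z) u*v)"] by simp
  have "k**h**FA L f = mk (dom f) (Cod FC k) ((ext (lmap ?Z) u*v)*f)"
   by (subst u, subst v, subst FA_L) (use 1 in auto)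
  thus ?thesis by simp
 qed
 have "is_right_adjoint C FC L ?G"
  unfolding is_right_adjoint_def using functor_L G bij nat
  by (intro conjI exI[of _ "%_ _. fnf"]) auto
 thus ?thesis by blast
qed

text \<open>\<open>F\<close> need not preserve local objects, hence its value at an arrow has no
  simple normal form. It is determined by \<open>mkF\<close> after composing with the image of
  \<open>lmap Y\<close>, which is invertible; functoriality is checked after this
  composition.\<close>

lemma frac_functor:
 assumes F: "is_functor C C F" and FS: "!!s. s : S ==> FA F s : S"
 shows "is_functor FC FC (frac_functor C S F)"
  and "arr f ==> FA (frac_functor C S F) (FA L f) = FA L (FA F f)"
proof -
 note Fs [simp] = is_functor_simps[OF F]
 let ?F = "frac_functor C S F"
 have [simp]: "FO ?F X = FO F X" for X by (simp add: frac_functor_def)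
 have roof: "(FA F f, FA F s) : roofs C S" if "(f, s) : roofs C S" for f s
  using that FS by (auto simp: roofs_iff S_Arr)
 have rel: "((FA F f, FA F s), (FA F f', FA F s')) : roof_rel C S" if fs: "((f, s), (f', s')) : roof_rel C S" for f s f' s'
 proof -
  from fs have r: "arr f" "s : S" "arr s" "cod f = cod s" "arr f'" "s' : S" "arr s'" "cod f' = cod s'"
   "dom f = dom f'" "dom s = dom s'" by (auto simp: roof_rel_iff roofs_iff S_Arr)
  from fs obtain Z u v where uv: "obj Z" "u : hom (cod f) Z" "v : hom (cod f') Z"
   "u*f = v*f'" "u*s = v*s'" "u*s : S" unfolding roof_rel_def by blast
  have "FA F u*FA F f = FA F v*FA F f'" "FA F u*FA F s = FA F v*FA F s'" "FA F u*FA F s : S"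
   using uv r FS[of "u*s"] Fs(6)[of f u] Fs(6)[of f' v] Fs(6)[of s u] Fs(6)[of s' v] by auto
  moreover have "FA F u : hom (cod (FA F f)) (FO F Z)" "FA F v : hom (cod (FA F f')) (FO F Z)" "obj (FO F Z)"
   using uv r by auto
  moreover have "dom (FA F f) = dom (FA F f')" "dom (FA F s) = dom (FA F s')"
   "cod (FA F f) = cod (FA F s)" "cod (FA F f') = cod (FA F s')"
   using r by simp_all
  moreover have "(FA F f, FA F s) : roofs C S" "(FA F f', FA F s') : roofs C S"
   using r FS by (simp_all add: roofs_iff)
  ultimately show ?thesis unfolding roof_rel_def by blast
 qed
 have cls: "FA ?F (roof_rel C S `` {(f, s)}) = roof_rel C S `` {(FA F f, FA F s)}" if fs: "(f, s) : roofs C S" for f s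
 proof -
  have "(f, s) : roof_rel C S `` {(f, s)}" using fs by (simp add: roof_rel_iff)
  hence "(FA F f, FA F s) : map_prod (FA F) (FA F) ` (roof_rel C S `` {(f, s)})" by force
  moreover have "map_prod (FA F) (FA F) ` (roof_rel C S `` {(f, s)}) <= roof_rel C S `` {(FA F f, FA F s)}"
   using rel by auto
  ultimately show ?thesis unfolding frac_functor_def cfunctor.simps
   using class_eq_mk[OF roof[OF fs]] by (metis Image_roof_rel)
 qed
 have L: "FA ?F (FA L f) = FA L (FA F f)" if "arr f" for f
  using that cls[of f "idt (cod f)"] by (simp add: frac_loc_def roofs_iff S_Idt)
 thus "arr f ==> FA ?F (FA L f) = FA L (FA F f)" .
 have mkF: "FA ?F (mk X Y g) : Hom FC (FO F X) (FO F Y) & FA L (FA F (lmap Y))**FA ?F (mk X Y g) = FA L (FA F g)"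
  if [simp]: "obj Y" "arr g" "dom g = X" "cod g = lobj Y" for X Y g
 proof -
  let ?s = "FA F (lmap Y)"
  have s [simp]: "?s : S" by (simp add: FS)
  have [simp]: "obj X" using Dom_Obj[of g] by simp
  have r: "(FA F g, ?s) : roofs C S" by (simp add: roofs_iff)
  have e: "FA ?F (mk X Y g) = mk (FO F X) (FO F Y) (nf (FA F g, ?s))"
   using mk_class[of Y g X] cls[of g "lmap Y"] class_eq_mk[OF r] by (simp add: roofs_iff)
  let ?W = "FO F (lobj Y)"
  have "ext (lmap (FO F Y)) (lmap ?W*?s)*ext ?s (lmap (FO F Y)) = lmap ?W"
   by (rule local_unique[OF s, where Z = "lobj ?W"]) auto
  hence "ext (lmap (FO F Y)) (lmap ?W*?s)*nf (FA F g, ?s) = lmap ?W*FA F g"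
   using Cmp_assoc_simp[of "FA F g" "ext ?s (lmap (FO F Y))" "ext (lmap (FO F Y)) (lmap ?W*?s)"]
   by (simp add: nf_def)
  thus ?thesis using e nf_simps[OF r] by (simp add: FA_L)
 qed
 interpret FC: category FC by (rule category_FC)
 show "is_functor FC FC ?F" unfolding is_functor_def
 proof (intro conjI ballI impI)
  fix a assume "a : Arr FC"
  thus "FA ?F a : Hom FC (FO ?F (Dom FC a)) (FO ?F (Cod FC a))"
   by (elim FC_ArrE) (metis mkF \<open>!!X. FO ?F X = FO F X\<close>)
 next
  fix X assume "X : Obj FC"
  hence "obj X" by simp
  thus "FA ?F (Idt FC X) = Idt FC (FO ?F X)"
   using L[of "idt X"] is_functor_simps(5)[OF functor_L] by simp
 next
  fix a b assume ab: "a : Arr FC" "b : Arr FC" "Cod FC a = Dom FC b"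
  from ab obtain g where g: "a = mk (Dom FC a) (Cod FC a) g" and [simp]: "obj (Dom FC a)" "obj (Cod FC a)"
   "arr g" "dom g = Dom FC a" "cod g = lobj (Cod FC a)" by (elim FC_ArrE)
  from ab obtain h where h: "b = mk (Cod FC a) (Cod FC b) h" and [simp]: "obj (Cod FC b)"
   "arr h" "dom h = Cod FC a" "cod h = lobj (Cod FC b)" by (metis FC_ArrE)
  let ?X = "Dom FC a" and ?Y = "Cod FC a" and ?Z = "Cod FC b"
  define e where "e = ext (lmap ?Y) h"
  have e [simp]: "arr e" "dom e = lobj ?Y" "cod e = lobj ?Z" "e*lmap ?Y = h" by (auto simp: e_def)
  have c: "b**a = mk ?X ?Z (e*g)" unfolding e_def by (subst g, subst h) simp
  note LF = is_functor_simps[OF functor_L]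
  have Fa: "FA ?F a : Hom FC (FO F ?X) (FO F ?Y)" "FA L (FA F (lmap ?Y))**FA ?F a = FA L (FA F g)"
   using mkF[of ?Y g ?X] g by auto
  have Fb: "FA ?F b : Hom FC (FO F ?Y) (FO F ?Z)" "FA L (FA F (lmap ?Z))**FA ?F b = FA L (FA F h)"
   using mkF[of ?Z h ?Y] h by auto
  have Fc: "FA ?F (b**a) : Hom FC (FO F ?X) (FO F ?Z)"
    "FA L (FA F (lmap ?Z))**FA ?F (b**a) = FA L (FA F (e*g))"
   using mkF[of ?Z "e*g" ?X] c by auto
  have iso: "is_iso FC (FA L (FA F (lmap ?Z)))" by (intro L_iso FS) auto
  have "FA L (FA F (lmap ?Z))**(FA ?F b**FA ?F a) =
     (FA L (FA F (lmap ?Z))**FA ?F b)**FA ?F a"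
   using Fa Fb LF by (subst FC.Cmp_assoc_simp) auto
  also have "... = (FA L (FA F e)**FA L (FA F (lmap ?Y)))**FA ?F a"
   using Fb(2) Fs(6)[of "lmap ?Y" e] LF(6)[of "FA F (lmap ?Y)" "FA F e"] by simp
  also have "... = FA L (FA F e)**(FA L (FA F (lmap ?Y))**FA ?F a)"
   using Fa(1) LF by (subst FC.Cmp_assoc_simp) auto
  also have "... = FA L (FA F (lmap ?Z))**FA ?F (b**a)"
   unfolding Fa Fc using LF by simp
  finally have eq: "FA L (FA F (lmap ?Z))**(FA ?F b**FA ?F a) =
   FA L (FA F (lmap ?Z))**FA ?F (b**a)" .
  have t: "FA ?F b**FA ?F a : Hom FC (FO F ?X) (FO F ?Z)" using Fa(1) Fb(1) by simp
  show "FA ?F (b**a) = FA ?F b**FA ?F a"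
   by (rule FC.iso_mono_cancel[OF iso _ _ _ _ eq[symmetric]]) (use Fc(1) t LF in simp_all)
 qed simp
qed

end

section \<open>Abelian categories\<close>

context preadditive begin

abbreviation "neg == Neg C"
abbreviation "zer == Zer C"

lemma hom_group_facts:
 assumes "obj X" "obj Y"
 shows "f : hom X Y ==> g : hom X Y ==> f++g : hom X Y"
  and "zer X Y : hom X Y"
  and "f : hom X Y ==> g : hom X Y ==> f++g = g++f"
  and "f : hom X Y ==> g : hom X Y ==> h : hom X Y ==> (f++g)++h = f++(g++h)"
  and "f : hom X Y ==> zer X Y++f = f"
  and "f : hom X Y ==> neg f : hom X Y"
  and "f : hom X Y ==> neg f++f = zer X Y"
  and "f : hom X Y ==> g : hom X Y ==> h : hom X Y ==> f++g = f++h <-> g = h"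
proof -
 interpret G: comm_group "hom_group C X Y" by (rule hom_comm_group[OF assms])
 have c: "carrier (hom_group C X Y) = hom X Y" "mult (hom_group C X Y) = Add C"
  "one (hom_group C X Y) = zer X Y" by (simp_all add: hom_group_def)
 show "f : hom X Y ==> g : hom X Y ==> f++g : hom X Y"
  using G.m_closed[of f g] unfolding c by blast
 show "zer X Y : hom X Y" using G.one_closed unfolding c by blast
 show "f : hom X Y ==> g : hom X Y ==> f++g = g++f"
  using G.m_comm[of f g] unfolding c by blast
 show "f : hom X Y ==> g : hom X Y ==> h : hom X Y ==> (f++g)++h = f++(g++h)"
  using G.m_assoc[of f g h] unfolding c by blast
 show "f : hom X Y ==> zer X Y++f = f"
  using G.l_one[of f] unfolding c by blast
 show "f : hom X Y ==> neg f : hom X Y"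
  using G.inv_closed[of f] unfolding c Neg_def by simp
 show "f : hom X Y ==> neg f++f = zer X Y"
  using G.l_inv[of f] unfolding c Neg_def by simp
 show "f : hom X Y ==> g : hom X Y ==> h : hom X Y ==> f++g = f++h <-> g = h"
  using G.Units_l_cancel[of f g h] unfolding G.Units_eq c by simp
qed

lemma Add_simps [simp]:
 assumes "arr f" "arr g" "dom g = dom f" "cod g = cod f"
 shows "f++g : Arr C" "dom (f++g) = dom f" "cod (f++g) = cod f"
 using hom_group_facts(1)[of "dom f" "cod f" f g] assms by auto

lemma Zer_simps [simp]:
 assumes "obj X" "obj Y"
 shows "arr (zer X Y)" "dom (zer X Y) = X" "cod (zer X Y) = Y"
 using hom_group_facts(2)[OF assms] by auto

lemma Add_commute:
 "arr f ==> arr g ==> dom g = dom f ==> cod g = cod f ==> f++g = g++f"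
 using hom_group_facts(3)[of "dom f" "cod f" f g] by auto

lemma Add_assoc:
 "arr f ==> arr g ==> arr h ==> dom g = dom f ==> cod g = cod f ==>
  dom h = dom f ==> cod h = cod f ==> (f++g)++h = f++(g++h)"
 using hom_group_facts(4)[of "dom f" "cod f" f g h] by auto

lemma Add_left_commute:
 "arr f ==> arr g ==> arr h ==> dom g = dom f ==> cod g = cod f ==>
  dom h = dom f ==> cod h = cod f ==> f++(g++h) = g++(f++h)"
 using Add_assoc[of f g h] Add_assoc[of g f h] Add_commute[of f g] by simp

lemma Add_Zer_left [simp]: "arr f ==> dom f = X ==> cod f = Y ==> zer X Y++f = f"
 using hom_group_facts(5)[of "dom f" "cod f" f] by auto

lemma Add_Zer_right [simp]: "arr f ==> dom f = X ==> cod f = Y ==> f++zer X Y = f"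
 using Add_commute[of f "zer X Y"] Dom_Obj[of f] Cod_Obj[of f] by fastforce

lemma Neg_simps [simp]:
 assumes "arr f"
 shows "arr (neg f)" "dom (neg f) = dom f" "cod (neg f) = cod f"
 using hom_group_facts(6)[of "dom f" "cod f" f] assms by auto

lemma Neg_Add [simp]: "arr f ==> neg f++f = zer (dom f) (cod f)"
 using hom_group_facts(7)[of "dom f" "cod f" f] by auto

lemma Add_Neg [simp]: "arr f ==> f++neg f = zer (dom f) (cod f)"
 using Neg_Add[of f] Add_commute[of f "neg f"] by simp

lemma Add_cancel:
 "arr f ==> arr g ==> arr h ==> dom g = dom f ==> cod g = cod f ==>
  dom h = dom f ==> cod h = cod f ==> f++g = f++h <-> g = h"
 using hom_group_facts(8)[of "dom f" "cod f" f g h] by auto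

lemma Add_Neg_cancel [simp]:
 assumes "arr f" "arr g" "dom g = dom f" "cod g = cod f"
 shows "f++(neg f++g) = g" "neg f++(f++g) = g"
 using assms Add_assoc[of f "neg f" g] Add_assoc[of "neg f" f g] by simp_all

lemma Neg_unique:
 assumes "arr f" "arr g" "dom g = dom f" "cod g = cod f"
  "f++g = zer (dom f) (cod f)"
 shows "neg f = g"
proof -
 have "f++neg f = f++g" using assms by simp
 thus ?thesis using Add_cancel[of f "neg f" g] assms by simp
qed

lemma Neg_Neg [simp]: "arr f ==> neg (neg f) = f"
 by (rule Neg_unique) auto

lemma Neg_Zer [simp]: "obj X ==> obj Y ==> neg (zer X Y) = zer X Y"
 by (rule Neg_unique) auto

lemma Neg_distrib:
 assumes "arr f" "arr g" "dom g = dom f" "cod g = cod f"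
 shows "neg (f++g) = neg f++neg g"
proof (rule Neg_unique)
 have "f++g++(neg f++neg g) = f++(neg f++(g++neg g))"
  using assms Add_left_commute[of g "neg f" "neg g"] Add_assoc[of f g "neg f++neg g"] by simp
 also have "... = zer (dom f) (cod f)" using assms by simp
 finally show "f++g++(neg f++neg g) = zer (dom (f++g)) (cod (f++g))"
  using assms by simp
qed (use assms in auto)

lemma Cmp_Add:
 "arr f ==> arr f' ==> arr g ==> dom f' = dom f ==> cod f' = cod f ==>
  dom g = cod f ==> g*(f++f') = (g*f)++(g*f')"
 using Cmp_Add[of f "dom f" "cod f" f' g "cod g"] by simp

lemma Add_Cmp:
 "arr f ==> arr g ==> arr g' ==> dom g' = dom g ==> cod g' = cod g ==>
  dom g = cod f ==> (g++g')*f = (g*f)++(g'*f)"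
 using Add_Cmp[of f "dom f" "cod f" g "cod g" g'] by simp

lemma Add_self_Zer:
 assumes "arr f" "f++f = f"
 shows "f = zer (dom f) (cod f)"
 using Add_cancel[of f f "zer (dom f) (cod f)"] assms by simp

lemma Zer_Cmp [simp]:
 assumes "arr f" "cod f = Y" "obj Z"
 shows "zer Y Z*f = zer (dom f) Z"
proof -
 have Y: "obj Y" using assms by auto
 hence "zer Y Z*f++zer Y Z*f = zer Y Z*f"
  using Add_Cmp[of f "zer Y Z" "zer Y Z"] assms by simp
 from Add_self_Zer[OF _ this] show ?thesis using assms Y by simp
qed

lemma Cmp_Zer [simp]:
 assumes "arr f" "dom f = Y" "obj Z"
 shows "f*zer Z Y = zer Z (cod f)"
proof -
 have Y: "obj Y" using assms by auto
 hence "f*zer Z Y++f*zer Z Y = f*zer Z Y"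
  using Cmp_Add[of "zer Z Y" "zer Z Y" f] assms by simp
 from Add_self_Zer[OF _ this] show ?thesis using assms Y by simp
qed

lemma Cmp_Neg [simp]:
 assumes "arr f" "arr g" "dom g = cod f"
 shows "g*neg f = neg (g*f)"
 by (rule Neg_unique[symmetric]) (use assms Cmp_Add[of f "neg f" g] in auto)

lemma Neg_Cmp [simp]:
 assumes "arr f" "arr g" "dom g = cod f"
 shows "neg g*f = neg (g*f)"
 by (rule Neg_unique[symmetric]) (use assms Add_Cmp[of f g "neg g"] in auto)

lemmas Add_ac = Add_assoc Add_commute Add_left_commute

text \<open>Vanishing without mention of the end points, so that it propagates through composites by
  simplification rules.\<close>

definition nul where
 "nul f <-> f = zer (dom f) (cod f)"

lemma nul_Zer [simp]: "obj X ==> obj Y ==> nul (zer X Y)" by (simp add: nul_def)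

lemma nul_eq: "nul f ==> dom f = X ==> cod f = Y ==> f = zer X Y" by (simp add: nul_def)

lemma nul_Cmp_left [simp]: "nul g ==> arr f ==> arr g ==> dom g = cod f ==> nul (g*f)"
 by (metis Cod_Obj Zer_Cmp Cmp_simps(2,3) nul_def)

lemma nul_Cmp_right [simp]: "nul f ==> arr f ==> arr g ==> dom g = cod f ==> nul (g*f)"
 by (metis Dom_Obj Cmp_Zer Cmp_simps(2,3) nul_def)

lemma nul_Cmp_left2 [simp]:
 "nul (h*g) ==> arr f ==> arr g ==> arr h ==> dom g = cod f ==> dom h = cod g ==>
  nul (h*(g*f))"
 using nul_Cmp_left[of "h*g" f] by simp

lemma nul_dif:
 assumes "arr f" "arr g" "dom g = dom f" "cod g = cod f"
 shows "nul (f++neg g) <-> f = g"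
proof
 assume "nul (f++neg g)"
 hence "f++neg g = zer (dom f) (cod f)" using assms by (simp add: nul_def)
 hence "neg f = neg g" using assms by (intro Neg_unique) auto
 thus "f = g" using assms by (metis Neg_Neg)
qed (use assms in auto)

lemma nul_Neg [simp]: "arr f ==> nul (neg f) <-> nul f"
 by (metis Cod_Obj Dom_Obj Neg_Neg Neg_Zer Neg_simps(2,3) nul_def)

lemma nul_Add: "nul f ==> arr f ==> arr g ==> dom g = dom f ==> cod g = cod f ==> f++g = g"
 by (metis Add_Zer_left nul_def)

lemma nul_Add_right: "nul f ==> arr f ==> arr g ==> dom g = dom f ==> cod g = cod f ==> g++f = g"
 by (metis Add_Zer_right nul_def)

lemma Add_eq_iff:
 assumes "arr f" "arr g" "arr h" "dom g = dom f" "cod g = cod f" "dom h = dom f" "cod h = cod f"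
 shows "f = g++h <-> f++neg g = h"
proof -
 have 1: "(g++h)++neg g = h" using Add_commute[of "g++h" "neg g"] assms by simp
 have 2: "g++(f++neg g) = f" using Add_left_commute[of g f "neg g"] assms by simp
 show ?thesis using 1 2 by metis
qed

lemma mono_iff:
 "mono m <-> arr m & (ALL x : Arr C. cod x = dom m --> nul (m*x) --> nul x)"
proof
 assume m: "mono m"
 hence "arr m" by (simp add: is_mono_def)
 moreover have "nul x" if x: "arr x" "cod x = dom m" "nul (m*x)" for x
 proof -
  have "m*x = m*zer (dom x) (dom m)" using x \<open>arr m\<close> by (simp add: nul_def)
  hence "x = zer (dom x) (dom m)" using m x \<open>arr m\<close> unfolding is_mono_def
   by (metis Dom_Obj Hom_iff Zer_simps)
  thus ?thesis using x by (simp add: nul_def)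
 qed
 ultimately show "arr m & (ALL x : Arr C. cod x = dom m --> nul (m*x) --> nul x)" by blast
next
 assume a: "arr m & (ALL x : Arr C. cod x = dom m --> nul (m*x) --> nul x)"
 show "mono m" unfolding is_mono_def
 proof (intro conjI ballI impI)
  fix X g h assume X: "obj X" and g: "g : hom X (dom m)" and h: "h : hom X (dom m)" and e: "m*g = m*h"
  have "m*(g++neg h) = m*g++neg (m*h)" using g h a by (simp add: Cmp_Add)
  hence "nul (m*(g++neg h))" using e g h a X by simp
  hence "nul (g++neg h)" using a g h by auto
  thus "g = h" using g h by (simp add: nul_dif)
 qed (use a in auto)
qed

lemma epi_iff:
 "epi m <-> arr m & (ALL x : Arr C. dom x = cod m --> nul (x*m) --> nul x)"
proof
 assume m: "epi m"
 hence "arr m" by (simp add: is_epi_def)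
 moreover have "nul x" if x: "arr x" "dom x = cod m" "nul (x*m)" for x
 proof -
  have "x*m = zer (cod m) (cod x)*m" using x \<open>arr m\<close> by (simp add: nul_def)
  hence "x = zer (cod m) (cod x)" using m x \<open>arr m\<close> unfolding is_epi_def
   by (metis Cod_Obj Hom_iff Zer_simps)
  thus ?thesis using x by (simp add: nul_def)
 qed
 ultimately show "arr m & (ALL x : Arr C. dom x = cod m --> nul (x*m) --> nul x)" by blast
next
 assume a: "arr m & (ALL x : Arr C. dom x = cod m --> nul (x*m) --> nul x)"
 show "epi m" unfolding is_epi_def
 proof (intro conjI ballI impI)
  fix X g h assume X: "obj X" and g: "g : hom (cod m) X" and h: "h : hom (cod m) X" and e: "g*m = h*m"
  have "(g++neg h)*m = g*m++neg (h*m)" using g h a by (simp add: Add_Cmp)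
  hence "nul ((g++neg h)*m)" using e g h a X by simp
  hence "nul (g++neg h)" using a g h by auto
  thus "g = h" using g h by (simp add: nul_dif)
 qed (use a in auto)
qed

lemma mono_Arr [simp]: "mono m ==> arr m" by (simp add: is_mono_def)
lemma epi_Arr [simp]: "epi m ==> arr m" by (simp add: is_epi_def)

lemma mono_cancel:
 "mono m ==> m*x = m*y ==> arr x ==> arr y ==> cod x = dom m ==> cod y = dom m ==> x = y"
 unfolding is_mono_def by (metis Cmp_simps(2) Dom_Obj Hom_iff)

lemma epi_cancel:
 "epi m ==> x*m = y*m ==> arr x ==> arr y ==> dom x = cod m ==> dom y = cod m ==> x = y"
 unfolding is_epi_def by (metis Cmp_simps(3) Cod_Obj Hom_iff)

lemma mono_nul: "mono m ==> nul (m*x) ==> arr x ==> cod x = dom m ==> nul x"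
 unfolding mono_iff by simp

lemma epi_nul: "epi m ==> nul (x*m) ==> arr x ==> dom x = cod m ==> nul x"
 unfolding epi_iff by simp

lemma mono_Cmp [simp]:
 assumes "mono f" "mono g" "dom g = cod f"
 shows "mono (g*f)"
 unfolding mono_iff
proof (intro conjI ballI impI)
 fix x assume x: "arr x" "cod x = dom (g*f)" "nul ((g*f)*x)"
 hence "nul (g*(f*x))" using assms by simp
 hence "nul (f*x)" by (rule mono_nul[OF assms(2)]) (use x assms in auto)
 thus "nul x" by (rule mono_nul[OF assms(1)]) (use x assms in auto)
qed (use assms in simp)

lemma epi_Cmp [simp]:
 assumes "epi f" "epi g" "dom g = cod f"
 shows "epi (g*f)"
 unfolding epi_iff
proof (intro conjI ballI impI)
 fix x assume x: "arr x" "dom x = cod (g*f)" "nul (x*(g*f))"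
 hence "nul ((x*g)*f)" using assms by simp
 hence "nul (x*g)" by (rule epi_nul[OF assms(1)]) (use x assms in auto)
 thus "nul x" by (rule epi_nul[OF assms(2)]) (use x assms in auto)
qed (use assms in simp)

lemma mono_Idt [simp]: "obj X ==> mono (idt X)" unfolding mono_iff by simp
lemma epi_Idt [simp]: "obj X ==> epi (idt X)" unfolding epi_iff by simp

lemma mono_right:
 assumes "mono (g*f)" "arr f" "arr g" "dom g = cod f"
 shows "mono f"
 unfolding mono_iff
proof (intro conjI ballI impI)
 fix x assume x: "arr x" "cod x = dom f" "nul (f*x)"
 hence "nul (g*(f*x))" using assms by simp
 hence "nul ((g*f)*x)" using x assms by simp
 thus "nul x" by (rule mono_nul[OF assms(1)]) (use x assms in auto)
qed fact

lemma epi_left: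
 assumes "epi (g*f)" "arr f" "arr g" "dom g = cod f"
 shows "epi g"
 unfolding epi_iff
proof (intro conjI ballI impI)
 fix x assume x: "arr x" "dom x = cod g" "nul (x*g)"
 hence "nul (x*(g*f))" using assms by simp
 thus "nul x" by (rule epi_nul[OF assms(1)]) (use x assms in auto)
qed fact

lemma iso_mono_epi: "is_iso C f ==> mono f & epi f"
 by (erule is_isoE) (metis mono_right epi_left mono_Idt epi_Idt Dom_Obj Cod_Obj)

lemma is_zero_iff: "zero Z <-> obj Z & nul (idt Z)"
proof
 assume z: "zero Z"
 hence Z: "obj Z" by (simp add: is_zero_def)
 have "idt Z = zer Z Z" using z Z unfolding is_zero_def by (metis Hom_iff Idt_simps Zer_simps)
 thus "obj Z & nul (idt Z)" using Z by simp
next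
 assume a: "obj Z & nul (idt Z)"
 have "f = zer X Z" if "f : hom X Z" for f X
  using nul_Cmp_left[of "idt Z" f] a that by (auto intro: nul_eq)
 moreover have "f = zer Z X" if "f : hom Z X" for f X
  using nul_Cmp_right[of "idt Z" f] a that by (auto intro: nul_eq)
 ultimately show "zero Z" unfolding is_zero_def using a by (metis Hom_iff Zer_simps)
qed

lemma zero_nul: "zero Z ==> arr f ==> dom f = Z | cod f = Z ==> nul f"
 unfolding is_zero_iff using nul_Cmp_left[of "idt Z" f] nul_Cmp_right[of "idt Z" f] by auto

lemma kernel_mono: "is_kernel C k f ==> mono k"
 unfolding is_mono_def
proof (intro conjI ballI impI)
 assume k: "is_kernel C k f"
 thus "arr k" by (simp add: is_kernel_def)
 fix X g h assume X: "obj X" and g: "g : hom X (dom k)" and h: "h : hom X (dom k)" and e: "k*g = k*h"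
 have ka: "arr k" "arr f" "cod k = dom f" "f*k = zer (dom k) (cod f)"
  using k by (auto simp: is_kernel_def)
 have "f*(k*g) = (f*k)*g" using ka(1-3) g by (subst Cmp_assoc_simp) auto
 hence "f*(k*g) = zer X (cod f)" using ka g by simp
 hence "EX! h. h : hom X (dom k) & k*h = k*g"
  using k X g ka unfolding is_kernel_def by (metis Cmp_simps Hom_iff)
 thus "g = h" using g h e by metis
qed

lemma cokernel_epi: "is_cokernel C k f ==> epi k"
 unfolding is_epi_def
proof (intro conjI ballI impI)
 assume k: "is_cokernel C k f"
 thus "arr k" by (simp add: is_cokernel_def)
 fix X g h assume X: "obj X" and g: "g : hom (cod k) X" and h: "h : hom (cod k) X" and e: "g*k = h*k"
 have ka: "arr k" "arr f" "dom k = cod f" "k*f = zer (dom f) (cod k)"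
  using k by (auto simp: is_cokernel_def)
 have "(g*k)*f = zer (dom f) X" using ka g by simp
 hence "EX! h. h : hom (cod k) X & h*k = g*k"
  using k X g ka unfolding is_cokernel_def by (metis Cmp_simps Hom_iff)
 thus "g = h" using g h e by metis
qed

end

section \<open>Kernels, images and subobjects through generalized elements\<close>

context abelian_category begin

text \<open>Arrows into \<open>X\<close> are used as generalized elements of \<open>X\<close>:
  \<open>sv\<close>, \<open>el\<close>, \<open>zr\<close> and \<open>kr\<close> are the elements of
  a subobject, of the whole object, of zero and of a kernel.\<close>

definition sv :: "'m => 'm set" where
 "sv i = {x : Arr C. cod x = cod i & (EX h : hom (dom x) (dom i). i*h = x)}"

definition el :: "'o => 'm set" where "el X = {x : Arr C. cod x = X}"

definition zr :: "'o => 'm set" where "zr X = {x : Arr C. cod x = X & nul x}"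

definition kr :: "'m => 'm set" where "kr f = {x : Arr C. cod x = dom f & nul (f*x)}"

lemma el_iff [simp]: "x : el X <-> arr x & cod x = X" by (simp add: el_def)
lemma zr_iff [simp]: "x : zr X <-> arr x & cod x = X & nul x" by (simp add: zr_def)
lemma kr_iff [simp]: "x : kr f <-> arr x & cod x = dom f & nul (f*x)" by (simp add: kr_def)

lemma sv_self: "arr i ==> i : sv i"
 unfolding sv_def by (auto intro!: bexI[of _ "idt (dom i)"])

lemma svI: "arr h ==> cod h = dom i ==> arr i ==> i*h : sv i"
 unfolding sv_def by auto

lemma svE:
 assumes "x : sv i"
 obtains h where "arr h" "cod h = dom i" "x = i*h"
 using assms unfolding sv_def by auto

lemma kernel_sv: "is_kernel C k f ==> mono k & arr f & cod k = dom f & sv k = kr f"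
proof (intro conjI)
 assume k: "is_kernel C k f"
 thus "mono k" by (rule kernel_mono)
 from k have ka: "arr k" "arr f" "cod k = dom f" and fk: "f*k = zer (dom k) (cod f)"
  by (auto simp: is_kernel_def)
 thus "arr f" "cod k = dom f" by auto
 show "sv k = kr f"
 proof (intro equalityI subsetI)
  fix x assume "x : sv k"
  then obtain h where h: "arr h" "cod h = dom k" "x = k*h" by (rule svE)
  have "nul (f*k)" using fk ka by simp
  thus "x : kr f" using h ka by simp
 next
  fix x assume x: "x : kr f"
  hence "f*x = zer (dom x) (cod f)" using ka by (auto intro!: nul_eq)
  hence "EX h. h : hom (dom x) (dom k) & k*h = x"
   using k x unfolding is_kernel_def by (metis Dom_Obj Hom_iff kr_iff)
  thus "x : sv k" unfolding sv_def using x ka by auto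
 qed
qed

lemma kernelI:
 assumes k: "mono k" and f: "arr f" "cod k = dom f" and sv: "sv k = kr f"
 shows "is_kernel C k f"
proof -
 have "k : kr f" using sv_self[of k] k sv by simp
 hence fk: "f*k = zer (dom k) (cod f)" using k f by (intro nul_eq) auto
 have U: "EX! h. h : hom X (dom k) & k*h = g"
  if g: "g : hom X (dom f)" "f*g = zer X (cod f)" "obj X" for X g
 proof -
  have "g : sv k" using g f unfolding sv by auto
  then obtain h where h: "arr h" "cod h = dom k" "g = k*h" by (rule svE)
  hence "dom h = X" using g k by simp
  show ?thesis
   by (rule ex1I[of _ h]) (use h k \<open>dom h = X\<close> in "auto intro: mono_cancel")
 qed
 show ?thesis unfolding is_kernel_def by (intro conjI ballI impI U) (use fk k f in simp_all)
qed

lemma ex_ker: "arr f ==> EX k. mono k & cod k = dom f & sv k = kr f"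
 using ex_kernel kernel_sv by blast

lemma epi_factor:
 assumes q: "epi q" and f: "arr f" "dom f = dom q" and k: "kr q <= kr f"
 shows "EX g. arr g & dom g = cod q & cod g = cod f & g*q = f"
proof -
 obtain g where g: "is_cokernel C q g" using epi_is_cokernel[OF q] by auto
 hence ga: "arr g" "dom q = cod g" "q*g = zer (dom g) (cod q)"
  by (auto simp: is_cokernel_def)
 hence "g : kr f" using k q by (intro subsetD[OF k]) simp
 hence "f*g = zer (dom g) (cod f)" using f ga by (intro nul_eq) auto
 hence "EX h. h : hom (cod q) (cod f) & h*q = f"
  using g f ga unfolding is_cokernel_def by (metis Cod_Obj Hom_iff)
 thus ?thesis by auto
qed

text \<open>A monomorphism is the kernel of some \<open>g\<close>, and \<open>g\<close> factors
  through the cokernel \<open>c\<close>; so everything killed by \<open>c\<close> is killed by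
  \<open>g\<close>.\<close>

lemma mono_kr_coker:
 assumes m: "mono m" and c: "is_cokernel C c m"
 shows "sv m = kr c"
proof -
 have ca: "arr c" "dom c = cod m" "c*m = zer (dom m) (cod c)"
  using c by (auto simp: is_cokernel_def)
 obtain g where g: "is_kernel C m g" using mono_is_kernel[OF m] by auto
 hence gs: "arr g" "cod m = dom g" "sv m = kr g" using kernel_sv by auto
 have "m : kr g" using sv_self[of m] m gs by simp
 hence "g*m = zer (dom m) (cod g)" using gs m by (intro nul_eq) auto
 then obtain h where h: "h : hom (cod c) (cod g)" "h* c = g"
  using c gs m unfolding is_cokernel_def by (metis Cod_Obj Hom_iff)
 show ?thesis
 proof (intro equalityI subsetI)
  fix x assume "x : sv m"
  then obtain y where y: "arr y" "cod y = dom m" "x = m*y" by (rule svE)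
  have "nul (c*m)" using ca m by simp
  thus "x : kr c" using y m ca by simp
 next
  fix x assume x: "x : kr c"
  have "g*x = h*(c*x)" using h ca x by auto
  hence "x : kr g" using x h gs ca by (auto intro!: nul_Cmp_right)
  thus "x : sv m" using gs by simp
 qed
qed

lemma ex_coker:
 assumes "arr f"
 shows "EX q. epi q & dom q = cod f & nul (q*f) & is_cokernel C q f"
proof -
 obtain q where q: "is_cokernel C q f" using ex_cokernel[OF assms] by auto
 hence "arr q" "dom q = cod f" "q*f = zer (dom f) (cod q)" by (auto simp: is_cokernel_def)
 hence "epi q & dom q = cod f & nul (q*f) & is_cokernel C q f"
  using q cokernel_epi[OF q] assms by simp
 thus ?thesis by blast
qed

lemma cokernel_factor:
 assumes "is_cokernel C q f" "arr g" "dom g = cod f" "nul (g*f)" "arr f"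
 shows "EX h. arr h & dom h = cod q & cod h = cod g & h*q = g"
proof -
 have "g*f = zer (dom f) (cod g)" using assms by (intro nul_eq) auto
 thus ?thesis using assms unfolding is_cokernel_def by (metis Cod_Obj Hom_iff)
qed

lemma cokernelI:
 assumes q: "epi q" and f: "arr f" "dom q = cod f" "nul (q*f)" and k: "kr q <= sv f"
 shows "is_cokernel C q f"
proof -
 have U: "EX! h. h : hom (cod q) Y & h*q = g"
  if g: "g : hom (cod f) Y" "g*f = zer (dom f) Y" "obj Y" for Y g
 proof -
  have "kr q <= kr g"
  proof
   fix x assume "x : kr q"
   with k have "x : sv f" by blast
   then obtain h where h: "arr h" "cod h = dom f" "x = f*h" by (rule svE)
   have "nul (g*f)" using g f by simp
   thus "x : kr g" using g(1) h f by simp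
  qed
  from epi_factor[OF q _ _ this] obtain h where h: "h : hom (cod q) Y" "h*q = g"
   using g f by auto
  show ?thesis by (rule ex1I[of _ h]) (use h q in "auto intro: epi_cancel")
 qed
 show ?thesis unfolding is_cokernel_def by (intro conjI ballI impI U) (use f q nul_eq[OF f(3)] in simp_all)
qed

lemma ex_image:
 assumes f: "arr f"
 shows "EX m e. mono m & epi e & dom e = dom f & cod e = dom m & cod m = cod f & f = m*e"
proof -
 obtain c where c: "epi c" "dom c = cod f" "nul (c*f)" "is_cokernel C c f" using ex_coker[OF f] by auto
 obtain m where m: "mono m" "cod m = dom c" "sv m = kr c" using ex_ker[of c] c by auto
 have "f : sv m" unfolding m using f c by auto
 then obtain e where e: "arr e" "cod e = dom m" "f = m*e" by (rule svE)
 have "epi e" unfolding epi_iff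
 proof (intro conjI ballI impI)
  fix g assume g: "arr g" "dom g = cod e" "nul (g*e)"
  obtain k where k: "mono k" "cod k = dom g" "sv k = kr g" using ex_ker[of g] g by auto
  have "e : sv k" unfolding k using e g by auto
  then obtain e' where e': "arr e'" "cod e' = dom k" "e = k*e'" by (rule svE)
  \<comment> \<open>If \<open>g\<close> kills \<open>e\<close>, then \<open>f\<close> factors
    through the smaller subobject \<open>m*k\<close>. The cokernel of the latter then kills
    \<open>f\<close>, factors through \<open>c\<close> and so kills \<open>m\<close>; hence
    \<open>k\<close> has a right inverse and \<open>g\<close> vanishes.\<close>
  let ?n = "m*k"
  have n: "mono ?n" using m k e g by simp
  obtain d where d: "epi d" "dom d = cod ?n" "is_cokernel C d ?n" using ex_coker[of ?n] n by auto
  have sn: "sv ?n = kr d" by (rule mono_kr_coker) fact+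
  have mk: "dom m = cod k" using k(2) e(2) g(2) by simp
  have "f : sv ?n" unfolding e(3) e'(3) using svI[of e' ?n] e'(1,2) m k(1) mk by simp
  hence "nul (d*f)" using sn by simp
  then obtain t where t: "arr t" "dom t = cod c" "t* c = d"
   using cokernel_factor[OF c(4), of d] d f e m k mk by auto
  have "m : kr c" using sv_self[of m] m by auto
  hence "nul (d*m)" unfolding t(3)[symmetric] using t c m by (auto intro: nul_Cmp_right)
  hence "m : sv ?n" unfolding sn using m d k mk by simp
  then obtain r where r: "arr r" "cod r = dom ?n" "m = ?n*r" by (rule svE)
  have r2: "cod r = dom k" using r(2) m k(1) mk by simp
  have r3: "m*(k*r) = m*idt (dom m)" using r(1) r(3)[symmetric] r2 m(1) k(1) mk by simp
  have "dom (?n*r) = dom m" unfolding r(3)[symmetric] ..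
  hence r4: "dom r = dom m" using r(1) r2 m(1) k(1) mk by simp
  have kr: "k*r = idt (dom m)" by (rule mono_cancel[OF m(1) r3]) (use r(1) r2 r4 m(1) k(1) mk in auto)
  have "g = g*(k*r)" using kr g e(2) by simp
  also have "... = (g*k)*r" using g(1) k(1,2) r(1) r2 by simp
  finally have "g = (g*k)*r" .
  moreover have "nul (g*k)" using sv_self[of k] k by auto
  ultimately show "nul g" using g(1) k(1,2) r(1) r2 nul_Cmp_left[of "g*k" r] by simp
 qed (use e in auto)
 thus ?thesis using m e c by (intro exI[of _ m] exI[of _ e]) simp
qed

lemma mono_epi_iso:
 assumes "mono f" "epi f"
 shows "is_iso C f"
proof -
 obtain c where c: "epi c" "dom c = cod f" "nul (c*f)" "is_cokernel C c f" using ex_coker[of f] assms by auto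
 have "nul c" using epi_nul[OF assms(2) c(3)] c by simp
 hence "idt (cod f) : kr c" using c assms by (auto intro: nul_Cmp_left)
 hence "idt (cod f) : sv f" using mono_kr_coker[OF assms(1) c(4)] by simp
 then obtain g where g': "arr g" "cod g = dom f" "idt (cod f) = f*g" by (rule svE)
 have "dom (f*g) = cod f" unfolding g'(3)[symmetric] using assms by simp
 hence g: "arr g" "dom g = cod f" "cod g = dom f" "f*g = idt (cod f)"
  using g' assms by simp_all
 have "f*(g*f) = f*idt (dom f)"
  using Cmp_assoc_simp[of f g f] g assms by simp
 from mono_cancel[OF assms(1) this] have "g*f = idt (dom f)" using g assms by simp
 thus ?thesis by (intro is_isoI[of f g]) (use g assms in auto)
qed

text \<open>Pullbacks of epimorphisms are epimorphisms: \<open>x\<close> and \<open>e\<close> are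
  the projections of the pullback of \<open>f\<close> and \<open>y\<close>, the kernel of
  \<open>f*p - y*q\<close> on the biproduct. In element chases this lifts elements along
  \<open>f\<close> at the price of an epimorphic change of domain.\<close>

lemma cover:
 assumes f: "epi f" and y: "arr y" "cod y = cod f"
 shows "EX e x. epi e & cod e = dom y & arr x & dom x = dom e & cod x = dom f & f*x = y*e"
proof -
 have fa [simp]: "arr f" "arr y" using f y by auto
 obtain B i j p q where B: "is_biproduct C (dom f) (dom y) B i j p q"
  using ex_biproduct[of "dom f" "dom y"] by auto
 hence b [simp]: "arr i" "dom i = dom f" "cod i = B" "arr j" "dom j = dom y" "cod j = B"
  "arr p" "dom p = B" "cod p = dom f" "arr q" "dom q = B" "cod q = dom y" "obj B"
  and bb: "p*i = idt (dom f)" "q*j = idt (dom y)" "q*i = zer (dom f) (dom y)" "p*j = zer (dom y) (dom f)"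
  and s: "i*p++j*q = idt B"
  unfolding is_biproduct_def by auto
 let ?g = "f*p++neg (y*q)"
 have g [simp]: "arr ?g" "dom ?g = B" "cod ?g = cod f" using y by auto
 have gi: "?g*i = f" using y by (simp add: Add_Cmp bb)
 have ge: "epi ?g" by (rule epi_left[of _ i]) (use gi f in auto)
 obtain k where k: "mono k" "cod k = B" "sv k = kr ?g" using ex_ker[of ?g] by auto
 have k' [simp]: "arr k" "cod k = B" using k by auto
 have "nul (?g*k)" using sv_self[of k] k by auto
 moreover have "?g*k = f*(p*k)++neg (y*(q*k))" using y by (simp add: Add_Cmp)
 ultimately have eq: "f*(p*k) = y*(q*k)" using y by (simp add: nul_dif)
 \<comment> \<open>If \<open>h\<close> kills \<open>q*k\<close>, then \<open>h*q\<close> factors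
   through the epimorphism \<open>?g\<close>; restriction to the first summand shows that the factor
   \<open>t\<close> satisfies \<open>t*f = 0\<close>, so it is zero.\<close>
 have "epi (q*k)" unfolding epi_iff
 proof (intro conjI ballI impI)
  fix h assume h: "arr h" "dom h = cod (q*k)" "nul (h*(q*k))"
  have "kr ?g <= kr (h*q)"
  proof
   fix x assume "x : kr ?g"
   then obtain t where t: "arr t" "cod t = dom k" "x = k*t" unfolding k(3)[symmetric] by (rule svE)
   show "x : kr (h*q)" using h t nul_Cmp_left[of "h*(q*k)" t] by simp
  qed
  from epi_factor[OF ge _ _ this] obtain t where t: "arr t" "dom t = cod f" "cod t = cod h" "t*?g = h*q"
   using h by auto
  have "t*f = (t*?g)*i" using t gi by (subst Cmp_assoc_simp) auto
  also have "... = zer (dom f) (cod h)" unfolding t(4) using h by (simp add: bb)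
  finally have "nul t" using epi_nul[OF f, of t] t h by simp
  hence "nul (h*q)" using t(4) nul_Cmp_left[of t ?g] t by simp
  hence "nul ((h*q)*j)" using h by simp
  thus "nul h" using h by (simp add: bb)
 qed simp
 thus ?thesis using eq y by (intro exI[of _ "q*k"] exI[of _ "p*k"]) simp
qed

lemma bip_facts:
 assumes "is_biproduct C X Y B i j p q" "obj X" "obj Y"
 shows "obj B" "arr i" "dom i = X" "cod i = B" "arr j" "dom j = Y" "cod j = B"
  "arr p" "dom p = B" "cod p = X" "arr q" "dom q = B" "cod q = Y"
  "p*i = idt X" "q*j = idt Y" "q*i = zer X Y" "p*j = zer Y X"
  "!!x. arr x ==> cod x = X ==> p*(i*x) = x"
  "!!x. arr x ==> cod x = X ==> q*(i*x) = zer (dom x) Y"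
  "!!x. arr x ==> cod x = Y ==> q*(j*x) = x"
  "!!x. arr x ==> cod x = Y ==> p*(j*x) = zer (dom x) X"
proof -
 show a: "obj B" "arr i" "dom i = X" "cod i = B" "arr j" "dom j = Y" "cod j = B"
  "arr p" "dom p = B" "cod p = X" "arr q" "dom q = B" "cod q = Y"
  "p*i = idt X" "q*j = idt Y" "q*i = zer X Y" "p*j = zer Y X"
  using assms(1) unfolding is_biproduct_def by auto
 fix x assume x: "arr x"
 show "cod x = X ==> p*(i*x) = x" using x a Cmp_assoc_simp[of x i p] by simp
 show "cod x = X ==> q*(i*x) = zer (dom x) Y" using x a assms Cmp_assoc_simp[of x i q] by simp
 show "cod x = Y ==> q*(j*x) = x" using x a Cmp_assoc_simp[of x j q] by simp
 show "cod x = Y ==> p*(j*x) = zer (dom x) X" using x a assms Cmp_assoc_simp[of x j p] by simp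
qed

lemma bip_decomp:
 assumes "is_biproduct C X Y B i j p q" "obj X" "obj Y" "arr z" "cod z = B"
 shows "i*(p*z)++j*(q*z) = z"
proof -
 note b = bip_facts[OF assms(1-3)]
 have "i*p++j*q = idt B" using assms(1) unfolding is_biproduct_def by blast
 hence "(i*p++j*q)*z = z" using assms by simp
 thus ?thesis using b(1-13) assms by (simp add: Add_Cmp)
qed

lemma bip_decomp':
 assumes "is_biproduct C X Y B i j p q" "obj X" "obj Y" "arr z" "dom z = B"
 shows "(z*i)*p++(z*j)*q = z"
proof -
 note b = bip_facts[OF assms(1-3)]
 have "i*p++j*q = idt B" using assms(1) unfolding is_biproduct_def by blast
 hence "z*(i*p++j*q) = z" using assms by simp
 thus ?thesis using b(1-13) assms by (simp add: Cmp_Add)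
qed

lemma ex_bip: "obj X ==> obj Y ==> (!!B i j p q. is_biproduct C X Y B i j p q ==> thesis) ==> thesis"
 using ex_biproduct by blast

text \<open>A subobject of \<open>X\<close> is represented by the set of all arrows that factor through it: these
 sets do not depend on the representing monomorphism, inclusion is the order of subobjects and
 intersection is the meet.\<close>

definition Sub where "Sub X = {S. EX i. mono i & cod i = X & sv i = S}"

definition inc where "inc S = (SOME i. mono i & sv i = S)"

definition qt where "qt S = (SOME q. epi q & kr q = S)"

lemma sv_mono_Cod: "sv i = sv j ==> arr i ==> arr j ==> cod i = cod j"
 using sv_self[of i] unfolding sv_def by auto

lemma inc:
 assumes "S : Sub X"
 shows "mono (inc S)" "arr (inc S)" "cod (inc S) = X" "sv (inc S) = S" "obj (dom (inc S))" "obj X"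
proof -
 obtain i where i: "mono i" "cod i = X" "sv i = S" using assms unfolding Sub_def by auto
 have *: "mono (inc S) & sv (inc S) = S" unfolding inc_def by (rule someI[of _ i]) (use i in auto)
 thus "mono (inc S)" "arr (inc S)" "sv (inc S) = S" "obj (dom (inc S))" by auto
 show "cod (inc S) = X" using sv_mono_Cod[of "inc S" i] * i by auto
 thus "obj X" using * by auto
qed

lemma sv_Sub: "mono i ==> sv i : Sub (cod i)" unfolding Sub_def by auto

lemma kr_Sub: "arr f ==> kr f : Sub (dom f)"
 using ex_ker[of f] unfolding Sub_def by auto

lemma kr_self_Dom: "kr q = kr q' ==> arr q ==> arr q' ==> dom q = dom q'"
proof -
 assume a: "kr q = kr q'" "arr q" "arr q'"
 have z: "zer (dom q) (dom q) : kr q" using a(2) by simp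
 have "cod (zer (dom q) (dom q)) = dom q'" using z unfolding a(1) kr_iff by blast
 thus ?thesis using a by simp
qed

lemma qt:
 assumes "S : Sub X"
 shows "epi (qt S)" "arr (qt S)" "dom (qt S) = X" "kr (qt S) = S" "obj (cod (qt S))"
proof -
 obtain i where i: "mono i" "cod i = X" "sv i = S" using assms unfolding Sub_def by auto
 obtain q where q: "epi q" "dom q = cod i" "is_cokernel C q i" using ex_coker[of i] i by auto
 have q2: "kr q = S" using mono_kr_coker[OF i(1) q(3)] i by simp
 have *: "epi (qt S) & kr (qt S) = S" unfolding qt_def by (rule someI[of _ q]) (use q q2 in auto)
 thus "epi (qt S)" "arr (qt S)" "kr (qt S) = S" "obj (cod (qt S))" by auto
 show "dom (qt S) = X" using kr_self_Dom[of "qt S" q] * q q2 i by auto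
qed

lemma SubE:
 assumes "S : Sub X"
 obtains i where "mono i" "arr i" "cod i = X" "S = sv i"
 using assms unfolding Sub_def by auto

lemma Sub_kr:
 assumes "S : Sub X"
 obtains q where "epi q" "arr q" "dom q = X" "S = kr q"
 using qt[OF assms] that[of "qt S"] by simp

lemma Sub_el: "S : Sub X ==> x : S ==> arr x & cod x = X"
 by (erule Sub_kr) auto

lemma Sub_Cmp: "S : Sub X ==> x : S ==> arr h ==> cod h = dom x ==> x*h : S"
 by (erule Sub_kr) simp

lemma Sub_Add: "S : Sub X ==> x : S ==> y : S ==> dom y = dom x ==> x++y : S"
 by (erule Sub_kr) (auto simp: Cmp_Add nul_Add)

lemma Sub_Neg: "S : Sub X ==> x : S ==> neg x : S"
 by (erule Sub_kr) auto

lemma Sub_nul: "S : Sub X ==> arr x ==> cod x = X ==> nul x ==> x : S"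
 by (erule Sub_kr) auto

text \<open>Membership in a subobject may be tested after an epimorphic change of domain. Together
  with \<open>cover\<close> this justifies arguments with elements.\<close>

lemma Sub_local:
 assumes "S : Sub X" "arr x" "cod x = X" "epi e" "cod e = dom x" "x*e : S"
 shows "x : S"
 using assms(1)
proof (rule Sub_kr)
 fix q assume q: "epi q" "arr q" "dom q = X" "S = kr q"
 have "nul ((q*x)*e)" using assms q by simp
 hence "nul (q*x)" by (rule epi_nul[OF assms(4)]) (use assms q in auto)
 thus "x : S" using q assms by simp
qed

lemma Sub_Add_cancel:
 assumes "S : Sub X" "arr x" "cod x = X" "y : S" "dom y = dom x" "x++y : S"
 shows "x : S"
proof -
 have y: "arr y" "cod y = X" using Sub_el[OF assms(1,4)] by auto
 have "(x++y)++neg y : S"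
  by (rule Sub_Add[OF assms(1,6) Sub_Neg[OF assms(1,4)]]) (use assms y in auto)
 thus ?thesis using assms y by (simp add: Add_assoc)
qed

lemma Sub_inc: "S : Sub X ==> inc S : S"
 using inc[of S X] sv_self[of "inc S"] by simp

lemma inc_lift:
 assumes "S : Sub X" "x : S"
 obtains h where "arr h" "dom h = dom x" "cod h = dom (inc S)" "inc S*h = x"
proof -
 have "x : sv (inc S)" using assms inc(4) by simp
 then obtain h where h: "arr h" "cod h = dom (inc S)" "x = inc S*h" by (rule svE)
 hence "dom h = dom x" using inc[OF assms(1)] by simp
 thus ?thesis using that h by simp
qed

lemma inc_Cmp_mem: "S : Sub X ==> arr h ==> cod h = dom (inc S) ==> inc S*h : S"
 by (rule Sub_Cmp[OF _ Sub_inc])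

lemma el_Sub: "obj X ==> el X : Sub X"
 using kr_Sub[of "zer X X"] by (auto simp: el_def kr_def cong: conj_cong)

lemma zr_Sub: "obj X ==> zr X : Sub X"
 using kr_Sub[of "idt X"] by (auto simp: zr_def kr_def cong: conj_cong)

lemma zr_least: "S : Sub X ==> zr X <= S"
 using Sub_nul by auto

lemma Sub_inter:
 assumes S: "S : Sub X" and T: "T : Sub X"
 shows "S Int T : Sub X"
proof -
 obtain f where f: "arr f" "dom f = X" "S = kr f" using S by (rule Sub_kr)
 obtain g where g: "arr g" "dom g = X" "T = kr g" using T by (rule Sub_kr)
 obtain B i j p q where B: "is_biproduct C (cod f) (cod g) B i j p q" by (rule ex_bip[OF Cod_Obj[OF f(1)] Cod_Obj[OF g(1)]])
 note b = bip_facts[OF B, simplified f g, OF Cod_Obj[OF f(1)] Cod_Obj[OF g(1)]]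
 let ?h = "i*f++j*g"
 have h: "arr ?h" "dom ?h = X" "cod ?h = B" using b f g by auto
 have "S Int T = kr ?h"
 proof (intro equalityI subsetI)
  fix x assume "x : S Int T"
  hence x: "arr x" "cod x = X" "nul (f*x)" "nul (g*x)" using f g by auto
  have "nul (i*(f*x))" "nul (j*(g*x))" using x b(1-13) f g by (auto intro: nul_Cmp_right)
  hence "nul (?h*x)" using x f g b(1-13) by (simp add: Add_Cmp nul_Add)
  thus "x : kr ?h" using x h by simp
 next
  fix x assume x: "x : kr ?h"
  hence "nul (p*(?h*x))" "nul (q*(?h*x))" using h b(1-13) by (auto intro!: nul_Cmp_right)
  moreover have "p*(?h*x) = f*x" "q*(?h*x) = g*x" using x h f g b
   by (simp_all add: Add_Cmp Cmp_Add)
  ultimately show "x : S Int T" using x h f g by auto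
 qed
 thus ?thesis using kr_Sub[OF h(1)] h by simp
qed

definition pre where "pre f T = {x : Arr C. cod x = dom f & f*x : T}"

lemma pre_iff [simp]: "x : pre f T <-> arr x & cod x = dom f & f*x : T" by (simp add: pre_def)

lemma pre_Sub:
 assumes "arr f" "T : Sub (cod f)" shows "pre f T : Sub (dom f)"
proof -
 obtain g where g: "arr g" "dom g = cod f" "T = kr g" using assms(2) by (rule Sub_kr)
 have "pre f T = kr (g*f)" using g assms by (auto simp: pre_def kr_def)
 thus ?thesis using kr_Sub[of "g*f"] g assms by simp
qed

text \<open>Since generalized elements lift along an epimorphism only after a cover, an element of
  the image is one that becomes a value of \<open>f\<close> after an epimorphism \<open>e\<close>.
  The sum \<open>sm\<close> follows the same pattern.\<close>

definition img where
 "img f S = {y : Arr C. cod y = cod f &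
   (EX e x. epi e & cod e = dom y & x : S & dom x = dom e & y*e = f*x)}"

lemma imgE:
 assumes "y : img f S"
 obtains e x where "epi e" "arr e" "cod e = dom y" "x : S" "dom x = dom e" "y*e = f*x" "arr y" "cod y = cod f"
 using assms unfolding img_def by auto

lemma imgI:
 "epi e ==> cod e = dom y ==> x : S ==> dom x = dom e ==> y*e = f*x ==> arr y ==>
  cod y = cod f ==> y : img f S"
 unfolding img_def by blast

lemma img_sv:
 assumes f: "arr f" and i: "mono i" "cod i = dom f"
  and m: "mono m" "epi e" "dom e = dom i" "cod e = dom m" "cod m = cod f" "f*i = m*e"
 shows "img f (sv i) = sv m"
proof (intro equalityI subsetI)
 fix y assume "y : img f (sv i)"
 then obtain e' x where x: "epi e'" "cod e' = dom y" "x : sv i" "dom x = dom e'" "y*e' = f*x" "arr y" "cod y = cod f"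
  by (elim imgE)
 from x(3) obtain h where h: "arr h" "cod h = dom i" "x = i*h" by (rule svE)
 have "y*e' = (f*i)*h" using x(5) h f i by simp
 also have "... = m*(e*h)" unfolding m(6) using h m by simp
 finally have "y*e' : sv m" using h m by (simp add: svI)
 thus "y : sv m" by (rule Sub_local[OF sv_Sub[OF m(1)], rotated -1]) (use x m in auto)
next
 fix y assume "y : sv m"
 then obtain h where h: "arr h" "cod h = dom m" "y = m*h" by (rule svE)
 obtain e' x where x: "epi e'" "cod e' = dom h" "arr x" "dom x = dom e'" "cod x = dom e" "e*x = h*e'"
  using cover[OF m(2), of h] h m by auto
 have "y*e' = m*(e*x)" using h m x by simp
 also have "... = (m*e)*x" using m x(1-5) by simp
 also have "... = f*(i*x)" unfolding m(6)[symmetric] using f i x(1-5) m(1-5) by simp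
 finally have "y*e' = f*(i*x)" .
 moreover have "i*x : sv i" by (rule svI) (use x m i in auto)
 ultimately show "y : img f (sv i)"
  by (intro imgI[of e' y "i*x"]) (use h m(1-5) x(1-5) f i in auto)
qed

lemma img_Sub:
 assumes f: "arr f" and S: "S : Sub (dom f)"
 shows "img f S : Sub (cod f)"
proof -
 obtain i where i: "mono i" "cod i = dom f" "S = sv i" using S by (elim SubE)
 obtain m e where m: "mono m" "epi e" "dom e = dom i" "cod e = dom m" "cod m = cod f" "f*i = m*e"
  using ex_image[of "f*i"] f i by auto
 have "img f S = sv m" unfolding i(3) by (rule img_sv[OF f i(1,2) m(1,2)]) (use m f i in auto)
 thus ?thesis using sv_Sub[OF m(1)] m f i by simp
qed

lemma img_mem: "arr f ==> S : Sub (dom f) ==> x : S ==> f*x : img f S"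
 using Sub_el[of S "dom f" x] by (intro imgI[of "idt (dom x)" "f*x" x]) auto

lemma img_subset:
 assumes f: "arr f" and S: "S : Sub (dom f)" and T: "T : Sub (cod f)"
 shows "img f S <= T <-> S <= pre f T"
proof
 assume "img f S <= T"
 thus "S <= pre f T" using img_mem[OF f S] Sub_el[OF S] unfolding pre_def by blast
next
 assume a: "S <= pre f T"
 show "img f S <= T"
 proof
  fix y assume "y : img f S"
  then obtain e x where x: "epi e" "cod e = dom y" "x : S" "y*e = f*x" "arr y" "cod y = cod f" by (elim imgE)
  hence "y*e : T" using a by auto
  thus "y : T" using x by (intro Sub_local[OF T, of y e]) auto
 qed
qed

lemma img_mono: "S <= T ==> img f S <= img f T"
 unfolding img_def by blast

lemma img_pre_epi:
 assumes "epi q" "T : Sub (cod q)" shows "img q (pre q T) = T"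
proof (intro equalityI)
 show "img q (pre q T) <= T" using img_subset[of q "pre q T" T] pre_Sub[of q T] assms by simp
 show "T <= img q (pre q T)"
 proof
  fix y assume y: "y : T"
  hence ya: "arr y" "cod y = cod q" using Sub_el assms by auto
  obtain e x where x: "epi e" "cod e = dom y" "arr x" "dom x = dom e" "cod x = dom q" "q*x = y*e"
   using cover[OF assms(1) ya] by auto
  have "y*e : T" using Sub_Cmp[OF assms(2) y] x by simp
  thus "y : img q (pre q T)" using x ya by (intro imgI[of e y x]) auto
 qed
qed

lemma pre_img:
 assumes "arr q" "S : Sub (dom q)" "kr q <= S" shows "pre q (img q S) = S"
proof (intro equalityI subsetI)
 fix x assume x: "x : pre q (img q S)"
 hence "q*x : img q S" "arr x" "cod x = dom q" by auto
 then obtain e s where s: "epi e" "cod e = dom x" "s : S" "dom s = dom e" "(q*x)*e = q*s"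
  using assms by (auto elim!: imgE)
 have sa: "arr s" "cod s = dom q" using Sub_el[OF assms(2) s(3)] by auto
 have "nul (q*(x*e++neg s))" using s sa x assms by (simp add: Cmp_Add nul_dif)
 hence "x*e++neg s : S" using s sa x assms by (intro subsetD[OF assms(3)]) auto
 hence "x*e : S" using s sa x assms by (intro Sub_Add_cancel[OF assms(2), of "x*e" "neg s"] Sub_Neg) auto
 thus "x : S" using x s by (intro Sub_local[OF assms(2), of x e]) auto
next
 fix x assume "x : S" thus "x : pre q (img q S)" using Sub_el[OF assms(2)] img_mem assms by auto
qed

definition sm where
 "sm S T = {z : Arr C. EX e x y. epi e & cod e = dom z & x : S & y : T & dom x = dom e & dom y = dom e & z*e = x++y}"

lemma smI:
 "epi e ==> cod e = dom z ==> x : S ==> y : T ==> dom x = dom e ==> dom y = dom e ==> z*e = x++y ==>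
  z : Arr C ==> z : sm S T"
 unfolding sm_def by blast

lemma smE:
 assumes "z : sm S T"
 obtains e x y where "epi e" "arr e" "cod e = dom z" "x : S" "y : T" "dom x = dom e" "dom y = dom e" "z*e = x++y" "arr z"
 using assms unfolding sm_def by auto

lemma sm_Sub:
 assumes S: "S : Sub X" and T: "T : Sub X"
 shows "sm S T : Sub X" "S <= sm S T" "T <= sm S T"
proof -
 obtain s where s: "mono s" "arr s" "cod s = X" "S = sv s" using S by (rule SubE)
 obtain t where t: "mono t" "arr t" "cod t = X" "T = sv t" using T by (rule SubE)
 have X [simp]: "obj X" using s by auto
 obtain B i j p q where B: "is_biproduct C (dom s) (dom t) B i j p q" by (rule ex_bip[OF Dom_Obj[OF s(2)] Dom_Obj[OF t(2)]])
 note b = bip_facts[OF B, OF Dom_Obj[OF s(2)] Dom_Obj[OF t(2)]]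
 define h where "h = s*p++t*q"
 have h: "arr h" "dom h = B" "cod h = X" using b s t by (auto simp: h_def)
 have hi: "h*i = s" "h*j = t" using b s t by (auto simp: h_def Add_Cmp)
 have "sm S T = img h (el B)"
 proof (intro equalityI subsetI)
  fix z assume "z : sm S T"
  then obtain e x y where z: "epi e" "arr e" "cod e = dom z" "x : S" "y : T" "dom x = dom e" "dom y = dom e" "z*e = x++y" "arr z"
   by (rule smE)
  from z(4) obtain x' where x': "arr x'" "cod x' = dom s" "x = s*x'" unfolding s(4) by (rule svE)
  from z(5) obtain y' where y': "arr y'" "cod y' = dom t" "y = t*y'" unfolding t(4) by (rule svE)
  have d: "dom x' = dom e" "dom y' = dom e" using z(6,7) x' y' s t by auto
  have "cod (z*e) = cod (x++y)" unfolding z(8) ..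
  hence zc: "cod z = X" using z(1-3,9) x' y' d s t by simp
  have "h*(i*x'++j*y') = (h*i)*x'++(h*j)*y'"
   using h x' y' b(1-13) d by (simp add: Cmp_Add)
  hence "z*e = h*(i*x'++j*y')" unfolding hi z(8) x' y' by simp
  thus "z : img h (el B)"
   by (intro imgI[of e z "i*x'++j*y'"]) (use z(1-3,9) zc h b(1-13) x'(1,2) y'(1,2) d in auto)
 next
  fix z assume "z : img h (el B)"
  then obtain e x where z: "epi e" "arr e" "cod e = dom z" "x : el B" "dom x = dom e" "z*e = h*x" "arr z" "cod z = cod h" by (rule imgE)
  have "h*x = s*(p*x)++t*(q*x)" using z(4) b(1-13) s t by (simp add: h_def Add_Cmp)
  moreover have "s*(p*x) : S" "t*(q*x) : T" using z(4) b(1-13) s t by (auto intro!: svI)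
  ultimately show "z : sm S T"
   by (intro smI[of e z "s*(p*x)" _ "t*(q*x)"]) (use z b(1-13) s(2,3) t(2,3) in auto)
 qed
 thus "sm S T : Sub X" using img_Sub[OF h(1), of "el B"] el_Sub b h by simp
 show "S <= sm S T"
 proof
  fix x assume x: "x : S"
  hence "arr x" "cod x = X" using Sub_el[OF S] by auto
  moreover have "zer (dom x) X : T" using Sub_nul[OF T] calculation by simp
  ultimately show "x : sm S T" using x
   by (intro smI[of "idt (dom x)" x x _ "zer (dom x) X"]) auto
 qed
 show "T <= sm S T"
 proof
  fix x assume x: "x : T"
  hence "arr x" "cod x = X" using Sub_el[OF T] by auto
  moreover have "zer (dom x) X : S" using Sub_nul[OF S] calculation by simp
  ultimately show "x : sm S T" using x
   by (intro smI[of "idt (dom x)" x "zer (dom x) X" _ x]) auto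
 qed
qed

lemma mono_kr: "arr f ==> mono f <-> kr f <= zr (dom f)"
 unfolding mono_iff by auto

lemma sv_el_epi:
 assumes "mono i" "el (cod i) <= sv i"
 shows "is_iso C i"
proof (rule mono_epi_iso[OF assms(1)])
 have "idt (cod i) : sv i" using assms by (intro subsetD[OF assms(2)]) simp
 then obtain h where h: "arr h" "cod h = dom i" "idt (cod i) = i*h" by (rule svE)
 have "epi (i*h)" unfolding h(3)[symmetric] using assms by simp
 thus "epi i" by (rule epi_left) (use h assms in auto)
qed

lemma zero_sv:
 assumes "mono i" shows "zero (dom i) <-> sv i <= zr (cod i)"
proof
 assume z: "zero (dom i)"
 show "sv i <= zr (cod i)"
 proof
  fix x assume "x : sv i"
  then obtain h where h: "arr h" "cod h = dom i" "x = i*h" by (rule svE)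
  thus "x : zr (cod i)" using zero_nul[OF z, of h] assms by simp
 qed
next
 assume "sv i <= zr (cod i)"
 hence "nul (i*idt (dom i))" using sv_self[of i] assms by auto
 hence "nul (idt (dom i))" by (rule mono_nul[OF assms]) (use assms in auto)
 thus "zero (dom i)" using assms by (simp add: is_zero_iff)
qed

lemma zero_inc: "S : Sub X ==> zero (dom (inc S)) <-> S <= zr X"
 using zero_sv[of "inc S"] inc[of S X] by simp

lemma sv_Cmp_mono_iso:
 assumes "mono i" "mono j" "sv i = sv j"
 shows "EX h. is_iso C h & dom h = dom i & cod h = dom j & i = j*h"
proof -
 have "i : sv j" "j : sv i" using assms(3) sv_self[of i] sv_self[of j] assms by auto
 from this(1) obtain h where h: "arr h" "cod h = dom j" "i = j*h" by (rule svE)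
 from \<open>j : sv i\<close> obtain k where k: "arr k" "cod k = dom i" "j = i*k" by (rule svE)
 have dh: "dom h = dom i" "dom k = dom j"
  using arg_cong[OF h(3), of "dom"] arg_cong[OF k(3), of "dom"] h(1,2) k(1,2) assms by auto
 have 1: "j*(h*k) = j*idt (dom j)"
  using h(3) k(3) h(1,2) k(1,2) dh assms(1,2) by (metis Cmp_assoc_simp Cmp_Idt_right mono_Arr)
 have 2: "i*(k*h) = i*idt (dom i)"
  using h(3) k(3) h(1,2) k(1,2) dh assms(1,2) by (metis Cmp_assoc_simp Cmp_Idt_right mono_Arr)
 have "h*k = idt (dom j)" by (rule mono_cancel[OF assms(2) 1]) (use h(1,2) k(1,2) dh assms in auto)
 moreover have "k*h = idt (dom i)" by (rule mono_cancel[OF assms(1) 2]) (use h(1,2) k(1,2) dh assms in auto)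
 ultimately have "is_iso C h" by (intro is_isoI[of h k]) (use h(1,2) k(1,2) dh in auto)
 thus ?thesis using h(2,3) dh by blast
qed

end

section \<open>Locally noetherian Grothendieck categories\<close>

lemma small_inj_on: "small \<kappa> Y ==> inj_on f X ==> f ` X <= Y ==> small \<kappa> X"
 unfolding small_def by (meson card_of_ordLeq ordLeq_ordLess_trans)

lemma small_mono: "small \<kappa> Y ==> X <= Y ==> small \<kappa> X"
 by (rule small_inj_on[of _ _ "%x. x"]) auto

lemma small_image: "small \<kappa> X ==> small \<kappa> (f ` X)"
 unfolding small_def using card_of_image ordLeq_ordLess_trans by blast

text \<open>Coproducts and filtered colimits are postulated for index sets in the type of
  \<open>\<kappa>\<close>; other small sets are transported there.\<close>

lemma small_embed:
 assumes "universe_cardinal \<kappa>" "small \<kappa> X"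
 obtains e where "inj_on e X" "e ` X <= Field \<kappa>"
proof -
 have "|X| <=o |Field \<kappa>|"
  using assms unfolding universe_cardinal_def small_def
  by (meson card_of_Field_ordIso ordIso_symmetric ordLess_imp_ordLeq ordLeq_ordIso_trans)
 thus ?thesis using that unfolding card_of_ordLeq[symmetric] by auto
qed

lemma small_Pow:
 assumes "universe_cardinal \<kappa>" "small \<kappa> X"
 shows "small \<kappa> (Pow X)"
proof -
 obtain e where e: "inj_on e X" "e ` X <= Field \<kappa>" using small_embed[OF assms] by auto
 have "small \<kappa> (Pow (e ` X))"
  using assms(1) e(2) small_image[OF assms(2), of e] unfolding universe_cardinal_def small_def by blast
 thus ?thesis by (rule small_inj_on[of _ _ "(`) e"]) (use e inj_on_image_Pow in auto)
qed

lemma small_Sigma: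
 assumes u: "universe_cardinal \<kappa>" and "small \<kappa> I" "!!i. i : I ==> small \<kappa> (X i)"
 shows "small \<kappa> (Sigma I X)"
proof -
 have inf: "~ finite (Field \<kappa>)"
  using u unfolding universe_cardinal_def
  by (metis finite_iff_ordLess_natLeq card_of_Field_ordIso ordIso_symmetric ordLess_ordIso_trans ordLess_transitive ordLess_irreflexive)
 have "stable \<kappa>" using u inf unfolding universe_cardinal_def by (intro regularCard_stable) auto
 thus ?thesis using assms unfolding small_def by (intro stable_elim) auto
qed

lemma small_nat: "universe_cardinal \<kappa> ==> small \<kappa> (UNIV :: nat set)"
 unfolding universe_cardinal_def small_def
 by (metis Field_natLeq card_of_Field_ordIso natLeq_Card_order ordIso_ordLess_trans)

locale grothendieck = abelian_category A for A :: "('o, 'm, 'z) acat_scheme" (structure) +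
 fixes \<kappa> :: "'u rel"
 assumes univ: "universe_cardinal \<kappa>" and groth: "grothendieck_category \<kappa> A"
begin

lemma coproduct:
 assumes "small \<kappa> I" "!!i. i : I ==> obj (X i)"
 shows "EX P io. is_coproduct A I X P io"
proof -
 obtain e where e: "inj_on e I" "e ` I <= Field \<kappa>" using small_embed[OF univ assms(1)] by auto
 have "has_small_coproducts \<kappa> A" using groth by (simp add: grothendieck_category_def)
 moreover have "small \<kappa> (e ` I)" using assms(1) by (rule small_image)
 moreover have "ALL j : e ` I. obj (X (inv_into I e j))" using assms(2) e by auto
 ultimately obtain P io where P: "is_coproduct A (e ` I) (%j. X (inv_into I e j)) P io"
  unfolding has_small_coproducts_def by (metis (no_types, lifting))
 have "is_coproduct A I X P (io \<circ> e)" unfolding is_coproduct_def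
 proof (intro conjI ballI allI impI)
  show "obj P" using P by (simp add: is_coproduct_def)
  show "(io \<circ> e) i : hom (X i) P" if "i : I" for i using P e that unfolding is_coproduct_def by auto
  fix Q f assume Q: "obj Q" and f: "ALL i:I. f i : hom (X i) Q"
  have f': "ALL j : e ` I. f (inv_into I e j) : hom (X (inv_into I e j)) Q" using f e by auto
  note U = conjunct2[OF conjunct2[OF P[unfolded is_coproduct_def]], THEN bspec, OF Q]
  have "EX! h. h : hom P Q & (ALL j : e ` I. h*io j = f (inv_into I e j))"
   by (rule U[THEN spec, THEN mp, OF f'])
  thus "EX! h. h : hom P Q & (ALL i:I. h*(io \<circ> e) i = f i)" using e by simp
 qed
 thus ?thesis by blast
qed

lemma coproduct_facts:
 assumes P: "is_coproduct A I X P io"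
 shows "obj P" "!!i. i : I ==> arr (io i)" "!!i. i : I ==> dom (io i) = X i" "!!i. i : I ==> cod (io i) = P"
  "!!f Q. obj Q ==> (!!i. i : I ==> f i : hom (X i) Q) ==> EX h. arr h & dom h = P & cod h = Q & (ALL i : I. h*io i = f i)"
  "!!h. arr h ==> dom h = P ==> (!!i. i : I ==> nul (h*io i)) ==> nul h"
proof -
 show a: "obj P" "!!i. i : I ==> arr (io i)" "!!i. i : I ==> dom (io i) = X i" "!!i. i : I ==> cod (io i) = P"
  using P unfolding is_coproduct_def by auto
 have U: "EX! h. h : hom P Q & (ALL i : I. h*io i = f i)" if Q: "obj Q" and f: "!!i. i : I ==> f i : hom (X i) Q" for f Q
 proof -
  note U = conjunct2[OF conjunct2[OF P[unfolded is_coproduct_def]], THEN bspec, OF Q]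
  show ?thesis by (rule U[THEN spec, THEN mp]) (use f in blast)
 qed
 show "EX h. arr h & dom h = P & cod h = Q & (ALL i : I. h*io i = f i)"
  if "obj Q" "!!i. i : I ==> f i : hom (X i) Q" for f Q using U[of Q f] that by auto
 fix h assume h: "arr h" "dom h = P" "!!i. i : I ==> nul (h*io i)"
 let ?Q = "cod h"
 have Xo: "obj (X i)" if "i : I" for i using a(2)[OF that] a(3)[OF that] Dom_Obj by metis
 have "EX! g. g : hom P ?Q & (ALL i : I. g*io i = zer (X i) ?Q)" using h Xo by (intro U) auto
 moreover have "h*io i = zer (X i) ?Q" if "i : I" for i using h that a by (auto intro: nul_eq)
 moreover have "zer P ?Q*io i = zer (X i) ?Q" if "i : I" for i using h that a by simp
 ultimately have "h = zer P ?Q" using h a(1) by (metis Hom_iff Zer_simps Cod_Obj)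
 thus "nul h" unfolding nul_def h(2) .
qed

text \<open>The composite of \<open>inc S\<close> with the quotient by \<open>T\<close> is nonzero,
  and the generating set distinguishes it from zero.\<close>

lemma gen_sub:
 assumes g: "is_generating_set A \<G>" and S: "S : Sub X" and T: "T : Sub X" and n: "~ S <= T"
 shows "EX G : \<G>. EX h : S. dom h = G & h ~: T"
proof -
 note i = inc[OF S] and q = qt[OF T]
 let ?f = "qt T*inc S"
 have "~ nul ?f"
 proof
  assume nf: "nul ?f"
  have "S <= T"
  proof
   fix x assume "x : S"
   then obtain h where h: "arr h" "cod h = dom (inc S)" "inc S*h = x" using inc_lift[OF S] by metis
   have "nul (qt T*(inc S*h))" using nf h(1,2) i q by simp
   hence "x : kr (qt T)" unfolding h(3)[symmetric] using h(1,2) i q by auto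
   thus "x : T" using q by simp
  qed
  with n show False ..
 qed
 hence "?f ~= zer (dom ?f) (cod ?f)" by (simp add: nul_def)
 then obtain G h where h: "G : \<G>" "h : hom G (dom ?f)" "?f*h ~= zer (dom ?f) (cod ?f)*h"
  using conjunct2[OF g[unfolded is_generating_set_def], rule_format, of "dom ?f" "cod ?f" ?f "zer (dom ?f) (cod ?f)"] i q by auto
 have "inc S*h : S" using inc_Cmp_mem[OF S] h i q by simp
 moreover have "inc S*h ~: T"
 proof
  assume "inc S*h : T"
  hence "nul (qt T*(inc S*h))" using q(4) kr_iff by metis
  thus False using h i q by (simp add: nul_def)
 qed
 ultimately show ?thesis using h i q by (intro bexI[of _ G] bexI[of _ "inc S*h"]) auto
qed

text \<open>A subobject is determined by its elements with domain a generator \<open>G\<close>, that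
  is, by a subset of the small set \<open>hom G X\<close>.\<close>

lemma small_Sub:
 assumes "obj X" shows "small \<kappa> (Sub X)"
proof -
 obtain G where G: "is_generating_set A {G}" using groth unfolding grothendieck_category_def by blast
 hence "obj G" by (simp add: is_generating_set_def)
 hence "small \<kappa> (hom G X)" using groth assms unfolding grothendieck_category_def by blast
 hence "small \<kappa> (Pow (hom G X))" using small_Pow univ by blast
 thus ?thesis
 proof (rule small_inj_on[of _ _ "%S. S Int hom G X"])
  have "S <= T" if "S : Sub X" "T : Sub X" "S Int hom G X = T Int hom G X" for S T
  proof (rule ccontr)
   assume "~ S <= T"
   from gen_sub[OF G that(1,2) this] obtain h where "h : S" "dom h = G" "h ~: T" by auto
   moreover have "h : hom G X" using Sub_el[OF that(1) \<open>h : S\<close>] \<open>dom h = G\<close> by simp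
   ultimately show False using that(3) by blast
  qed
  thus "inj_on (%S. S Int hom G X) (Sub X)" unfolding inj_on_def by (metis subset_antisym)
 qed auto
qed

definition SupS where "SupS X CC = \<Inter>{T : Sub X. ALL S : CC. S <= T}"

text \<open>That the intersection of all upper bounds is a subobject follows from its equality with
  the image of the coproduct of the members; this coproduct exists because \<open>X\<close> has only
  a small set of subobjects.\<close>

lemma SupS:
 assumes C: "CC <= Sub X" and X: "obj X"
 shows "SupS X CC : Sub X" "!!S. S : CC ==> S <= SupS X CC" "!!T. T : Sub X ==> (!!S. S : CC ==> S <= T) ==> SupS X CC <= T"
proof -
 show 2: "!!S. S : CC ==> S <= SupS X CC" unfolding SupS_def by blast
 show 3: "!!T. T : Sub X ==> (!!S. S : CC ==> S <= T) ==> SupS X CC <= T" unfolding SupS_def by blast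
 have sm: "small \<kappa> CC" using small_mono[OF small_Sub[OF X] C] .
 have i: "mono (inc S)" "arr (inc S)" "cod (inc S) = X" if "S : CC" for S using inc(1-3)[of S X] C that by blast+
 have so: "obj (dom (inc S))" if "S : CC" for S using i[OF that] by auto
 obtain P io where P: "is_coproduct A CC (%S. dom (inc S)) P io" using coproduct[OF sm, of "%S. dom (inc S)"] so by auto
 note p = coproduct_facts[OF P]
 obtain f where f: "arr f" "dom f = P" "cod f = X" "!!S. S : CC ==> f*io S = inc S"
  using p(5)[of X inc] X i by auto
 let ?U = "img f (el P)"
 have U: "?U : Sub X" using img_Sub[OF f(1), of "el P"] f el_Sub p by simp
 have ub: "S <= ?U" if S: "S : CC" for S
 proof
  fix x assume "x : S"
  then obtain h where h: "arr h" "cod h = dom (inc S)" "inc S*h = x" using inc_lift[of S X] C S by blast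
  have "x = f*(io S*h)" using Cmp_assoc_simp[of h "io S" f] h f p(2-4)[OF S] S by simp
  thus "x : ?U" using img_mem[OF f(1), of "el P" "io S*h"] el_Sub[OF p(1)] h f p(2-4)[OF S] by simp
 qed
 have "?U <= T" if T: "T : Sub X" "!!S. S : CC ==> S <= T" for T
 proof -
  obtain q where q: "epi q" "arr q" "dom q = X" "T = kr q" using T(1) by (rule Sub_kr)
  have "nul (q*f)"
  proof (rule p(6))
   fix S assume S: "S : CC"
   have "inc S : T" using Sub_inc[of S X] C S T by auto
   hence "nul (q*inc S)" using q by simp
   thus "nul ((q*f)*io S)" using q f p(2-4)[OF S] f(4)[OF S] by simp
  qed (use q f in auto)
  hence "el P <= pre f T" using q f by auto
  thus ?thesis using img_subset[OF f(1), of "el P" T] el_Sub[OF p(1)] T f by simp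
 qed
 hence "SupS X CC = ?U" using 2 3[OF U] ub U unfolding SupS_def by blast
 thus "SupS X CC : Sub X" using U by simp
qed

text \<open>The exact sequences from \<open>T\<close> to \<open>X/S\<close> to
  \<open>X/(S+T)\<close>, for \<open>S\<close> in the family, have as colimit the corresponding
  sequence for the supremum \<open>U\<close>. Exactness of filtered colimits makes \<open>T\<close>
  a subobject of \<open>X/U\<close>, so \<open>T\<close> meets \<open>U\<close> in zero.\<close>

lemma AB5:
 assumes C: "CC <= Sub X" "CC ~= {}" and X: "obj X"
  and dir: "!!S S'. S : CC ==> S' : CC ==> EX S'' : CC. S <= S'' & S' <= S''"
  and T: "T : Sub X" and disj: "!!S. S : CC ==> T Int S <= zr X"
 shows "T Int SupS X CC <= zr X"
proof -
 define U where "U = SupS X CC"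
 have U: "U : Sub X" "!!S. S : CC ==> S <= U" and Ul: "!!T. T : Sub X ==> (!!S. S : CC ==> S <= T) ==> U <= T"
  unfolding U_def using SupS[OF C(1) X] by auto
 define t where "t = inc T"
 have t [simp]: "mono t" "arr t" "cod t = X" "sv t = T" using inc[OF T] by (auto simp: t_def)
 let ?D = "insert U CC"
 have q: "epi (qt S)" "arr (qt S)" "dom (qt S) = X" "kr (qt S) = S" if "S : ?D" for S
  using qt[of S X] that C U by auto
 define c where "c S = (SOME c. is_cokernel A c (qt S*t))" for S
 have c0: "is_cokernel A (c S) (qt S*t)" if "S : ?D" for S
  unfolding c_def by (rule someI_ex) (use ex_coker[of "qt S*t"] q[OF that] in auto)
 have c: "epi (c S)" "arr (c S)" "dom (c S) = cod (qt S)" "nul (c S*(qt S*t))" if "S : ?D" for S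
  using c0[OF that] cokernel_epi[OF c0[OF that]] q[OF that] by (auto simp: is_cokernel_def)
 define f where "f S S' = (SOME f. arr f & dom f = cod (qt S) & cod f = cod (qt S') & f*qt S = qt S')" for S S'
 have f: "arr (f S S')" "dom (f S S') = cod (qt S)" "cod (f S S') = cod (qt S')" "f S S'*qt S = qt S'"
  if "S : ?D" "S' : ?D" "S <= S'" for S S'
 proof -
  have "EX f. arr f & dom f = cod (qt S) & cod f = cod (qt S') & f*qt S = qt S'"
   using epi_factor[OF q(1)[OF that(1)], of "qt S'"] q[OF that(1)] q[OF that(2)] that(3) by auto
  from someI_ex[OF this] show "arr (f S S')" "dom (f S S') = cod (qt S)" "cod (f S S') = cod (qt S')" "f S S'*qt S = qt S'"
   unfolding f_def[symmetric] by auto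
 qed
 define g where "g S S' = (SOME g. arr g & dom g = cod (c S) & cod g = cod (c S') & g* c S = c S'*f S S')" for S S'
 have g: "arr (g S S')" "dom (g S S') = cod (c S)" "cod (g S S') = cod (c S')" "g S S'* c S = c S'*f S S'"
  if that': "S : ?D" "S' : ?D" "S <= S'" for S S'
 proof -
  note ff = f[OF that'] and qq = q[OF that'(1)] q[OF that'(2)] and cc = c[OF that'(1)] c[OF that'(2)]
  have "f S S'*(qt S*t) = qt S'*t" using Cmp_assoc_simp[of t "qt S" "f S S'"] ff qq by simp
  hence "nul (c S'*(f S S'*(qt S*t)))" using cc by simp
  hence "nul ((c S'*f S S')*(qt S*t))" using ff qq cc by simp
  hence "EX g. arr g & dom g = cod (c S) & cod g = cod (c S') & g* c S = c S'*f S S'"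
   using cokernel_factor[OF c0[OF that'(1)], of "c S'*f S S'"] ff qq cc by simp
  from someI_ex[OF this] show "arr (g S S')" "dom (g S S') = cod (c S)" "cod (g S S') = cod (c S')" "g S S'* c S = c S'*f S S'"
   unfolding g_def[symmetric] by auto
 qed
 have ffc: "f S' S''*f S S' = f S S''" if "S : ?D" "S' : ?D" "S'' : ?D" "S <= S'" "S' <= S''" for S S' S''
 proof -
  have s: "S <= S''" using that by blast
  note ff = f[OF that(1,2,4)] f[OF that(2,3,5)] f[OF that(1,3) s] and qq = q[OF that(1)]
  show ?thesis by (rule epi_cancel[OF qq(1)]) (use ff qq in simp_all)
 qed
 have ffi: "f S S = idt (cod (qt S))" if "S : ?D" for S
  by (rule epi_cancel[OF q(1)[OF that]]) (use f[OF that that] q[OF that] in simp_all)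
 have ggc: "g S' S''*g S S' = g S S''" if "S : ?D" "S' : ?D" "S'' : ?D" "S <= S'" "S' <= S''" for S S' S''
 proof -
  have s: "S <= S''" using that by blast
  note gg = g[OF that(1,2,4)] g[OF that(2,3,5)] g[OF that(1,3) s] and ff = f[OF that(1,2,4)] f[OF that(2,3,5)]
   and cc = c(1-3)[OF that(1)] c(1-3)[OF that(2)] c(1-3)[OF that(3)]
  have "g S' S''*(c S'*f S S') = (g S' S''* c S')*f S S'" using gg(1-3,5-7) ff cc by simp
  also have "... = c S''*f S S''" unfolding gg(8) using ff cc by (simp add: ffc[OF that])
  finally have e: "g S' S''*(c S'*f S S') = c S''*f S S''" .
  show ?thesis by (rule epi_cancel[OF cc(1)]) (use gg cc e in simp_all)
 qed
 have ggi: "g S S = idt (cod (c S))" if "S : ?D" for S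
  by (rule epi_cancel[OF c(1)[OF that]]) (use g[OF that that] c[OF that] ffi[OF that] in simp_all)
 have smC: "small \<kappa> CC" using small_mono[OF small_Sub[OF X] C(1)] .
 hence smC2: "small \<kappa> (CC \<times> CC)" by (intro small_Sigma[OF univ])
 obtain e where e: "inj_on e CC" "e ` CC <= Field \<kappa>" using small_embed[OF univ smC] by auto
 obtain e2 where e2: "inj_on e2 (CC \<times> CC)" "e2 ` (CC \<times> CC) <= Field \<kappa>" using small_embed[OF univ smC2] by auto
 define d where "d = inv_into CC e"
 define d2 where "d2 = inv_into (CC \<times> CC) e2"
 have d [simp]: "d (e S) = S" if "S : CC" for S unfolding d_def using e that by simp
 have d2 [simp]: "d2 (e2 (S, S')) = (S, S')" if "S : CC" "S' : CC" for S S' unfolding d2_def using e2 that by simp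
 \<comment> \<open>The poset of the family, copied into the type of \<open>\<kappa>\<close> by the
   injections \<open>e\<close> on objects and \<open>e2\<close> on pairs, that is, on
   arrows.\<close>
 define J :: "('u, 'u) cat" where "J = \<lparr>Obj = e ` CC, Arr = e2 ` {(S, S'). S : CC & S' : CC & S <= S'},
   Dom = (%u. e (fst (d2 u))), Cod = (%u. e (snd (d2 u))), Idt = (%j. e2 (d j, d j)),
   Cmp = (%v u. e2 (fst (d2 u), snd (d2 v)))\<rparr>"
 have JO: "Obj J = e ` CC" by (simp add: J_def)
 have JA: "u : Arr J <-> (EX S S'. S : CC & S' : CC & S <= S' & u = e2 (S, S'))" for u by (auto simp: J_def)
 have JS: "Dom J (e2 (S, S')) = e S" "Cod J (e2 (S, S')) = e S'" if "S : CC" "S' : CC" for S S' using that by (simp_all add: J_def)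
 have JI: "Idt J (e S) = e2 (S, S)" if "S : CC" for S using that by (simp add: J_def)
 have JC: "Cmp J (e2 (S', S'')) (e2 (S, S')) = e2 (S, S'')" if "S : CC" "S' : CC" "S'' : CC" for S S' S'' using that by (simp add: J_def)
 have eq: "e S = e S' <-> S = S'" if "S : CC" "S' : CC" for S S' using e that by (auto simp: inj_on_def)
 have JH: "u : Hom J i j <-> (EX S S'. S : CC & S' : CC & S <= S' & u = e2 (S, S') & i = e S & j = e S')" for u i j
  unfolding Hom_iff JA using JS by metis
 have catJ: "category J"
 proof
  show "!!u. u : Arr J ==> Dom J u : Obj J" "!!u. u : Arr J ==> Cod J u : Obj J" using JS by (auto simp: JA JO)
  show "!!j. j : Obj J ==> Idt J j : Hom J j j" unfolding JO JH using JI by blast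
  show "Cmp J v u : Hom J i k" if "u : Hom J i j" "v : Hom J j k" for u v i j k
   using that unfolding JH using eq JC by (metis order_trans)
  show "Cmp J u (Idt J i) = u" "Cmp J (Idt J j) u = u" if "u : Hom J i j" for u i j
   using that unfolding JH using JC JI by auto
  show "Cmp J w (Cmp J v u) = Cmp J (Cmp J w v) u" if "u : Hom J i j" "v : Hom J j k" "w : Hom J k l" for u v w i j k l
   using that unfolding JH using eq JC by auto
 qed
 have filt: "is_filtered J" unfolding is_filtered_def
 proof (intro conjI ballI)
  show "category J" by fact
  show "Obj J ~= {}" using C JO by simp
  fix i j assume "i : Obj J" "j : Obj J"
  then obtain S S' where S: "S : CC" "S' : CC" "i = e S" "j = e S'" unfolding JO by auto
  obtain S'' where S'': "S'' : CC" "S <= S''" "S' <= S''" using dir[OF S(1,2)] by auto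
  have "e2 (S, S'') : Hom J i (e S'')" "e2 (S', S'') : Hom J j (e S'')" unfolding JH using S S'' by auto
  thus "EX k:Obj J. Hom J i k ~= {} & Hom J j k ~= {}" using S'' JO by blast
 next
  fix i j u v assume "u : Hom J i j" "v : Hom J i j" and j: "j : Obj J"
  hence "u = v" unfolding JH using eq by auto
  moreover have "Idt J j : Hom J j j" using j unfolding JO JH using JI by blast
  ultimately show "EX k:Obj J. EX w:Hom J j k. Cmp J w u = Cmp J w v" using j by auto
 qed
 have smJ: "small \<kappa> (Obj J)" "small \<kappa> (Arr J)"
  using small_image[OF smC, of e] small_image[OF small_mono[OF smC2, of "{(S, S'). S : CC & S' : CC & S <= S'}"], of e2]
  by (auto simp: J_def)
 let ?F = "\<lparr>FO = (%j. dom t), FA = (%u. idt (dom t))\<rparr> :: ('u, 'u, 'o, 'm) cfunctor"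
 let ?G = "\<lparr>FO = (%j. cod (qt (d j))), FA = (%u. f (fst (d2 u)) (snd (d2 u)))\<rparr> :: ('u, 'u, 'o, 'm) cfunctor"
 let ?H = "\<lparr>FO = (%j. cod (c (d j))), FA = (%u. g (fst (d2 u)) (snd (d2 u)))\<rparr> :: ('u, 'u, 'o, 'm) cfunctor"
 have F: "is_functor J A ?F" unfolding is_functor_def by simp
 have G: "is_functor J A ?G" unfolding is_functor_def
 proof (intro conjI ballI impI)
  fix j assume "j : Obj J"
  then obtain S where S: "S : CC" "j = e S" unfolding JO by auto
  show "obj (FO ?G j)" using q(2)[of S] S by simp
 next
  fix u assume "u : Arr J"
  then obtain S S' where S: "S : CC" "S' : CC" "S <= S'" "u = e2 (S, S')" unfolding JA by auto
  show "FA ?G u : hom (FO ?G (Dom J u)) (FO ?G (Cod J u))" using f(1-3)[of S S'] S by (simp add: JS)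
 next
  show "FA ?G (Idt J j) = idt (FO ?G j)" if "j : Obj J" for j using that unfolding JO by (auto simp: JI ffi)
  show "FA ?G (Cmp J v u) = FA ?G v*FA ?G u" if "u : Arr J" "v : Arr J" "Cod J u = Dom J v" for u v
   using that unfolding JA by (auto simp: JS JC eq ffc)
 qed
 have H: "is_functor J A ?H" unfolding is_functor_def
 proof (intro conjI ballI impI)
  fix j assume "j : Obj J"
  then obtain S where S: "S : CC" "j = e S" unfolding JO by auto
  show "obj (FO ?H j)" using c(2)[of S] S by simp
 next
  fix u assume "u : Arr J"
  then obtain S S' where S: "S : CC" "S' : CC" "S <= S'" "u = e2 (S, S')" unfolding JA by auto
  show "FA ?H u : hom (FO ?H (Dom J u)) (FO ?H (Cod J u))" using g(1-3)[of S S'] S by (simp add: JS)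
 next
  show "FA ?H (Idt J j) = idt (FO ?H j)" if "j : Obj J" for j using that unfolding JO by (auto simp: JI ggi)
  show "FA ?H (Cmp J v u) = FA ?H v*FA ?H u" if "u : Arr J" "v : Arr J" "Cod J u = Dom J v" for u v
   using that unfolding JA by (auto simp: JS JC eq ggc)
 qed
 let ?\<alpha> = "%j. qt (d j)*t" and ?be = "%j. c (d j)"
 have al: "is_nat_trans J A ?F ?G ?\<alpha>" unfolding is_nat_trans_def
 proof (intro conjI ballI)
  show "?\<alpha> j : hom (FO ?F j) (FO ?G j)" if "j : Obj J" for j
  proof -
   obtain S where S: "S : CC" "j = e S" using \<open>j : Obj J\<close> unfolding JO by auto
   show ?thesis using q(2,3)[of S] S by simp
  qed
  fix u assume "u : Arr J"
  then obtain S S' where S: "S : CC" "S' : CC" "S <= S'" "u = e2 (S, S')" unfolding JA by auto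
  have "f S S'*(qt S*t) = (f S S'*qt S)*t" using f(1-3)[of S S'] q(2,3)[of S] S by simp
  thus "?\<alpha> (Cod J u)*FA ?F u = FA ?G u*?\<alpha> (Dom J u)" using f[of S S'] S q(2,3)[of S'] by (simp add: JS)
 qed
 have be: "is_nat_trans J A ?G ?H ?be" unfolding is_nat_trans_def
 proof (intro conjI ballI)
  show "?be j : hom (FO ?G j) (FO ?H j)" if "j : Obj J" for j
  proof -
   obtain S where S: "S : CC" "j = e S" using \<open>j : Obj J\<close> unfolding JO by auto
   show ?thesis using c(2,3)[of S] S by simp
  qed
  fix u assume "u : Arr J"
  then obtain S S' where S: "S : CC" "S' : CC" "S <= S'" "u = e2 (S, S')" unfolding JA by auto
  show "?be (Cod J u)*FA ?G u = FA ?H u*?be (Dom J u)"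
   using g(4)[of S S'] S by (simp add: JS)
 qed
 have monoS: "mono (qt S*t)" if "S : CC" for S
  unfolding mono_iff
 proof (intro conjI ballI impI)
  fix x assume x: "arr x" "cod x = dom (qt S*t)" "nul ((qt S*t)*x)"
  hence "t*x : kr (qt S)" "t*x : T" using q(2,3)[of S] that svI[of x t] by auto
  hence "t*x : T Int S" using q(4)[of S] that by blast
  hence "nul (t*x)" using disj[OF that] by auto
  thus "nul x" by (rule mono_nul[OF t(1)]) (use x q(2,3)[of S] that in auto)
 qed (use q(2,3)[of S] that in auto)
 have se: "short_exact A (?\<alpha> j) (?be j)" if j: "j : Obj J" for j
 proof -
  obtain S where S: "S : CC" "j = e S" using j unfolding JO by auto
  have "is_kernel A (qt S*t) (c S)"
   by (rule kernelI) (use monoS[OF S(1)] c[of S] S q(2,3)[of S] mono_kr_coker[OF monoS[OF S(1)] c0] in auto)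
  thus ?thesis unfolding short_exact_def using monoS[OF S(1)] c(1)[of S] S by simp
 qed
 have const: "k S = k S'" if k: "!!S S'. S : CC ==> S' : CC ==> S <= S' ==> k S = k S'" and "S : CC" "S' : CC" for k :: "_ => 'm" and S S'
  using dir[OF that(2,3)] k that by metis
 have cc: "k S'*FA F' (e2 (S, S')) = k S"
  if "is_cocone J A F' M ms" "!!S. S : CC ==> k S = ms (e S)" "S : CC" "S' : CC" "S <= S'" for F' M ms k S S'
  using that unfolding is_cocone_def by (metis JA JS)
 obtain S0 where S0: "S0 : CC" using C by blast
 have colF: "is_colimit J A ?F (dom t) (%_. idt (dom t))" unfolding is_colimit_def
 proof (intro conjI allI impI)
  show "is_cocone J A ?F (dom t) (%_. idt (dom t))" unfolding is_cocone_def by simp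
  fix M ms assume m: "is_cocone J A ?F M ms"
  have m1: "ms (e S) : hom (dom t) M" if "S : CC" for S using m that unfolding is_cocone_def JO by simp
  have m2: "ms (e S) = ms (e S')" if SS': "S : CC" "S' : CC" for S S'
  proof (rule const[of "%S. ms (e S)", OF _ SS'])
   fix S S' assume S: "S : CC" "S' : CC" "S <= S'"
   have "ms (e S')*idt (dom t) = ms (e S)" using cc[OF m, of "%S. ms (e S)" S S'] S by simp
   thus "ms (e S) = ms (e S')" using m1[OF S(2)] by simp
  qed
  show "EX! h. h : hom (dom t) M & (ALL j:Obj J. h*idt (dom t) = ms j)"
  proof (rule ex1I[of _ "ms (e S0)"])
   have "ms (e S0)*idt (dom t) = ms (e S)" if S: "S : CC" for S
    using m1[OF S0] m2[OF S0 S] by simp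
   thus "ms (e S0) : hom (dom t) M & (ALL j:Obj J. ms (e S0)*idt (dom t) = ms j)"
    using m1[OF S0] unfolding JO by blast
   fix h assume h: "h : hom (dom t) M & (ALL j:Obj J. h*idt (dom t) = ms j)"
   hence "h*idt (dom t) = ms (e S0)" using S0 unfolding JO by blast
   thus "h = ms (e S0)" using h by simp
  qed
 qed
 let ?r = "%j. f (d j) U"
 have fU: "arr (f S U)" "dom (f S U) = cod (qt S)" "cod (f S U) = cod (qt U)" "f S U*qt S = qt U" if "S : CC" for S
  using f[of S U] that U(2) by auto
 have gU: "arr (g S U)" "dom (g S U) = cod (c S)" "cod (g S U) = cod (c U)" "g S U* c S = c U*f S U" if "S : CC" for S
  using g[of S U] that U(2) by auto
 \<comment> \<open>A compatible family on the quotients \<open>X/S\<close> amounts to one arrow on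
   \<open>X\<close> killing every \<open>S\<close>; its kernel then contains the supremum
   \<open>U\<close>, so it descends to \<open>X/U\<close>.\<close>
 have univG: "EX! h. h : hom (cod (qt U)) M & (ALL S : CC. h*f S U = k S)"
  if M: "obj M" "!!S. S : CC ==> k S : hom (cod (qt S)) M"
   and k: "!!S S'. S : CC ==> S' : CC ==> S <= S' ==> k S'*f S S' = k S" for M k
 proof -
  have kq: "k S*qt S = k S'*qt S'" if "S : CC" "S' : CC" for S S'
  proof (rule const[of "%S. k S*qt S", OF _ that])
   fix S S' assume S: "S : CC" "S' : CC" "S <= S'"
   have "k S*qt S = (k S'*f S S')*qt S" using k S by simp
   also have "... = k S'*qt S'" using f[of S S'] M(2)[OF S(2)] q(2,3)[of S] S by simp
   finally show "k S*qt S = k S'*qt S'" .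
  qed
  let ?k = "k S0*qt S0"
  have kk: "arr ?k" "dom ?k = X" "cod ?k = M" using M(2)[OF S0] q(2,3)[of S0] S0 by auto
  have "U <= kr ?k"
  proof (rule Ul)
   show "kr ?k : Sub X" using kr_Sub[OF kk(1)] kk by simp
   fix S assume S: "S : CC"
   show "S <= kr ?k"
   proof
    fix x assume "x : S"
    hence "x : kr (qt S)" using q(4)[of S] S by simp
    hence "nul ((k S*qt S)*x)" "arr x" "cod x = X" using M(2)[OF S] q(2,3)[of S] S by auto
    thus "x : kr ?k" using kq[OF S S0] kk by simp
   qed
  qed
  then obtain h where h: "arr h" "dom h = cod (qt U)" "cod h = M" "h*qt U = ?k"
   using epi_factor[OF q(1)[of U], of ?k] q[of U] kk by auto
  have hf: "h*f S U = k S" if S: "S : CC" for S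
  proof (rule epi_cancel[OF q(1)[of S]])
   show "(h*f S U)*qt S = k S*qt S" using h fU[OF S] q(2,3)[of S] S kq[OF S S0] by simp
  qed (use S h fU[OF S] M(2)[OF S] q(2,3)[of S] in auto)
  show ?thesis
  proof (rule ex1I[of _ h])
   show "h : hom (cod (qt U)) M & (ALL S : CC. h*f S U = k S)" using h hf by auto
   fix h' assume h': "h' : hom (cod (qt U)) M & (ALL S : CC. h'*f S U = k S)"
   hence ht: "arr h'" "dom h' = cod (qt U)" "h'*f S0 U = k S0" using S0 by auto
   have "h'*qt U = (h'*f S0 U)*qt S0" using ht(1,2) fU[OF S0] q(2,3)[of S0] S0 by simp
   also have "... = h*qt U" unfolding ht(3) using h by simp
   finally show "h' = h" by (rule epi_cancel[OF q(1)[of U], rotated 1]) (use h h' in auto)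
  qed
 qed
 have colG: "is_colimit J A ?G (cod (qt U)) ?r" unfolding is_colimit_def
 proof (intro conjI allI impI)
  show "is_cocone J A ?G (cod (qt U)) ?r" unfolding is_cocone_def
   using fU(1-3) q(2)[of U] ffc U by (auto simp: JO JA JS)
  fix M ms assume m: "is_cocone J A ?G M ms"
  have "EX! h. h : hom (cod (qt U)) M & (ALL S : CC. h*f S U = ms (e S))"
   by (rule univG) (use m cc[OF m, of "%S. ms (e S)"] in "auto simp: is_cocone_def JO")
  thus "EX! h. h : hom (cod (qt U)) M & (ALL j:Obj J. h*?r j = ms j)" by (simp add: JO)
 qed
 let ?w = "%j. g (d j) U"
 have colH: "is_colimit J A ?H (cod (c U)) ?w" unfolding is_colimit_def
 proof (intro conjI allI impI)
  show "is_cocone J A ?H (cod (c U)) ?w" unfolding is_cocone_def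
   using gU(1-3) c(2)[of U] ggc U by (auto simp: JO JA JS)
  fix M ms assume m: "is_cocone J A ?H M ms"
  hence M: "obj M" by (simp add: is_cocone_def)
  have m1: "arr (ms (e S))" "dom (ms (e S)) = cod (c S)" "cod (ms (e S)) = M" if "S : CC" for S
   using m that unfolding is_cocone_def JO by auto
  have m2: "ms (e S')*g S S' = ms (e S)" if "S : CC" "S' : CC" "S <= S'" for S S'
   using cc[OF m, of "%S. ms (e S)"] that by auto
  have ex: "EX! h. h : hom (cod (qt U)) M & (ALL S : CC. h*f S U = ms (e S)* c S)"
  proof (rule univG)
   fix S S' assume S: "S : CC" "S' : CC" "S <= S'"
   have "ms (e S')*(g S S'* c S) = (ms (e S')*g S S')* c S"
    using m1[of S'] S g(1-3)[of S S'] c(2,3)[of S] by simp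
   thus "ms (e S')* c S'*f S S' = ms (e S)* c S"
    using m1[of S'] m2[of S S'] S g[of S S'] c(2,3)[of S'] f(1-3)[of S S'] by simp
  qed (use M m1 c(2,3) in auto)
  then obtain h where h: "arr h" "dom h = cod (qt U)" "cod h = M" "!!S. S : CC ==> h*f S U = ms (e S)* c S" by auto
  have "qt U*t = f S0 U*(qt S0*t)"
   using Cmp_assoc_simp[of t "qt S0" "f S0 U"] fU[OF S0] q(2,3)[of S0] S0 by simp
  hence "h*(qt U*t) = h*(f S0 U*(qt S0*t))" by (rule arg_cong)
  also have "... = (h*f S0 U)*(qt S0*t)"
   using h(1-3) fU(1-3)[OF S0] q(2,3)[of S0] S0 by simp
  also have "... = ms (e S0)*(c S0*(qt S0*t))" using h(4)[OF S0] m1[OF S0] c(2,3)[of S0] q(2,3)[of S0] S0 by simp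
  finally have "nul (h*(qt U*t))" using c[of S0] S0 m1[OF S0] q(2,3)[of S0] by simp
  then obtain h' where h': "arr h'" "dom h' = cod (c U)" "cod h' = M" "h'* c U = h"
   using cokernel_factor[OF c0[of U], of h] h q(2,3)[of U] by auto
  have hg: "h'*g S U = ms (e S)" if S: "S : CC" for S
  proof (rule epi_cancel[OF c(1)[of S]])
   have "(h'* c U)*f S U = ms (e S)* c S" using h h' S by simp
   thus "(h'*g S U)* c S = ms (e S)* c S" using h'(1-3) gU[OF S] c(2,3)[of S] c(2,3)[of U] S fU(1-3)[OF S] by simp
  qed (use S h' gU[OF S] m1[OF S] c(2,3)[of S] in auto)
  show "EX! h. h : hom (cod (c U)) M & (ALL j:Obj J. h*?w j = ms j)"
  proof (rule ex1I[of _ h'])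
   show "h' : hom (cod (c U)) M & (ALL j:Obj J. h'*?w j = ms j)" using h' hg JO by auto
   fix k assume k: "k : hom (cod (c U)) M & (ALL j:Obj J. k*?w j = ms j)"
   have kt: "arr k" "dom k = cod (c U)" "cod k = M" using k by auto
   have kc: "(k* c U)*f S U = ms (e S)* c S" if S: "S : CC" for S
   proof -
    have "(k* c U)*f S U = (k*g S U)* c S" using k gU[OF S] c(2,3)[of S] c(2,3)[of U] S fU(1-3)[OF S] by simp
    thus ?thesis using k S JO by simp
   qed
   have 1: "k* c U : hom (cod (qt U)) M & (ALL S : CC. (k* c U)*f S U = ms (e S)* c S)"
    by (intro conjI ballI kc) (use kt c(2,3)[of U] in simp_all)
   have 2: "h : hom (cod (qt U)) M & (ALL S : CC. h*f S U = ms (e S)* c S)" using h by auto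
   have "k* c U = h" using ex 1 2 by blast
   hence "k* c U = h'* c U" using h'(4) by simp
   thus "k = h'" by (rule epi_cancel[OF c(1)[of U], rotated 1]) (use h'(1-3) kt in auto)
  qed
 qed
 have ex: "filtered_colimits_exact \<kappa> A" using groth by (simp add: grothendieck_category_def)
 have eqt: "qt U*t = f S U*(qt S*t)" if "S : CC" for S
  using Cmp_assoc_simp[of t "qt S" "f S U"] fU[OF that] q(2,3)[of S] that by simp
 have "short_exact A (qt U*t) (c U)"
  by (rule ex[unfolded filtered_colimits_exact_def, rule_format,
     of J ?F ?G ?H ?\<alpha> ?be "dom t" "%_. idt (dom t)" "cod (qt U)" ?r "cod (c U)" ?w])
   (intro conjI filt smJ F G H al be ballI se colF colG colH, use q(2,3)[of U] c(2,3)[of U] gU(4) eqt in "auto simp: JO")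
 hence mono: "mono (qt U*t)" by (simp add: short_exact_def)
 show ?thesis
 proof
  fix x assume x: "x : T Int SupS X CC"
  hence xs: "x : sv t" and "x : kr (qt U)" using q(4)[of U] by (auto simp: U_def)
  from xs obtain h where h: "arr h" "cod h = dom t" "x = t*h" by (rule svE)
  hence "nul ((qt U*t)*h)" using \<open>x : kr (qt U)\<close> q(2,3)[of U] by simp
  hence "nul h" by (rule mono_nul[OF mono]) (use h q(2,3)[of U] in auto)
  thus "x : zr X" using h by simp
 qed
qed

end

section \<open>Injective, monoform and noetherian objects\<close>

context abelian_category begin

lemma epi_factor_mono:
 assumes q: "epi q" and f: "arr f" "dom f = dom q" and k: "kr q = kr f"
 obtains g where "mono g" "dom g = cod q" "cod g = cod f" "g*q = f"
proof -
 obtain g where g: "arr g" "dom g = cod q" "cod g = cod f" "g*q = f"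
  using epi_factor[OF q f] k by auto
 have "mono g" unfolding mono_iff
 proof (intro conjI ballI impI g)
  fix x assume x: "arr x" "cod x = dom g" "nul (g*x)"
  obtain e y where y: "epi e" "cod e = dom x" "arr y" "dom y = dom e" "cod y = dom q" "q*y = x*e"
   using cover[OF q, of x] x g by auto
  have "f*y = g*(q*y)" unfolding g(4)[symmetric] using g(1,2) y(3,5) q by simp
  hence "nul (f*y)" unfolding y(6) using x y g by simp
  hence "y : kr q" unfolding k using y f by simp
  hence "nul (x*e)" using y(6) by simp
  thus "nul x" by (rule epi_nul[OF y(1)]) (use x y in auto)
 qed
 thus ?thesis using that g by blast
qed

lemma qt_mem: "S : Sub X ==> x : S <-> arr x & cod x = X & nul (qt S*x)"
 using qt(3,4)[of S X] kr_iff[of x "qt S"] by simp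

lemma sv_le: "S : Sub X ==> i : S ==> sv i <= S"
proof
 fix x assume S: "S : Sub X" "i : S" and "x : sv i"
 then obtain h where h: "arr h" "cod h = dom i" "x = i*h" by (elim svE)
 show "x : S" unfolding h(3) by (rule Sub_Cmp[OF S h(1,2)])
qed

lemma qt_cokernel: "S : Sub X ==> is_cokernel C (qt S) (inc S)"
 using qt[of S X] inc[of S X] Sub_inc[of S X] by (intro cokernelI) auto

lemma is_injectiveD:
 assumes "inject E" "mono m" "arr f" "dom f = dom m" "cod f = E"
 obtains g where "arr g" "dom g = cod m" "cod g = E" "g*m = f"
 using assms unfolding is_injective_def by (metis Hom_iff)

lemma is_injective_Obj: "inject E ==> obj E" by (simp add: is_injective_def)

lemma is_injectiveI:
 assumes "obj E" "!!m f. mono m ==> arr f ==> dom f = dom m ==> cod f = E ==>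
  EX g. arr g & dom g = cod m & cod g = E & g*m = f"
 shows "inject E"
 using assms unfolding is_injective_def by (metis Hom_iff)

lemma is_injective_retract:
 assumes E: "inject E" and i: "arr i" "cod i = E" and r: "arr r" "dom r = E" "r*i = idt (dom i)" "cod r = dom i"
 shows "inject (dom i)"
proof (rule is_injectiveI)
 fix m f assume m: "mono m" and f: "arr f" "dom f = dom m" "cod f = dom i"
 obtain g where g: "arr g" "dom g = cod m" "cod g = E" "g*m = i*f"
  by (rule is_injectiveD[OF E m, of "i*f"]) (use i f in auto)
 have "(r*g)*m = r*(i*f)" using g m r by simp
 also have "... = (r*i)*f" using r(1,2) i f by simp
 also have "... = f" unfolding r(3) using f by simp
 finally show "EX g. arr g & dom g = cod m & cod g = dom i & g*m = f"
  using g r by (intro exI[of _ "r*g"]) simp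
qed (use i in auto)

lemma is_injective_iso:
 assumes E: "inject E" and i: "is_iso C i" "cod i = E"
 shows "inject (dom i)"
proof -
 obtain r where "arr i" "arr r" "dom r = cod i" "cod r = dom i" "r*i = idt (dom i)"
  using i(1) by (rule is_isoE) blast
 thus ?thesis using is_injective_retract[OF E, of i r] i by simp
qed

lemma is_injective_zero: "zero Z ==> inject Z"
proof (rule is_injectiveI)
 assume Z: "zero Z"
 thus "obj Z" by (simp add: is_zero_def)
 fix m f assume m: "mono m" and f: "arr f" "dom f = dom m" "cod f = Z"
 have "zer (cod m) Z*m = f" using m f nul_eq[OF zero_nul[OF Z f(1)]] Z by (simp add: is_zero_def)
 thus "EX g. arr g & dom g = cod m & cod g = Z & g*m = f"
  using Z m by (intro exI[of _ "zer (cod m) Z"]) (simp add: is_zero_def)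
qed

lemma is_injective_bip:
 assumes B: "is_biproduct C X Y B i j p q" and X: "inject X" and Y: "inject Y"
 shows "inject B"
proof -
 have XY: "obj X" "obj Y" using X Y is_injective_Obj by auto
 note b = bip_facts[OF B XY]
 show ?thesis
 proof (rule is_injectiveI)
  fix m f assume m: "mono m" and f: "arr f" "dom f = dom m" "cod f = B"
  obtain g where g: "arr g" "dom g = cod m" "cod g = X" "g*m = p*f"
   by (rule is_injectiveD[OF X m, of "p*f"]) (use b(1-13) f in auto)
  obtain h where h: "arr h" "dom h = cod m" "cod h = Y" "h*m = q*f"
   by (rule is_injectiveD[OF Y m, of "q*f"]) (use b(1-13) f in auto)
  have "(i*g++j*h)*m = f" using g h b(1-13) m f bip_decomp[OF B XY f(1,3)] by (simp add: Add_Cmp)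
  thus "EX g. arr g & dom g = cod m & cod g = B & g*m = f"
   using g h b(1-13) by (intro exI[of _ "i*g++j*h"]) simp
 qed (rule b(1))
qed

text \<open>If \<open>S\<close> meets \<open>T\<close> in zero, then \<open>T\<close> embeds into
  the quotient by \<open>S\<close> and is also a subobject of \<open>H\<close>; with both nonzero
  this contradicts the definition.\<close>

lemma monoform_uniform:
 assumes H: "is_monoform C H" and S: "S : Sub H" and T: "T : Sub H" and d: "S Int T <= zr H"
 shows "S <= zr H | T <= zr H"
proof (rule ccontr)
 assume a: "~ (S <= zr H | T <= zr H)"
 note s = inc[OF S] and t = inc[OF T] and q = qt[OF S]
 have "mono (qt S*inc T)" unfolding mono_iff
 proof (intro conjI ballI impI)
  fix x assume x: "arr x" "cod x = dom (qt S*inc T)" "nul ((qt S*inc T)*x)"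
  have "inc T*x : T" using inc_Cmp_mem[OF T x(1)] x t q by simp
  moreover have "inc T*x : S" unfolding qt_mem[OF S] using x t q(1-3) by simp
  ultimately have "nul (inc T*x)" using d by auto
  thus "nul x" by (rule mono_nul[OF t(1)]) (use x t q in auto)
 qed (use t q in auto)
 moreover have "~ zero (dom (inc S))" "~ zero (dom (inc T))" using a zero_inc S T by auto
 moreover have "isomorphic C (dom (inc T)) (dom (qt S*inc T))" using t q by (simp add: isomorphic_refl)
 moreover have "cod (qt S*inc T) = cod (qt S)" using t q by simp
 ultimately show False using H qt_cokernel[OF S] s t unfolding is_monoform_def by blast
qed

text \<open>The maximal element form of \<open>is_noetherian\<close>, suited to the extremal
  arguments below; \<open>noethI\<close> derives it by dependent choice.\<close>

definition noeth where
 "noeth M <-> obj M & (ALL CC <= Sub M. CC ~= {} --> (EX S : CC. ALL S' : CC. S <= S' --> S' = S))"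

lemma noethE:
 assumes "noeth M" "CC <= Sub M" "CC ~= {}"
 obtains S where "S : CC" "!!S'. S' : CC ==> S <= S' ==> S' = S"
 using assms unfolding noeth_def by meson

lemma factors_through_sv:
 assumes "mono i" "mono j" "cod i = cod j"
 shows "factors_through C i j <-> sv i <= sv j"
proof
 assume "factors_through C i j"
 hence "i : sv j" using assms unfolding factors_through_def sv_def by auto
 thus "sv i <= sv j" by (rule sv_le[OF sv_Sub[OF assms(2)]])
next
 assume "sv i <= sv j"
 hence "i : sv j" using sv_self[of i] assms by auto
 thus "factors_through C i j" unfolding factors_through_def sv_def by auto
qed

lemma noethI:
 assumes "is_noetherian C M" shows "noeth M"
proof (rule ccontr)
 assume "~ noeth M"
 moreover have M: "obj M" using assms by (simp add: is_noetherian_def)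
 ultimately obtain CC where C: "CC <= Sub M" "CC ~= {}" "!!S. S : CC ==> EX S' : CC. S \<subset> S'"
  unfolding noeth_def by (metis psubsetI)
 obtain S0 where S0: "S0 : CC" using C by blast
 have "EX \<sigma>. ALL n. \<sigma> n : CC & \<sigma> n \<subset> \<sigma> (Suc n)"
 proof (rule dependent_nat_choice)
  show "EX S. S : CC" using S0 ..
  fix S n assume "S : CC"
  thus "EX S'. S' : CC & S \<subset> S'" using C(3)[of S] by auto
 qed
 then obtain \<sigma> where \<sigma>0: "ALL n. \<sigma> n : CC & \<sigma> n \<subset> \<sigma> (Suc n)" ..
 hence \<sigma>: "!!n. \<sigma> n : Sub M" "!!n. \<sigma> n \<subset> \<sigma> (Suc n)" using C(1) by (meson subsetD)+
 note i = inc[OF \<sigma>(1)]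
 have f: "factors_through C (inc (\<sigma> m)) (inc (\<sigma> n)) <-> \<sigma> m <= \<sigma> n" for m n
  using factors_through_sv[of "inc (\<sigma> m)" "inc (\<sigma> n)"] i by simp
 have "ALL n. mono (inc (\<sigma> n)) & cod (inc (\<sigma> n)) = M & factors_through C (inc (\<sigma> n)) (inc (\<sigma> (Suc n)))"
  using i f \<sigma>(2) by blast
 hence "EX N. ALL n >= N. factors_through C (inc (\<sigma> n)) (inc (\<sigma> N))"
  using conjunct2[OF assms[unfolded is_noetherian_def], THEN spec, of "%n. inc (\<sigma> n)"] by blast
 then obtain N where N: "!!n. n >= N ==> \<sigma> n <= \<sigma> N" unfolding f by blast
 have "\<sigma> (Suc N) <= \<sigma> N" by (rule N) simp
 thus False using \<sigma>(2)[of N] by blast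
qed

lemma noeth_epi:
 assumes "noeth M" "epi e" "dom e = M" shows "noeth (cod e)"
 unfolding noeth_def
proof (intro conjI allI impI)
 fix CC assume C: "CC <= Sub (cod e)" "CC ~= {}"
 have "pre e ` CC <= Sub M" using pre_Sub[of e] C assms by auto
 then obtain D where D: "D : pre e ` CC" "!!S'. S' : pre e ` CC ==> D <= S' ==> S' = D"
  by (rule noethE[OF assms(1)]) (use C in auto)
 then obtain S where S: "S : CC" "D = pre e S" by auto
 have "S' = S" if "S' : CC" "S <= S'" for S'
 proof -
  have "pre e S <= pre e S'" using that by (auto simp: pre_def)
  moreover have "pre e S' : pre e ` CC" using that(1) by (rule imageI)
  ultimately have "pre e S' = pre e S" using D(2) S(2) by simp
  thus ?thesis using img_pre_epi[OF assms(2), of S] img_pre_epi[OF assms(2), of S'] S(1) that(1) C by auto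
 qed
 thus "EX S:CC. ALL S':CC. S <= S' --> S' = S" using S by blast
qed (use assms in auto)

lemma noeth_mono:
 assumes "noeth M" "mono i" "cod i = M" shows "noeth (dom i)"
 unfolding noeth_def
proof (intro conjI allI impI)
 fix CC assume C: "CC <= Sub (dom i)" "CC ~= {}"
 have k: "kr i <= S" if "S : CC" for S using mono_kr[of i] zr_least[of S "dom i"] assms that C by auto
 have pi: "pre i (img i S) = S" if "S : CC" for S using pre_img[of i S] k[OF that] C that assms by auto
 have "img i ` CC <= Sub M" using img_Sub[of i] C assms by auto
 then obtain D where D: "D : img i ` CC" "!!S'. S' : img i ` CC ==> D <= S' ==> S' = D"
  by (rule noethE[OF assms(1)]) (use C in auto)
 then obtain S where S: "S : CC" "D = img i S" by auto
 have "S' = S" if "S' : CC" "S <= S'" for S'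
 proof -
  have "img i S' : img i ` CC" using that(1) by (rule imageI)
  hence "img i S' = img i S" using D(2) S(2) img_mono[OF that(2)] by simp
  thus ?thesis using pi[OF S(1)] pi[OF that(1)] by simp
 qed
 thus "EX S:CC. ALL S':CC. S <= S' --> S' = S" using S by blast
qed (use assms in auto)

text \<open>Let \<open>N\<close> be maximal such that some nonzero subobject \<open>j\<close> of
  \<open>M\<close> also embeds into \<open>M/N\<close>; the zero subobject shows that such
  \<open>N\<close> exist. Then the source of \<open>j\<close> is monoform: otherwise a proper
  quotient of it shares a nonzero subobject with it, and the preimage \<open>N'\<close> of what was
  divided out is a larger choice.\<close>

lemma noeth_monoform:
 assumes M: "noeth M" "~ zero M"
 shows "EX m. mono m & cod m = M & is_monoform C (dom m)"
proof -
 let ?P = "%N j k. mono j & cod j = M & ~ zero (dom j) & mono k & dom k = dom j & cod k = cod (qt N)"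
 let ?C = "{N : Sub M. EX j k. ?P N j k}"
 have Mo: "obj M" using M by (simp add: noeth_def)
 have z: "zr M : Sub M" using zr_Sub[OF Mo] .
 have "mono (qt (zr M))" using mono_kr[of "qt (zr M)"] qt[OF z] by simp
 hence "?P (zr M) (idt M) (qt (zr M))" using qt[OF z] M Mo by simp
 hence "?C ~= {}" using z by blast
 then obtain N where N: "N : ?C" and max: "!!S'. S' : ?C ==> N <= S' ==> S' = N"
  by (rule noethE[OF M(1), rotated]) auto
 from N have NS: "N : Sub M" by simp
 from N obtain j k where j: "mono j" "cod j = M" "~ zero (dom j)" and k: "mono k" "dom k = dom j" "cod k = cod (qt N)"
  by auto
 have ja: "arr j" "arr k" using j k by auto
 note q = qt[OF NS]
 have "is_monoform C (dom j)"
 proof (rule ccontr)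
  assume "~ is_monoform C (dom j)"
  then obtain i c j' k' where i: "mono i" "cod i = dom j" "~ zero (dom i)" "is_cokernel C c i"
   and j': "mono j'" "cod j' = dom j" "~ zero (dom j')" and k': "mono k'" "cod k' = cod c"
   and iso: "isomorphic C (dom j') (dom k')"
   using j(3) Dom_Obj[OF ja(1)] unfolding is_monoform_def by blast
  obtain f where f: "arr f" "dom f = dom j'" "cod f = dom k'" "is_iso C f" using iso unfolding isomorphic_def by auto
  have c: "epi c" "arr c" "dom c = cod i" using i(4) cokernel_epi[OF i(4)] by (auto simp: is_cokernel_def)
  have ck: "kr c = sv i" using mono_kr_coker[OF i(1,4)] by simp
  have ki: "mono (k*i)" "cod (k*i) = cod (qt N)" using k i by auto
  define P where "P = sv (k*i)"
  have P: "P : Sub (cod (qt N))" using sv_Sub[OF ki(1)] ki by (simp add: P_def)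
  \<comment> \<open>The preimage in \<open>M\<close> of the subobject \<open>i\<close> of
    \<open>dom j\<close>, seen in \<open>M/N\<close> by \<open>k\<close>. The quotient of
    \<open>dom j\<close> by \<open>i\<close> embeds into \<open>M/N'\<close>, so \<open>N'\<close>
    competes with \<open>N\<close>.\<close>
  define N' where "N' = pre (qt N) P"
  have N': "N' : Sub M" using pre_Sub[OF q(2) P] q by (simp add: N'_def)
  have NN': "N <= N'"
  proof
   fix x assume "x : N"
   hence "x : kr (qt N)" using q by simp
   thus "x : N'" unfolding N'_def using q(2) Sub_nul[OF P, of "qt N*x"] by simp
  qed
  note q' = qt[OF N']
  obtain g where g: "arr g" "dom g = cod (qt N)" "cod g = cod (qt N')" "g*qt N = qt N'"
   using epi_factor[OF q(1), of "qt N'"] q q' NN' by auto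
  have gk: "arr (g*k)" "dom (g*k) = dom j" "cod (g*k) = cod (qt N')" using g k ja by auto
  have "kr (g*k) = sv i"
  proof (intro equalityI subsetI)
   fix x assume x: "x : kr (g*k)"
   hence xa: "arr x" "cod x = dom j" "nul (g*(k*x))" using gk g k ja by auto
   obtain e y where y: "epi e" "cod e = dom x" "arr y" "dom y = dom e" "cod y = M" "qt N*y = (k*x)*e"
    using cover[OF q(1), of "k*x"] xa k ja q by auto
   have "qt N'*y = g*(qt N*y)" unfolding g(4)[symmetric] using g(1,2) q(2,3) y(3,5) by simp
   also have "... = (g*(k*x))*e" unfolding y(6) using g(1,2) k ja xa(1,2) y(1,2) by simp
   finally have e1: "qt N'*y = (g*(k*x))*e" .
   have "nul (qt N'*y)" unfolding e1 by (rule nul_Cmp_left) (use xa g(1,2) k ja y(1,2) in auto)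
   hence "y : N'" unfolding qt_mem[OF N'] using y(3,5) by simp
   hence "(k*x)*e : P" unfolding N'_def y(6)[symmetric] by simp
   then obtain h where h: "arr h" "cod h = dom (k*i)" "(k*x)*e = (k*i)*h" unfolding P_def by (rule svE)
   have "k*(x*e) = k*(i*h)" using h k i ja xa y by simp
   hence "x*e = i*h" by (rule mono_cancel[OF k(1)]) (use h k i ja xa y in auto)
   hence "x*e : sv i" using svI[of h i] h i k ja by simp
   thus "x : sv i" using Sub_local[OF sv_Sub[OF i(1)], of x e] xa y i by simp
  next
   fix x assume "x : sv i"
   then obtain h where h: "arr h" "cod h = dom i" "x = i*h" by (rule svE)
   obtain e y where y: "epi e" "cod e = dom h" "arr y" "dom y = dom e" "cod y = M" "qt N*y = ((k*i)*h)*e"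
    using cover[OF q(1), of "(k*i)*h"] h i k ja q by auto
   have "((k*i)*h)*e : P" unfolding P_def using svI[of "h*e" "k*i"] h(1,2) y(1,2) ki i k ja by simp
   hence "y : N'" unfolding N'_def using y q by simp
   hence "nul (qt N'*y)" using q'(4) kr_iff by metis
   moreover have "qt N'*y = g*(qt N*y)" unfolding g(4)[symmetric] using g(1,2) q(2,3) y(3,5) by simp
   ultimately have "nul (g*(((k*i)*h)*e))" unfolding y(6) by simp
   hence "nul ((g*(k*(i*h)))*e)" using g(1,2) k ja i h(1,2) y(1,2) by simp
   hence "nul (g*(k*(i*h)))" by (rule epi_nul[OF y(1)]) (use g(1,2) k ja i h(1,2) y(1,2) in auto)
   thus "x : kr (g*k)" using g(1,2) k ja i h by simp
  qed
  then obtain p where p: "mono p" "dom p = cod c" "cod p = cod (qt N')" "p* c = g*k"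
   using epi_factor_mono[OF c(1) gk(1)] gk c i ck by auto
  have "?P N' (j*j') (p*(k'*f))"
   using j j' p k' f iso_mono_epi[OF f(4)] by simp
  hence "N' : ?C" using N' by blast
  hence "N' = N" using max NN' by blast
  hence "P = img (qt N) N" unfolding N'_def using img_pre_epi[OF q(1) P] by simp
  moreover have "img (qt N) N <= zr (cod (qt N))"
  proof -
   have "N <= pre (qt N) (zr (cod (qt N)))"
    using qt_mem[OF NS] q(2,3) by (intro subsetI) simp
   thus ?thesis using img_subset[OF q(2), of N "zr (cod (qt N))"] q(3,5) NS zr_Sub by simp
  qed
  ultimately have "nul (k*i)" using sv_self[of "k*i"] ki unfolding P_def by auto
  hence "nul i" by (rule mono_nul[OF k(1)]) (use i k ja in auto)
  hence "nul (i*idt (dom i))" using i by simp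
  hence "nul (idt (dom i))" by (rule mono_nul[OF i(1)]) (use i in auto)
  thus False using i by (simp add: is_zero_iff)
 qed
 thus ?thesis using j by blast
qed

end

locale loc_noetherian = grothendieck A \<kappa> for A :: "('o, 'm, 'z) acat_scheme" (structure) and \<kappa> :: "'u rel" +
 fixes \<G> :: "'o set"
 assumes small_G: "small \<kappa> \<G>" and gen_G: "is_generating_set A \<G>" and noeth_G: "G : \<G> ==> noeth G"
begin

text \<open>Noetherian objects are finitely generated: an arrow from one into a directed union
  factors through a member. The preimages of the members stabilize at \<open>pre f S0\<close>;
  modulo its image, the image of \<open>f\<close> meets every member trivially, so by
  \<open>AB5\<close> it meets the union trivially and is zero.\<close>

lemma noeth_dir:
 assumes C: "CC <= Sub X" "CC ~= {}" and X: "obj X"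
  and dir: "!!S S'. S : CC ==> S' : CC ==> EX S'' : CC. S <= S'' & S' <= S''"
  and f: "f : SupS X CC" "noeth (dom f)"
 shows "EX S : CC. f : S"
proof -
 note Sup = SupS[OF C(1) X]
 have fa: "arr f" "cod f = X" using Sub_el[OF Sup(1) f(1)] by auto
 have "pre f ` CC <= Sub (dom f)" using pre_Sub[of f] C fa by auto
 then obtain D where D: "D : pre f ` CC" "!!S'. S' : pre f ` CC ==> D <= S' ==> S' = D"
  by (rule noethE[OF f(2)]) (use C in auto)
 then obtain S0 where S0: "S0 : CC" "D = pre f S0" by auto
 have S0S: "S0 : Sub X" using S0 C by auto
 have N0: "pre f S0 : Sub (dom f)" using pre_Sub[of f S0] fa S0S by simp
 have le: "pre f S <= pre f S0" if S: "S : CC" for S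
 proof -
  obtain S'' where S'': "S'' : CC" "S <= S''" "S0 <= S''" using dir[OF S S0(1)] by auto
  hence "pre f S'' = pre f S0" using D(2)[of "pre f S''"] S0 by (auto simp: pre_def)
  thus ?thesis using S'' by (auto simp: pre_def)
 qed
 \<comment> \<open>The part of the image of \<open>f\<close> that lies in \<open>S0\<close>; the
   argument continues in the quotient by it.\<close>
 define R where "R = img f (pre f S0)"
 have R: "R : Sub X" using img_Sub[OF fa(1) N0] fa by (simp add: R_def)
 have RS0: "R <= S0" unfolding R_def using img_subset[OF fa(1) N0, of S0] fa S0S by auto
 note q = qt[OF R]
 define T where "T = img (qt R*f) (el (dom f))"
 let ?Y = "cod (qt R)"
 have T: "T : Sub ?Y" using img_Sub[of "qt R*f" "el (dom f)"] el_Sub q fa by (simp add: T_def)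
 have TI: "T Int S' <= zr ?Y" if S'I: "S' : img (qt R) ` CC" for S'
 proof
  obtain S where S: "S : CC" "S' = img (qt R) S" using S'I by auto
  obtain S1 where S1: "S1 : CC" "S <= S1" "S0 <= S1" using dir[OF S(1) S0(1)] by auto
  have S1S: "S1 : Sub X" using S1 C by auto
  fix y assume y: "y : T Int S'"
  hence "y : img (qt R*f) (el (dom f))" "y : img (qt R) S1" using S img_mono[OF S1(2), of "qt R"] by (auto simp: T_def)
  then obtain e x e' s where x: "epi e" "arr e" "cod e = dom y" "x : el (dom f)" "dom x = dom e" "y*e = (qt R*f)*x" "arr y" "cod y = cod (qt R*f)"
   and s: "epi e'" "arr e'" "cod e' = dom y" "s : S1" "dom s = dom e'" "y*e' = qt R*s" by (elim imgE)
  have xa: "arr x" "cod x = dom f" using x(4) by auto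
  have sa: "arr s" "cod s = X" using Sub_el[OF S1S s(4)] by auto
  obtain d d' where d: "epi d" "cod d = dom e" "arr d'" "dom d' = dom d" "cod d' = dom e'" "e'*d' = e*d"
   using cover[OF s(1), of e] x s by auto
  have "(y*e)*d = (y*e')*d'" using x(1-3,7) s(1-3) d by simp
  hence eq: "qt R*((f*x)*d) = qt R*(s*d')" unfolding x(6) s(6) using q(2,3) fa xa sa d(1-5) x(5) s(5) by simp
  have m: "(f*x)*d++neg (s*d') : R" unfolding qt_mem[OF R]
   using eq q(1-3) fa xa sa d(1-5) x(2,5) s(2,5) by (simp add: Cmp_Add)
  have "s*d' : S1" by (rule Sub_Cmp[OF S1S s(4)]) (use d s in auto)
  hence n: "neg (s*d') : S1" by (rule Sub_Neg[OF S1S])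
  have m1: "(f*x)*d++neg (s*d') : S1" using m RS0 S1(3) by blast
  have "(f*x)*d : S1"
   by (rule Sub_Add_cancel[OF S1S _ _ n _ m1]) (use fa xa sa d(1-5) x(2,5) s(2,5) in auto)
  hence "x*d : pre f S1" using fa xa d(1,2) x(5) by simp
  hence "x*d : pre f S0" using le[OF S1(1)] by blast
  hence "f*(x*d) : R" unfolding R_def by (rule img_mem[OF fa(1) N0])
  hence "nul (qt R*(f*(x*d)))" using q(4) kr_iff by metis
  moreover have "y*(e*d) = (y*e)*d" using x(2,3,7) d(1,2) by simp
  hence "y*(e*d) = qt R*(f*(x*d))" unfolding x(6) using q(2,3) fa xa d(1,2) x(5) by simp
  ultimately have "nul (y*(e*d))" by simp
  hence "nul y" by (rule epi_nul[rotated]) (use x(1-3,7) d(1,2) in auto)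
  thus "y : zr ?Y" using x(7,8) q fa by simp
 qed
 let ?D = "img (qt R) ` CC"
 have D': "?D <= Sub ?Y" using img_Sub[OF q(2)] q C by auto
 have Y: "obj ?Y" using q by simp
 have dirD: "EX S'':?D. S <= S'' & S' <= S''" if SS': "S : ?D" "S' : ?D" for S S'
 proof -
  obtain U U' where U: "U : CC" "S = img (qt R) U" "U' : CC" "S' = img (qt R) U'" using SS' by auto
  obtain U'' where "U'' : CC" "U <= U''" "U' <= U''" using dir[OF U(1,3)] by auto
  thus ?thesis using img_mono[of U U'' "qt R"] img_mono[of U' U'' "qt R"] U by (intro bexI[of _ "img (qt R) U''"]) auto
 qed
 have z: "T Int SupS ?Y ?D <= zr ?Y"
  by (rule AB5[OF D' _ Y dirD T TI]) (use C in auto)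
 note SD = SupS[OF D' Y]
 have "SupS X CC <= pre (qt R) (SupS ?Y ?D)"
 proof (rule Sup(3))
  show "pre (qt R) (SupS ?Y ?D) : Sub X" using pre_Sub[OF q(2) SD(1)] q by simp
  fix S assume S: "S : CC"
  show "S <= pre (qt R) (SupS ?Y ?D)"
   using img_subset[OF q(2), of S "SupS ?Y ?D"] SD(1) SD(2)[of "img (qt R) S"] S C q by auto
 qed
 hence "qt R*f : SupS ?Y ?D" using f by auto
 moreover have "qt R*f : T" using img_mem[of "qt R*f" "el (dom f)" "idt (dom f)"] el_Sub fa q by (simp add: T_def)
 ultimately have "nul (qt R*f)" using z by auto
 hence "f : R" unfolding qt_mem[OF R] using fa q(1-3) by simp
 thus ?thesis using RS0 S0 by blast
qed

lemma noeth_sub: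
 assumes S: "S : Sub X" "~ S <= zr X"
 shows "EX m. mono m & cod m = X & sv m <= S & ~ zero (dom m) & noeth (dom m)"
proof -
 have X: "obj X" using inc[OF S(1)] by simp
 obtain h where h: "h : S" "dom h : \<G>" "h ~: zr X" using gen_sub[OF gen_G S(1) zr_Sub[OF X] S(2)] by auto
 have ha: "arr h" "cod h = X" using Sub_el[OF S(1) h(1)] by auto
 obtain m e where m: "mono m" "epi e" "dom e = dom h" "cod e = dom m" "cod m = cod h" "h = m*e"
  using ex_image[OF ha(1)] by blast
 have "m : S" by (rule Sub_local[OF S(1), of m e]) (use m ha h in auto)
 hence "sv m <= S" by (rule sv_le[OF S(1)])
 moreover have "noeth (dom m)" using noeth_epi[OF noeth_G[OF h(2)] m(2,3)] m(4) by simp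
 moreover have "~ zero (dom m)"
 proof
  assume "zero (dom m)"
  hence "nul e" using zero_nul[of "dom m" e] m(2,4) by auto
  hence "nul (m*e)" using m(1,2,4) by simp
  hence "nul h" unfolding m(6) .
  thus False using h ha by simp
 qed
 ultimately show ?thesis using m ha by blast
qed

text \<open>A nonzero subobject contains a nonzero noetherian one, the image of an arrow from a
  generator, and that contains a monoform one.\<close>

lemma monoform_sub:
 assumes S: "S : Sub X" "~ S <= zr X"
 shows "EX m. mono m & cod m = X & sv m <= S & is_monoform A (dom m)"
proof -
 obtain m where m: "mono m" "cod m = X" "sv m <= S" "~ zero (dom m)" "noeth (dom m)" using noeth_sub[OF S] by blast
 obtain n where n: "mono n" "cod n = dom m" "is_monoform A (dom n)" using noeth_monoform[OF m(5,4)] by blast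
 have "m : S" using sv_self[of m] m by auto
 hence "m*n : S" using Sub_Cmp[OF S(1)] n by simp
 hence "sv (m*n) <= S" by (rule sv_le[OF S(1)])
 thus ?thesis using m n by (intro exI[of _ "m*n"]) simp
qed

end

context grothendieck begin

text \<open>The closure condition is stated for directed families instead of chains because
  \<open>AB5\<close> and \<open>injective_chain\<close> have this form.\<close>

lemma zorn_Sub:
 assumes Z: "\<Z> <= Sub X" "S0 : \<Z>" and X: "obj X"
  and ch: "!!CC. CC <= \<Z> ==> CC ~= {} ==> (!!S S'. S : CC ==> S' : CC ==> EX S'' : CC. S <= S'' & S' <= S'') ==> SupS X CC : \<Z>"
 obtains M where "M : \<Z>" "!!S. S : \<Z> ==> M <= S ==> S = M"
proof -
 have "EX M:\<Z>. ALL S:\<Z>. M <= S --> S = M"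
 proof (rule subset_Zorn)
  fix CC assume c: "subset.chain \<Z> CC"
  hence C: "CC <= \<Z>" by (simp add: subset.chain_def)
  have dir: "EX S'' : CC. S <= S'' & S' <= S''" if "S : CC" "S' : CC" for S S'
   using subset.chain_total[OF c that] that by blast
  show "EX U:\<Z>. ALL S:CC. S <= U"
  proof (cases "CC = {}")
   case True thus ?thesis using Z by blast
  next
   case False
   hence "SupS X CC : \<Z>" using ch C dir by blast
   moreover have "CC <= Sub X" using C Z by blast
   ultimately show ?thesis using SupS(2)[OF _ X] by blast
  qed
 qed
 thus ?thesis using that by blast
qed

end

section \<open>Baer's criterion, enough injectives, injective hulls\<close>

context loc_noetherian begin

definition baer where
 "baer E <-> (ALL G : \<G>. ALL R : Sub G. ALL f : hom (dom (inc R)) E. EX g : hom G E. g*inc R = f)"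

text \<open>Partial extensions of \<open>f\<close> along \<open>m\<close> are encoded by their
  graphs, the subobjects of \<open>cod m \<oplus> E\<close> that contain the graph
  \<open>\<gamma>\<close> of \<open>f\<close> and meet the summand \<open>E\<close>, which is
  \<open>kr p\<close>, trivially. Zorn's lemma gives a maximal one, and the criterion enlarges it if
  its domain of definition is not all of \<open>cod m\<close>.\<close>

lemma baer_injective:
 assumes E: "obj E" and baer: "baer E"
 shows "inject E"
proof (rule is_injectiveI[OF E])
 fix m f assume m: "mono m" and f: "arr f" "dom f = dom m" "cod f = E"
 have ma: "arr m" using m by simp
 let ?Y = "cod m"
 have Y: "obj ?Y" using ma by simp
 obtain B i j p q where B: "is_biproduct A ?Y E B i j p q" using ex_bip[OF Y E] by blast
 note b = bip_facts[OF B Y E]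
 define \<gamma> where "\<gamma> = i*m++j*f"
 have \<gamma>: "\<gamma> : Arr A" "dom \<gamma> = dom m" "cod \<gamma> = B" using b(1-13) ma f by (auto simp: \<gamma>_def)
 have p\<gamma>: "p*\<gamma> = m" "q*\<gamma> = f" using b ma f by (simp_all add: \<gamma>_def Cmp_Add)
 have "mono (p*\<gamma>)" using p\<gamma> m by simp
 hence \<gamma>m: "mono \<gamma>" by (rule mono_right) (use \<gamma> b(1-13) in auto)
 have pk: "kr p : Sub B" using kr_Sub[OF b(8)] b by simp
 let ?Z = "{S : Sub B. \<gamma> : S & kr p Int S <= zr B}"
 have "kr p Int sv \<gamma> <= zr B"
 proof
  fix z assume z: "z : kr p Int sv \<gamma>"
  then obtain h where h: "arr h" "cod h = dom \<gamma>" "z = \<gamma>*h" by (auto elim: svE)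
  have "nul (p*(\<gamma>*h))" using z h by simp
  hence "nul ((p*\<gamma>)*h)" using h \<gamma> b(1-13) by simp
  hence "nul (m*h)" unfolding p\<gamma> .
  hence "nul h" by (rule mono_nul[OF m]) (use h \<gamma> in auto)
  thus "z : zr B" using h \<gamma> by simp
 qed
 hence Z0: "sv \<gamma> : ?Z" using sv_Sub[OF \<gamma>m] sv_self[OF \<gamma>(1)] \<gamma> by simp
 obtain S where SZ: "S : ?Z" and max: "!!S'. S' : ?Z ==> S <= S' ==> S' = S"
 proof (rule zorn_Sub[OF _ Z0 b(1)])
  fix CC assume C: "CC <= ?Z" "CC ~= {}" and d: "!!S S'. S : CC ==> S' : CC ==> EX S'':CC. S <= S'' & S' <= S''"
  have C': "CC <= Sub B" using C by blast
  note Su = SupS[OF C' b(1)]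
  have "kr p Int SupS B CC <= zr B" by (rule AB5[OF C' C(2) b(1) d pk]) (use C in auto)
  moreover obtain S where "S : CC" using C by blast
  hence "\<gamma> : SupS B CC" using Su(2)[of S] C by blast
  ultimately show "SupS B CC : ?Z" using Su by simp
 qed auto
 have S: "S : Sub B" "\<gamma> : S" "kr p Int S <= zr B" using SZ by auto
 note s = inc[OF S(1)]
 define u where "u = p*inc S"
 have u: "arr u" "dom u = dom (inc S)" "cod u = ?Y" using s b(1-13) by (auto simp: u_def)
 have um: "mono u" unfolding mono_iff
 proof (intro conjI ballI impI u)
  fix x assume x: "arr x" "cod x = dom u" "nul (u*x)"
  have "inc S*x : S" by (rule inc_Cmp_mem[OF S(1)]) (use x u in auto)
  moreover have "inc S*x : kr p" using x u s b(1-13) by (simp add: u_def)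
  ultimately have "nul (inc S*x)" using S(3) by auto
  thus "nul x" by (rule mono_nul[OF s(1)]) (use x u in auto)
 qed
 have "el ?Y <= sv u"
 proof (rule ccontr)
  have P: "sv u : Sub ?Y" using sv_Sub[OF um] u by simp
  assume "~ el ?Y <= sv u"
  then obtain y where y: "y : el ?Y" "dom y : \<G>" "y ~: sv u" using gen_sub[OF gen_G el_Sub[OF Y] P] by blast
  have ya: "arr y" "cod y = ?Y" using y by auto
  let ?G = "dom y"
  have R: "pre y (sv u) : Sub ?G" using pre_Sub[OF ya(1)] P ya by simp
  define R where "R = pre y (sv u)"
  note r = inc[OF R[folded R_def]]
  have "inc R : pre y (sv u)" using Sub_inc[OF R[folded R_def]] by (simp add: R_def)
  hence "y*inc R : sv u" by simp
  then obtain x where x: "arr x" "cod x = dom u" "y*inc R = u*x" by (rule svE)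
  have dx: "dom x = dom (inc R)" using arg_cong[OF x(3), of "dom"] x(1,2) u r ya by simp
  have sx: "arr (inc S*x)" "dom (inc S*x) = dom (inc R)" "cod (inc S*x) = B" using x(1,2) dx s u by auto
  have "q*(inc S*x) : hom (dom (inc R)) E" using sx b(1-13) by simp
  then obtain g where g: "g : hom ?G E" "g*inc R = q*(inc S*x)"
   using baer y(2) R[folded R_def] unfolding baer_def by blast
  have ga: "arr g" "dom g = ?G" "cod g = E" using g by auto
  \<comment> \<open>The graph of the extension \<open>g\<close> over the generator. It agrees with
    \<open>S\<close> on \<open>R\<close>, the part of the generator that \<open>y\<close> sends into
    the domain already reached, so adding it to \<open>S\<close> keeps the intersection with
    \<open>kr p\<close> zero.\<close>
  define w where "w = i*y++j*g"
  have w: "arr w" "dom w = ?G" "cod w = B" using b(1-13) ya ga by (auto simp: w_def)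
  have pw: "p*w = y" "q*w = g" using b ya ga by (simp_all add: w_def Cmp_Add)
  have wr: "w*inc R = inc S*x"
  proof -
   have "i*(p*(inc S*x))++j*(q*(inc S*x)) = inc S*x" by (rule bip_decomp[OF B Y E sx(1,3)])
   moreover have "p*(inc S*x) = y*inc R" unfolding x(3) u_def using x(1,2) u s b(1-13) by simp
   moreover have "w*inc R = i*(y*inc R)++j*(g*inc R)" using b(1-13) ya ga r by (simp add: w_def Add_Cmp)
   ultimately show ?thesis using g(2) by simp
  qed
  let ?W = "img w (el ?G)"
  have G: "obj ?G" using ya by simp
  have elG: "el ?G : Sub (dom w)" using el_Sub[OF G] w by simp
  have W: "?W : Sub B" using img_Sub[OF w(1) elG] w by simp
  note SW = sm_Sub[OF S(1) W]
  have "kr p Int sm S ?W <= zr B"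
  proof
   fix z assume z: "z : kr p Int sm S ?W"
   hence za: "arr z" "cod z = B" "nul (p*z)" using b by auto
   from z obtain e a c where e: "epi e" "arr e" "cod e = dom z" "a : S" "c : ?W" "dom a = dom e" "dom c = dom e" "z*e = a++c"
    by (auto elim: smE)
   from e(5) obtain e2 t where t: "epi e2" "arr e2" "cod e2 = dom c" "t : el ?G" "dom t = dom e2" "c*e2 = w*t" "arr c" "cod c = cod w"
    by (rule imgE)
   have ta: "arr t" "cod t = ?G" using t by auto
   have aa: "arr a" "cod a = B" using Sub_el[OF S(1) e(4)] by auto
   have e2d: "cod e2 = dom e" using t e by simp
   have ae: "a*e2 : S" by (rule Sub_Cmp[OF S(1) e(4)]) (use t e in auto)
   have eq: "(z*e)*e2 = a*e2++w*t" unfolding e(8) t(6)[symmetric]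
    by (rule Add_Cmp) (use aa t e w in auto)
   have "nul (p*((z*e)*e2))" using za e(1-3) t(1,2) e2d b(1-13) by simp
   hence "nul (p*(a*e2)++y*t)" unfolding eq
    using Cmp_Add[of "a*e2" "w*t" p] aa t(2,5) e(6) e2d ta w b(1-13) pw(1) Cmp_assoc_simp[of t w p] by simp
   hence "y*t = neg (p*(a*e2))"
    using nul_dif[of "y*t" "neg (p*(a*e2))"] Add_commute[of "y*t" "p*(a*e2)"]
     aa t(2,5) e(6) e2d ta ya b(1-13) by simp
   moreover have "p*(a*e2) : sv u"
   proof -
    obtain h where h: "arr h" "dom h = dom (a*e2)" "cod h = dom (inc S)" "inc S*h = a*e2"
     by (rule inc_lift[OF S(1) ae])
    have "p*(a*e2) = u*h" unfolding h(4)[symmetric] using h(1,3) s b(1-13) by (simp add: u_def)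
    thus ?thesis using svI[of h u] h(1,3) u by simp
   qed
   ultimately have "y*t : sv u" using Sub_Neg[OF P] by simp
   hence "t : R" using ta by (simp add: R_def)
   then obtain t' where t': "arr t'" "dom t' = dom t" "cod t' = dom (inc R)" "inc R*t' = t" by (rule inc_lift[OF R[folded R_def]])
   have "w*t = inc S*(x*t')"
    using Cmp_reassoc[OF wr, of t'] t' w r s x(1,2) u dx by simp
   hence "w*t : S" using inc_Cmp_mem[OF S(1), of "x*t'"] t' x(1,2) u dx by simp
   hence "a*e2++w*t : S" by (intro Sub_Add[OF S(1) ae]) (use aa t(2,5) e(6) e2d ta w in auto)
   hence "(z*e)*e2 : S" unfolding eq .
   moreover have "(z*e)*e2 : kr p" using za e(1-3) t(1,2) e2d b(1-13) by simp
   ultimately have "nul ((z*e)*e2)" using S(3) by auto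
   hence "nul (z*e)" by (rule epi_nul[OF t(1)]) (use za e(1-3) e2d in auto)
   hence "nul z" by (rule epi_nul[OF e(1)]) (use za e(1-3) in auto)
   thus "z : zr B" using za by simp
  qed
  hence "sm S ?W : ?Z" using SW S(2) by auto
  hence "sm S ?W = S" using max SW(2) by blast
  moreover have "w : ?W" using img_mem[OF w(1) elG, of "idt ?G"] G w by simp
  ultimately have "w : S" using SW(3) by blast
  then obtain h where h: "arr h" "dom h = dom w" "cod h = dom (inc S)" "inc S*h = w" by (rule inc_lift[OF S(1)])
  have "y = u*h" unfolding pw(1)[symmetric] h(4)[symmetric] using h(1,3) s b(1-13) by (simp add: u_def)
  thus False using y(3) svI[of h u] h u by simp
 qed
 \<comment> \<open>The projection of the maximal graph to \<open>cod m\<close> is an isomorphism, so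
   the graph is that of an everywhere defined arrow, \<open>q*(inc S*v)\<close>.\<close>
 hence "is_iso A u" using sv_el_epi[OF um] u by simp
 then obtain v where v: "arr v" "dom v = ?Y" "cod v = dom (inc S)" "v*u = idt (dom (inc S))" using u by (auto elim: is_isoE)
 obtain h where h: "arr h" "dom h = dom \<gamma>" "cod h = dom (inc S)" "inc S*h = \<gamma>" by (rule inc_lift[OF S(1,2)])
 have mu: "m = u*h" unfolding p\<gamma>(1)[symmetric] h(4)[symmetric] using h(1,3) s b(1-13) by (simp add: u_def)
 have "v*(u*h) = (v*u)*h" by (rule Cmp_assoc_simp[symmetric]) (use v(1-3) u h(1,3) in auto)
 hence "v*m = h" unfolding v(4) mu[symmetric] using h(1,3) by simp
 hence "(q*(inc S*v))*m = q*(inc S*h)" using v(1-3) ma s b(1-13) by simp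
 hence "(q*(inc S*v))*m = f" using h p\<gamma> by simp
 thus "EX g. arr g & dom g = cod m & cod g = E & g*m = f"
  using v(1-3) s b(1-13) by (intro exI[of _ "q*(inc S*v)"]) simp
qed

text \<open>By Baer's criterion it suffices to consider arrows from subobjects of generators. These
  are noetherian, so such an arrow lands in one member of the family and extends there.\<close>

lemma injective_chain:
 assumes C: "CC <= Sub X" "CC ~= {}" and X: "obj X"
  and dir: "!!S S'. S : CC ==> S' : CC ==> EX S'' : CC. S <= S'' & S' <= S''"
  and inj: "!!S. S : CC ==> inject (dom (inc S))"
 shows "inject (dom (inc (SupS X CC)))"
proof -
 define U where "U = SupS X CC"
 have U: "U : Sub X" "!!S. S : CC ==> S <= U" unfolding U_def using SupS[OF C(1) X] by auto
 note u = inc[OF U(1)]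
 have "inject (dom (inc U))"
 proof (rule baer_injective[OF u(5)], unfold baer_def, intro ballI)
  fix G R f assume G: "G : \<G>" and R: "R : Sub G" and f: "f : hom (dom (inc R)) (dom (inc U))"
  note r = inc[OF R]
  have "inc U*f : U" by (rule inc_Cmp_mem[OF U(1)]) (use f in auto)
  moreover have "noeth (dom (inc U*f))" using noeth_mono[OF noeth_G[OF G] r(1,3)] f u by simp
  ultimately obtain S where S: "S : CC" "inc U*f : S" using noeth_dir[OF C X dir] unfolding U_def by blast
  have SS: "S : Sub X" using S C by blast
  note s = inc[OF SS]
  obtain h where h: "arr h" "dom h = dom (inc U*f)" "cod h = dom (inc S)" "inc S*h = inc U*f" by (rule inc_lift[OF SS S(2)])
  obtain g where g: "arr g" "dom g = G" "cod g = dom (inc S)" "g*inc R = h"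
   by (rule is_injectiveD[OF inj[OF S(1)] r(1), of h]) (use h(1-3) f u r in auto)
  have "inc S*g : U" using U(2)[OF S(1)] inc_Cmp_mem[OF SS g(1,3)] by blast
  then obtain k where k: "arr k" "dom k = dom (inc S*g)" "cod k = dom (inc U)" "inc U*k = inc S*g" by (rule inc_lift[OF U(1)])
  have "inc U*(k*inc R) = inc S*(g*inc R)" by (rule Cmp_reassoc[OF k(4)]) (use k(1-3) g(1-3) s r u in auto)
  hence "inc U*(k*inc R) = inc U*f" using g h by simp
  hence "k*inc R = f" by (rule mono_cancel[OF u(1)]) (use k(1-3) g(1-3) s r u f in auto)
  thus "EX g:hom G (dom (inc U)). g*inc R = f" using k g s by (intro bexI[of _ k]) auto
 qed
 thus ?thesis by (simp add: U_def)
qed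

text \<open>All extension problems into \<open>M\<close> are solved at once by a pushout:
  \<open>M\<close> plus the coproduct of one generator for each problem, modulo the relations
  identifying the two images of the subobject \<open>R\<close>. The relations meet \<open>M\<close>
  trivially, by induction for finitely many problems and by \<open>AB5\<close> in general.\<close>

lemma one_step:
 assumes M: "obj M"
 shows "EX a. mono a & dom a = M &
  (ALL G : \<G>. ALL R : Sub G. ALL f : hom (dom (inc R)) M. EX g : hom G (cod a). g*inc R = a*f)"
proof -
 define I where "I = (SIGMA G:\<G>. SIGMA R:Sub G. hom (dom (inc R)) M)"
 have GO: "obj G" if "G : \<G>" for G using gen_G that unfolding is_generating_set_def by blast
 have hs: "small \<kappa> (hom X Y)" if "obj X" "obj Y" for X Y using groth that unfolding grothendieck_category_def by blast
 have smI: "small \<kappa> I" unfolding I_def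
  by (intro small_Sigma[OF univ] small_G small_Sub hs GO M inc(5)) auto
 have I: "fst k : \<G>" "fst (snd k) : Sub (fst k)" "arr (snd (snd k))" "dom (snd (snd k)) = dom (inc (fst (snd k)))" "cod (snd (snd k)) = M"
  if "k : I" for k using that unfolding I_def by auto
 obtain P io where P: "is_coproduct A I fst P io" using coproduct[OF smI, of fst] GO I(1) by blast
 note c = coproduct_facts[OF P]
 obtain B i j p q where B: "is_biproduct A M P B i j p q" using ex_bip[OF M c(1)] by blast
 note b = bip_facts[OF B M c(1)]
 define r where "r k = inc (fst (snd k))" for k :: "'o \<times> 'm set \<times> 'm"
 have r: "mono (r k)" "arr (r k)" "cod (r k) = fst k" "obj (dom (r k))" if "k : I" for k
  using inc[OF I(2)[OF that]] by (auto simp: r_def)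
 define \<delta> where "\<delta> k = neg (i*snd (snd k))++j*(io k*r k)" for k
 have \<delta>: "arr (\<delta> k)" "dom (\<delta> k) = dom (r k)" "cod (\<delta> k) = B" "q*\<delta> k = io k*r k" if k: "k : I" for k
  using I(3-5)[OF k] r(2-4)[OF k] c(2-4)[OF k] c(1) b by (simp_all add: \<delta>_def r_def Cmp_Add)
 define K where "K k = img (\<delta> k) (el (dom (r k)))" for k
 have elk: "el (dom (r k)) : Sub (dom (\<delta> k))" if "k : I" for k using el_Sub[OF r(4)[OF that]] \<delta>(2)[OF that] by simp
 have K: "K k : Sub B" if "k : I" for k using img_Sub[OF \<delta>(1)[OF that] elk[OF that]] \<delta>(3)[OF that] by (simp add: K_def)
 define KF where "KF F = SupS B (K ` F)" for F
 have KF: "KF F : Sub B" "!!k. k : F ==> K k <= KF F" "!!T. T : Sub B ==> (!!k. k : F ==> K k <= T) ==> KF F <= T" if "F <= I" for F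
 proof -
  have s: "K ` F <= Sub B" using K that by blast
  note Su = SupS[OF s b(1)]
  show "KF F : Sub B" using Su(1) by (simp add: KF_def)
  show "!!k. k : F ==> K k <= KF F" using Su(2) by (simp add: KF_def)
  show "!!T. T : Sub B ==> (!!k. k : F ==> K k <= T) ==> KF F <= T" unfolding KF_def by (rule Su(3)) auto
 qed
 have KFm: "KF F <= KF F'" if FF: "F <= F'" "F' <= I" for F F'
 proof (rule KF(3))
  show "F <= I" using FF by (rule order_trans)
  show "KF F' : Sub B" by (rule KF(1)[OF FF(2)])
  fix k assume "k : F" thus "K k <= KF F'" using KF(2)[OF FF(2), of k] FF(1) by blast
 qed
 have qS: "kr q : Sub B" using kr_Sub[OF b(11)] b by simp
 have fin: "kr q Int KF F <= zr B" if "finite F" "F <= I" for F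
  using that
 proof (induction F rule: finite_induct)
  case empty
  have "KF {} <= zr B" by (rule KF(3)) (use zr_Sub[OF b(1)] in auto)
  thus ?case by blast
 next
  case (insert k F)
  have kI: "k : I" and FI: "F <= I" and IH: "kr q Int KF F <= zr B" using insert by auto
  note FF = KF(1)[OF FI] and Kk = K[OF kI]
  have Gk: "obj (fst k)" using GO I(1)[OF kI] by blast
  \<comment> \<open>The projection \<open>\<rho>\<close> of the coproduct to the summand
    \<open>k\<close> kills the relations of the other problems and is the monomorphism
    \<open>r k\<close> on the relation of \<open>k\<close>, so the coefficient of the new relation
    vanishes.\<close>
  let ?t = "%l. if l = k then idt (fst k) else zer (fst l) (fst k)"
  have "EX \<rho>. arr \<rho> & dom \<rho> = P & cod \<rho> = fst k & (ALL l : I. \<rho>*io l = ?t l)"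
  proof (rule c(5)[OF Gk])
   fix l assume "l : I"
   hence "obj (fst l)" using GO I(1) by blast
   thus "?t l : hom (fst l) (fst k)" using Gk by simp
  qed
  then obtain \<rho> where \<rho>: "arr \<rho>" "dom \<rho> = P" "cod \<rho> = fst k" "ALL l : I. \<rho>*io l = ?t l"
   by blast
  have \<rho>q: "arr (\<rho>*q)" "dom (\<rho>*q) = B" using \<rho> b by auto
  have sub: "KF F <= kr (\<rho>*q)"
  proof (rule KF(3)[OF FI])
   show kS: "kr (\<rho>*q) : Sub B" using kr_Sub[OF \<rho>q(1)] \<rho>q by simp
   fix l assume l: "l : F"
   hence lI: "l : I" and lk: "l ~= k" using FI insert by auto
   have e: "(\<rho>*q)*\<delta> l = (\<rho>*io l)*r l" using \<rho>(1-3) b(1-13) \<delta>[OF lI] c(2-4)[OF lI] r(2,3)[OF lI] by simp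
   have "nul ((\<rho>*q)*\<delta> l)" unfolding e using \<rho>(4) lI lk r(2,3)[OF lI] Gk r(4)[OF lI] by simp
   hence "el (dom (r l)) <= pre (\<delta> l) (kr (\<rho>*q))" using \<delta>[OF lI] \<rho>q by auto
   thus "K l <= kr (\<rho>*q)" unfolding K_def
    using img_subset[OF \<delta>(1)[OF lI] elk[OF lI], of "kr (\<rho>*q)"] kS \<delta>(3)[OF lI] by simp
  qed
  have "KF (insert k F) <= sm (KF F) (K k)"
  proof (rule KF(3))
   show "insert k F <= I" using kI FI by simp
   show "sm (KF F) (K k) : Sub B" by (rule sm_Sub[OF FF Kk])
   fix l assume "l : insert k F"
   thus "K l <= sm (KF F) (K k)" using sm_Sub(2,3)[OF FF Kk] KF(2)[OF FI, of l] by blast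
  qed
  moreover have "kr q Int sm (KF F) (K k) <= zr B"
  proof
   fix z assume z: "z : kr q Int sm (KF F) (K k)"
   hence za: "arr z" "cod z = B" "nul (q*z)" using b by auto
   from z obtain e a d where e: "epi e" "arr e" "cod e = dom z" "a : KF F" "d : K k" "dom a = dom e" "dom d = dom e" "z*e = a++d"
    by (auto elim: smE)
   from e(5)[unfolded K_def] obtain e2 t where t: "epi e2" "arr e2" "cod e2 = dom d" "t : el (dom (r k))" "dom t = dom e2" "d*e2 = \<delta> k*t" "arr d" "cod d = cod (\<delta> k)"
    by (rule imgE)
   have ta: "arr t" "cod t = dom (r k)" using t by auto
   have aa: "arr a" "cod a = B" using Sub_el[OF FF e(4)] by auto
   have e2d: "cod e2 = dom e" using t e by simp
   have ae: "a*e2 : KF F" by (rule Sub_Cmp[OF FF e(4)]) (use t e in auto)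
   have eq: "(z*e)*e2 = a*e2++\<delta> k*t" unfolding e(8) t(6)[symmetric]
    by (rule Add_Cmp) (use aa t e \<delta>[OF kI] in auto)
   have "a*e2 : kr (\<rho>*q)" using ae sub by blast
   hence n1: "nul ((\<rho>*q)*(a*e2))" by simp
   have "nul ((\<rho>*q)*((z*e)*e2))" using za e(1-3) t(1,2) e2d b(1-13) \<rho>(1-3) by simp
   moreover have "(\<rho>*q)*((z*e)*e2) = (\<rho>*q)*(a*e2)++(\<rho>*q)*(\<delta> k*t)" unfolding eq
    by (rule Cmp_Add) (use aa t(2,5) e2d e(6) ta \<delta>[OF kI] \<rho>q in auto)
   ultimately have "nul ((\<rho>*q)*(\<delta> k*t))"
    using nul_Add[OF n1, of "(\<rho>*q)*(\<delta> k*t)"] aa t(2,5) e2d e(6) ta \<delta>[OF kI] \<rho>q by simp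
   moreover have "(\<rho>*q)*(\<delta> k*t) = (\<rho>*(q*\<delta> k))*t" using \<rho>(1-3) b(1-13) \<delta>(1-3)[OF kI] ta by simp
   moreover have "\<rho>*(q*\<delta> k) = (\<rho>*io k)*r k" using \<delta>(4)[OF kI] \<rho>(1-3) c(2-4)[OF kI] r(2,3)[OF kI] by simp
   moreover have "... = r k" using \<rho>(4) kI r(2,3)[OF kI] by simp
   ultimately have "nul (r k*t)" by simp
   hence "nul t" by (rule mono_nul[OF r(1)[OF kI]]) (use ta in auto)
   hence "nul (\<delta> k*t)" using ta \<delta>[OF kI] by simp
   hence "(z*e)*e2 = a*e2" unfolding eq
    by (rule nul_Add_right) (use aa t(2,5) e2d e(6) ta \<delta>[OF kI] in auto)
   moreover have "(z*e)*e2 : kr q" using za e(1-3) t(1,2) e2d b(1-13) by simp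
   ultimately have "(z*e)*e2 : kr q Int KF F" using ae by simp
   hence "nul ((z*e)*e2)" using IH by auto
   hence "nul (z*e)" by (rule epi_nul[OF t(1)]) (use za e(1-3) e2d in auto)
   hence "nul z" by (rule epi_nul[OF e(1)]) (use za e(1-3) in auto)
   thus "z : zr B" using za by simp
  qed
  ultimately show ?case by blast
 qed
 let ?D = "KF ` {F. finite F & F <= I}"
 have D: "?D <= Sub B" using KF(1) by auto
 have De: "?D ~= {}" by auto
 have Dd: "EX S'' : ?D. S <= S'' & S' <= S''" if SS: "S : ?D" "S' : ?D" for S S'
 proof -
  obtain F F' where F: "finite F" "F <= I" "S = KF F" "finite F'" "F' <= I" "S' = KF F'" using SS by auto
  thus ?thesis using KFm[of F "F Un F'"] KFm[of F' "F Un F'"] by (intro bexI[of _ "KF (F Un F')"]) auto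
 qed
 define T where "T = SupS B ?D"
 note Su = SupS[OF D b(1), folded T_def]
 have qT: "kr q Int T <= zr B" unfolding T_def
  by (rule AB5[OF D De b(1) Dd qS]) (use fin in auto)
 note qt = qt[OF Su(1)]
 define a where "a = qt T*i"
 have a: "arr a" "dom a = M" "cod a = cod (qt T)" using qt b by (auto simp: a_def)
 have am: "mono a" unfolding mono_iff
 proof (intro conjI ballI impI a)
  fix x assume x: "arr x" "cod x = dom a" "nul (a*x)"
  have "i*x : T" unfolding qt_mem[OF Su(1)] using x a b(1-13) qt by (simp add: a_def)
  moreover have "i*x : kr q" using x a b c(1) by simp
  ultimately have "i*x : zr B" using qT by blast
  hence "nul (p*(i*x))" using x a b(1-13) by simp
  thus "nul x" using b(18)[of x] x a by simp
 qed
 have "EX g : hom G (cod a). g*inc R = a*f" if G: "G : \<G>" "R : Sub G" "f : hom (dom (inc R)) M" for G R f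
 proof -
  let ?k = "(G, R, f)"
  have k: "?k : I" using G by (simp add: I_def)
  have fa: "arr f" "dom f = dom (inc R)" "cod f = M" using G by auto
  have rk: "r ?k = inc R" by (simp add: r_def)
  have "\<delta> ?k*idt (dom (r ?k)) : K ?k" unfolding K_def
   by (rule img_mem[OF \<delta>(1)[OF k] elk[OF k]]) (use r[OF k] in auto)
  hence "\<delta> ?k : K ?k" using \<delta>[OF k] by simp
  moreover have "K ?k <= KF {?k}" using KF(2)[of "{?k}"] k by simp
  moreover have "KF {?k} <= T" by (rule Su(2)) (use k in auto)
  ultimately have "\<delta> ?k : T" by blast
  hence "nul (qt T*\<delta> ?k)" unfolding qt_mem[OF Su(1)] by simp
  moreover have "qt T*\<delta> ?k = neg (a*f)++(qt T*(j*io ?k))*inc R"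
   using qt b(1-13) fa c(2-4)[OF k] r(2,3)[OF k] rk by (simp add: \<delta>_def a_def Cmp_Add)
  ultimately have "nul ((qt T*(j*io ?k))*inc R++neg (a*f))"
   using Add_commute[of "neg (a*f)" "(qt T*(j*io ?k))*inc R"] qt b(1-13) fa c(2-4)[OF k] r(2,3)[OF k] rk a by simp
  hence "(qt T*(j*io ?k))*inc R = a*f"
   using nul_dif[of "(qt T*(j*io ?k))*inc R" "a*f"] qt b(1-13) fa c(2-4)[OF k] r(2,3)[OF k] rk a by simp
  thus ?thesis using qt b(1-13) c(2-4)[OF k] a by (intro bexI[of _ "qt T*(j*io ?k)"]) auto
 qed
 thus ?thesis using am a by blast
qed

text \<open>Countably many steps suffice: a subobject of a noetherian generator maps into the
  colimit through some stage \<open>X n\<close>, and its arrow extends at stage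
  \<open>n + 1\<close>. The colimit is realized as the coproduct of the stages modulo the relations
  \<open>d n\<close>.\<close>

lemma enough_injectives:
 assumes M: "obj M"
 shows "EX a. mono a & dom a = M & inject (cod a)"
proof -
 define st where "st M = (SOME a. mono a & dom a = M &
  (ALL G : \<G>. ALL R : Sub G. ALL f : hom (dom (inc R)) M. EX g : hom G (cod a). g*inc R = a*f))" for M
 have st: "mono (st M) & dom (st M) = M &
  (ALL G : \<G>. ALL R : Sub G. ALL f : hom (dom (inc R)) M. EX g : hom G (cod (st M)). g*inc R = st M*f)"
  if "obj M" for M unfolding st_def by (rule someI_ex) (rule one_step[OF that])
 define X where "X = rec_nat M (%_ N. cod (st N))"
 have X0: "X 0 = M" and XS: "X (Suc n) = cod (st (X n))" for n by (simp_all add: X_def)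
 have X: "obj (X n)" for n by (induction n) (use M st X0 XS in auto)
 define m where "m n = st (X n)" for n
 have m: "mono (m n)" "arr (m n)" "dom (m n) = X n" "cod (m n) = X (Suc n)" for n
  using st[OF X] XS by (auto simp: m_def)
 obtain P io where P: "is_coproduct A (UNIV :: nat set) X P io" using coproduct[OF small_nat[OF univ], of X] X by blast
 note c = coproduct_facts[OF P, simplified]
 define d where "d n = io n++neg (io (Suc n)*m n)" for n
 have d: "arr (d n)" "dom (d n) = X n" "cod (d n) = P" for n using c(2-4) m by (auto simp: d_def)
 have elX: "el (X n) : Sub (dom (d n))" "el (X n) : Sub (dom (io n))" for n using el_Sub[OF X] d c by auto
 define D where "D n = img (d n) (el (X n))" for n
 have D: "D n : Sub P" for n using img_Sub[OF d(1) elX(1)] d(3) by (simp add: D_def)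
 define K where "K n = SupS P (D ` {..<n})" for n
 have Ks: "D ` {..<n} <= Sub P" for n using D by blast
 note KS = SupS[OF Ks c(1), folded K_def]
 have Km: "K k <= K n" if "k <= n" for k n
 proof (rule KS(3)[OF KS(1)])
  fix S assume "S : D ` {..<k}"
  hence "S : D ` {..<n}" using that by auto
  thus "S <= K n" by (rule KS(2))
 qed
 have KR: "range K <= Sub P" "range K ~= {}" using KS(1) by auto
 have Kd: "EX S'':range K. S <= S'' & S' <= S''" if SS: "S : range K" "S' : range K" for S S'
 proof -
  obtain k n where "S = K k" "S' = K n" using SS by auto
  thus ?thesis using Km[of k "max k n"] Km[of n "max k n"] by auto
 qed
 define T where "T = SupS P (range K)"
 note T = SupS[OF KR(1) c(1), folded T_def]
 note q = qt[OF T(1)]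
 define E where "E = cod (qt T)"
 define a where "a n = qt T*io n" for n
 have a: "arr (a n)" "dom (a n) = X n" "cod (a n) = E" for n using q c(2-4) by (auto simp: a_def E_def)
 have E: "obj E" using q by (simp add: E_def)
 have dT: "d n : T" for n
 proof -
  have "d n*idt (X n) : D n" unfolding D_def by (rule img_mem[OF d(1) elX(1)]) (use X in auto)
  hence "d n : D n" using d by simp
  thus ?thesis using KS(2)[of "D n" "Suc n"] T(2)[of "K (Suc n)"] by auto
 qed
 have am: "a (Suc n)*m n = a n" for n
 proof -
  have "nul (qt T*d n)" using dT[of n] unfolding qt_mem[OF T(1)] by simp
  moreover have "qt T*d n = a n++neg (a (Suc n)*m n)" using q c(2-4) m by (simp add: d_def a_def Cmp_Add)
  ultimately show ?thesis using nul_dif[of "a n" "a (Suc n)*m n"] a m by simp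
 qed
 define cm where "cm k = rec_nat (idt (X k)) (%j f. m (k + j)*f)" for k
 have cm0: "cm k 0 = idt (X k)" and cmS: "cm k (Suc j) = m (k + j)* cm k j" for k j by (simp_all add: cm_def)
 have cm: "mono (cm k j) & dom (cm k j) = X k & cod (cm k j) = X (k + j)" for k j
  by (induction j) (use X m in "auto simp: cm0 cmS")
 have cmA: "arr (cm k j)" for k j using cm by auto
 have cms: "cm k (Suc j) = cm (Suc k) j*m k" for k j
 proof (induction j)
  case 0 thus ?case using m X by (simp add: cm0 cmS)
 next
  case (Suc j)
  have "cm k (Suc (Suc j)) = m (k + Suc j)* cm k (Suc j)" by (rule cmS)
  also have "... = m (Suc k + j)*(cm (Suc k) j*m k)" using Suc by simp
  also have "... = (m (Suc k + j)* cm (Suc k) j)*m k" using m cm cmA by simp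
  finally show ?case by (simp only: cmS)
 qed
 \<comment> \<open>The transition maps assemble to an arrow from the coproduct to stage
   \<open>N\<close>; it kills the relations \<open>d k\<close> with \<open>k < N\<close> and is mono
   on the stages up to \<open>N\<close>. This shows that a stage meets the finite sums of relations
   trivially.\<close>
 have ret: "EX r. arr r & dom r = P & (ALL k <= N. r*io k = cm k (N - k))" for N
 proof -
  have "EX h. arr h & dom h = P & cod h = X N & (ALL i. h*io i = (if i <= N then cm i (N - i) else zer (X i) (X N)))"
  proof (rule c(5)[OF X])
   fix i show "arr (if i <= N then cm i (N - i) else zer (X i) (X N)) &
     dom (if i <= N then cm i (N - i) else zer (X i) (X N)) = X i &
     cod (if i <= N then cm i (N - i) else zer (X i) (X N)) = X N"
    using cm[of i "N - i"] cmA X by simp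
  qed
  then obtain h where "arr h" "dom h = P" "ALL i. h*io i = (if i <= N then cm i (N - i) else zer (X i) (X N))" by blast
  thus ?thesis by (intro exI[of _ h]) simp
 qed
 have disj: "img (io n) (el (X n)) Int K l <= zr P" for n l
 proof
  fix z assume z: "z : img (io n) (el (X n)) Int K l"
  define N where "N = max n l"
  obtain r where r: "arr r" "dom r = P" "!!k. k <= N ==> r*io k = cm k (N - k)" using ret[of N] by blast
  have kS: "kr r : Sub P" using kr_Sub[OF r(1)] r by simp
  have "K l <= kr r"
  proof (rule KS(3)[OF kS])
   fix S assume "S : D ` {..<l}"
   then obtain k where k: "k < l" "S = D k" by auto
   hence kN: "k < N" by (simp add: N_def)
   have "Suc (N - Suc k) = N - k" using kN by simp
   hence e: "r*io k = (r*io (Suc k))*m k" using r(3)[of k] r(3)[of "Suc k"] kN cms[of k "N - Suc k"] by simp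
   have "r*d k = r*io k++neg (r*(io (Suc k)*m k))" using r(1,2) c(2-4) m by (simp add: d_def Cmp_Add)
   also have "r*(io (Suc k)*m k) = r*io k" unfolding e using r(1,2) c(2-4) m by simp
   finally have "nul (r*d k)" using r(1,2) c(2-4) X by simp
   hence "el (X k) <= pre (d k) (kr r)" using d[of k] r(1,2) by auto
   thus "S <= kr r" unfolding k D_def using img_subset[OF d(1)[of k] elX(1)[of k], of "kr r"] kS d(3) by simp
  qed
  hence "nul (r*z)" "arr z" "cod z = P" using z r(2) by auto
  from z obtain e x where x: "epi e" "arr e" "cod e = dom z" "x : el (X n)" "dom x = dom e" "z*e = io n*x" "arr z" "cod z = cod (io n)"
   by (auto elim: imgE)
  have xa: "arr x" "cod x = X n" using x by auto
  have "nul (r*(z*e))" using \<open>nul (r*z)\<close> \<open>cod z = P\<close> x(1-3,7) r(1,2) by simp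
  hence "nul ((r*io n)*x)" unfolding x(6) using r(1,2) c(2-4) xa by simp
  hence "nul (cm n (N - n)*x)" using r(3)[of n] by (simp add: N_def)
  hence "nul x" by (rule mono_nul[rotated]) (use cm xa in auto)
  hence "nul (z*e)" unfolding x(6) using xa c(2-4) by simp
  hence "nul z" by (rule epi_nul[OF x(1)]) (use x in auto)
  thus "z : zr P" using \<open>arr z\<close> \<open>cod z = P\<close> by simp
 qed
 have mono_a: "mono (a n)" for n unfolding mono_iff
 proof (intro conjI ballI impI a)
  have ts: "img (io n) (el (X n)) : Sub P" using img_Sub[OF c(2) elX(2)] c(4) by simp
  have z: "img (io n) (el (X n)) Int T <= zr P" unfolding T_def
   by (rule AB5[OF KR c(1) Kd ts]) (use disj in auto)
  fix x assume x: "arr x" "cod x = dom (a n)" "nul (a n*x)"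
  have xX: "cod x = X n" using x a by simp
  have "io n*x : img (io n) (el (X n))" by (rule img_mem[OF c(2) elX(2)]) (use x xX in auto)
  moreover have "io n*x : T" unfolding qt_mem[OF T(1)] using x xX c(2-4) q by (simp add: a_def)
  ultimately have "io n*x : zr P" by (intro subsetD[OF z] IntI)
  hence "nul (io n*x)" by simp
  obtain r where r: "arr r" "dom r = P" "!!k. k <= n ==> r*io k = cm k (n - k)" using ret[of n] by blast
  have "nul (r*(io n*x))" using \<open>nul (io n*x)\<close> r(1,2) c(2-4) x(1) xX by simp
  hence "nul ((r*io n)*x)" using r(1,2) c(2-4) x(1) xX by simp
  thus "nul x" using r(3)[of n] x(1) xX by (simp add: cm0)
 qed
 have svm: "sv (a k) <= sv (a n)" if "k <= n" for k n
  using that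
 proof (induction n rule: dec_induct)
  case (step n)
  have "a n : sv (a (Suc n))" using svI[of "m n" "a (Suc n)"] am[of n] m a by simp
  hence "sv (a n) <= sv (a (Suc n))" using sv_le[OF sv_Sub[OF mono_a]] by blast
  thus ?case using step by blast
 qed simp
 let ?R = "range (%n. sv (a n))"
 have R: "?R <= Sub E" "?R ~= {}" using sv_Sub[OF mono_a] a(3) by auto
 have Rd: "EX S'':?R. S <= S'' & S' <= S''" if SS: "S : ?R" "S' : ?R" for S S'
 proof -
  obtain k n where "S = sv (a k)" "S' = sv (a n)" using SS by auto
  thus ?thesis using svm[of k "max k n"] svm[of n "max k n"] by auto
 qed
 note U = SupS[OF R(1) E]
 note qU = qt[OF U(1)]
 have top: "f : SupS E ?R" if f: "arr f" "cod f = E" for f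
 proof -
  have "nul (qt (SupS E ?R)*qt T)"
  proof (rule c(6))
   fix n
   have "a n : SupS E ?R" using U(2)[of "sv (a n)"] sv_self[OF a(1)] by blast
   hence "nul (qt (SupS E ?R)*a n)" unfolding qt_mem[OF U(1)] by simp
   thus "nul ((qt (SupS E ?R)*qt T)*io n)" using qU q c(2-4) by (simp add: a_def E_def)
  qed (use qU q in "auto simp: E_def")
  hence "nul (qt (SupS E ?R))" by (rule epi_nul[OF q(1)]) (use qU in "auto simp: E_def")
  thus ?thesis unfolding qt_mem[OF U(1)] using f qU by simp
 qed
 have "inject E"
 proof (rule baer_injective[OF E], unfold baer_def, intro ballI)
  fix G R f assume G: "G : \<G>" and Rs: "R : Sub G" and f: "f : hom (dom (inc R)) E"
  note r = inc[OF Rs]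
  have "f : SupS E ?R" using top f by simp
  moreover have "noeth (dom f)" using noeth_mono[OF noeth_G[OF G] r(1,3)] f by simp
  ultimately obtain n where "f : sv (a n)" using noeth_dir[OF R E Rd] by blast
  then obtain h where h: "arr h" "cod h = dom (a n)" "f = a n*h" by (rule svE)
  have dh: "dom h = dom (inc R)" using f h a by simp
  hence "h : hom (dom (inc R)) (X n)" using h a by simp
  then obtain g where g: "g : hom G (X (Suc n))" "g*inc R = m n*h" using st[OF X] G Rs unfolding m_def XS by blast
  have "(a (Suc n)*g)*inc R = a (Suc n)*(m n*h)" using g a r by simp
  also have "... = (a (Suc n)*m n)*h" using a m h by simp
  also have "... = f" unfolding am h(3) ..
  finally show "EX g:hom G E. g*inc R = f" using g a by (intro bexI[of _ "a (Suc n)*g"]) auto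
 qed
 thus ?thesis using mono_a[of 0] a[of 0] X0 by (intro exI[of _ "a 0"]) simp
qed

definition ess where "ess E M S <-> M <= S & (ALL T : Sub E. T <= S --> T Int M <= zr E --> T <= zr E)"

text \<open>A maximal essential extension of \<open>M\<close> inside the injective object \<open>E\<close> is a direct summand:
 modulo a maximal complement it stays essential, and the resulting map back to \<open>E\<close> is again an
 essential extension of \<open>M\<close>.\<close>

lemma ex_envelope:
 assumes E: "inject E" and M: "M : Sub E"
 shows "EX S : Sub E. ess E M S & inject (dom (inc S))"
proof -
 have EO: "obj E" using E by (rule is_injective_Obj)
 let ?Z = "{S : Sub E. ess E M S}"
 have Z0: "M : ?Z" using M by (auto simp: ess_def)
 obtain S where SZ: "S : ?Z" and max: "!!S'. S' : ?Z ==> S <= S' ==> S' = S"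
 proof (rule zorn_Sub[OF _ Z0 EO])
  fix CC assume C: "CC <= ?Z" "CC ~= {}" and d: "!!S S'. S : CC ==> S' : CC ==> EX S'':CC. S <= S'' & S' <= S''"
  have C': "CC <= Sub E" using C by blast
  note Su = SupS[OF C' EO]
  have "T <= zr E" if T: "T : Sub E" "T <= SupS E CC" "T Int M <= zr E" for T
  proof -
   have "T Int SupS E CC <= zr E"
   proof (rule AB5[OF C' C(2) EO d T(1)])
    fix S assume S: "S : CC"
    have "T Int S : Sub E" using Sub_inter[OF T(1)] S C' by blast
    moreover have "(T Int S) Int M <= zr E" using T(3) by blast
    ultimately show "T Int S <= zr E" using S C unfolding ess_def by blast
   qed
   thus ?thesis using T(2) by blast
  qed
  moreover obtain S where "S : CC" using C by blast
  hence "M <= SupS E CC" using Su(2)[of S] C unfolding ess_def by blast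
  ultimately show "SupS E CC : ?Z" using Su(1) unfolding ess_def by blast
 qed auto
 have S: "S : Sub E" "ess E M S" using SZ by auto
 note s = inc[OF S(1)]
 let ?Y = "{T : Sub E. T Int S <= zr E}"
 have Y0: "zr E : ?Y" using zr_Sub[OF EO] by auto
 obtain C where CY: "C : ?Y" and maxC: "!!T. T : ?Y ==> C <= T ==> T = C"
 proof (rule zorn_Sub[OF _ Y0 EO])
  fix CC assume C: "CC <= ?Y" "CC ~= {}" and d: "!!S S'. S : CC ==> S' : CC ==> EX S'':CC. S <= S'' & S' <= S''"
  have C': "CC <= Sub E" using C by blast
  have "S Int SupS E CC <= zr E" by (rule AB5[OF C' C(2) EO d S(1)]) (use C in auto)
  thus "SupS E CC : ?Y" using SupS(1)[OF C' EO] by blast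
 qed auto
 have C: "C : Sub E" "C Int S <= zr E" using CY by auto
 note q = qt[OF C(1)]
 have jm: "mono (qt C*inc S)" unfolding mono_iff
 proof (intro conjI ballI impI)
  fix x assume x: "arr x" "cod x = dom (qt C*inc S)" "nul ((qt C*inc S)*x)"
  have "inc S*x : S" by (rule inc_Cmp_mem[OF S(1)]) (use x s q in auto)
  moreover have "inc S*x : C" unfolding qt_mem[OF C(1)] using x s q(1-3) by simp
  ultimately have "nul (inc S*x)" using C(2) by auto
  thus "nul x" by (rule mono_nul[OF s(1)]) (use x s q in auto)
 qed (use s q in auto)
 obtain g where g: "arr g" "dom g = cod (qt C)" "cod g = E" "g*(qt C*inc S) = inc S"
  by (rule is_injectiveD[OF E jm, of "inc S"]) (use s q in auto)
 \<comment> \<open>An endomorphism of \<open>E\<close> that is the identity on \<open>S\<close> and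
   kills the complement \<open>C\<close>.\<close>
 define k where "k = g*qt C"
 have k: "arr k" "dom k = E" "cod k = E" "k*inc S = inc S" using g q s by (auto simp: k_def)
 have kx: "k*x = x" if xS: "x : S" for x
 proof -
  obtain h where h: "arr h" "dom h = dom x" "cod h = dom (inc S)" "inc S*h = x" using inc_lift[OF S(1) xS] by blast
  have "k*(inc S*h) = (k*inc S)*h" using k(1,2) s h(1,3) by simp
  thus ?thesis unfolding k(4) h(4) .
 qed
 \<comment> \<open>If \<open>T\<close> meets \<open>S\<close> trivially, so does its preimage under
   \<open>k\<close>, because \<open>k\<close> fixes \<open>S\<close>; the maximality of
   \<open>C\<close> forces the preimage to be \<open>C\<close>.\<close>
 have preC: "pre k T = C" if T: "T : Sub E" "T Int S <= zr E" for T
 proof (rule maxC)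
  have "pre k T : Sub E" using pre_Sub[OF k(1), of T] k T by simp
  moreover have "pre k T Int S <= zr E"
  proof
   fix x assume x: "x : pre k T Int S"
   hence "x : T" using kx[of x] by auto
   thus "x : zr E" using x T by blast
  qed
  ultimately show "pre k T : ?Y" by blast
  show "C <= pre k T"
  proof
   fix x assume "x : C"
   hence x: "arr x" "cod x = E" "nul (qt C*x)" unfolding qt_mem[OF C(1)] by auto
   hence "nul (k*x)" using g(1,2) q(1-3) by (simp add: k_def)
   hence "k*x : T" using Sub_nul[OF T(1), of "k*x"] x k by simp
   thus "x : pre k T" using x k by simp
  qed
 qed
 define I where "I = img k (el E)"
 have elE: "el E : Sub (dom k)" using el_Sub[OF EO] k by simp
 have I: "I : Sub E" using img_Sub[OF k(1) elE] k by (simp add: I_def)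
 have SI: "S <= I"
 proof
  fix x assume x: "x : S"
  hence "k*x : I" unfolding I_def using img_mem[OF k(1) elE, of x] Sub_el[OF S(1) x] by simp
  thus "x : I" using kx[OF x] by simp
 qed
 have eI: "T <= zr E" if T: "T : Sub E" "T <= I" "T Int M <= zr E" for T
 proof
  have TS: "T Int S <= zr E"
  proof -
   have "T Int S : Sub E" using Sub_inter[OF T(1) S(1)] .
   moreover have "(T Int S) Int M <= zr E" using T(3) by blast
   ultimately show ?thesis using S(2) unfolding ess_def by blast
  qed
  fix y assume y: "y : T"
  hence "y : img k (el E)" using T(2) by (auto simp: I_def)
  then obtain e x where x: "epi e" "arr e" "cod e = dom y" "x : el E" "dom x = dom e" "y*e = k*x" "arr y" "cod y = cod k"
   by (rule imgE)
  have "y*e : T" by (rule Sub_Cmp[OF T(1) y]) (use x in auto)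
  hence "x : pre k T" using x k by simp
  hence "x : C" using preC[OF T(1) TS] by simp
  hence "nul (qt C*x)" unfolding qt_mem[OF C(1)] by simp
  hence "nul (k*x)" using g(1,2) q(1-3) x(4) by (simp add: k_def)
  hence "nul (y*e)" using x(6) by simp
  hence "nul y" by (rule epi_nul[OF x(1)]) (use x(1-3,7) in auto)
  thus "y : zr E" using x(7,8) k by simp
 qed
 have "M <= I" using SI S(2) unfolding ess_def by (auto dest: subsetD)
 hence "ess E M I" unfolding ess_def using eI by (intro conjI ballI impI)
 hence "I : ?Z" using I by simp
 hence IS: "I = S" using max SI by blast
 \<comment> \<open>The image of \<open>k\<close> is \<open>S\<close>, so \<open>k\<close>
   corestricts to a retraction of \<open>E\<close> onto \<open>S\<close>.\<close>
 have "k*idt E : I" unfolding I_def by (rule img_mem[OF k(1) elE]) (use EO in auto)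
 hence "k : S" using k IS by simp
 then obtain r where r: "arr r" "dom r = dom k" "cod r = dom (inc S)" "inc S*r = k" by (rule inc_lift[OF S(1)])
 have "inc S*(r*inc S) = (inc S*r)*inc S" using r(1-3) s k by simp
 also have "... = inc S*idt (dom (inc S))" unfolding r(4) k(4) using s by simp
 finally have "r*inc S = idt (dom (inc S))" by (rule mono_cancel[OF s(1)]) (use r(1-3) s k in auto)
 hence "inject (dom (inc S))" using is_injective_retract[OF E s(2,3) r(1)] r k by simp
 thus ?thesis using S by blast
qed

text \<open>Translates an essential extension inside \<open>E\<close> into an injective envelope in
  the sense used by \<open>locally_stable\<close>.\<close>

lemma ess_envelope:
 assumes E: "obj E" and M: "M : Sub E" and S: "S : Sub E" "ess E M S" "inject (dom (inc S))"
 shows "EX m. is_injective_envelope A m & dom m = dom (inc M) & cod m = dom (inc S)"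
proof -
 note s = inc[OF S(1)] and i = inc[OF M]
 have MS: "M <= S" using S(2) by (simp add: ess_def)
 obtain m where m: "arr m" "dom m = dom (inc M)" "cod m = dom (inc S)" "inc S*m = inc M"
  using inc_lift[OF S(1), of "inc M"] MS Sub_inc[OF M] by blast
 have mm: "mono m" by (rule mono_right[of "inc S"]) (use m s i in auto)
 have "is_essential_mono A m" unfolding is_essential_mono_def
 proof (intro conjI allI impI mm)
  fix n assume n: "mono n & cod n = cod m & ~ zero (dom n)"
  have na: "arr n" "cod n = dom (inc S)" using n m by auto
  have sn: "mono (inc S*n)" "cod (inc S*n) = E" using n na s by auto
  define T where "T = sv (inc S*n)"
  have T: "T : Sub E" using sv_Sub[OF sn(1)] sn by (simp add: T_def)
  have "inc S*n : S" using inc_Cmp_mem[OF S(1)] na by simp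
  hence TS: "T <= S" unfolding T_def by (rule sv_le[OF S(1)])
  have "~ T <= zr E" using zero_sv[OF sn(1)] n na sn s by (simp add: T_def)
  hence nz: "~ T Int M <= zr E" using S(2) T TS unfolding ess_def by blast
  define V where "V = T Int M"
  have V: "V : Sub E" using Sub_inter[OF T M] by (simp add: V_def)
  note v = inc[OF V]
  have "inc V : T" "inc V : M" using Sub_inc[OF V] by (auto simp: V_def)
  then obtain h where h: "arr h" "dom h = dom (inc V)" "cod h = dom (inc M)" "inc M*h = inc V" using inc_lift[OF M] by blast
  from \<open>inc V : T\<close> obtain k where k: "arr k" "cod k = dom (inc S*n)" "inc V = (inc S*n)*k" unfolding T_def by (rule svE)
  have dk: "dom k = dom (inc V)" using arg_cong[OF k(3), of "dom"] k(1,2) na s by simp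
  have kd: "cod k = dom n" using k(2) na s by simp
  have "inc S*(m*h) = (inc S*m)*h" using m(1-3) h(1,3) s by simp
  also have "... = inc S*(n*k)" unfolding m(4) h(4) k(3) using k(1) kd na s by simp
  finally have mh: "m*h = n*k" by (rule mono_cancel[OF s(1)]) (use m(1-3) h(1-3) k(1) kd na in auto)
  have hm: "mono h" by (rule mono_right[of "inc M"]) (use h v i in auto)
  have "mono (m*h)" using mm hm h m by simp
  moreover have "cod (m*h) = cod m" using m h by simp
  moreover have "~ zero (dom (m*h))" using zero_inc[OF V] nz h m by (simp add: V_def)
  moreover have "factors_through A (m*h) m" unfolding factors_through_def using m h by (intro bexI[of _ h]) auto
  moreover have "factors_through A (m*h) n" unfolding factors_through_def using mh m(1-3) h(1-3) k(1) kd dk na by (intro bexI[of _ k]) auto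
  ultimately show "EX l. mono l & cod l = cod m & ~ zero (dom l) & factors_through A l m & factors_through A l n" by blast
 qed
 thus ?thesis using m S(3) unfolding is_injective_envelope_def by (intro exI[of _ m]) simp
qed

end

section \<open>Hereditary torsion classes and their local cohomology\<close>

text \<open>The class \<open>\<J>\<close> is arbitrary here; later it consists of the injectives
  killed by \<open>\<delta>\<close>. Injectivity of its members makes the torsion class they
  cogenerate closed under subobjects.\<close>

locale torsion = loc_noetherian A \<kappa> \<G> for A :: "('o, 'm, 'z) acat_scheme" (structure) and \<kappa> :: "'u rel" and \<G> :: "'o set" +
 fixes \<J> :: "'o set"
 assumes J_injective: "J : \<J> ==> is_injective A J"
begin

definition tors where "tors = {M : Obj A. ALL J : \<J>. ALL f : hom M J. nul f}"

lemma torsI: "obj M ==> (!!f. arr f ==> dom f = M ==> cod f : \<J> ==> nul f) ==> M : tors"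
 unfolding tors_def by simp

lemma tors_nul: "dom f : tors ==> cod f : \<J> ==> arr f ==> nul f"
 unfolding tors_def by simp

lemma tors_Obj: "M : tors ==> obj M" by (simp add: tors_def)

lemma tors_mono:
 assumes i: "mono i" "cod i : tors" shows "dom i : tors"
proof (rule torsI)
 fix f assume f: "arr f" "dom f = dom i" "cod f : \<J>"
 obtain g where g: "arr g" "dom g = cod i" "cod g = cod f" "g*i = f"
  by (rule is_injectiveD[OF J_injective[OF f(3)] i(1) f(1,2)]) auto
 have "nul g" using tors_nul[of g] g(1-3) i f by simp
 hence "nul (g*i)" using g(1,2) i by simp
 thus "nul f" unfolding g(4) .
qed (use i in auto)

lemma tors_epi:
 assumes e: "epi e" "dom e : tors" shows "cod e : tors"
proof (rule torsI)
 fix f assume f: "arr f" "dom f = cod e" "cod f : \<J>"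
 have "nul (f*e)" by (rule tors_nul) (use f e in auto)
 thus "nul f" by (rule epi_nul[OF e(1)]) (use f in auto)
qed (use e in auto)

lemma tors_iso: "is_iso A i ==> dom i : tors <-> cod i : tors"
 using iso_mono_epi tors_mono tors_epi by blast

lemma tors_zero: "zero Z ==> Z : tors"
 by (rule torsI) (use zero_nul in "auto simp: is_zero_iff")

lemma tors_ext:
 assumes i: "mono i" "dom i : tors" and q: "epi q" "dom q = cod i" "cod q : tors" "kr q <= sv i"
 shows "cod i : tors"
proof (rule torsI)
 fix f assume f: "arr f" "dom f = cod i" "cod f : \<J>"
 have fi: "nul (f*i)" by (rule tors_nul) (use f i in auto)
 have "kr q <= kr f"
 proof
  fix x assume "x : kr q"
  hence "x : sv i" using q by blast
  then obtain h where h: "arr h" "cod h = dom i" "x = i*h" by (rule svE)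
  thus "x : kr f" using fi f i by simp
 qed
 then obtain g where g: "arr g" "dom g = cod q" "cod g = cod f" "g*q = f"
  using epi_factor[OF q(1) f(1)] f q by auto
 have "nul g" by (rule tors_nul) (use g f q in auto)
 hence "nul (g*q)" using g(1,2) q by simp
 thus "nul f" unfolding g(4) .
qed (use i in auto)

lemma serre_tors: "is_serre A tors"
 unfolding is_serre_def
proof (intro conjI allI impI)
 show "tors <= Obj A" using tors_Obj by blast
 show "tors ~= {}" using ex_zero tors_zero by blast
 fix f g assume "short_exact A f g"
 hence s: "mono f" "epi g" "is_kernel A f g" by (auto simp: short_exact_def)
 have k: "sv f = kr g" "cod f = dom g" using kernel_sv[OF s(3)] by auto
 show "(cod f : tors) = (dom f : tors & cod g : tors)"
 proof (intro iffI conjI)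
  assume c: "cod f : tors"
  show "dom f : tors" by (rule tors_mono[OF s(1) c])
  show "cod g : tors" by (rule tors_epi[OF s(2)]) (use c k(2) in simp)
 next
  assume "dom f : tors & cod g : tors"
  thus "cod f : tors" using tors_ext[OF s(1) _ s(2) k(2)[symmetric]] k(1) by blast
 qed
qed

definition tsub where "tsub M = SupS M {S : Sub M. dom (inc S) : tors}"

definition tfree where "tfree M <-> (ALL f : Arr A. cod f = M --> dom f : tors --> nul f)"

lemma tfreeD: "tfree M ==> arr f ==> cod f = M ==> dom f : tors ==> nul f"
 by (simp add: tfree_def)

lemma J_tfree: "J : \<J> ==> tfree J" unfolding tfree_def using tors_nul by blast

lemma tsub_Sub: "obj M ==> tsub M : Sub M"
 unfolding tsub_def by (rule SupS(1)) auto

text \<open>An arrow from the supremum to a member of \<open>\<J>\<close> extends to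
  \<open>M\<close> and kills every torsion subobject, so its kernel contains their supremum.\<close>

lemma tors_tsub:
 assumes M: "obj M" shows "dom (inc (tsub M)) : tors"
proof -
 let ?C = "{S : Sub M. dom (inc S) : tors}"
 have C: "?C <= Sub M" by blast
 note Su = SupS[OF C M, folded tsub_def]
 note i = inc[OF Su(1)]
 show ?thesis
 proof (rule torsI[OF i(5)])
  fix f assume f: "arr f" "dom f = dom (inc (tsub M))" "cod f : \<J>"
  obtain g where g: "arr g" "dom g = cod (inc (tsub M))" "cod g = cod f" "g*inc (tsub M) = f"
   by (rule is_injectiveD[OF J_injective[OF f(3)] i(1) f(1,2)]) auto
  have gM: "dom g = M" using g i by simp
  have "tsub M <= kr g"
  proof (rule Su(3))
   show "kr g : Sub M" using kr_Sub[OF g(1)] gM by simp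
   fix S assume "S : ?C"
   hence S: "S : Sub M" "dom (inc S) : tors" by auto
   note s = inc[OF S(1)]
   have "nul (g*inc S)" by (rule tors_nul) (use S s g(1-3) gM f in auto)
   hence "inc S : kr g" using s gM by simp
   hence "sv (inc S) <= kr g" by (rule sv_le[OF kr_Sub[OF g(1)]])
   thus "S <= kr g" using s by simp
  qed
  hence "nul (g*inc (tsub M))" using Sub_inc[OF Su(1)] by auto
  thus "nul f" unfolding g(4) .
 qed
qed

lemma tors_mem:
 assumes f: "arr f" "dom f : tors" shows "f : tsub (cod f)"
proof -
 obtain m e where m: "mono m" "epi e" "dom e = dom f" "cod e = dom m" "cod m = cod f" "f = m*e"
  using ex_image[OF f(1)] by blast
 let ?M = "cod f"
 have S: "sv m : Sub ?M" using sv_Sub[OF m(1)] m(5) by simp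
 obtain h where h: "is_iso A h" "dom h = dom (inc (sv m))" "cod h = dom m"
  using sv_Cmp_mono_iso[OF inc(1)[OF S] m(1) inc(4)[OF S]] by blast
 have "dom m : tors" using tors_epi[OF m(2)] m(3,4) f by simp
 hence "dom (inc (sv m)) : tors" using tors_iso[OF h(1)] h by simp
 hence "sv m <= tsub ?M" unfolding tsub_def using S f by (intro SupS(2)) auto
 moreover have "m*e : sv m" using svI[of e m] m(1,2,4) by simp
 ultimately show ?thesis using m(6) by auto
qed

lemma tors_subsub:
 assumes M: "obj M" and S: "S : Sub M" "S <= tsub M" shows "dom (inc S) : tors"
proof -
 note t = inc[OF tsub_Sub[OF M]] and s = inc[OF S(1)]
 obtain h where h: "arr h" "dom h = dom (inc S)" "cod h = dom (inc (tsub M))" "inc (tsub M)*h = inc S"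
  using inc_lift[OF tsub_Sub[OF M]] Sub_inc[OF S(1)] S(2) by blast
 have "mono h" by (rule mono_right[of "inc (tsub M)"]) (use h t s in auto)
 thus ?thesis using tors_mono[of h] h tors_tsub[OF M] by simp
qed

lemma tsub_kill:
 assumes g: "arr g" "tfree (cod g)" and x: "x : tsub (dom g)" shows "nul (g*x)"
proof -
 have D: "obj (dom g)" using g by simp
 note t = inc[OF tsub_Sub[OF D]]
 obtain h where h: "arr h" "dom h = dom x" "cod h = dom (inc (tsub (dom g)))" "inc (tsub (dom g))*h = x"
  by (rule inc_lift[OF tsub_Sub[OF D] x])
 have "nul (g*inc (tsub (dom g)))" by (rule tfreeD[OF g(2)]) (use g t tors_tsub[OF D] in auto)
 hence "nul (g*(inc (tsub (dom g))*h))" using g(1) t h(1,3) by simp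
 thus ?thesis unfolding h(4) .
qed

text \<open>The preimage \<open>V\<close> in \<open>M\<close> of the torsion part of the quotient is
  an extension of a torsion object by a torsion object, hence lies in \<open>tsub M\<close>.\<close>

lemma tfree_quot:
 assumes M: "obj M" shows "tfree (cod (qt (tsub M)))"
proof -
 note T = tsub_Sub[OF M] and q = qt[OF tsub_Sub[OF M]] and t = inc[OF tsub_Sub[OF M]]
 let ?Y = "cod (qt (tsub M))"
 note S = tsub_Sub[OF q(5)] and s = inc[OF tsub_Sub[OF q(5)]]
 define V where "V = pre (qt (tsub M)) (tsub ?Y)"
 have V: "V : Sub M" using pre_Sub[OF q(2) S] q by (simp add: V_def)
 note v = inc[OF V]
 have "qt (tsub M)*inc V : tsub ?Y" using Sub_inc[OF V] by (simp add: V_def)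
 then obtain e where e: "arr e" "dom e = dom (qt (tsub M)*inc V)" "cod e = dom (inc (tsub ?Y))" "inc (tsub ?Y)*e = qt (tsub M)*inc V"
  by (rule inc_lift[OF S])
 have eD: "dom e = dom (inc V)" using e(2) v q by simp
 have ee: "epi e"
 proof -
  obtain d y where y: "epi d" "cod d = dom (inc (tsub ?Y))" "arr y" "dom y = dom d" "cod y = M" "qt (tsub M)*y = inc (tsub ?Y)*d"
   using cover[OF q(1), of "inc (tsub ?Y)"] s q by auto
  have "y : V" using y(1-5) inc_Cmp_mem[OF S, of d] q by (simp add: V_def y(6))
  then obtain h where h: "arr h" "dom h = dom y" "cod h = dom (inc V)" "inc V*h = y" by (rule inc_lift[OF V])
  have "inc (tsub ?Y)*(e*h) = qt (tsub M)*(inc V*h)"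
   by (rule Cmp_reassoc[OF e(4)]) (use e(1,3) eD h(1,3) v q s in auto)
  hence "inc (tsub ?Y)*(e*h) = inc (tsub ?Y)*d" unfolding h(4) y(6) .
  hence "e*h = d" by (rule mono_cancel[OF s(1)]) (use e(1,3) eD h(1-3) y(1,2) in auto)
  thus ?thesis using epi_left[of e h] y(1) e(1) eD h(1,3) by simp
 qed
 have "tsub M <= V"
 proof
  fix x assume "x : tsub M"
  hence x: "arr x" "cod x = M" "nul (qt (tsub M)*x)" unfolding qt_mem[OF T] by auto
  thus "x : V" using Sub_nul[OF S, of "qt (tsub M)*x"] q by (simp add: V_def)
 qed
 then obtain i where i: "arr i" "dom i = dom (inc (tsub M))" "cod i = dom (inc V)" "inc V*i = inc (tsub M)"
  using inc_lift[OF V] Sub_inc[OF T] by blast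
 have im: "mono i" by (rule mono_right[of "inc V"]) (use i t v in auto)
 have "kr e <= sv i"
 proof
  fix x assume x: "x : kr e"
  hence xa: "arr x" "cod x = dom (inc V)" "nul (e*x)" using eD by auto
  have "qt (tsub M)*(inc V*x) = inc (tsub ?Y)*(e*x)"
   by (rule Cmp_reassoc[OF e(4)[symmetric]]) (use e(1,3) eD xa v q s in auto)
  hence "nul (qt (tsub M)*(inc V*x))" using xa e(1,3) eD s by simp
  hence "inc V*x : tsub M" unfolding qt_mem[OF T] using xa v by simp
  then obtain h where h: "arr h" "dom h = dom (inc V*x)" "cod h = dom (inc (tsub M))" "inc (tsub M)*h = inc V*x" by (rule inc_lift[OF T])
  have "inc V*(i*h) = (inc V*i)*h" using i(1-3) h(1,3) v by simp
  hence "inc V*(i*h) = inc V*x" unfolding i(4) h(4) .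
  hence "i*h = x" by (rule mono_cancel[OF v(1)]) (use i(1-3) h(1,3) xa v in auto)
  thus "x : sv i" using svI[of h i] h(1,3) i(1,2) by simp
 qed
 hence "dom (inc V) : tors" using tors_ext[OF im _ ee] i e(3) eD tors_tsub[OF M] tors_tsub[OF q(5)] by simp
 hence "inc V : tsub M" using tors_mem[of "inc V"] v by simp
 hence VT: "V <= tsub M" using sv_le[OF T, of "inc V"] v by simp
 show ?thesis unfolding tfree_def
 proof (intro ballI impI)
  fix f assume f: "arr f" "cod f = ?Y" "dom f : tors"
  obtain d y where y: "epi d" "cod d = dom f" "arr y" "dom y = dom d" "cod y = M" "qt (tsub M)*y = f*d"
   using cover[OF q(1) f(1,2)] q by auto
  have "f : tsub ?Y" using tors_mem[OF f(1,3)] f by simp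
  hence "f*d : tsub ?Y" by (rule Sub_Cmp[OF S]) (use y in auto)
  hence "y : V" using y q by (simp add: V_def)
  hence "nul (qt (tsub M)*y)" using VT qt_mem[OF T] by blast
  hence "nul (f*d)" unfolding y(6) .
  thus "nul f" by (rule epi_nul[OF y(1)]) (use f y in auto)
 qed
qed

section \<open>The localization functor of a torsion class\<close>

definition SI where "SI = serre_isos A tors"

lemma SI_Arr: "s : SI ==> arr s" unfolding SI_def serre_isos_def by simp

lemma SI_tfree_inj:
 assumes s: "s : SI" and g: "arr g" "dom g = cod s" "nul (g*s)" "tfree (cod g)" shows "nul g"
proof -
 from s obtain q where q: "is_cokernel A q s" "cod q : tors" unfolding SI_def serre_isos_def by blast
 obtain h where h: "arr h" "dom h = cod q" "cod h = cod g" "h*q = g"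
  using cokernel_factor[OF q(1) g(1-3) SI_Arr[OF s]] by auto
 have "nul h" by (rule tfreeD[OF g(4)]) (use h q in auto)
 moreover have "arr q" using q(1) by (simp add: is_cokernel_def)
 ultimately have "nul (h*q)" using h(1,2) by simp
 thus ?thesis unfolding h(4) .
qed

lemma SI_extend:
 assumes s: "s : SI" and f: "arr f" "dom f = dom s" "tfree (cod f)" "inject (cod f)"
 obtains g where "arr g" "dom g = cod s" "cod g = cod f" "g*s = f"
proof -
 have sa: "arr s" using SI_Arr[OF s] .
 from s obtain k where k: "is_kernel A k s" "dom k : tors" unfolding SI_def serre_isos_def by blast
 have ks: "mono k" "cod k = dom s" "sv k = kr s" using kernel_sv[OF k(1)] by auto
 have fk: "nul (f*k)" by (rule tfreeD[OF f(3)]) (use f ks k in auto)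
 obtain m e where m: "mono m" "epi e" "dom e = dom s" "cod e = dom m" "cod m = cod s" "s = m*e"
  using ex_image[OF sa] by blast
 have "kr e <= kr f"
 proof
  fix x assume "x : kr e"
  hence x: "arr x" "cod x = dom s" "nul (e*x)" using m(3) by auto
  have "nul (m*(e*x))" using x m(1-4) by simp
  hence "nul ((m*e)*x)" using x m(1-4) by simp
  hence "x : sv k" using x m(6) ks(3) by simp
  then obtain h where h: "arr h" "cod h = dom k" "x = k*h" by (rule svE)
  thus "x : kr f" using fk f ks(1,2) by simp
 qed
 then obtain f' where f': "arr f'" "dom f' = cod e" "cod f' = cod f" "f'*e = f"
  using epi_factor[OF m(2) f(1)] f(2) m(3) by auto
 obtain g where g: "arr g" "dom g = cod m" "cod g = cod f" "g*m = f'"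
  by (rule is_injectiveD[OF f(4) m(1) f'(1)]) (use f'(2,3) m(4) in auto)
 have "g*(m*e) = (g*m)*e" using g(1,2) m(1,2,4) by simp
 hence "g*s = f" using m(6) g(4) f'(4) by simp
 thus ?thesis using that g m(5) by simp
qed

text \<open>These are the arrows that every member of \<open>\<J>\<close> sees as isomorphisms. In
  the converse direction, an arrow from the kernel to \<open>J\<close> extends to the domain and
  then over \<open>s\<close>, so it vanishes; an arrow from the cokernel vanishes by the uniqueness
  condition.\<close>

lemma SI_iff:
 "s : SI <-> arr s &
  (ALL f : Arr A. dom f = dom s --> cod f : \<J> --> (EX g : Arr A. dom g = cod s & cod g = cod f & g*s = f)) &
  (ALL g : Arr A. dom g = cod s --> cod g : \<J> --> nul (g*s) --> nul g)" (is "_ <-> ?R")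
proof
 assume s: "s : SI"
 show ?R using SI_Arr[OF s] SI_extend[OF s] SI_tfree_inj[OF s] J_tfree J_injective by metis
next
 assume R: ?R
 hence sa: "arr s" by blast
 obtain k where k: "is_kernel A k s" using ex_kernel[OF sa] by auto
 have ks: "mono k" "cod k = dom s" "sv k = kr s" using kernel_sv[OF k] by auto
 obtain q where q: "epi q" "dom q = cod s" "nul (q*s)" "is_cokernel A q s" using ex_coker[OF sa] by auto
 have "dom k : tors"
 proof (rule torsI)
  fix f assume f: "arr f" "dom f = dom k" "cod f : \<J>"
  obtain f2 where f2: "arr f2" "dom f2 = cod k" "cod f2 = cod f" "f2*k = f"
   by (rule is_injectiveD[OF J_injective[OF f(3)] ks(1) f(1,2)]) auto
  obtain g where g: "arr g" "dom g = cod s" "g*s = f2" using R f2 f ks by metis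
  have "k : kr s" using sv_self[of k] ks by simp
  hence "nul (g*(s*k))" using g(1,2) sa ks by simp
  hence "nul ((g*s)*k)" using g(1,2) sa ks by simp
  thus "nul f" unfolding g(3) f2(4) .
 qed (use ks in auto)
 moreover have "cod q : tors"
 proof (rule torsI)
  fix h assume h: "arr h" "dom h = cod q" "cod h : \<J>"
  have "nul ((h*q)*s)" using h q sa by simp
  hence "nul (h*q)" using R h q(1,2) by (metis Cmp_simps epi_Arr)
  thus "nul h" by (rule epi_nul[OF q(1)]) (use h in auto)
 qed (use q in auto)
 ultimately show "s : SI" unfolding SI_def serre_isos_def using sa k q(4) by blast
qed

text \<open>The Gabriel localization of \<open>X\<close>: the quotient by the torsion part is
  embedded by \<open>a\<close> into its injective hull \<open>?D\<close>, and \<open>L\<close> is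
  the part of \<open>?D\<close> that is torsion modulo the image of \<open>a\<close>.\<close>

lemma SI_local_ex:
 assumes X: "obj X"
 shows "EX l : SI. dom l = X & is_local A SI (cod l)"
proof -
 note T = tsub_Sub[OF X] and q = qt[OF tsub_Sub[OF X]]
 let ?q = "qt (tsub X)"
 obtain a0 where a0: "mono a0" "dom a0 = cod ?q" "inject (cod a0)" using enough_injectives[OF q(5)] by blast
 let ?E = "cod a0"
 have EO: "obj ?E" using a0 by simp
 have MS: "sv a0 : Sub ?E" by (rule sv_Sub[OF a0(1)])
 obtain S where S: "S : Sub ?E" "ess ?E (sv a0) S" "inject (dom (inc S))" using ex_envelope[OF a0(3) MS] by blast
 note s = inc[OF S(1)]
 let ?D = "dom (inc S)"
 have "a0 : S" using S(2) sv_self[of a0] a0(1) unfolding ess_def by auto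
 then obtain a where a: "arr a" "dom a = dom a0" "cod a = ?D" "inc S*a = a0" by (rule inc_lift[OF S(1)])
 have am: "mono a" by (rule mono_right[of "inc S"]) (use a a0 s in auto)
 \<comment> \<open>The hull is an essential extension of a torsion-free object: its torsion meets
   that object in zero, hence is zero.\<close>
 have Dfree: "tfree ?D"
 proof -
  let ?T = "tsub ?E Int S"
  have TS: "?T : Sub ?E" by (rule Sub_inter[OF tsub_Sub[OF EO] S(1)])
  define V where "V = ?T Int sv a0"
  have V: "V : Sub ?E" using Sub_inter[OF TS MS] by (simp add: V_def)
  note v = inc[OF V]
  have Vt: "dom (inc V) : tors" by (rule tors_subsub[OF EO V]) (auto simp: V_def)
  have "inc V : sv a0" using Sub_inc[OF V] by (simp add: V_def)
  then obtain h where h: "arr h" "cod h = dom a0" "inc V = a0*h" by (rule svE)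
  have hd: "dom h = dom (inc V)" using arg_cong[OF h(3), of "dom"] h(1,2) a0 by simp
  have "nul h" by (rule tfreeD[OF tfree_quot[OF X]]) (use h(1,2) hd a0 Vt in auto)
  hence "nul (a0*h)" using h(1,2) a0 by simp
  hence "inc V : zr ?E" using h(3) v by simp
  hence "V <= zr ?E" using sv_le[OF zr_Sub[OF EO], of "inc V"] v by simp
  hence "?T <= zr ?E" using S(2) TS unfolding ess_def V_def by blast
  show ?thesis unfolding tfree_def
  proof (intro ballI impI)
   fix f assume f: "arr f" "cod f = ?D" "dom f : tors"
   have "inc S*f : tsub ?E" using tors_mem[of "inc S*f"] f s by simp
   moreover have "inc S*f : S" by (rule inc_Cmp_mem[OF S(1) f(1,2)])
   ultimately have "inc S*f : zr ?E" using \<open>?T <= zr ?E\<close> by blast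
   hence "nul (inc S*f)" by simp
   thus "nul f" by (rule mono_nul[OF s(1)]) (use f in auto)
  qed
 qed
 have aS: "sv a : Sub ?D" using sv_Sub[OF am] a by simp
 note c = qt[OF aS]
 let ?c = "qt (sv a)" and ?Y = "cod (qt (sv a))"
 note U = tsub_Sub[OF c(5)]
 define L where "L = pre ?c (tsub ?Y)"
 have L: "L : Sub ?D" using pre_Sub[OF c(2) U] c by (simp add: L_def)
 note li = inc[OF L]
 have "a : L" using sv_self[OF a(1)] qt_mem[OF aS, of a] Sub_nul[OF U, of "?c*a"] a c by (simp add: L_def)
 then obtain l' where l': "arr l'" "dom l' = dom a" "cod l' = dom (inc L)" "inc L*l' = a" by (rule inc_lift[OF L])
 define l where "l = l'*?q"
 have qa: "dom a = cod ?q" using a(2) a0(2) by simp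
 have l: "arr l" "dom l = X" "cod l = dom (inc L)" using l' q qa by (auto simp: l_def)
 have cL: "?c*inc L : tsub ?Y" using Sub_inc[OF L] by (simp add: L_def)
 have "l : SI" unfolding SI_iff
 proof (intro conjI ballI impI l)
  fix f assume f: "arr f" "dom f = dom l" "cod f : \<J>"
  have "kr ?q <= kr f"
  proof
   fix x assume "x : kr ?q"
   hence x: "x : tsub X" using q(4) by simp
   have fX: "dom f = X" using f l by simp
   have "nul (f*x)" using tsub_kill[OF f(1) J_tfree[OF f(3)], of x] x fX by simp
   thus "x : kr f" using Sub_el[OF T x] fX by simp
  qed
  then obtain f1 where f1: "arr f1" "dom f1 = cod ?q" "cod f1 = cod f" "f1*?q = f"
   using epi_factor[OF q(1) f(1)] f l q by auto
  obtain f2 where f2: "arr f2" "dom f2 = cod a" "cod f2 = cod f" "f2*a = f1"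
   by (rule is_injectiveD[OF J_injective[OF f(3)] am f1(1)]) (use f1 qa in auto)
  have "(f2*inc L)*l = f2*((inc L*l')*?q)" using f2(1,2) a(3) li l'(1-3) q qa by (simp add: l_def)
  also have "... = (f2*a)*?q" unfolding l'(4) using f2(1,2) a(1) qa q by simp
  also have "... = f" unfolding f2(4) f1(4) ..
  finally show "EX g:Arr A. dom g = cod l & cod g = cod f & g*l = f"
   using f2 a(3) li l by (intro bexI[of _ "f2*inc L"]) auto
 next
  fix g assume g: "arr g" "dom g = cod l" "cod g : \<J>" "nul (g*l)"
  have gL: "dom g = dom (inc L)" using g l by simp
  have "nul ((g*l')*?q)" using g(1,4) gL l' q qa by (simp add: l_def)
  hence gl': "nul (g*l')" by (rule epi_nul[OF q(1)]) (use g(1) gL l' qa in auto)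
  obtain g2 where g2: "arr g2" "dom g2 = cod (inc L)" "cod g2 = cod g" "g2*inc L = g"
   by (rule is_injectiveD[OF J_injective[OF g(3)] li(1) g(1) gL]) auto
  have g2D: "dom g2 = ?D" using g2 li by simp
  have "g2*(inc L*l') = (g2*inc L)*l'" using g2(1) g2D li l'(1-3) by simp
  hence "nul (g2*a)" unfolding l'(4) g2(4) using gl' by simp
  hence "a : kr g2" using a g2D by simp
  hence "sv a <= kr g2" by (rule sv_le[OF kr_Sub[OF g2(1)]])
  then obtain g3 where g3: "arr g3" "dom g3 = ?Y" "cod g3 = cod g2" "g3*?c = g2"
   using epi_factor[OF c(1) g2(1)] g2D c by auto
  have "nul (g3*(?c*inc L))" using tsub_kill[of g3 "?c*inc L"] g3(1-3) g2(3) J_tfree[OF g(3)] cL by simp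
  hence "nul ((g3*?c)*inc L)" using g3(1,2) c li by simp
  thus "nul g" unfolding g3(4) g2(4) .
 qed
 \<comment> \<open>An arrow into \<open>L\<close> extends along \<open>r\<close> to the injective
   torsion-free \<open>?D\<close>. The extension lands in \<open>L\<close>: modulo \<open>L\<close>,
   which leaves a torsion-free quotient, it kills the image of \<open>r\<close> and so factors
   through the torsion cokernel of \<open>r\<close>.\<close>
 moreover have "is_local A SI (dom (inc L))" unfolding is_local_def
 proof (intro conjI ballI li(5))
  fix r f assume r: "r : SI" and f: "f : hom (dom r) (dom (inc L))"
  have fa: "arr f" "dom f = dom r" "cod f = dom (inc L)" using f by auto
  have ra: "arr r" by (rule SI_Arr[OF r])
  obtain g where g: "arr g" "dom g = cod r" "cod g = cod (inc L*f)" "g*r = inc L*f"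
   by (rule SI_extend[OF r, of "inc L*f"]) (use fa li Dfree S(3) in auto)
  have gD: "cod g = ?D" using g(3) fa li by simp
  let ?p = "qt (tsub ?Y)"
  note p = qt[OF U]
  have n0: "nul (?p*(?c*inc L))" using cL unfolding qt_mem[OF U] by blast
  have n: "nul ((?p*(?c*inc L))*f)" by (rule nul_Cmp_left[OF n0]) (use fa li c p in auto)
  have "(?p*(?c*g))*r = ?p*(?c*(g*r))" using g(1,2) gD ra c p by simp
  also have "... = (?p*(?c*inc L))*f" unfolding g(4) using fa li c p by simp
  finally have "nul ((?p*(?c*g))*r)" using n by simp
  hence "nul (?p*(?c*g))" by (rule SI_tfree_inj[OF r, rotated 2]) (use g(1,2) gD c p tfree_quot[OF c(5)] in auto)
  hence "?c*g : tsub ?Y" unfolding qt_mem[OF U] using g(1) gD c by simp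
  hence "g : L" using g(1) gD c by (simp add: L_def)
  then obtain h where h: "arr h" "dom h = dom g" "cod h = dom (inc L)" "inc L*h = g" by (rule inc_lift[OF L])
  have hr: "dom h = cod r" using h g by simp
  have "inc L*(h*r) = (inc L*h)*r" using h(1,3) hr ra li by simp
  hence e: "inc L*(h*r) = inc L*f" unfolding h(4) g(4) .
  have hf: "h*r = f" by (rule mono_cancel[OF li(1) e]) (use h(1,3) hr ra fa in auto)
  show "EX! g. g : hom (cod r) (dom (inc L)) & g*r = f"
  proof (rule ex1I[of _ h])
   show "h : hom (cod r) (dom (inc L)) & h*r = f" using h(1,3) hr hf by simp
   fix k assume "k : hom (cod r) (dom (inc L)) & k*r = f"
   hence k: "arr k" "dom k = cod r" "cod k = dom (inc L)" "k*r = f" by auto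
   let ?d = "inc L*(k++neg h)"
   have d: "arr ?d" "dom ?d = cod r" "cod ?d = ?D" using k h(1,3) hr li by auto
   have "(k++neg h)*r = f++neg f" using k h(1,3) hr hf ra by (simp add: Add_Cmp)
   hence "nul ((k++neg h)*r)" using fa ra li by simp
   hence "nul (inc L*((k++neg h)*r))" by (rule nul_Cmp_right) (use k(1-3) h(1,3) hr ra li in auto)
   hence "nul (?d*r)" using k(1-3) h(1,3) hr ra li by simp
   hence "nul ?d" by (rule SI_tfree_inj[OF r d(1,2)]) (use d Dfree in simp)
   hence "nul (k++neg h)" by (rule mono_nul[OF li(1)]) (use k(1-3) h(1,3) hr in auto)
   thus "k = h" using nul_dif[of k h] k(1-3) h(1,3) hr by simp
  qed
 qed
 ultimately show ?thesis using l by (intro bexI[of _ l]) auto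
qed

lemma fractions_SI: "fractions A SI"
proof
 show "s : SI ==> arr s" for s by (rule SI_Arr)
 show "idt X : SI" if "obj X" for X unfolding SI_iff using that by auto
 show "EX l:SI. dom l = X & is_local A SI (cod l)" if "obj X" for X by (rule SI_local_ex[OF that])
 show "t*s : SI" if st: "s : SI" "t : SI" "dom t = cod s" for s t
 proof -
  have a: "arr s" "arr t" using SI_Arr st by auto
  show ?thesis unfolding SI_iff
  proof (intro conjI ballI impI)
   fix f assume f: "arr f" "dom f = dom (t*s)" "cod f : \<J>"
   obtain g where g: "arr g" "dom g = cod s" "cod g = cod f" "g*s = f"
    by (rule SI_extend[OF st(1) f(1)]) (use f a st J_tfree J_injective in auto)
   obtain h where h: "arr h" "dom h = cod t" "cod h = cod g" "h*t = g"
    by (rule SI_extend[OF st(2) g(1)]) (use f g st J_tfree J_injective in auto)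
   have "h*(t*s) = (h*t)*s" using h(1,2) a st by simp
   hence "h*(t*s) = f" unfolding h(4) g(4) .
   thus "EX g:Arr A. dom g = cod (t*s) & cod g = cod f & g*(t*s) = f"
    using h(1-3) g(3) a st by (intro bexI[of _ h]) auto
  next
   fix g assume g: "arr g" "dom g = cod (t*s)" "cod g : \<J>" "nul (g*(t*s))"
   have gt: "dom g = cod t" using g a st by simp
   have "nul ((g*t)*s)" using g(1,4) gt a st by simp
   hence "nul (g*t)" by (rule SI_tfree_inj[OF st(1), rotated 2]) (use g gt a st J_tfree in auto)
   thus "nul g" by (rule SI_tfree_inj[OF st(2) g(1) gt]) (use g J_tfree in auto)
  qed (use a st in auto)
 qed
qed

text \<open>The right adjoint of the quotient functor comes from the local objects. This makes local
  stability applicable to \<open>tors\<close>.\<close>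

lemma localizing_tors: "is_localizing A tors"
 unfolding is_localizing_def
 using serre_tors fractions.right_adjoint_L[OF fractions_SI] by (simp add: SI_def)

section \<open>Torsion classes and open sets of atoms\<close>

definition atoms where "atoms = {\<alpha> : ASpec A. EX H : \<alpha>. H : tors}"

lemma subquotient_tors: "is_subquotient A H M ==> M : tors ==> H : tors"
 unfolding is_subquotient_def using tors_mono tors_epi by metis

lemma open_atoms: "is_open_atoms A atoms"
 unfolding is_open_atoms_def
proof (intro conjI ballI)
 fix \<alpha> assume "\<alpha> : atoms"
 then obtain H where H: "H : \<alpha>" "H : tors" by (auto simp: atoms_def)
 have "ASupp A H <= atoms" using subquotient_tors[OF _ H(2)] unfolding ASupp_def atoms_def by blast
 thus "EX H:\<alpha>. ASupp A H <= atoms" using H by blast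
qed (auto simp: atoms_def)

text \<open>A nonzero arrow to some \<open>J\<close> has an image containing a monoform
  \<open>H\<close>, which is a subquotient of the source. If the atom of \<open>H\<close> has a
  torsion representative, then \<open>H\<close> has a nonzero torsion subobject; but
  \<open>H\<close> sits inside \<open>J\<close>, which is torsion-free.\<close>

lemma ASupp_atoms:
 assumes M: "obj M" shows "ASupp A M <= atoms <-> M : tors"
proof
 assume "M : tors" thus "ASupp A M <= atoms" using subquotient_tors unfolding ASupp_def atoms_def by blast
next
 assume W: "ASupp A M <= atoms"
 show "M : tors"
 proof (rule torsI[OF M], rule ccontr)
  fix f assume f: "arr f" "dom f = M" "cod f : \<J>" "~ nul f"
  obtain m e where m: "mono m" "epi e" "dom e = dom f" "cod e = dom m" "cod m = cod f" "f = m*e"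
   using ex_image[OF f(1)] by blast
  have ma: "arr m" "arr e" using m by auto
  have "m ~: zr (cod m)"
  proof
   assume "m : zr (cod m)"
   hence "nul (m*e)" using ma m(4) by simp
   thus False using f(4) m(6) by simp
  qed
  hence "~ sv m <= zr (cod m)" using sv_self[OF ma(1)] by blast
  then obtain n where n: "mono n" "cod n = cod m" "sv n <= sv m" "is_monoform A (dom n)"
   using monoform_sub[OF sv_Sub[OF m(1)]] by blast
  have "n : sv m" using n(3) sv_self[of n] n(1) by auto
  then obtain h where h: "arr h" "cod h = dom m" "n = m*h" by (rule svE)
  have hd: "dom h = dom n" using arg_cong[OF h(3), of "dom"] h(1,2) ma by simp
  have hm: "mono h" by (rule mono_right[of m]) (use n(1) h ma in auto)
  let ?H = "dom n"
  have eM: "dom e = M" using m f by simp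
  \<comment> \<open>\<open>?H\<close> lies in the image of \<open>f\<close>; its preimage
    \<open>P\<close> maps onto it, which displays \<open>?H\<close> as a subquotient of
    \<open>M\<close>.\<close>
  define P where "P = pre e (sv h)"
  have P: "P : Sub M" using pre_Sub[OF ma(2), of "sv h"] sv_Sub[OF hm] h(2) m(4) eM by (simp add: P_def)
  note p = inc[OF P]
  have "e*inc P : sv h" using Sub_inc[OF P] by (simp add: P_def)
  then obtain e' where e': "arr e'" "cod e' = dom h" "e*inc P = h*e'" by (rule svE)
  have e'd: "dom e' = dom (inc P)" using arg_cong[OF e'(3), of "dom"] e'(1,2) h(1) ma p eM by simp
  have "epi e'"
  proof -
   obtain d x where x: "epi d" "cod d = dom h" "arr x" "dom x = dom d" "cod x = dom e" "e*x = h*d"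
    using cover[OF m(2), of h] h m(4) by auto
   have "x : P" unfolding P_def using x(1-5) svI[of d h] h(1) by (simp add: x(6))
   then obtain x' where x': "arr x'" "dom x' = dom x" "cod x' = dom (inc P)" "inc P*x' = x" by (rule inc_lift[OF P])
   have "h*(e'*x') = e*(inc P*x')"
    by (rule Cmp_reassoc[OF e'(3)[symmetric]]) (use e'(1,2) e'd x'(1,3) h(1) ma p eM in auto)
   hence "h*(e'*x') = h*d" unfolding x'(4) x(6) .
   hence "e'*x' = d" by (rule mono_cancel[OF hm]) (use e'(1,2) e'd x'(1-3) x(1,2) in auto)
   thus ?thesis using epi_left[of e' x'] x(1) e'(1) e'd x'(1,3) by simp
  qed
  hence sq: "is_subquotient A ?H M" unfolding is_subquotient_def
   using p e' e'd hd by (intro exI[of _ "inc P"] exI[of _ e']) simp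
  define \<alpha> where "\<alpha> = atom_equiv A `` {?H}"
  have Hz: "~ zero ?H" "obj ?H" using n(4) by (auto simp: is_monoform_def)
  have "(?H, ?H) : atom_equiv A" unfolding atom_equiv_def using n(4) Hz
   by (auto intro!: exI[of _ "idt ?H"] isomorphic_refl)
  hence "\<alpha> : ASpec A" "?H : \<alpha>" using n(4) unfolding \<alpha>_def ASpec_def by (auto intro: quotientI)
  hence "\<alpha> : atoms" using W sq unfolding ASupp_def by blast
  then obtain H' where "(?H, H') : atom_equiv A" "H' : tors" unfolding atoms_def \<alpha>_def by auto
  then obtain i j where ij: "mono i" "cod i = ?H" "mono j" "cod j : tors" "~ zero (dom i)" "isomorphic A (dom i) (dom j)"
   unfolding atom_equiv_def by auto
  have "dom j : tors" by (rule tors_mono[OF ij(3,4)])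
  hence "dom i : tors" using ij(6) tors_iso unfolding isomorphic_def by (metis Hom_iff)
  hence "nul (n*i)" using tors_nul[of "n*i"] n(1,2) ij(1,2) m(5) f(3) by simp
  hence "nul i" by (rule mono_nul[OF n(1)]) (use ij in auto)
  hence "nul (i*idt (dom i))" using ij by simp
  hence "nul (idt (dom i))" by (rule mono_nul[OF ij(1)]) (use ij in auto)
  thus False using ij by (simp add: is_zero_iff)
 qed
qed

abbreviation "gam == Gamma_incl A atoms"
abbreviation "\<Gamma> == Gamma A atoms"

text \<open>Whatever representative the choice operator picks, its elements are those of
  \<open>tsub M\<close>; this identifies \<open>\<Gamma>\<close> with the torsion radical.\<close>

lemma gam:
 assumes M: "obj M"
 shows "mono (gam M)" "arr (gam M)" "cod (gam M) = M" "dom (gam M) : tors" "sv (gam M) = tsub M" "dom (gam M) = FO \<Gamma> M"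
proof -
 note t = inc[OF tsub_Sub[OF M]]
 have "is_largest_supported A atoms M (inc (tsub M))" unfolding is_largest_supported_def
 proof (intro conjI allI impI)
  show "ASupp A (dom (inc (tsub M))) <= atoms" using ASupp_atoms[OF t(5)] tors_tsub[OF M] by simp
  fix j assume j: "mono j & cod j = M & ASupp A (dom j) <= atoms"
  hence "dom j : tors" using ASupp_atoms[of "dom j"] by simp
  hence "j : tsub M" using tors_mem[of j] j by auto
  thus "factors_through A j (inc (tsub M))" using inc_lift[OF tsub_Sub[OF M]] unfolding factors_through_def by (metis Hom_iff)
 qed (use t in auto)
 hence g: "is_largest_supported A atoms M (gam M)" unfolding Gamma_incl_def by (rule someI)
 hence gg: "mono (gam M)" "cod (gam M) = M" "ASupp A (dom (gam M)) <= atoms" by (auto simp: is_largest_supported_def)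
 thus gt: "mono (gam M)" "arr (gam M)" "cod (gam M) = M" "dom (gam M) : tors"
  using ASupp_atoms[of "dom (gam M)"] by auto
 show "dom (gam M) = FO \<Gamma> M" by (simp add: Gamma_def)
 have "gam M : tsub M" using tors_mem[of "gam M"] gt by simp
 moreover have "factors_through A (inc (tsub M)) (gam M)"
  using g t ASupp_atoms[OF t(5)] tors_tsub[OF M] unfolding is_largest_supported_def by simp
 hence "tsub M <= sv (gam M)" using factors_through_sv[of "inc (tsub M)" "gam M"] t gt by simp
 ultimately show "sv (gam M) = tsub M" using sv_le[OF tsub_Sub[OF M]] by blast
qed

lemma gam_lift:
 assumes M: "obj M" and x: "x : tsub M"
 obtains h where "arr h" "dom h = dom x" "cod h = FO \<Gamma> M" "gam M*h = x"
proof -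
 have "x : sv (gam M)" using gam[OF M] x by simp
 then obtain h where h: "arr h" "cod h = dom (gam M)" "x = gam M*h" by (rule svE)
 thus ?thesis using that[of h] gam(2,3,6)[OF M] by (metis Cmp_simps(2))
qed

lemma Gamma_arr:
 assumes f: "arr f"
 shows "arr (FA \<Gamma> f)" "dom (FA \<Gamma> f) = FO \<Gamma> (dom f)" "cod (FA \<Gamma> f) = FO \<Gamma> (cod f)"
  "gam (cod f)*FA \<Gamma> f = f*gam (dom f)"
proof -
 have O: "obj (dom f)" "obj (cod f)" using f by auto
 note d = gam[OF O(1)] and c = gam[OF O(2)]
 have "f*gam (dom f) : tsub (cod f)" using tors_mem[of "f*gam (dom f)"] d f by simp
 then obtain h where h: "arr h" "dom h = dom (f*gam (dom f))" "cod h = FO \<Gamma> (cod f)" "gam (cod f)*h = f*gam (dom f)"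
  by (rule gam_lift[OF O(2)])
 have hd: "dom h = FO \<Gamma> (dom f)" using h(2) d f by simp
 have "FA \<Gamma> f = h" unfolding Gamma_def cfunctor.simps
 proof (rule the_equality)
  show "h : hom (dom (gam (dom f))) (dom (gam (cod f))) & gam (cod f)*h = f*gam (dom f)"
   using h(1,3,4) hd c d by simp
  fix g assume g: "g : hom (dom (gam (dom f))) (dom (gam (cod f))) & gam (cod f)*g = f*gam (dom f)"
  hence "gam (cod f)*g = gam (cod f)*h" using h(4) by simp
  thus "g = h" by (rule mono_cancel[OF c(1)]) (use g h(1,3) c in auto)
 qed
 thus "arr (FA \<Gamma> f)" "dom (FA \<Gamma> f) = FO \<Gamma> (dom f)" "cod (FA \<Gamma> f) = FO \<Gamma> (cod f)"
  "gam (cod f)*FA \<Gamma> f = f*gam (dom f)" using h hd by auto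
qed

lemma Gamma_unique:
 assumes f: "arr f" and g: "arr g" "cod g = FO \<Gamma> (cod f)" "dom g = FO \<Gamma> (dom f)" "gam (cod f)*g = f*gam (dom f)"
 shows "FA \<Gamma> f = g"
proof -
 note G = Gamma_arr[OF f]
 have O: "obj (cod f)" using f by auto
 show ?thesis by (rule mono_cancel[OF gam(1)[OF O]]) (use G g gam[OF O] in auto)
qed

lemma Gamma_Obj: "obj M ==> obj (FO \<Gamma> M)" "obj M ==> FO \<Gamma> M : tors"
 using gam[of M] tors_Obj by auto

lemma additive_Gamma: "is_additive A A \<Gamma>"
 unfolding is_additive_def is_functor_def
proof (intro conjI ballI impI)
 show "obj (FO \<Gamma> X)" if "obj X" for X using Gamma_Obj that by auto
 show "FA \<Gamma> f : hom (FO \<Gamma> (dom f)) (FO \<Gamma> (cod f))" if "arr f" for f using Gamma_arr[OF that] by auto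
 show "FA \<Gamma> (idt X) = idt (FO \<Gamma> X)" if "obj X" for X
  by (rule Gamma_unique) (use gam[OF that] Gamma_Obj that in auto)
 show "FA \<Gamma> (g*f) = FA \<Gamma> g*FA \<Gamma> f" if fg: "arr f" "arr g" "cod f = dom g" for f g
 proof (rule Gamma_unique)
  note F = Gamma_arr[OF fg(1)] and G = Gamma_arr[OF fg(2)]
  have O: "obj (dom f)" "obj (cod f)" "obj (cod g)" using fg by auto
  note gd = gam[OF O(1)] gam[OF O(2)] gam[OF O(3)]
  have "gam (cod g)*(FA \<Gamma> g*FA \<Gamma> f) = g*(gam (cod f)*FA \<Gamma> f)"
   unfolding fg(3) by (rule Cmp_reassoc[OF G(4)]) (use F G gd fg in auto)
  also have "... = (g*f)*gam (dom f)" unfolding F(4) using gd fg by simp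
  finally show "gam (cod (g*f))*(FA \<Gamma> g*FA \<Gamma> f) = (g*f)*gam (dom (g*f))" using fg by simp
 qed (use fg Gamma_arr[OF fg(1)] Gamma_arr[OF fg(2)] in auto)
 show "FA \<Gamma> (f++g) = FA \<Gamma> f++FA \<Gamma> g" if X: "obj X" "obj Y" and f: "f : hom X Y" and g: "g : hom X Y" for X Y f g
 proof (rule Gamma_unique)
  have fa: "arr f" "dom f = X" "cod f = Y" "arr g" "dom g = X" "cod g = Y" using f g by auto
  note F = Gamma_arr[OF fa(1), unfolded fa] and G = Gamma_arr[OF fa(4), unfolded fa]
  have "gam Y*(FA \<Gamma> f++FA \<Gamma> g) = (f++g)*gam X"
   using F G fa gam[OF X(1)] gam[OF X(2)] by (simp add: Cmp_Add Add_Cmp)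
  thus "gam (cod (f++g))*(FA \<Gamma> f++FA \<Gamma> g) = (f++g)*gam (dom (f++g))" using fa by simp
  show "FA \<Gamma> f++FA \<Gamma> g : Arr A" "cod (FA \<Gamma> f++FA \<Gamma> g) = FO \<Gamma> (cod (f++g))" "dom (FA \<Gamma> f++FA \<Gamma> g) = FO \<Gamma> (dom (f++g))"
   using F G fa by auto
 qed (use f g in auto)
qed

end

locale stable_torsion = torsion + assumes stable: "locally_stable A"
begin

text \<open>The injective hull of the torsion part inside \<open>E\<close> is torsion by local
  stability, so it is not larger than the torsion part.\<close>

lemma injective_tsub:
 assumes E: "inject E" shows "inject (dom (inc (tsub E)))"
proof -
 have EO: "obj E" using E by (rule is_injective_Obj)
 note T = tsub_Sub[OF EO]
 obtain S where S: "S : Sub E" "ess E (tsub E) S" "inject (dom (inc S))" using ex_envelope[OF E T] by blast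
 obtain m where m: "is_injective_envelope A m" "dom m = dom (inc (tsub E))" "cod m = dom (inc S)"
  using ess_envelope[OF EO T S] by blast
 have "dom (inc S) : tors" using stable localizing_tors m tors_tsub[OF EO] unfolding locally_stable_def by metis
 hence "inc S : tsub E" using tors_mem[of "inc S"] inc[OF S(1)] by simp
 hence "S <= tsub E" using sv_le[OF T, of "inc S"] inc[OF S(1)] by simp
 hence "S = tsub E" using S(2) unfolding ess_def by blast
 thus ?thesis using S(3) by simp
qed

lemma injective_Gamma:
 assumes E: "inject E" shows "inject (FO \<Gamma> E)"
proof -
 have EO: "obj E" using E by (rule is_injective_Obj)
 note T = tsub_Sub[OF EO] and g = gam[OF EO]
 obtain h where h: "is_iso A h" "dom h = dom (gam E)" "cod h = dom (inc (tsub E))"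
  using sv_Cmp_mono_iso[OF g(1) inc(1)[OF T]] g(5) inc(4)[OF T] by auto
 show ?thesis using is_injective_iso[OF injective_tsub[OF E] h(1)] h g by simp
qed

text \<open>Supplies the torsion injectives for resolving a complex of torsion objects within the
  torsion class.\<close>

lemma tors_embed:
 assumes N: "N : tors"
 shows "EX a. mono a & dom a = N & inject (cod a) & cod a : tors"
proof -
 obtain a where a: "mono a" "dom a = N" "inject (cod a)" using enough_injectives[OF tors_Obj[OF N]] by blast
 have EO: "obj (cod a)" using a by simp
 have "a : tsub (cod a)" using tors_mem[of a] a N by simp
 then obtain h where h: "arr h" "dom h = dom a" "cod h = FO \<Gamma> (cod a)" "gam (cod a)*h = a" by (rule gam_lift[OF EO])
 have "mono h" by (rule mono_right[of "gam (cod a)"]) (use h a gam[OF EO] in auto)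
 thus ?thesis using h a(2) injective_Gamma[OF a(3)] Gamma_Obj[OF EO] by (intro exI[of _ h]) simp
qed

end

section \<open>Quotient categories and the homotopy category\<close>

locale quotient_category = category C for C :: "('o, 'm, 'z) acat_scheme" (structure) +
 fixes R :: "'m rel"
 assumes R_equiv: "equiv (Arr C) R"
  and R_Dom_Cod: "(f, g) : R ==> Dom C f = Dom C g & Cod C f = Cod C g"
  and R_Cmp: "(f, f') : R ==> (g, g') : R ==> Dom C g = Cod C f ==> (g*f, g'*f') : R"
begin

abbreviation "QC == quot_cat C R"

lemma R_self: "arr f ==> f : R `` {f}"
 using R_equiv by (rule equiv_class_self)

lemma R_class_eq: "arr f ==> arr g ==> R `` {f} = R `` {g} <-> (f, g) : R"
 using eq_equiv_class_iff[OF R_equiv] by blast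

lemma Obj_QC [simp]: "Obj QC = Obj C" by (simp add: quot_cat_def)

lemma Dom_Cod_QC [simp]:
 assumes f: "arr f" shows "Dom QC (R `` {f}) = dom f" "Cod QC (R `` {f}) = cod f"
proof -
 have "(SOME g. g : R `` {f}) : R `` {f}" by (rule someI[of _ f]) (rule R_self[OF f])
 thus "Dom QC (R `` {f}) = dom f" "Cod QC (R `` {f}) = cod f"
  using R_Dom_Cod unfolding quot_cat_def by force+
qed

lemma Arr_QC [simp]: "arr f ==> R `` {f} : Arr QC" by (simp add: quot_cat_def quotientI)

lemma QC_ArrE:
 assumes "a : Arr QC" obtains f where "arr f" "a = R `` {f}" "dom f = Dom QC a" "cod f = Cod QC a"
proof -
 obtain f where f: "arr f" "a = R `` {f}" using assms unfolding quot_cat_def by (auto elim: quotientE)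
 show ?thesis by (rule that[OF f]) (use f in simp_all)
qed

lemma Image_class:
 assumes f: "arr f" and S: "S <= R `` {f}" "S ~= {}" shows "R `` S = R `` {f}"
proof -
 have "R `` {g} = R `` {f}" if "g : S" for g
  using that S(1) f equiv_class_eq[OF R_equiv] by blast
 hence "(UN g:S. R `` {g}) = R `` {f}" using S(2) by auto
 thus ?thesis by blast
qed

lemma Cmp_QC [simp]:
 assumes "arr f" "arr g" "dom g = cod f"
 shows "Cmp QC (R `` {g}) (R `` {f}) = R `` {g*f}"
proof -
 have "R `` {g'*f' | f' g'. f' : R `` {f} & g' : R `` {g}} = R `` {g*f}"
 proof (rule Image_class)
  show "arr (g*f)" using assms by simp
  show "{g'*f' | f' g'. f' : R `` {f} & g' : R `` {g}} <= R `` {g*f}" using R_Cmp assms by auto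
  show "{g'*f' | f' g'. f' : R `` {f} & g' : R `` {g}} ~= {}" using R_self assms by blast
 qed
 thus ?thesis by (simp add: quot_cat_def)
qed

lemma Idt_QC: "Idt QC X = R `` {idt X}" by (simp add: quot_cat_def)

lemma category_QC: "category QC"
proof
 show "Dom QC a : Obj QC" "Cod QC a : Obj QC" if "a : Arr QC" for a
  using that by (auto elim!: QC_ArrE)
 show "Idt QC X : Hom QC X X" if "X : Obj QC" for X using that by (simp add: Idt_QC)
 show "Cmp QC b a : Hom QC X Z" if ab: "a : Hom QC X Y" "b : Hom QC Y Z" for a b X Y Z
 proof -
  obtain f where f: "arr f" "a = R `` {f}" "dom f = X" "cod f = Y" using ab(1) by (auto elim: QC_ArrE)
  obtain g where g: "arr g" "b = R `` {g}" "dom g = Y" "cod g = Z" using ab(2) by (auto elim: QC_ArrE)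
  show ?thesis using f g by simp
 qed
 show "Cmp QC a (Idt QC X) = a" "Cmp QC (Idt QC Y) a = a" if a: "a : Hom QC X Y" for a X Y
 proof -
  obtain f where f: "arr f" "a = R `` {f}" "dom f = X" "cod f = Y" using a by (auto elim: QC_ArrE)
  have "obj X" "obj Y" using f by auto
  thus "Cmp QC a (Idt QC X) = a" "Cmp QC (Idt QC Y) a = a" using f by (simp_all add: Idt_QC)
 qed
 show "Cmp QC c (Cmp QC b a) = Cmp QC (Cmp QC c b) a" if abc: "a : Hom QC X Y" "b : Hom QC Y Z" "c : Hom QC Z V" for a b c X Y Z V
 proof -
  obtain f where f: "arr f" "a = R `` {f}" "dom f = X" "cod f = Y" using abc(1) by (auto elim: QC_ArrE)
  obtain g where g: "arr g" "b = R `` {g}" "dom g = Y" "cod g = Z" using abc(2) by (auto elim: QC_ArrE)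
  obtain h where h: "arr h" "c = R `` {h}" "dom h = Z" "cod h = V" using abc(3) by (auto elim: QC_ArrE)
  show ?thesis using f g h by simp
 qed
qed

end

text \<open>Recursive construction of chain maps, homotopies and resolutions: \<open>x0\<close>
  gives the trivial values in low degrees, where a bounded below complex is zero, and the step
  extends them upwards.\<close>

lemma int_choice:
 fixes N :: int
 assumes base: "!!n. n <= N ==> P n (x0 n)" "!!n. n < N ==> R n (x0 n) (x0 (n+1))"
  and step: "!!n x. N <= n ==> P n x ==> EX y. P (n+1) y & R n x y"
 shows "EX x. (ALL n. P n (x n) & R n (x n) (x (n+1))) & (ALL n <= N. x n = x0 n)"
proof -
 have "EX f. ALL k. (P (N + int k) (f k) & (k = 0 --> f k = x0 N)) & R (N + int k) (f k) (f (Suc k))"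
 proof (rule dependent_nat_choice)
  show "EX x. P (N + int 0) x & (0 = 0 --> x = x0 N)" using base(1)[of N] by auto
  fix x k assume "P (N + int k) x & (k = 0 --> x = x0 N)"
  thus "EX y. (P (N + int (Suc k)) y & (Suc k = 0 --> y = x0 N)) & R (N + int k) x y"
   using step[of "N + int k" x] by (auto simp: add_ac)
 qed
 then obtain f where f: "!!k. P (N + int k) (f k)" "f 0 = x0 N" "!!k. R (N + int k) (f k) (f (Suc k))" by blast
 define x where "x n = (if n <= N then x0 n else f (nat (n - N)))" for n
 have xN: "x (N + int k) = f k" for k by (auto simp: x_def f(2))
 have "P n (x n) & R n (x n) (x (n+1))" for n
 proof (cases "n < N")
  case True thus ?thesis using base by (simp add: x_def)
 next
  case False
  define k where "k = nat (n - N)"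
  have n: "n = N + int k" "n+1 = N + int (Suc k)" using False by (auto simp: k_def)
  have "x n = f k" "x (n+1) = f (Suc k)" using xN[of k] xN[of "Suc k"] n by metis+
  thus ?thesis using f(1,3)[of k] n(1) by simp
 qed
 thus ?thesis by (intro exI[of _ x]) (auto simp: x_def)
qed

section \<open>Complexes, chain maps and homotopies\<close>

context abelian_category begin

abbreviation cx where "cx X == is_lb_complex C X"

lemma cxD [simp]:
 assumes "cx X"
 shows "obj (ob X n)" "arr (df X n)" "dom (df X n) = ob X n" "cod (df X n) = ob X (n+1)"
  "nul (df X (n+1)*df X n)"
proof -
 have a: "obj (ob X n) & df X n : hom (ob X n) (ob X (n+1)) & df X (n+1)*df X n = zer (ob X n) (ob X (n+1+1))" for n
  using assms unfolding is_lb_complex_def by blast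
 thus "obj (ob X n)" "arr (df X n)" "dom (df X n) = ob X n" "cod (df X n) = ob X (n+1)"
  "nul (df X (n+1)*df X n)" using a[of n] a[of "n+1"] a[of "n+1+1"] by auto
qed

lemma cx_dd: "cx X ==> nul (df X n*df X (n-1))"
 using cxD(5)[of X "n-1"] by simp

lemma cx_bound: "cx X ==> EX N. ALL n <= N. zero (ob X n)"
 unfolding is_lb_complex_def by (metis add_le_same_cancel1 add1_zle_eq diff_add_cancel zle_diff1_eq)

lemma cxI:
 assumes "!!n. obj (ob X n)" "!!n. arr (df X n)" "!!n. dom (df X n) = ob X n" "!!n. cod (df X n) = ob X (n+1)"
  "!!n. nul (df X (n+1)*df X n)" "!!n. n <= N ==> zero (ob X n)"
 shows "cx X"
 unfolding is_lb_complex_def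
proof (intro conjI allI)
 show "df X (n+1)*df X n = zer (ob X n) (ob X (n+1+1))" for n by (rule nul_eq[OF assms(5)]) (use assms in auto)
 show "EX N. ALL n<N. zero (ob X n)" using assms(6) by (intro exI[of _ N]) simp
qed (use assms in auto)

definition cm where
 "cm X Y f <-> cx X & cx Y & (ALL n. arr (f n) & dom (f n) = ob X n & cod (f n) = ob Y n & f (n+1)*df X n = df Y n*f n)"

lemma cmI:
 "cx X ==> cx Y ==> (!!n. arr (f n)) ==> (!!n. dom (f n) = ob X n) ==> (!!n. cod (f n) = ob Y n) ==>
  (!!n. f (n+1)*df X n = df Y n*f n) ==> cm X Y f"
 unfolding cm_def by simp

lemma cmD:
 assumes "cm X Y f"
 shows "cx X" "cx Y" "arr (f n)" "dom (f n) = ob X n" "cod (f n) = ob Y n" "f (n+1)*df X n = df Y n*f n"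
 using assms unfolding cm_def by auto

lemma cmD': "cm X Y f ==> f n*df X (n-1) = df Y (n-1)*f (n-1)"
 using cmD(6)[of X Y f "n-1"] by simp

lemma Arr_Ch: "(X, Y, f) : Arr (Ch C) <-> cm X Y f"
 unfolding cm_def Ch_def by auto

lemma Ch_simps [simp]: "Dom (Ch C) (X, Y, f) = X" "Cod (Ch C) (X, Y, f) = Y"
 "Cmp (Ch C) (Y', Z, g) (X, Y, f) = (X, Z, %n. g n*f n)" "Idt (Ch C) X = (X, X, %n. idt (ob X n))"
 "Obj (Ch C) = {X. cx X}"
 by (simp_all add: Ch_def)

lemma cm_Cmp: "cm X Y f ==> cm Y Z g ==> cm X Z (%n. g n*f n)"
proof (rule cmI)
 assume f: "cm X Y f" and g: "cm Y Z g"
 note F = cmD[OF f] and G = cmD[OF g]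
 show "g (n+1)*f (n+1)*df X n = df Z n*(g n*f n)" for n
  using F(1-5) G(1-5) F(6)[of n] Cmp_reassoc[OF G(6)[of n], of "f n"] by simp
qed (auto simp: cmD)

lemma cm_Idt: "cx X ==> cm X X (%n. idt (ob X n))"
 by (rule cmI) auto

lemma cm_Add: "cm X Y f ==> cm X Y g ==> cm X Y (%n. f n++g n)"
proof (rule cmI)
 assume f: "cm X Y f" and g: "cm X Y g"
 note F = cmD[OF f] and G = cmD[OF g]
 show "(f (n+1)++g (n+1))*df X n = df Y n*(f n++g n)" for n
  using F G by (simp add: Cmp_Add Add_Cmp)
qed (auto simp: cmD)

lemma cm_Neg: "cm X Y f ==> cm X Y (%n. neg (f n))"
proof (rule cmI)
 assume f: "cm X Y f"
 note F = cmD[OF f]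
 show "neg (f (n+1))*df X n = df Y n*neg (f n)" for n using F by simp
qed (auto simp: cmD)

lemma cm_Zer: "cx X ==> cx Y ==> cm X Y (%n. zer (ob X n) (ob Y n))"
 by (rule cmI) auto

lemma category_Ch: "category (Ch C)"
proof
 fix f assume "f : Arr (Ch C)"
 thus "Dom (Ch C) f : Obj (Ch C)" "Cod (Ch C) f : Obj (Ch C)" by (cases f; auto simp: Arr_Ch cm_def)+
next
 fix X assume "X : Obj (Ch C)" thus "Idt (Ch C) X : Hom (Ch C) X X" by (simp add: Arr_Ch cm_Idt)
next
 fix f g X Y Z assume "f : Hom (Ch C) X Y" "g : Hom (Ch C) Y Z"
 thus "Cmp (Ch C) g f : Hom (Ch C) X Z" by (cases f; cases g) (auto simp: Arr_Ch cm_Cmp)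
next
 fix f X Y assume "f : Hom (Ch C) X Y"
 thus "Cmp (Ch C) f (Idt (Ch C) X) = f" "Cmp (Ch C) (Idt (Ch C) Y) f = f" by (cases f; auto simp: Arr_Ch cm_def)+
next
 fix f g h X Y Z V assume "f : Hom (Ch C) X Y" "g : Hom (Ch C) Y Z" "h : Hom (Ch C) Z V"
 thus "Cmp (Ch C) h (Cmp (Ch C) g f) = Cmp (Ch C) (Cmp (Ch C) h g) f"
  by (cases f; cases g; cases h) (auto simp: Arr_Ch cm_def)
qed

definition nh where
 "nh X Y u <-> (EX h. ALL n. arr (h n) & dom (h n) = ob X n & cod (h n) = ob Y (n-1) &
   u n = df Y (n-1)*h n++h (n+1)*df X n)"

lemma nhI:
 "(!!n. arr (h n)) ==> (!!n. dom (h n) = ob X n) ==> (!!n. cod (h n) = ob Y (n-1)) ==>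
  (!!n. u n = df Y (n-1)*h n++h (n+1)*df X n) ==> nh X Y u"
 unfolding nh_def by blast

lemma nhE:
 assumes "nh X Y u" obtains h where "!!n. arr (h n)" "!!n. dom (h n) = ob X n" "!!n. cod (h n) = ob Y (n-1)"
  "!!n. u n = df Y (n-1)*h n++h (n+1)*df X n"
 using assms unfolding nh_def by blast

lemma nh_Neg:
 assumes "cx X" "cx Y" "nh X Y u" shows "nh X Y (%n. neg (u n))"
proof -
 obtain h where h: "!!n. arr (h n)" "!!n. dom (h n) = ob X n" "!!n. cod (h n) = ob Y (n-1)"
  "!!n. u n = df Y (n-1)*h n++h (n+1)*df X n" using nhE[OF assms(3)] by blast
 show ?thesis by (rule nhI[of "%n. neg (h n)"]) (use h assms(1,2) in "simp_all add: Neg_distrib")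
qed

lemma Add_4:
 assumes "arr a" "arr b" "arr c" "arr d" "dom b = dom a" "cod b = cod a" "dom c = dom a" "cod c = cod a" "dom d = dom a" "cod d = cod a"
 shows "(a++b)++(c++d) = (a++c)++(b++d)"
 using assms Add_left_commute[of b c d] by (simp add: Add_assoc)

lemma nh_Add:
 assumes "cx X" "cx Y" "nh X Y u" "nh X Y v" shows "nh X Y (%n. u n++v n)"
proof -
 obtain h where h: "!!n. arr (h n)" "!!n. dom (h n) = ob X n" "!!n. cod (h n) = ob Y (n-1)"
  "!!n. u n = df Y (n-1)*h n++h (n+1)*df X n" using nhE[OF assms(3)] by blast
 obtain k where k: "!!n. arr (k n)" "!!n. dom (k n) = ob X n" "!!n. cod (k n) = ob Y (n-1)"
  "!!n. v n = df Y (n-1)*k n++k (n+1)*df X n" using nhE[OF assms(4)] by blast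
 show ?thesis
 proof (rule nhI[of "%n. h n++k n"])
  show "u n++v n = df Y (n-1)*(h n++k n)++(h (n+1)++k (n+1))*df X n" for n
   unfolding h(4) k(4) using h(1-3) k(1-3) assms(1,2)
    Add_4[of "df Y (n-1)*h n" "h (n+1)*df X n" "df Y (n-1)*k n" "k (n+1)*df X n"]
   by (simp add: Cmp_Add Add_Cmp)
 qed (use h k in auto)
qed

lemma nh_Cmp:
 assumes g: "cm Y Z g" and u: "nh X Y u" and f: "cm W X f" shows "nh W Z (%n. g n*(u n*f n))"
proof -
 note F = cmD[OF f] and G = cmD[OF g]
 obtain h where h: "!!n. arr (h n)" "!!n. dom (h n) = ob X n" "!!n. cod (h n) = ob Y (n-1)"
  "!!n. u n = df Y (n-1)*h n++h (n+1)*df X n" using nhE[OF u] by blast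
 show ?thesis
 proof (rule nhI[of "%n. g (n-1)*(h n*f n)"])
  fix n
  have e1: "g n*(df Y (n-1)*(h n*f n)) = df Z (n-1)*(g (n-1)*(h n*f n))"
   by (rule Cmp_reassoc[OF cmD'[OF g]]) (use F G h in auto)
  show "g n*(u n*f n) = df Z (n-1)*(g (n-1)*(h n*f n))++g (n+1 - 1)*(h (n+1)*f (n+1))*df W n"
   unfolding h(4) e1[symmetric] using F(1-5) G(1-5) h(1-3) F(6)[of n] by (simp add: Cmp_Add Add_Cmp)
 qed (use F G h in auto)
qed

lemma homotopy_rel_iff:
 "((X, Y, f), (X', Y', g)) : homotopy_rel C <-> cm X Y f & cm X Y g & X' = X & Y' = Y & nh X Y (%n. f n++neg (g n))"
  (is "?L <-> ?R")
proof -
 let ?T = "%h. ALL n. arr (h n) & dom (h n) = ob X n & cod (h n) = ob Y (n-1)"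
 let ?H = "%h. ALL n. h n : hom (ob X n) (ob Y (n-1)) & f n = g n++(df Y (n-1)*h n++h (n+1)*df X n)"
 have key: "(EX h. ?H h) <-> nh X Y (%n. f n++neg (g n))" if F: "cm X Y f" and G: "cm X Y g"
 proof -
  note c = cmD[OF F] cmD[OF G]
  have e: "f n = g n++(df Y (n-1)*h n++h (n+1)*df X n) <-> f n++neg (g n) = df Y (n-1)*h n++h (n+1)*df X n"
   if t: "?T h" for h n
   by (rule Add_eq_iff) (use t c in auto)
  show ?thesis
  proof
   assume "EX h. ?H h"
   then obtain h where h: "?T h" "!!n. f n = g n++(df Y (n-1)*h n++h (n+1)*df X n)" by auto
   show "nh X Y (%n. f n++neg (g n))" by (rule nhI[of h]) (use h(1) e[OF h(1)] h(2) in blast)+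
  next
   assume "nh X Y (%n. f n++neg (g n))"
   then obtain h where h: "!!n. arr (h n)" "!!n. dom (h n) = ob X n" "!!n. cod (h n) = ob Y (n-1)"
    "!!n. f n++neg (g n) = df Y (n-1)*h n++h (n+1)*df X n" using nhE by blast
   have t: "?T h" using h by blast
   have "?H h" using t h(4) e[OF t] unfolding Hom_iff by blast
   thus "EX h. ?H h" by blast
  qed
 qed
 have "?L <-> cm X Y f & cm X' Y' g & X = X' & Y = Y' & (EX h. ?H h)"
  unfolding homotopy_rel_def by (simp add: Arr_Ch)
 also have "... <-> (X = X' & Y = Y') & cm X Y f & cm X Y g & (EX h. ?H h)" by auto
 also have "... <-> (X = X' & Y = Y') & cm X Y f & cm X Y g & nh X Y (%n. f n++neg (g n))" using key by (intro conj_cong refl)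
 finally show ?thesis by auto
qed

abbreviation "KK == Kplus C"

lemma quotient_Ch: "quotient_category (Ch C) (homotopy_rel C)"
proof -
 interpret Ch: category "Ch C" by (rule category_Ch)
 have refl: "(a, a) : homotopy_rel C" if "a : Arr (Ch C)" for a
 proof -
  obtain X Y f where a: "a = (X, Y, f)" using prod_cases3 by blast
  hence f: "cm X Y f" using that by (simp add: Arr_Ch)
  have "nh X Y (%n. f n++neg (f n))"
   by (rule nhI[of "%n. zer (ob X n) (ob Y (n-1))"]) (use cmD[OF f] in auto)
  thus ?thesis using f by (simp add: a homotopy_rel_iff)
 qed
 have sym: "(b, a) : homotopy_rel C" if ab: "(a, b) : homotopy_rel C" for a b
 proof -
  obtain X Y f X' Y' g where a: "a = (X, Y, f)" "b = (X', Y', g)" using prod_cases3 by metis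
  hence e: "X' = X" "Y' = Y" and f: "cm X Y f" and g: "cm X Y g" and n: "nh X Y (%n. f n++neg (g n))" using ab by (auto simp: homotopy_rel_iff)
  have "nh X Y (%n. neg (f n++neg (g n)))" by (rule nh_Neg[OF cmD(1,2)[OF f] n])
  moreover have "neg (f n++neg (g n)) = g n++neg (f n)" for n
   using cmD[OF f] cmD[OF g] Add_commute[of "neg (f n)" "g n"] by (simp add: Neg_distrib)
  ultimately show ?thesis using f g by (simp add: a e homotopy_rel_iff)
 qed
 have trans: "(a, c) : homotopy_rel C" if ab: "(a, b) : homotopy_rel C" and bc: "(b, c) : homotopy_rel C" for a b c
 proof -
  obtain X Y f X' Y' g X'' Y'' h where a: "a = (X, Y, f)" "b = (X', Y', g)" "c = (X'', Y'', h)" using prod_cases3 by metis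
  hence e: "X' = X" "Y' = Y" "X'' = X" "Y'' = Y" and f: "cm X Y f" and g: "cm X Y g" and h: "cm X Y h"
   and n: "nh X Y (%n. f n++neg (g n))" "nh X Y (%n. g n++neg (h n))" using ab bc by (auto simp: homotopy_rel_iff)
  have "nh X Y (%n. (f n++neg (g n))++(g n++neg (h n)))" by (rule nh_Add[OF cmD(1,2)[OF f] n])
  moreover have "(f n++neg (g n))++(g n++neg (h n)) = f n++neg (h n)" for n
   using cmD[OF f] cmD[OF g] cmD[OF h] by (simp add: Add_assoc)
  ultimately show ?thesis using f h by (simp add: a e homotopy_rel_iff)
 qed
 have cmp: "(Cmp (Ch C) b a, Cmp (Ch C) b' a') : homotopy_rel C"
  if aa: "(a, a') : homotopy_rel C" and bb: "(b, b') : homotopy_rel C" and d: "Dom (Ch C) b = Cod (Ch C) a" for a a' b b'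
 proof -
  obtain X Y f X' Y' f' where a: "a = (X, Y, f)" "a' = (X', Y', f')" using prod_cases3 by metis
  obtain Y1 Z g Y1' Z' g' where b: "b = (Y1, Z, g)" "b' = (Y1', Z', g')" using prod_cases3 by metis
  have e: "X' = X" "Y' = Y" "Y1 = Y" "Y1' = Y" "Z' = Z" and f: "cm X Y f" "cm X Y f'" and g: "cm Y Z g" "cm Y Z g'"
   and n: "nh X Y (%n. f n++neg (f' n))" "nh Y Z (%n. g n++neg (g' n))"
   using aa bb d by (auto simp: a b homotopy_rel_iff)
  note ff = cmD[OF f(1)] cmD[OF f(2)] cmD[OF g(1)] cmD[OF g(2)]
  have 1: "nh X Z (%n. idt (ob Z n)*((g n++neg (g' n))*f n))"
   by (rule nh_Cmp[OF cm_Idt n(2) f(1)]) (use ff in auto)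
  have 2: "nh X Z (%n. g' n*((f n++neg (f' n))*idt (ob X n)))"
   by (rule nh_Cmp[OF g(2) n(1) cm_Idt]) (use ff in auto)
  have eq: "idt (ob Z n)*((g n++neg (g' n))*f n)++g' n*((f n++neg (f' n))*idt (ob X n)) = g n*f n++neg (g' n*f' n)" for n
   using ff by (simp add: Cmp_Add Add_Cmp Add_assoc)
  have "nh X Z (%n. g n*f n++neg (g' n*f' n))" using nh_Add[OF ff(1) ff(14) 1 2] unfolding eq by simp
  thus ?thesis using cm_Cmp f g by (simp add: a b e homotopy_rel_iff)
 qed
 show ?thesis
 proof
  have "homotopy_rel C <= Arr (Ch C) \<times> Arr (Ch C)" by (auto simp: homotopy_rel_iff Arr_Ch)
  thus "equiv (Arr (Ch C)) (homotopy_rel C)"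
   using refl sym trans unfolding equiv_def refl_on_def sym_on_def trans_def by blast
  show "Dom (Ch C) f = Dom (Ch C) g & Cod (Ch C) f = Cod (Ch C) g" if "(f, g) : homotopy_rel C" for f g
   using that by (cases f; cases g) (auto simp: homotopy_rel_iff)
 qed (rule cmp)
qed

definition kc where "kc X Y f = homotopy_rel C `` {(X, Y, f)}"

lemma K_cat: "category KK" unfolding Kplus_def by (rule quotient_category.category_QC[OF quotient_Ch])

lemma Obj_K [simp]: "Obj KK = {X. cx X}"
 unfolding Kplus_def using quotient_category.Obj_QC[OF quotient_Ch] by simp

lemma kc [simp]:
 assumes "cm X Y f" shows "kc X Y f : Arr KK" "Dom KK (kc X Y f) = X" "Cod KK (kc X Y f) = Y"
 using quotient_category.Arr_QC[OF quotient_Ch, of "(X, Y, f)"] quotient_category.Dom_Cod_QC[OF quotient_Ch, of "(X, Y, f)"] assms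
 by (simp_all add: Kplus_def kc_def Arr_Ch)

lemma K_ArrE:
 assumes "a : Arr KK" "Dom KK a = X" "Cod KK a = Y" obtains f where "cm X Y f" "a = kc X Y f"
proof -
 obtain f where f: "f : Arr (Ch C)" "a = homotopy_rel C `` {f}" "Dom (Ch C) f = X" "Cod (Ch C) f = Y"
  using quotient_category.QC_ArrE[OF quotient_Ch, of a] assms unfolding Kplus_def by blast
 obtain X' Y' g where g: "f = (X', Y', g)" using prod_cases3 by blast
 show ?thesis by (rule that[of g]) (use f g in "simp_all add: kc_def Arr_Ch")
qed

lemma kc_Cmp [simp]: "cm X Y f ==> cm Y Z g ==> Cmp KK (kc Y Z g) (kc X Y f) = kc X Z (%n. g n*f n)"
 using quotient_category.Cmp_QC[OF quotient_Ch, of "(X, Y, f)" "(Y, Z, g)"] by (simp add: Kplus_def kc_def Arr_Ch)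

lemma kc_Idt: "Idt KK X = kc X X (%n. idt (ob X n))"
 using quotient_category.Idt_QC[OF quotient_Ch, of X] by (simp add: Kplus_def kc_def)

lemma kc_eq: "cm X Y f ==> cm X Y g ==> kc X Y f = kc X Y g <-> nh X Y (%n. f n++neg (g n))"
 using quotient_category.R_class_eq[OF quotient_Ch, of "(X, Y, f)" "(X, Y, g)"] by (simp add: kc_def Arr_Ch homotopy_rel_iff)

text \<open>Test of exactness of the mapping cone of \<open>s\<close> by maps into the objects \<open>E\<close>.\<close>

definition cex where
 "cex \<E> X Y s <-> (ALL E : \<E>. ALL n a b. a : hom (ob X (n+1)) E --> b : hom (ob Y n) E --> nul (b*df Y (n-1)) --> b*s n = a*df X n -->
  (EX c : hom (ob Y (n+1)) E. EX h : hom (ob X (n+1+1)) E. b = c*df Y n & a = c*s (n+1)++h*df X (n+1)))"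

lemma cexD:
 assumes "cex \<E> X Y s" "E : \<E>" "arr a" "dom a = ob X (n+1)" "cod a = E" "arr b" "dom b = ob Y n" "cod b = E"
  "nul (b*df Y (n-1))" "b*s n = a*df X n"
 obtains c h where "arr c" "dom c = ob Y (n+1)" "cod c = E" "arr h" "dom h = ob X (n+1+1)" "cod h = E"
  "b = c*df Y n" "a = c*s (n+1)++h*df X (n+1)"
proof -
 have "EX c : hom (ob Y (n+1)) E. EX h : hom (ob X (n+1+1)) E. b = c*df Y n & a = c*s (n+1)++h*df X (n+1)"
  using assms unfolding cex_def by (metis Hom_iff)
 thus ?thesis using that by auto
qed

lemma zero_eq: "zero Z ==> arr f ==> arr g ==> dom f = dom g ==> cod f = cod g ==> dom f = Z | cod f = Z ==> f = g"
 using zero_nul[of Z f] zero_nul[of Z g] by (metis nul_def)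

text \<open>The chain map \<open>g\<close> and the homotopy are built degree by degree; the
  obstruction to the next step is a cocycle of the cone with values in a term of \<open>J\<close>,
  which \<open>cex\<close> makes a coboundary.\<close>

lemma cex_lift:
 assumes s: "cm X Y s" and J: "cx J" and ex: "cex (range (ob J)) X Y s" and f: "cm X J f"
 shows "EX g. cm Y J g & nh X J (%n. f n++neg (g n*s n))"
proof -
 note S = cmD[OF s] and F = cmD[OF f]
 note X = cxD[OF S(1)] and Y = cxD[OF S(2)] and Jx = cxD[OF J]
 obtain N where N: "!!n. n <= N ==> zero (ob J n)" using cx_bound[OF J] by blast
 \<comment> \<open>The state in degree \<open>n\<close> consists of \<open>g\<close> in degree
   \<open>n\<close> and of the homotopy leaving degree \<open>n + 1\<close> of \<open>X\<close>. The
   two equations are those that make the next obstruction a cocycle.\<close>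
 define P where "P n p <-> (case p of (g, h) => g : Arr C & dom g = ob Y n & cod g = ob J n & arr h & dom h = ob X (n+1) & cod h = ob J n &
  nul (df J n*(g*df Y (n-1))) & df J n*f n = df J n*(g*s n)++df J n*(h*df X n))" for n p
 define R where "R n p p' <-> (case p of (g, h) => case p' of (g', h') => g'*df Y n = df J n*g &
  f (n+1) = g'*s (n+1)++(df J n*h++h'*df X (n+1)))" for n p p'
 define x0 where "x0 n = (zer (ob Y n) (ob J n), zer (ob X (n+1)) (ob J n))" for n
 have "EX x. (ALL n. P n (x n) & R n (x n) (x (n+1))) & (ALL n <= N. x n = x0 n)"
 proof (rule int_choice)
  show "P n (x0 n)" if "n <= N" for n
   unfolding P_def x0_def prod.case using X Y Jx F(3-5) S(3-5) zero_nul[OF N[OF that], of "df J n"] nul_eq[of "df J n*f n" "ob X n" "ob J (n+1)"]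
   by simp
  show "R n (x0 n) (x0 (n+1))" if "n < N" for n
  proof -
   have z: "zero (ob J (n+1))" using N that by simp
   have "f (n+1) = zer (ob X (n+1)) (ob J (n+1))" by (rule nul_eq[OF zero_nul[OF z]]) (use F in auto)
   thus ?thesis unfolding R_def x0_def prod.case using X Y Jx S(3-5) by simp
  qed
  fix n p assume "N <= n" "P n p"
  obtain g h where p: "p = (g, h)" by fastforce
  have g: "arr g" "dom g = ob Y n" "cod g = ob J n" and h: "arr h" "dom h = ob X (n+1)" "cod h = ob J n"
   and n1: "nul (df J n*(g*df Y (n-1)))" and e1: "df J n*f n = df J n*(g*s n)++df J n*(h*df X n)"
   using \<open>P n p\<close> unfolding P_def p by auto
  \<comment> \<open>The pair \<open>(?a, ?b)\<close> is a cocycle on the cone; writing it as a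
    coboundary gives the new components \<open>c\<close> and \<open>k\<close>.\<close>
  let ?a = "f (n+1)++neg (df J n*h)" and ?b = "df J n*g"
  have a: "arr ?a" "dom ?a = ob X (n+1)" "cod ?a = ob J (n+1)" using F h Jx by auto
  have b: "arr ?b" "dom ?b = ob Y n" "cod ?b = ob J (n+1)" using g Jx by auto
  have bd: "nul (?b*df Y (n-1))" using n1 g Jx Y(2-4)[of "n-1"] by simp
  have "?a*df X n = df J n*f n++neg (df J n*(h*df X n))" using F h Jx X by (simp add: Add_Cmp)
  also have "... = df J n*(g*s n)" unfolding e1 using F g h S Jx X by (simp add: Add_assoc)
  finally have bs: "?b*s n = ?a*df X n" using g S Jx by simp
  obtain c k where c: "arr c" "dom c = ob Y (n+1)" "cod c = ob J (n+1)" and k: "arr k" "dom k = ob X (n+1+1)" "cod k = ob J (n+1)"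
   and e: "?b = c*df Y n" "?a = c*s (n+1)++k*df X (n+1)"
   by (rule cexD[OF ex _ a b bd bs]) auto
  have fe: "f (n+1) = c*s (n+1)++(df J n*h++k*df X (n+1))"
  proof -
   have "f (n+1) = df J n*h++(c*s (n+1)++k*df X (n+1))" unfolding Add_eq_iff[of "f (n+1)" "df J n*h"]
    by (subst Add_eq_iff) (use F h Jx c k S X e(2) in auto)
   also have "... = c*s (n+1)++(df J n*h++k*df X (n+1))" by (rule Add_left_commute) (use h Jx c k S X in auto)
   finally show ?thesis .
  qed
  have "R n p (c, k)" unfolding R_def p prod.case using e(1) fe by simp
  moreover have "P (n+1) (c, k)" unfolding P_def prod.case
  proof (intro conjI c k)
   have "df J (n+1)*(c*df Y n) = (df J (n+1)*df J n)*g" unfolding e(1)[symmetric] using g Jx by simp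
   thus "nul (df J (n+1)*(c*df Y (n+1 - 1)))" using nul_Cmp_left[OF Jx(5)[of n], of g] g Jx by simp
   have "nul (df J (n+1)*(df J n*h))" using Jx h by simp
   thus "df J (n+1)*f (n+1) = df J (n+1)*(c*s (n+1))++df J (n+1)*(k*df X (n+1))"
    unfolding fe using Jx h c k S X nul_Add[of "df J (n+1)*(df J n*h)" "df J (n+1)*(k*df X (n+1))"]
    by (simp add: Cmp_Add)
  qed
  ultimately show "EX p'. P (n+1) p' & R n p p'" by blast
 qed
 then obtain x where x: "!!n. P n (x n)" "!!n. R n (x n) (x (n+1))" by blast
 define g where "g n = fst (x n)" for n
 define h where "h n = snd (x (n-1))" for n
 have gp: "arr (g n)" "dom (g n) = ob Y n" "cod (g n) = ob J n" for n using x(1)[of n] unfolding P_def g_def by (auto split: prod.splits)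
 have hp: "arr (h n)" "dom (h n) = ob X n" "cod (h n) = ob J (n-1)" for n using x(1)[of "n-1"] unfolding P_def h_def by (auto split: prod.splits)
 have r1: "g (n+1)*df Y n = df J n*g n" for n using x(2)[of n] unfolding R_def g_def by (auto split: prod.splits)
 have r2: "f n = g n*s n++(df J (n-1)*h n++h (n+1)*df X n)" for n
  using x(2)[of "n-1"] unfolding R_def g_def h_def by (auto split: prod.splits)
 have "cm Y J g" by (rule cmI) (use gp r1 S J in auto)
 moreover have "nh X J (%n. f n++neg (g n*s n))"
  by (rule nhI[of h]) (use hp Add_eq_iff[THEN iffD1, OF _ _ _ _ _ _ _ r2] gp S F X Jx in auto)
 ultimately show ?thesis by blast
qed

text \<open>The homotopy \<open>h\<close> for \<open>u\<close> is built together with a second order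
  correction \<open>l\<close>, which compares the given homotopy \<open>k\<close> for
  \<open>u*s\<close> with \<open>h*s\<close> and keeps the induction going.\<close>

lemma cex_null:
 assumes s: "cm X Y s" and J: "cx J" and ex: "cex (range (ob J)) X Y s" and u: "cm Y J u" and us: "nh X J (%n. u n*s n)"
 shows "nh Y J u"
proof -
 note S = cmD[OF s] and U = cmD[OF u]
 note X = cxD[OF S(1)] and Y = cxD[OF S(2)] and Jx = cxD[OF J]
 obtain k where k: "!!n. arr (k n)" "!!n. dom (k n) = ob X n" "!!n. cod (k n) = ob J (n-1)"
  "!!n. u n*s n = df J (n-1)*k n++k (n+1)*df X n" using nhE[OF us] by blast
 have k': "cod (k (n+1)) = ob J n" "cod (k (n+1+1)) = ob J (n+1)" for n using k(3)[of "n+1"] k(3)[of "n+1+1"] by (simp_all only: add_diff_cancel_right')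
 obtain N where N: "!!n. n <= N ==> zero (ob J n)" using cx_bound[OF J] by blast
 define P where "P n p <-> (case p of (h, l) => h : Arr C & dom h = ob Y (n+1) & cod h = ob J n & arr l & dom l = ob X (n+1+1) & cod l = ob J n &
  df J n*u n = df J n*(h*df Y n) & df J n*k (n+1) = df J n*(h*s (n+1))++df J n*(l*df X (n+1)))" for n p
 define R where "R n p p' <-> (case p of (h, l) => case p' of (h', l') => u (n+1) = df J n*h++h'*df Y (n+1))" for n and p p' :: "'m \<times> 'm"
 define x0 where "x0 n = (zer (ob Y (n+1)) (ob J n), zer (ob X (n+1+1)) (ob J n))" for n
 have "EX x. (ALL n. P n (x n) & R n (x n) (x (n+1))) & (ALL n <= N. x n = x0 n)"
 proof (rule int_choice)
  show "P n (x0 n)" if "n <= N" for n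
   unfolding P_def x0_def prod.case
   using X Y Jx U(3-5) S(3-5) zero_nul[OF N[OF that], of "df J n"] nul_eq[of "df J n*u n" "ob Y n" "ob J (n+1)"]
    nul_eq[of "df J n*k (n+1)" "ob X (n+1)" "ob J (n+1)"] k(1,2) k'
   by simp
  show "R n (x0 n) (x0 (n+1))" if "n < N" for n
  proof -
   have z: "zero (ob J (n+1))" using N that by simp
   have "u (n+1) = zer (ob Y (n+1)) (ob J (n+1))" by (rule nul_eq[OF zero_nul[OF z]]) (use U in auto)
   thus ?thesis unfolding R_def x0_def prod.case using X Y Jx by simp
  qed
  fix n p assume "N <= n" "P n p"
  obtain h l where p: "p = (h, l)" by fastforce
  have h: "arr h" "dom h = ob Y (n+1)" "cod h = ob J n" and l: "arr l" "dom l = ob X (n+1+1)" "cod l = ob J n"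
   and e1: "df J n*u n = df J n*(h*df Y n)" and e2: "df J n*k (n+1) = df J n*(h*s (n+1))++df J n*(l*df X (n+1))"
   using \<open>P n p\<close> unfolding P_def p by auto
  let ?a = "k (n+1+1)++df J n*l" and ?b = "u (n+1)++neg (df J n*h)"
  have a: "arr ?a" "dom ?a = ob X (n+1+1)" "cod ?a = ob J (n+1)" using k(1,2) k' l Jx by auto
  have b: "arr ?b" "dom ?b = ob Y (n+1)" "cod ?b = ob J (n+1)" using U h Jx by auto
  have "?b*df Y n = df J n*u n++neg (df J n*(h*df Y n))" using U h Jx Y by (simp add: Add_Cmp)
  also have "... = zer (ob Y n) (ob J (n+1))" unfolding e1 using h Jx Y by simp
  finally have bd: "nul (?b*df Y (n+1 - 1))" using Y Jx by simp
  have "?b*s (n+1) = u (n+1)*s (n+1)++neg (df J n*(h*s (n+1)))" using U h Jx S by (simp add: Add_Cmp)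
  also have "u (n+1)*s (n+1) = df J n*k (n+1)++k (n+1+1)*df X (n+1)" using k(4)[of "n+1"] by simp
  also have "... = (df J n*(h*s (n+1))++df J n*(l*df X (n+1)))++k (n+1+1)*df X (n+1)" unfolding e2 ..
  also have "...++neg (df J n*(h*s (n+1))) = df J n*(l*df X (n+1))++k (n+1+1)*df X (n+1)"
   using h l S Jx X k(1,2) k' Add_commute[of "df J n*(h*s (n+1))++(df J n*(l*df X (n+1))++k (n+1+1)*df X (n+1))" "neg (df J n*(h*s (n+1)))"]
   by (simp add: Add_assoc)
  also have "... = ?a*df X (n+1)" using l Jx X k(1,2) k' Add_commute[of "df J n*(l*df X (n+1))" "k (n+1+1)*df X (n+1)"]
   by (simp add: Add_Cmp)
  finally have bs: "?b*s (n+1) = ?a*df X (n+1)" .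
  obtain c m where c: "arr c" "dom c = ob Y (n+1+1)" "cod c = ob J (n+1)" and m: "arr m" "dom m = ob X (n+1+1 + 1)" "cod m = ob J (n+1)"
   and e: "?b = c*df Y (n+1)" "?a = c*s (n+1+1)++m*df X (n+1+1)"
   by (rule cexD[OF ex _ a b bd bs]) auto
  have ue: "u (n+1) = df J n*h++c*df Y (n+1)"
   by (subst Add_eq_iff) (use U h Jx c Y e(1) in auto)
  have "R n p (c, m)" unfolding R_def p prod.case by (rule ue)
  moreover have "P (n+1) (c, m)" unfolding P_def prod.case
  proof (intro conjI c m)
   have "nul (df J (n+1)*(df J n*h))" using Jx h by simp
   thus "df J (n+1)*u (n+1) = df J (n+1)*(c*df Y (n+1))"
    unfolding ue using Jx h c Y nul_Add[of "df J (n+1)*(df J n*h)" "df J (n+1)*(c*df Y (n+1))"] by (simp add: Cmp_Add)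
   have "nul (df J (n+1)*(df J n*l))" using Jx l by simp
   hence "df J (n+1)*?a = df J (n+1)*k (n+1+1)"
    using Jx l k(1,2) k' nul_Add_right[of "df J (n+1)*(df J n*l)" "df J (n+1)*k (n+1+1)"] by (simp add: Cmp_Add)
   thus "df J (n+1)*k (n+1+1) = df J (n+1)*(c*s (n+1+1))++df J (n+1)*(m*df X (n+1+1))"
    unfolding e(2) using Jx c m S X by (simp add: Cmp_Add)
  qed
  ultimately show "EX p'. P (n+1) p' & R n p p'" by blast
 qed
 then obtain x where x: "!!n. P n (x n)" "!!n. R n (x n) (x (n+1))" by blast
 define h where "h n = fst (x (n-1))" for n
 have hp: "arr (h n)" "dom (h n) = ob Y n" "cod (h n) = ob J (n-1)" for n using x(1)[of "n-1"] unfolding P_def h_def by (auto split: prod.splits)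
 have r: "u n = df J (n-1)*h n++h (n+1)*df Y n" for n
  using x(2)[of "n-1"] unfolding R_def h_def by (auto split: prod.splits)
 show ?thesis by (rule nhI[of h]) (use hp r in auto)
qed

lemma inj_factor:
 assumes E: "inject E" and f: "arr f" and y: "arr y" "dom y = dom f" "cod y = E" and k: "kr f <= kr y"
 obtains y' where "arr y'" "dom y' = cod f" "cod y' = E" "y'*f = y"
proof -
 obtain m e where m: "mono m" "epi e" "dom e = dom f" "cod e = dom m" "cod m = cod f" and fe: "f = m*e"
  using ex_image[OF f] by blast
 have "kr e <= kr y"
 proof
  fix x assume "x : kr e"
  hence "x : kr f" unfolding fe using m by simp
  thus "x : kr y" using k by blast
 qed
 then obtain g where g: "arr g" "dom g = cod e" "cod g = E" "g*e = y" using epi_factor[of e y] m y by metis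
 obtain y' where y': "arr y'" "dom y' = cod m" "cod y' = E" "y'*m = g"
  by (rule is_injectiveD[OF E m(1) g(1) _ g(3)]) (use g m in auto)
 have "y'*f = y" unfolding fe using Cmp_assoc_simp[of e m y'] y' m g by simp
 thus ?thesis using that y' m by simp
qed

section \<open>Cohomology and quasi-isomorphisms tested by injective objects\<close>

lemma cohE:
 assumes X: "cx X" and c: "is_cohomology C X n k q"
 obtains b where "mono k" "arr k" "cod k = ob X n" "sv k = kr (df X n)" "nul (df X n*k)" "arr b" "dom b = ob X (n-1)" "cod b = dom k" "k*b = df X (n-1)"
  "is_cokernel C q b" "epi q" "arr q" "dom q = dom k" "nul (q*b)"
proof -
 obtain b where k: "is_kernel C k (df X n)" and b: "arr b" "dom b = ob X (n-1)" "cod b = dom k" "k*b = df X (n-1)" "is_cokernel C q b"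
  using c unfolding is_cohomology_def by auto
 have "mono k & cod k = ob X n & sv k = kr (df X n)" using kernel_sv[OF k] X by auto
 moreover have "nul (df X n*k)" using sv_self[of k] calculation by auto
 moreover have q: "arr q" "dom q = dom k" "q*b = zer (dom b) (cod q)" using b unfolding is_cokernel_def by auto
 moreover have "nul (q*b)" unfolding q(3) using b(1) q(1) by simp
 ultimately show ?thesis using that b cokernel_epi[OF b(5)] by simp
qed

lemma coh_ex: assumes X: "cx X" shows "EX k q. is_cohomology C X n k q"
proof -
 obtain k where k: "mono k" "cod k = ob X n" "sv k = kr (df X n)" using ex_ker[of "df X n"] X by auto
 have "df X (n-1) : sv k" unfolding k(3) using X cx_dd[OF X, of n] cxD(4)[OF X, of "n-1"] by simp
 then obtain b where b: "arr b" "cod b = dom k" "df X (n-1) = k*b" by (rule svE)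
 have "dom b = ob X (n-1)" using cxD(3)[OF X, of "n-1"] Cmp_simps(2)[of b k] b k by simp
 moreover obtain q where "is_cokernel C q b" using ex_coker b by blast
 moreover have "is_kernel C k (df X n)" by (rule kernelI[OF k(1) _ _ k(3)]) (use X k in auto)
 ultimately show ?thesis unfolding is_cohomology_def using b by (intro exI[of _ k] exI[of _ q] conjI bexI[of _ b]) simp_all
qed

text \<open>For injective \<open>E\<close>, arrows from the cohomology object to \<open>E\<close>
  correspond to arrows on the term in degree \<open>n\<close> that kill the incoming differential,
  modulo those that factor through the outgoing one: \<open>coh_up\<close>, \<open>coh_down\<close>
  and \<open>coh_zero\<close> are the pieces of this duality.\<close>

lemma coh_up:
 assumes X: "cx X" and c: "is_cohomology C X n k q" and y: "arr y" "dom y = ob X n" "nul (y*df X (n-1))"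
 obtains be where "arr be" "dom be = cod q" "cod be = cod y" "be*q = y*k"
proof (rule cohE[OF X c])
 fix b assume b: "mono k" "arr k" "cod k = ob X n" "sv k = kr (df X n)" "arr b" "dom b = ob X (n-1)" "cod b = dom k" "k*b = df X (n-1)"
  "is_cokernel C q b" "epi q" "arr q" "dom q = dom k" "nul (q*b)"
 have "nul ((y*k)*b)" using b y by simp
 from cokernel_factor[OF b(9) _ _ this b(5)] show ?thesis using that b y by auto
qed

lemma coh_down:
 assumes X: "cx X" and c: "is_cohomology C X n k q" and E: "inject E" and be: "arr be" "dom be = cod q" "cod be = E"
 obtains y where "arr y" "dom y = ob X n" "cod y = E" "nul (y*df X (n-1))" "y*k = be*q"
proof (rule cohE[OF X c])
 fix b assume b: "mono k" "arr k" "cod k = ob X n" "sv k = kr (df X n)" "arr b" "dom b = ob X (n-1)" "cod b = dom k" "k*b = df X (n-1)"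
  "is_cokernel C q b" "epi q" "arr q" "dom q = dom k" "nul (q*b)"
 obtain y where y: "arr y" "dom y = cod k" "cod y = E" "y*k = be*q"
  by (rule is_injectiveD[OF E b(1), of "be*q"]) (use b be in auto)
 have "y*df X (n-1) = be*(q*b)" unfolding b(8)[symmetric] using Cmp_assoc_simp[of b k y] y(1,2,4) b(2,3,5,7,11,12) be(1,2) by simp
 hence "nul (y*df X (n-1))" using nul_Cmp_right[OF b(13), of be] b(5,7,11,12) be(1,2) by simp
 thus ?thesis using that y b by auto
qed

lemma coh_zero:
 assumes X: "cx X" and c: "is_cohomology C X n k q" and E: "inject E" and y: "arr y" "dom y = ob X n" "cod y = E" "nul (y*k)"
 obtains y' where "arr y'" "dom y' = ob X (n+1)" "cod y' = E" "y'*df X n = y"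
proof (rule cohE[OF X c])
 fix b assume b: "arr k" "cod k = ob X n" "sv k = kr (df X n)"
 have "kr (df X n) <= kr y" unfolding b(3)[symmetric]
 proof
  fix x assume "x : sv k"
  then obtain h where h: "arr h" "cod h = dom k" "x = k*h" by (rule svE)
  have "nul (y*(k*h))" by (rule nul_Cmp_left2[OF y(4)]) (use h y b in auto)
  thus "x : kr y" using h y b by simp
 qed
 from inj_factor[OF E _ y(1) _ y(3) this] show ?thesis using that y X by auto
qed

text \<open>Quasi-isomorphism, expressed by exactness of the cone under arrows into injectives. No
  cohomology objects have to be chosen, and closure under composition and shift is a direct
  computation.\<close>

definition coqis where "coqis X Y s <-> cm X Y s & cex {E. inject E} X Y s"

lemma coqis_cm: "coqis X Y s ==> cm X Y s" by (simp add: coqis_def)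

lemma coqis_Idt: assumes X: "cx X" shows "coqis X X (%n. idt (ob X n))"
 unfolding coqis_def cex_def
proof (intro conjI ballI allI impI cm_Idt X)
 fix E n a b assume ab: "E : {E. inject E}" "a : hom (ob X (n+1)) E" "b : hom (ob X n) E" "b*idt (ob X n) = a*df X n"
 have E: "obj E" using ab by auto
 show "EX c : hom (ob X (n+1)) E. EX h : hom (ob X (n+1+1)) E. b = c*df X n & a = c*idt (ob X (n+1))++h*df X (n+1)"
  by (rule bexI[of _ a], rule bexI[of _ "zer (ob X (n+1+1)) E"]) (use ab X E in auto)
qed

lemma coqis_Cmp:
 assumes s: "coqis X Y s" and t: "coqis Y Z t" shows "coqis X Z (%n. t n*s n)"
proof -
 have S: "cm X Y s" "cex {E. inject E} X Y s" and T: "cm Y Z t" "cex {E. inject E} Y Z t" using s t unfolding coqis_def by auto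
 note s = cmD[OF S(1)] and t = cmD[OF T(1)]
 note X = cxD[OF s(1)] and Y = cxD[OF s(2)] and Z = cxD[OF t(2)]
 show ?thesis unfolding coqis_def cex_def
 proof (intro conjI ballI allI impI cm_Cmp[OF S(1) T(1)])
  fix E n a b assume E: "E : {E. inject E}" and ab: "a : hom (ob X (n+1)) E" "b : hom (ob Z n) E" and bd: "nul (b*df Z (n-1))"
   and e: "b*(t n*s n) = a*df X n"
  hence ab: "arr a" "dom a = ob X (n+1)" "cod a = E" "arr b" "dom b = ob Z n" "cod b = E" by auto
  have b1: "arr (b*t n)" "dom (b*t n) = ob Y n" "cod (b*t n) = E" using ab t by auto
  have "(b*t n)*df Y (n-1) = b*(df Z (n-1)*t (n-1))" using ab t Y(2-4) Y(4)[of "n-1"] cmD'[OF T(1), of n] by simp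
  also have "nul ..." using nul_Cmp_left2[OF bd, of "t (n-1)"] ab t Z(2,3) Z(4)[of "n-1"] by simp
  finally have n1: "nul ((b*t n)*df Y (n-1))" .
  have e1: "(b*t n)*s n = a*df X n" using e ab t s by simp
  obtain c h where c: "arr c" "dom c = ob Y (n+1)" "cod c = E" and h: "arr h" "dom h = ob X (n+1+1)" "cod h = E"
   and e2: "b*t n = c*df Y n" "a = c*s (n+1)++h*df X (n+1)"
   by (rule cexD[OF S(2) E ab(1-3) b1 n1 e1])
  obtain c' h' where c': "arr c'" "dom c' = ob Z (n+1)" "cod c' = E" and h': "arr h'" "dom h' = ob Y (n+1+1)" "cod h' = E"
   and e3: "b = c'*df Z n" "c = c'*t (n+1)++h'*df Y (n+1)"
   by (rule cexD[OF T(2) E c ab(4-6) bd e2(1)])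
  have "a = c'*(t (n+1)*s (n+1))++(h'*s (n+1+1)++h)*df X (n+1)"
   unfolding e2(2) e3(2) using c' h' h s(1-5) t(1-5) X Y s(6)[of "n+1"] by (simp add: Add_Cmp Add_assoc)
  moreover have "h'*s (n+1+1)++h : hom (ob X (n+1+1)) E" using h h' s by simp
  ultimately show "EX c : hom (ob Z (n+1)) E. EX h : hom (ob X (n+1+1)) E. b = c*df Z n & a = c*(t (n+1)*s (n+1))++h*df X (n+1)"
   using c' e3(1) by (intro bexI[of _ c'] bexI[of _ "h'*s (n+1+1)++h"] conjI) (simp_all only: Hom_iff)
 qed
qed

text \<open>For a cocycle \<open>(a, b)\<close> of the cone, the isomorphism in degree
  \<open>n\<close> shows that \<open>b\<close> induces zero on cohomology and so is a coboundary
  \<open>c0*df Y n\<close>; the one in degree \<open>n + 1\<close> then corrects \<open>c0\<close>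
  by some \<open>b'\<close> to account for \<open>a\<close>.\<close>

lemma quasi_iso_coqis:
 assumes qi: "is_quasi_iso C (X, Y, s)" shows "coqis X Y s"
proof -
 have S: "cm X Y s" using qi unfolding is_quasi_iso_def by (auto simp: Arr_Ch)
 note s = cmD[OF S] note X = cxD[OF s(1)] and Y = cxD[OF s(2)]
 have H: "EX k q k' q' z h. is_cohomology C X n k q & is_cohomology C Y n k' q' & arr z & dom z = dom k & cod z = dom k' & k'*z = s n*k
   & arr h & dom h = cod q & cod h = cod q' & h*q = q'*z & is_iso C h" for n
 proof -
  obtain k q k' q' where c: "is_cohomology C X n k q" "is_cohomology C Y n k' q'" using coh_ex s by metis
  obtain b where k: "arr k" "cod k = ob X n" "nul (df X n*k)" "arr b" "dom b = ob X (n-1)" "cod b = dom k" "k*b = df X (n-1)"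
   "is_cokernel C q b" by (rule cohE[OF s(1) c(1)]) blast
  obtain b' where k': "mono k'" "arr k'" "cod k' = ob Y n" "sv k' = kr (df Y n)" "arr b'" "dom b' = ob Y (n-1)" "cod b' = dom k'" "k'*b' = df Y (n-1)"
   and q': "epi q'" "arr q'" "dom q' = dom k'" "nul (q'*b')" by (rule cohE[OF s(2) c(2)]) blast
  have "df Y n*(s n*k) = s (n+1)*(df X n*k)" by (rule Cmp_reassoc[OF s(6)[symmetric]]) (use k s X Y in auto)
  hence "s n*k : kr (df Y n)" using k s X Y by simp
  then obtain z where z: "arr z" "cod z = dom k'" "k'*z = s n*k" unfolding k'(4)[symmetric] by (auto elim: svE)
  have zD: "dom z = dom k" using Cmp_simps(2)[of z k'] Cmp_simps(2)[of k "s n"] z k k' s by simp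
  have "k'*(z*b) = k'*(b'*s (n-1))"
  proof -
   have "k'*(z*b) = s n*(k*b)" by (rule Cmp_reassoc[OF z(3)]) (use z zD k k' s in auto)
   also have "... = (k'*b')*s (n-1)" unfolding k(7) k'(8) by (rule cmD'[OF S])
   finally show ?thesis using k'(2,5-7) s by simp
  qed
  hence zb: "z*b = b'*s (n-1)" by (rule mono_cancel[OF k'(1)]) (use z zD k k' s in auto)
  have "nul ((q'*z)*b)" using zb nul_Cmp_left2[OF q'(4), of "s (n-1)"] q' k' s z zD k by simp
  then obtain h where h: "arr h" "dom h = cod q" "cod h = cod q'" "h*q = q'*z"
   using cokernel_factor[OF k(8), of "q'*z"] q' z zD k by auto
  have "is_iso C h" using qi c z zD h unfolding is_quasi_iso_def by fastforce
  thus ?thesis using c z zD h by blast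
 qed
 show ?thesis unfolding coqis_def cex_def
 proof (intro conjI ballI allI impI S)
  fix E n a b assume E: "E : {E. inject E}" and ab: "a : hom (ob X (n+1)) E" "b : hom (ob Y n) E" and bd: "nul (b*df Y (n-1))"
   and e: "b*s n = a*df X n"
  hence E: "inject E" "obj E" and a: "arr a" "dom a = ob X (n+1)" "cod a = E" and b: "arr b" "dom b = ob Y n" "cod b = E" by auto
  obtain k q k' q' z h where c: "is_cohomology C X n k q" "is_cohomology C Y n k' q'" and z: "arr z" "dom z = dom k" "cod z = dom k'" "k'*z = s n*k"
   and h: "arr h" "dom h = cod q" "cod h = cod q'" "h*q = q'*z" "is_iso C h" using H[of n] by blast
  have k: "arr k" "cod k = ob X n" "nul (df X n*k)" "epi q" "arr q" "dom q = dom k" by (rule cohE[OF s(1) c(1)]; blast)+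
  have k': "arr k'" "cod k' = ob Y n" "arr q'" "dom q' = dom k'" by (rule cohE[OF s(2) c(2)]; blast)+
  obtain be where be: "arr be" "dom be = cod q'" "cod be = cod b" "be*q' = b*k'" by (rule coh_up[OF s(2) c(2) b(1,2) bd])
  have "(be*h)*q = a*(df X n*k)"
  proof -
   have "(be*h)*q = be*(q'*z)" using be(1,2) h k by simp
   also have "... = b*(k'*z)" by (rule Cmp_reassoc[OF be(4)]) (use be(1,2) z k' b in auto)
   also have "... = a*(df X n*k)" unfolding z(4) by (rule Cmp_reassoc[OF e]) (use a b k s X in auto)
   finally show ?thesis .
  qed
  hence "nul ((be*h)*q)" using a k X by simp
  hence "nul (be*h)" by (rule epi_nul[OF k(4)]) (use be(1,2) h in auto)
  hence nb: "nul be" by (rule epi_nul[OF iso_mono_epi[OF h(5), THEN conjunct2]]) (use be(1,2) h in auto)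
  have "nul (b*k')" unfolding be(4)[symmetric] by (rule nul_Cmp_left[OF nb]) (use be(1,2) k' in auto)
  then obtain c0 where c0: "arr c0" "dom c0 = ob Y (n+1)" "cod c0 = E" "c0*df Y n = b" by (rule coh_zero[OF s(2) c(2) E(1) b])
  \<comment> \<open>The rest of \<open>a\<close> kills the incoming differential, hence is an arrow
    on the cohomology of \<open>X\<close> in degree \<open>n + 1\<close>; it is carried over to
    \<open>Y\<close> by the inverse \<open>g\<close> of \<open>h\<close>.\<close>
  let ?a = "a++neg (c0*s (n+1))"
  have a1: "arr ?a" "dom ?a = ob X (n+1)" "cod ?a = E" using a c0(1-3) s by auto
  have "?a*df X n = a*df X n++neg ((c0*df Y n)*s n)" using a c0(1-3) s X Y by (simp add: Add_Cmp)
  hence a2: "nul (?a*df X (n+1 - 1))" unfolding c0(4) e using a X E by simp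
  obtain k q k' q' z h where c: "is_cohomology C X (n+1) k q" "is_cohomology C Y (n+1) k' q'" and z: "arr z" "dom z = dom k" "cod z = dom k'" "k'*z = s (n+1)*k"
   and h: "arr h" "dom h = cod q" "cod h = cod q'" "h*q = q'*z" "is_iso C h" using H[of "n+1"] by blast
  have k: "arr k" "cod k = ob X (n+1)" "epi q" "arr q" "dom q = dom k" by (rule cohE[OF s(1) c(1)]; blast)+
  have k': "arr k'" "cod k' = ob Y (n+1)" "arr q'" "dom q' = dom k'" by (rule cohE[OF s(2) c(2)]; blast)+
  obtain g where g: "arr g" "dom g = cod h" "cod g = dom h" "g*h = idt (dom h)" using is_isoE[OF h(5)] by blast
  obtain \<alpha> where \<alpha>: "arr \<alpha>" "dom \<alpha> = cod q" "cod \<alpha> = cod ?a" "\<alpha>*q = ?a*k" by (rule coh_up[OF s(1) c(1) a1(1,2) a2])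
  obtain b' where b': "arr b'" "dom b' = ob Y (n+1)" "cod b' = E" "nul (b'*df Y (n+1 - 1))" "b'*k' = (\<alpha>*g)*q'"
   by (rule coh_down[OF s(2) c(2) E(1), of "\<alpha>*g"]) (use \<alpha>(1-3) g h a1 in auto)
  have "b'*(s (n+1)*k) = (\<alpha>*g)*(q'*z)" unfolding z(4)[symmetric]
   by (rule Cmp_reassoc[OF b'(5)]) (use \<alpha>(1,2) g(1-3) h(1-3) k' z(1-3) b'(1,2) in auto)
  also have "... = \<alpha>*((g*h)*q)" unfolding h(4)[symmetric] using \<alpha>(1,2) g(1-3) h(1-3) k by simp
  also have "... = ?a*k" unfolding g(4) using \<alpha>(4) k h(2) by simp
  finally have bk: "b'*(s (n+1)*k) = ?a*k" .
  have "(?a++neg (b'*s (n+1)))*k = ?a*k++neg (b'*(s (n+1)*k))"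
   by (subst Add_Cmp) (use a1 b'(1-3) s k in auto)
  hence "nul ((?a++neg (b'*s (n+1)))*k)" unfolding bk using a1 k E by simp
  then obtain l where l: "arr l" "dom l = ob X (n+1+1)" "cod l = E" "l*df X (n+1) = ?a++neg (b'*s (n+1))"
   using coh_zero[OF s(1) c(1) E(1), of "?a++neg (b'*s (n+1))"] a1 b'(1-3) s by auto
  have "a = c0*s (n+1)++(b'*s (n+1)++l*df X (n+1))"
  proof (subst Add_eq_iff)
   show "?a = b'*s (n+1)++l*df X (n+1)" by (subst Add_eq_iff) (use a1 b'(1-3) s l X in auto)
  qed (use a c0(1-3) b'(1-3) s l(1-3) X in auto)
  hence "a = (c0++b')*s (n+1)++l*df X (n+1)" using c0(1-3) b'(1-3) s l(1-3) X by (simp add: Add_Cmp Add_assoc)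
  moreover have "b = (c0++b')*df Y n" using c0 b'(1-4) Y nul_Add_right[of "b'*df Y n" b] b by (simp add: Add_Cmp)
  moreover have "c0++b' : hom (ob Y (n+1)) E" "l : hom (ob X (n+1+1)) E" using c0(1-3) b'(1-3) l(1-3) by auto
  ultimately show "EX c : hom (ob Y (n+1)) E. EX h : hom (ob X (n+1+1)) E. b = c*df Y n & a = c*s (n+1)++h*df X (n+1)"
   by (intro bexI[of _ "c0++b'"] bexI[of _ l] conjI)
 qed
qed

end

context loc_noetherian begin

text \<open>As every object embeds into an injective one, the map \<open>h\<close> on cohomology may
  be tested with arrows into injectives: their extendability along \<open>h\<close> makes it mono,
  uniqueness of extensions makes it epi.\<close>

lemma coqis_quasi_iso:
 assumes co: "coqis X Y s" shows "is_quasi_iso A (X, Y, s)"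
proof -
 have S: "cm X Y s" and ex: "cex {E. inject E} X Y s" using co unfolding coqis_def by auto
 note s = cmD[OF S] note X = cxD[OF s(1)] and Y = cxD[OF s(2)]
 have "is_iso A h" if c: "is_cohomology A X n k q" "is_cohomology A Y n k' q'" and z: "arr z" "dom z = dom k" "cod z = dom k'" "k'*z = s n*k"
  and h: "arr h" "dom h = cod q" "cod h = cod q'" "h*q = q'*z" for n k q k' q' z h
 proof (rule mono_epi_iso)
  have k: "arr k" "cod k = ob X n" "sv k = kr (df X n)" "nul (df X n*k)" "epi q" "arr q" "dom q = dom k" by (rule cohE[OF s(1) c(1)]; blast)+
  have k': "arr k'" "cod k' = ob Y n" "nul (df Y n*k')" "epi q'" "arr q'" "dom q' = dom k'" by (rule cohE[OF s(2) c(2)]; blast)+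
  have key: "y*(s n*k) = (be*h)*q" if "arr y" "dom y = ob Y n" "arr be" "dom be = cod q'" "be*q' = y*k'" for y be
  proof -
   have "y*(s n*k) = be*(q'*z)" unfolding z(4)[symmetric] by (rule Cmp_reassoc[OF that(5)[symmetric]]) (use that(1-4) k' z in auto)
   thus ?thesis unfolding h(4)[symmetric] using that(3,4) h k by simp
  qed
  show "epi h" unfolding epi_iff
  proof (intro conjI ballI impI h)
   fix x assume x: "arr x" "dom x = cod h" "nul (x*h)"
   obtain u where u: "mono u" "dom u = cod x" and E: "inject (cod u)" using enough_injectives[of "cod x"] x by auto
   obtain y where y: "arr y" "dom y = ob Y n" "cod y = cod u" "nul (y*df Y (n-1))" "y*k' = (u*x)*q'"
    by (rule coh_down[OF s(2) c(2) E, of "u*x"]) (use u x h in auto)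
   have "y*(s n*k) = ((u*x)*h)*q" by (rule key) (use y u x h in auto)
   also have "nul ..." using u x k h(1-3) by simp
   finally have "nul ((y*s n)*k)" using y(1,2) s k by simp
   then obtain a where a: "arr a" "dom a = ob X (n+1)" "cod a = cod u" "a*df X n = y*s n"
    using coh_zero[OF s(1) c(1) E, of "y*s n"] y(1-3) s by auto
   obtain w where w: "arr w" "dom w = ob Y (n+1)" "y = w*df Y n"
    by (rule cexD[OF ex _ a(1,2,3) y(1-4) a(4)[symmetric]]) (use E in auto)
   have "nul ((u*x)*q')" unfolding y(5)[symmetric] w(3) using w(1,2) k' Y by simp
   hence "nul (u*x)" by (rule epi_nul[OF k'(4)]) (use u x h in auto)
   thus "nul x" by (rule mono_nul[OF u(1)]) (use u x in auto)
  qed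
  show "mono h"
  proof -
   obtain u where u: "mono u" "dom u = cod q" and E: "inject (cod u)" using enough_injectives[of "cod q"] k by auto
   obtain a where a: "arr a" "dom a = ob X n" "cod a = cod u" "nul (a*df X (n-1))" "a*k = u*q"
    by (rule coh_down[OF s(1) c(1) E, of u]) (use u in auto)
   let ?b = "zer (ob Y (n-1)) (cod u)"
   obtain w l where w: "arr w" "dom w = ob Y n" "cod w = cod u" and l: "arr l" "dom l = ob X (n+1)" "cod l = cod u"
    and e: "?b = w*df Y (n-1)" "a = w*s n++l*df X n"
   proof (rule cexD[OF ex, of "cod u" a "n-1" ?b])
    show "?b*s (n-1) = a*df X (n-1)" using nul_eq[OF a(4)] a(1-3) s u X Y(1) X(4)[of "n-1"] by simp
   qed (use E u a Y Y(4)[of "n-1 - 1"] in auto)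
   have n: "nul (w*df Y (n-1))" unfolding e(1)[symmetric] using Y u by simp
   obtain be where be: "arr be" "dom be = cod q'" "cod be = cod w" "be*q' = w*k'" by (rule coh_up[OF s(2) c(2) w(1,2) n])
   have "u*q = w*(s n*k)" unfolding a(5)[symmetric] e(2) using w l s k X nul_Add_right[of "l*(df X n*k)" "w*(s n*k)"] by (simp add: Add_Cmp)
   also have "... = (be*h)*q" by (rule key) (use w be in auto)
   finally have "u = be*h" by (rule epi_cancel[OF k(5)]) (use u be(1,2) h in auto)
   thus ?thesis using mono_right[of be h] u be(1,2) h by simp
  qed
 qed
 thus ?thesis using S unfolding is_quasi_iso_def by (auto simp: Arr_Ch)
qed

end

section \<open>Injective resolutions and the derived category\<close>

context abelian_category begin

lemma zero_object: "zero (zero_object C)"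
 unfolding zero_object_def using ex_zero by (rule someI_ex)

definition injcx where "injcx J <-> cx J & (ALL n. inject (ob J n))"

lemma injcxD: "injcx J ==> cx J" "injcx J ==> inject (ob J n)" by (auto simp: injcx_def)

text \<open>The term in degree \<open>n + 1\<close> is an injective object containing the cokernel of the differential of the mapping cone
 that has been constructed so far.\<close>

lemma resolution_step:
 assumes X: "cx X" and f: "arr f" "dom f = ob X n" and d: "arr d" "cod d = cod f"
  and emb: "!!B i j p q e. is_biproduct C (ob X (n+1)) (cod f) B i j p q ==> epi e ==> dom e = B ==>
   EX m. mono m & dom m = cod e & inject (cod m) & cod m : \<P>"
 shows "EX f' d'. arr f' & dom f' = ob X (n+1) & arr d' & dom d' = cod f & cod d' = cod f' &
  inject (cod f') & cod f' : \<P> & nul (d'*d) & f'*df X n = d'*f &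
  (ALL a : Arr C. ALL b : Arr C. inject (cod a) --> cod b = cod a --> dom a = ob X (n+1) --> dom b = cod f -->
   nul (b*d) --> b*f = a*df X n --> (EX c : Arr C. dom c = cod f' & cod c = cod a & b = c*d' & a = c*f'))"
proof -
 note x = cxD[OF X]
 have O: "obj (cod f)" using f Cod_Obj by blast
 obtain B i j p q where B: "is_biproduct C (ob X (n+1)) (cod f) B i j p q" using ex_bip[OF x(1) O] by blast
 note b = bip_facts[OF B x(1) O]
 define u where "u = i*neg (df X n)++j*f"
 have u: "arr u" "dom u = ob X n" "cod u = B" unfolding u_def using b(1-7) f x by auto
 obtain q1 where q1: "epi q1" "arr q1" "dom q1 = B" "nul (q1*u)" and c1: "is_cokernel C q1 u" using ex_coker[OF u(1)] u(3) epi_Arr by metis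
 \<comment> \<open>Dividing first by \<open>u\<close> and then by the image of \<open>d\<close>
   gives the cokernel of the whole cone differential into \<open>B\<close>.\<close>
 define v where "v = q1*(j*d)"
 have v: "arr v" "dom v = dom d" "cod v = cod q1" unfolding v_def using q1 b(1-7) d by auto
 obtain q2 where q2: "epi q2" "arr q2" "dom q2 = cod q1" "nul (q2*v)" and c2: "is_cokernel C q2 v" using ex_coker[OF v(1)] v(3) epi_Arr by metis
 have "epi (q2*q1)" using q1 q2 by simp
 then obtain m where m: "mono m" "dom m = cod q2" "inject (cod m)" "cod m : \<P>" using emb[OF B, of "q2*q1"] q1 q2 by auto
 define w where "w = m*(q2*q1)"
 have w: "arr w" "dom w = B" "cod w = cod m" unfolding w_def using m q1 q2 by auto
 have "nul (w*u)" unfolding w_def using m q1 q2 u nul_Cmp_right[OF q1(4), of "m*q2"] by simp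
 moreover have wu: "w*u = neg (w*(i*df X n))++w*(j*f)" unfolding u_def using w b(1-7) f x by (simp add: Cmp_Add)
 ultimately have "w*(j*f) = w*(i*df X n)"
  using nul_dif[of "w*(j*f)" "w*(i*df X n)"] Add_commute[of "w*(j*f)" "neg (w*(i*df X n))"] w b(1-7) f x by simp
 moreover have "nul ((w*j)*d)" unfolding w_def using nul_Cmp_right[OF q2(4), of m] m q1(1-3) q2(1-3) b(1-7) d by (simp add: v_def)
 moreover have "EX c : Arr C. dom c = cod m & cod c = cod a & b = c*(w*j) & a = c*(w*i)"
  if ab: "arr a" "arr b" "inject (cod a)" "cod b = cod a" "dom a = ob X (n+1)" "dom b = cod f" "nul (b*d)" "b*f = a*df X n" for a b
 proof -
  define g where "g = a*p++b*q"
  have g: "arr g" "dom g = B" "cod g = cod a" unfolding g_def using ab b(1-13) by auto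
  have gi: "g*i = a" unfolding g_def using ab(1-6) b x O by (simp add: Add_Cmp)
  have gj: "g*j = b" unfolding g_def using ab(1-6) b x O by (simp add: Add_Cmp)
  have "g*u = neg ((g*i)*df X n)++(g*j)*f" unfolding u_def using g b(1-7) f x by (simp add: Cmp_Add)
  hence "nul (g*u)" unfolding gi gj ab(8) using ab(1-6) x Cod_Obj by simp
  then obtain g1 where g1: "arr g1" "dom g1 = cod q1" "cod g1 = cod a" "g1*q1 = g" using cokernel_factor[OF c1 g(1)] g u q1 by auto
  have "g1*v = g*(j*d)" unfolding v_def g1(4)[symmetric] using g1(1,2) q1 b(1-7) d by simp
  also have "... = b*d" unfolding gj[symmetric] using g b(1-7) d by simp
  finally have "nul (g1*v)" using ab by simp
  then obtain g2 where g2: "arr g2" "dom g2 = cod q2" "cod g2 = cod a" "g2*q2 = g1" using cokernel_factor[OF c2 g1(1)] g1 v q2 by auto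
  obtain c where c: "arr c" "dom c = cod m" "cod c = cod a" "c*m = g2"
   by (rule is_injectiveD[OF ab(3) m(1) g2(1) _ g2(3)]) (use g2 m in auto)
  have "c*w = (c*m)*(q2*q1)" unfolding w_def using c(1,2) m q1 q2 by simp
  also have "... = (g2*q2)*q1" unfolding c(4) using g2(1,2) q1 q2 by simp
  finally have cw: "c*w = g" unfolding g2(4) g1(4) .
  have "c*(w*j) = (c*w)*j" "c*(w*i) = (c*w)*i" using c(1,2) w b(1-7) by simp_all
  thus ?thesis using c(1-3) gi gj cw by (intro bexI[of _ c]) simp_all
 qed
 ultimately show ?thesis
  using w b(1-7) f x d m O by (intro exI[of _ "w*i"] exI[of _ "w*j"] conjI) auto
qed

text \<open>The class \<open>\<P>\<close> constrains the terms of the resolution. It is used with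
  all objects and with the torsion objects; \<open>emb\<close> asks for injectives of the class
  containing quotients of biproducts of its members.\<close>

lemma resolution:
 assumes X: "cx X" and XP: "!!n. ob X n : \<P>" and Z: "zero_object C : \<P>"
  and emb: "!!M M' B i j p q e. M : \<P> ==> M' : \<P> ==> is_biproduct C M M' B i j p q ==> epi e ==> dom e = B ==>
   EX m. mono m & dom m = cod e & inject (cod m) & cod m : \<P>"
 obtains I s where "injcx I" "!!n. ob I n : \<P>" "coqis X I s"
proof -
 note x = cxD[OF X] and z = zero_object and zi = is_injective_zero[OF zero_object]
 let ?z = "zero_object C"
 have zO: "obj ?z" using z by (simp add: is_zero_def)
 obtain N where N: "!!n. n <= N ==> zero (ob X n)" using cx_bound[OF X] by blast
 define P where "P n p <-> (case p of (f, d) => f : Arr C & dom f = ob X n & arr d & cod d = cod f & inject (cod f) & cod f : \<P>)" for n p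
 define R where "R n p p' <-> (case p of (f, d) => case p' of (f', d') => dom d' = cod f & nul (d'*d) & f'*df X n = d'*f &
  (ALL a : Arr C. ALL b : Arr C. inject (cod a) --> cod b = cod a --> dom a = ob X (n+1) --> dom b = cod f -->
   nul (b*d) --> b*f = a*df X n --> (EX c : Arr C. dom c = cod f' & cod c = cod a & b = c*d' & a = c*f')))" for n p p'
 define x0 where "x0 n = (zer (ob X n) ?z, zer ?z ?z)" for n
 have "EX x. (ALL n. P n (x n) & R n (x n) (x (n+1))) & (ALL n <= N. x n = x0 n)"
 proof (rule int_choice)
  show "P n (x0 n)" if "n <= N" for n unfolding P_def x0_def prod.case using x zO zi Z by simp
  show "R n (x0 n) (x0 (n+1))" if "n < N" for n unfolding R_def x0_def prod.case
  proof (intro conjI ballI impI)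
   have zz: "zero (ob X (n+1))" using N that by simp
   fix a b assume ab: "arr a" "arr b" "inject (cod a)" "cod b = cod a" "dom a = ob X (n+1)" "dom b = cod (zer (ob X n) ?z)"
   let ?c = "zer ?z (cod a)"
   have O: "obj (cod a)" using ab by simp
   have "b = ?c*zer ?z ?z" by (rule zero_eq[OF z]) (use ab x zO O in auto)
   moreover have "a = ?c*zer (ob X (n+1)) ?z" by (rule zero_eq[OF zz]) (use ab x zO O in auto)
   ultimately show "EX c : Arr C. dom c = cod (zer (ob X (n+1)) ?z) & cod c = cod a & b = c*zer ?z ?z & a = c*zer (ob X (n+1)) ?z"
    using x zO O by (intro bexI[of _ ?c] conjI) auto
  qed (use x zO in auto)
  fix n p assume "N <= n" "P n p"
  obtain f d where p: "p = (f, d)" by fastforce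
  have f: "arr f" "dom f = ob X n" "arr d" "cod d = cod f" "cod f : \<P>" using \<open>P n p\<close> unfolding P_def p by auto
  have e: "EX m. mono m & dom m = cod e & inject (cod m) & cod m : \<P>"
   if "is_biproduct C (ob X (n+1)) (cod f) B i j p q" "epi e" "dom e = B" for B i j p q e using emb[OF XP f(5)] that by blast
  show "EX p'. P (n+1) p' & R n p p'"
   unfolding P_def R_def p split_paired_Ex prod.case
   by (rule exE[OF resolution_step[OF X f(1-4)]], rule e, assumption+, elim exE conjE, intro exI conjI; assumption)
 qed
 then obtain y where y: "!!n. P n (y n)" "!!n. R n (y n) (y (n+1))" "!!n. n <= N ==> y n = x0 n" by blast
 define s where "s n = fst (y n)" for n
 define I where "I = \<lparr>ob = %n. cod (s n), df = %n. snd (y (n+1))\<rparr>"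
 have s: "arr (s n)" "dom (s n) = ob X n" "cod (s n) = ob I n" "inject (ob I n)" "ob I n : \<P>" for n
  using y(1)[of n] unfolding P_def s_def I_def by (auto split: prod.splits)
 have d: "arr (df I n)" "dom (df I n) = ob I n" "cod (df I n) = ob I (n+1)" "s (n+1)*df X n = df I n*s n" for n
  using y(1)[of "n+1"] y(2)[of n] unfolding P_def R_def s_def I_def by (auto split: prod.splits)
 have dd: "nul (df I (n+1)*df I n)" for n using y(2)[of "n+1"] unfolding R_def I_def by (auto split: prod.splits)
 have I: "cx I" by (rule cxI[of I N]) (use s d dd y(3) zO z x in "auto simp: I_def s_def x0_def")
 have "coqis X I s" unfolding coqis_def cex_def
 proof (intro conjI ballI allI impI)
  show "cm X I s" by (rule cmI[OF X I]) (use s d in auto)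
  fix E n a b assume E: "E : {E. inject E}" and ab: "a : hom (ob X (n+1)) E" "b : hom (ob I n) E" "nul (b*df I (n-1))" "b*s n = a*df X n"
  hence E: "obj E" "inject E" and ab': "arr a" "arr b" "cod a = E" "cod b = E" "dom a = ob X (n+1)" "dom b = cod (fst (y n))" "nul (b*snd (y n))" "b*fst (y n) = a*df X n"
   by (auto simp: I_def s_def)
  obtain c where c: "arr c" "dom c = cod (fst (y (n+1)))" "cod c = E" "b = c*snd (y (n+1))" "a = c*fst (y (n+1))"
   using y(2)[of n] ab' E unfolding R_def case_prod_beta by metis
  have c': "c : hom (ob I (n+1)) E" "b = c*df I n" "a = c*s (n+1)" using c by (auto simp: I_def s_def)
  have "a = c*s (n+1)++zer (ob X (n+1+1)) E*df X (n+1)" unfolding c'(3)[symmetric] using x ab' E by simp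
  thus "EX c : hom (ob I (n+1)) E. EX h : hom (ob X (n+1+1)) E. b = c*df I n & a = c*s (n+1)++h*df X (n+1)"
   using c'(1,2) x E by (intro bexI[of _ c] bexI[of _ "zer (ob X (n+1+1)) E"] conjI) simp_all
 qed
 thus ?thesis using that[of I s] I s by (simp add: injcx_def)
qed

lemma qisE:
 assumes "a : qis C" obtains X Y s where "a = kc X Y s" "coqis X Y s"
proof -
 obtain \<phi> where a: "a : Arr KK" "\<phi> : a" "is_quasi_iso C \<phi>" using assms unfolding qis_def by blast
 obtain X Y s where p: "\<phi> = (X, Y, s)" using prod_cases3 by blast
 obtain f where f: "cm (Dom KK a) (Cod KK a) f" "a = kc (Dom KK a) (Cod KK a) f" using K_ArrE[OF a(1) refl refl] by blast
 have "((Dom KK a, Cod KK a, f), (X, Y, s)) : homotopy_rel C" using a(2) p f(2) unfolding kc_def by blast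
 hence e: "X = Dom KK a" "Y = Cod KK a" "cm X Y s" "nh X Y (%n. f n++neg (s n))" by (auto simp: homotopy_rel_iff)
 have "a = kc X Y s" using f e kc_eq[of X Y f s] by simp
 thus ?thesis using that quasi_iso_coqis a(3) p by blast
qed

text \<open>Existence of extensions along a quasi-isomorphism is \<open>cex_lift\<close>, uniqueness
  is \<open>cex_null\<close>.\<close>

lemma injcx_local:
 assumes J: "injcx J" shows "is_local KK (qis C) J"
 unfolding is_local_def
proof (intro conjI ballI)
 have cJ: "cx J" using J by (simp add: injcx_def)
 thus "J : Obj KK" by simp
 fix s f assume s: "s : qis C" and f: "f : Hom KK (Dom KK s) J"
 obtain X Y t where t: "s = kc X Y t" "coqis X Y t" using qisE[OF s] by blast
 have T: "cm X Y t" "cex (range (ob J)) X Y t" using t(2) J unfolding coqis_def cex_def injcx_def by blast+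
 obtain u where u: "cm X J u" "f = kc X J u" using f t(1) T by (auto elim: K_ArrE)
 note tD = cmD[OF T(1)]
 obtain g where g: "cm Y J g" "nh X J (%n. u n++neg (g n*t n))" using cex_lift[OF T(1) cJ T(2) u(1)] by blast
 have gt: "Cmp KK (kc Y J g) s = f" unfolding t(1) u(2) using T(1) g u(1) cm_Cmp[OF T(1) g(1)] kc_eq[of X J u "%n. g n*t n"] by simp
 show "EX! g. g : Hom KK (Cod KK s) J & Cmp KK g s = f"
 proof (rule ex1I[of _ "kc Y J g"])
  show "kc Y J g : Hom KK (Cod KK s) J & Cmp KK (kc Y J g) s = f" using gt g(1) T(1) t(1) by simp
  fix h assume h: "h : Hom KK (Cod KK s) J & Cmp KK h s = f"
  then obtain v where v: "cm Y J v" "h = kc Y J v" using t(1) T(1) by (auto elim: K_ArrE)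
  note vD = cmD[OF v(1)] and gD = cmD[OF g(1)]
  have "kc X J (%n. v n*t n) = kc X J (%n. g n*t n)" using h gt v g(1) t(1) T(1) by simp
  hence "nh X J (%n. v n*t n++neg (g n*t n))" using kc_eq cm_Cmp[OF T(1)] v(1) g(1) by blast
  hence "nh X J (%n. (v n++neg (g n))*t n)" using vD(1-5) gD(1-5) tD(1-5) by (simp add: Add_Cmp)
  hence "nh Y J (%n. v n++neg (g n))" using cex_null[OF T(1) cJ T(2), of "%n. v n++neg (g n)"] cm_Add[OF v(1) cm_Neg[OF g(1)]] by blast
  thus "h = kc Y J g" unfolding v(2) using kc_eq v(1) g(1) by blast
 qed
qed

end

context loc_noetherian begin

lemma coqis_qis:
 assumes s: "coqis X Y s" shows "kc X Y s : qis A"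
 unfolding qis_def
proof (intro CollectI conjI bexI)
 show "kc X Y s : Arr KK" using coqis_cm[OF s] by simp
 show "is_quasi_iso A (X, Y, s)" by (rule coqis_quasi_iso[OF s])
 show "(X, Y, s) : kc X Y s" unfolding kc_def by (rule quotient_category.R_self[OF quotient_Ch]) (use coqis_cm[OF s] in "simp add: Arr_Ch")
qed

lemma ex_resolution:
 assumes X: "cx X" obtains I s where "injcx I" "coqis X I s"
proof -
 have emb: "EX m. mono m & dom m = cod e & inject (cod m) & obj (cod m)" if e: "epi e" for e
  using enough_injectives[of "cod e"] is_injective_Obj epi_Arr[OF e] Cod_Obj by metis
 show ?thesis by (rule resolution[OF X, of "Obj A"]; (rule emb that)?) (use X zero_object in "simp_all add: is_zero_def")
qed

text \<open>Injective resolutions are the local maps, so arrows of the derived category into a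
  complex of injectives are homotopy classes of chain maps.\<close>

lemma fractions_K: "fractions KK (qis A)"
proof (rule fractions.intro[OF K_cat], unfold_locales)
 show "s : Arr KK" if "s : qis A" for s using that unfolding qis_def by blast
 show "Idt KK X : qis A" if "X : Obj KK" for X using that coqis_qis[OF coqis_Idt[of X]] by (simp add: kc_Idt)
 show "Cmp KK t s : qis A" if st: "s : qis A" "t : qis A" "Dom KK t = Cod KK s" for s t
 proof -
  obtain X Y f where f: "s = kc X Y f" "coqis X Y f" using qisE[OF st(1)] by blast
  obtain Y' Z g where g: "t = kc Y' Z g" "coqis Y' Z g" using qisE[OF st(2)] by blast
  have "Y' = Y" using st(3) f g coqis_cm[OF f(2)] coqis_cm[OF g(2)] by simp
  thus ?thesis using coqis_qis[OF coqis_Cmp[OF f(2)]] f g coqis_cm[OF f(2)] coqis_cm[OF g(2)] by simp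
 qed
 fix X assume "X : Obj KK"
 then obtain I s where I: "injcx I" "coqis X I s" using ex_resolution by auto
 show "EX l : qis A. Dom KK l = X & is_local KK (qis A) (Cod KK l)"
  by (rule bexI[of _ "kc X I s"]) (use I coqis_qis injcx_local coqis_cm[OF I(2)] in auto)
qed

sublocale K: fractions "Kplus A" "qis A" by (rule fractions_K)

abbreviation "DD == Dplus A"
abbreviation dcmp (infixl "**" 70) where "f**g == Cmp DD f g"

sublocale D: category "Dplus A" unfolding Dplus_def by (rule K.category_FC)

definition dm where "dm X Y f = Dmap A (X, Y, f)"

lemma dm_L: "dm X Y f = FA (frac_loc KK (qis A)) (kc X Y f)"
 by (simp add: dm_def Dmap_def Dloc_def kc_def)

lemma Obj_D [simp]: "X : Obj DD <-> cx X" by (simp add: Dplus_def)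

lemma dm [simp]:
 assumes "cm X Y f" shows "D.arr (dm X Y f)" "D.dom (dm X Y f) = X" "D.cod (dm X Y f) = Y"
 unfolding Dplus_def dm_L using is_functor_simps(2-4)[OF K.functor_L] assms by simp_all

lemma dm_Cmp: "cm X Y f ==> cm Y Z g ==> dm Y Z g**dm X Y f = dm X Z (%n. g n*f n)"
 unfolding Dplus_def dm_L using is_functor_simps(6)[OF K.functor_L, of "kc X Y f" "kc Y Z g"] by simp

lemma dm_Idt: "cx X ==> dm X X (%n. idt (ob X n)) = D.idt X"
 unfolding Dplus_def dm_L using is_functor_simps(5)[OF K.functor_L, of X] by (simp add: kc_Idt)

lemma dm_eq: "cm X Y f ==> cm X Y g ==> nh X Y (%n. f n++neg (g n)) ==> dm X Y f = dm X Y g"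
 unfolding dm_L using kc_eq[of X Y f g] by simp

lemma dm_iso: "coqis X Y s ==> is_iso DD (dm X Y s)"
 unfolding Dplus_def dm_L by (rule K.L_iso[OF coqis_qis])

lemma dm_inj:
 assumes J: "injcx J" and f: "cm X J f" and g: "cm X J g" and e: "dm X J f = dm X J g" shows "nh X J (%n. f n++neg (g n))"
proof -
 have "inj_on (FA (frac_loc KK (qis A))) (Hom KK X J)"
  using K.L_bij[OF injcx_local[OF J], of X] cmD(1)[OF f] by (simp add: bij_betw_def)
 hence "kc X J f = kc X J g" by (rule inj_onD) (use e f g in "auto simp: dm_L")
 thus ?thesis using kc_eq f g by blast
qed

lemma dm_full:
 assumes J: "injcx J" and a: "D.arr a" "D.dom a = X" "D.cod a = J" obtains f where "cm X J f" "a = dm X J f"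
proof -
 have X: "cx X" using D.Dom_Obj[OF a(1)] a(2) by simp
 have "a : FA (frac_loc KK (qis A)) ` Hom KK X J"
  using K.L_bij[OF injcx_local[OF J], of X] X a by (simp add: bij_betw_def Dplus_def)
 then obtain x where x: "x : Arr KK" "Dom KK x = X" "Cod KK x = J" "a = FA (frac_loc KK (qis A)) x" by auto
 obtain f where "cm X J f" "x = kc X J f" by (rule K_ArrE[OF x(1-3)])
 thus ?thesis using that x(4) by (simp add: dm_L)
qed

end

section \<open>Shifts, spheres and cones\<close>

context abelian_category begin

lemma quot_functor_kc:
 assumes f: "cm X Y f"
  and F: "!!g. cm X Y g ==> nh X Y (%n. f n++neg (g n)) ==> FA F (X, Y, g) = (X', Y', F' g) & cm X' Y' (F' g) & nh X' Y' (%n. F' f n++neg (F' g n))"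
 shows "FA (quot_functor (homotopy_rel C) F) (kc X Y f) = kc X' Y' (F' f)"
proof -
 have m: "(X, Y, f) : kc X Y f" unfolding kc_def by (rule quotient_category.R_self[OF quotient_Ch]) (use f in "simp add: Arr_Ch")
 hence f': "nh X Y (%n. f n++neg (f n))" by (simp add: kc_def homotopy_rel_iff)
 have "homotopy_rel C `` (FA F ` kc X Y f) = homotopy_rel C `` {(X', Y', F' f)}"
 proof (rule quotient_category.Image_class[OF quotient_Ch])
  show "(X', Y', F' f) : Arr (Ch C)" using F[OF f f'] by (simp add: Arr_Ch)
  show "FA F ` kc X Y f ~= {}" using m by blast
  show "FA F ` kc X Y f <= homotopy_rel C `` {(X', Y', F' f)}"
  proof
   fix y assume "y : FA F ` kc X Y f"
   then obtain Z V g where g: "((X, Y, f), (Z, V, g)) : homotopy_rel C" "y = FA F (Z, V, g)" unfolding kc_def by auto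
   hence "cm X Y g" "Z = X" "V = Y" "nh X Y (%n. f n++neg (g n))" by (auto simp: homotopy_rel_iff)
   thus "y : homotopy_rel C `` {(X', Y', F' f)}" using F[of g] F[OF f f'] g(2) by (simp add: homotopy_rel_iff)
  qed
 qed
 thus ?thesis by (simp add: quot_functor_def kc_def)
qed

text \<open>The differential changes sign once for every \<open>k\<close>, not \<open>k\<close>
  times. For \<open>k = 1\<close> this is the shift functor, and with this convention
  \<open>sh (- 1)\<close> is its strict inverse.\<close>

definition sh :: "int => ('o, 'm) cplx => ('o, 'm) cplx" where "sh k X = \<lparr>ob = %n. ob X (n + k), df = %n. neg (df X (n + k))\<rparr>"
definition CS where "CS k = \<lparr>FO = sh k, FA = %(X, Y, f). (sh k X, sh k Y, %n. f (n + k))\<rparr>"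

lemma sh_simps [simp]: "ob (sh k X) n = ob X (n + k)" "df (sh k X) n = neg (df X (n + k))" by (simp_all add: sh_def)

lemma shift_sh: "shift_cplx C = sh 1" "Ch_shift C = CS 1"
 by (auto simp: shift_cplx_def sh_def Ch_shift_def CS_def fun_eq_iff)

lemma int_ac: "n+1 + k = n + k+1" "n-1 + k = n + k-1" for n :: int by simp_all

lemma sh_cx:
 assumes X: "cx X" shows "cx (sh k X)"
proof -
 obtain N where N: "!!n. n <= N ==> zero (ob X n)" using cx_bound[OF X] by blast
 show ?thesis by (rule cxI[of _ "N - k"]) (use cxD[OF X] N in "simp_all add: int_ac")
qed

lemma sh_sh: "cx X ==> sh (- k) (sh k X) = X" using cxD(2)[of X] by (cases X) (auto simp: sh_def fun_eq_iff)

lemma sh_cm: "cm X Y f ==> cm (sh k X) (sh k Y) (%n. f (n + k))"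
 by (rule cmI) (simp_all add: sh_cx cmD int_ac[of _ k])

lemma sh_nh:
 assumes "cx X" "cx Y" "nh X Y u" shows "nh (sh k X) (sh k Y) (%n. u (n + k))"
proof -
 obtain h where h: "!!n. arr (h n)" "!!n. dom (h n) = ob X n" "!!n. cod (h n) = ob Y (n-1)"
  "!!n. u n = df Y (n-1)*h n++h (n+1)*df X n" using nhE[OF assms(3)] by blast
 show ?thesis by (rule nhI[of "%n. neg (h (n + k))"]) (use h assms(1,2) in "simp_all add: int_ac")
qed

lemma sh_coqis:
 assumes s: "coqis X Y s" shows "coqis (sh k X) (sh k Y) (%n. s (n + k))"
proof -
 have S: "cm X Y s" and ex: "cex {E. inject E} X Y s" using s by (auto simp: coqis_def)
 note s = cmD[OF S] note X = cxD[OF s(1)] and Y = cxD[OF s(2)]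
 show ?thesis unfolding coqis_def cex_def
 proof (intro conjI ballI allI impI sh_cm S)
  fix E n a b assume E: "E : {E. inject E}" and ab: "a : hom (ob (sh k X) (n+1)) E" "b : hom (ob (sh k Y) n) E"
   "nul (b*df (sh k Y) (n-1))" "b*s (n + k) = a*df (sh k X) n"
  hence a: "arr a" "dom a = ob X (n + k+1)" "cod a = E" and b: "arr b" "dom b = ob Y (n + k)" "cod b = E"
   "nul (b*df Y (n + k-1))" and e: "b*s (n + k) = neg a*df X (n + k)"
   using X Y Y(4)[of "n + k-1"] by (auto simp: int_ac[of _ k])
  obtain c h where c: "arr c" "dom c = ob Y (n + k+1)" "cod c = E" "arr h" "dom h = ob X (n + k+1+1)" "cod h = E"
   "b = c*df Y (n + k)" "neg a = c*s (n + k+1)++h*df X (n + k+1)"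
   by (rule cexD[OF ex E _ _ _ b e]) (use a in auto)
  have "b = neg c*df (sh k Y) n" using c(1-3,7) Y(2-4) by simp
  moreover have "neg (c*s (n + k+1)++h*df X (n + k+1)) = neg c*s (n+1 + k)++h*df (sh k X) (n+1)"
   using c(1-6) X(2-4) s(3-5) by (simp add: Neg_distrib int_ac[of _ k])
  hence "a = neg c*s (n+1 + k)++h*df (sh k X) (n+1)" unfolding c(8)[symmetric] using a(1) by simp
  ultimately show "EX c : hom (ob (sh k Y) (n+1)) E. EX h : hom (ob (sh k X) (n+1+1)) E. b = c*df (sh k Y) n & a = c*s (n+1 + k)++h*df (sh k X) (n+1)"
   using c(1-6) by - (rule bexI[of _ "neg c"], rule bexI[of _ h], rule conjI, assumption+, simp_all add: add_ac)
 qed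
qed

lemma sh_kc:
 assumes f: "cm X Y f" shows "FA (quot_functor (homotopy_rel C) (CS k)) (kc X Y f) = kc (sh k X) (sh k Y) (%n. f (n + k))"
 by (rule quot_functor_kc[OF f]) (use sh_nh[OF cmD(1,2)[OF f]] sh_cm in "auto simp: CS_def")

lemma sh_functor: "is_functor KK KK (quot_functor (homotopy_rel C) (CS k))" (is "is_functor KK KK ?F")
proof -
 have FO: "FO ?F X = sh k X" for X by (simp add: quot_functor_def CS_def)
 have 1: "FA ?F a : Hom KK (sh k (Dom KK a)) (sh k (Cod KK a))" if a: "a : Arr KK" for a
 proof -
  obtain X Y f where f: "a = kc X Y f" "cm X Y f" by (rule K_ArrE[OF a refl refl], rule that)
  show ?thesis using f sh_cm[OF f(2), of k] by (simp add: sh_kc)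
 qed
 have 2: "FA ?F (Cmp KK b a) = Cmp KK (FA ?F b) (FA ?F a)" if ab: "a : Arr KK" "b : Arr KK" "Dom KK b = Cod KK a" for a b
 proof -
  obtain X Y f where f: "a = kc X Y f" "cm X Y f" by (rule K_ArrE[OF ab(1) refl refl], rule that)
  have "Dom KK b = Y" using ab(3) f by simp
  then obtain Z g where g: "b = kc Y Z g" "cm Y Z g" by - (rule K_ArrE[OF ab(2) _ refl], assumption, rule that)
  show ?thesis using f g sh_cm[OF f(2), of k] sh_cm[OF g(2), of k] cm_Cmp[OF f(2) g(2)] by (simp add: sh_kc)
 qed
 have "FA ?F (Idt KK X) = Idt KK (sh k X)" if "cx X" for X using sh_kc[OF cm_Idt[OF that]] by (simp add: kc_Idt)
 thus ?thesis unfolding is_functor_def FO using 1 2 sh_cx by simp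
qed

text \<open>Arrows into such complexes with \<open>E\<close> injective are the test arrows that
  replace cohomology in the derived category.\<close>

definition sph where
 "sph E m = (let X = (%n. if n = m then E else zero_object C) in \<lparr>ob = X, df = %n. zer (X n) (X (n+1))\<rparr>)"

lemma zero_object_Obj [simp]: "obj (zero_object C)" using zero_object by (simp add: is_zero_def)

lemma sph_simps [simp]: "ob (sph E m) n = (if n = m then E else zero_object C)"
 "df (sph E m) n = zer (ob (sph E m) n) (ob (sph E m) (n+1))" by (simp_all add: sph_def Let_def)

lemma in_degree_0: "in_degree_0 C E = sph E 0" by (simp add: in_degree_0_def sph_def)

lemma sph_ob: "obj E ==> obj (ob (sph E m) n)" by simp

lemma sph_cx: "obj E ==> cx (sph E m)"
 by (rule cxI[of _ "m-1"]) (simp_all add: sph_ob zero_object del: sph_simps(1), auto simp: zero_object)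

lemma sph_injcx: "inject E ==> injcx (sph E m)"
 by (simp add: injcx_def sph_cx is_injective_Obj is_injective_zero[OF zero_object])

lemma sh_sph: "obj E ==> sh k (sph E m) = sph E (m - k)"
 unfolding sh_def by (auto simp: sph_def Let_def fun_eq_iff)

lemma sph_cm:
 assumes X: "cx X" and x: "arr x" "dom x = ob X m" "cod x = E" "nul (x*df X (m-1))"
 shows "cm X (sph E m) (%n. if n = m then x else zer (ob X n) (zero_object C))" (is "cm X _ ?f")
proof -
 note X' = cxD[OF X]
 have E: "obj E" using x by auto
 have f: "arr (?f n)" "dom (?f n) = ob X n" "cod (?f n) = ob (sph E m) n" for n using x X' by simp_all
 have z: "nul (?f (n+1)*df X n)" for n
 proof (cases "n+1 = m")
  case True hence "n = m-1" by simp
  thus ?thesis using x(4) by simp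
 qed (use X' in simp)
 show ?thesis
 proof (rule cmI[OF X sph_cx[OF E] f])
  fix n
  have "df (sph E m) n*?f n = zer (ob X n) (ob (sph E m) (n+1))" unfolding sph_simps(2) using f[of n] sph_ob[OF E] by (simp del: sph_simps)
  moreover have "?f (n+1)*df X n = zer (ob X n) (ob (sph E m) (n+1))" by (rule nul_eq[OF z]) (use f[of "n+1"] X' in "simp_all del: sph_simps")
  ultimately show "?f (n+1)*df X n = df (sph E m) n*?f n" by metis
 qed
qed

lemma sph_nh:
 assumes f: "cm X (sph E m) f" and x: "arr x" "dom x = ob X (m+1)" "cod x = E" "f m = x*df X m" shows "nh X (sph E m) f"
proof -
 note F = cmD[OF f] note X = cxD[OF F(1)] note S = cxD[OF F(2)]
 define h where "h n = (if n = m+1 then x else zer (ob X n) (zero_object C))" for n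
 have h: "arr (h n)" "dom (h n) = ob X n" "cod (h n) = ob (sph E m) (n-1)" for n unfolding h_def using x X by auto
 have h': "cod (h (n+1)) = ob (sph E m) n" for n using h(3)[of "n+1"] by (simp del: sph_simps)
 have "f n = df (sph E m) (n-1)*h n++h (n+1)*df X n" for n
 proof -
  have fe: "f n = h (n+1)*df X n"
  proof (cases "n = m")
   case True thus ?thesis using x by (simp add: h_def)
  next
   case False
   hence "cod (f n) = zero_object C" using F by simp
   thus ?thesis using zero_eq[OF zero_object, of "f n" "h (n+1)*df X n"] F(3-5) h(1,2) h' X by (simp del: sph_simps)
  qed
  have nn: "nul (df (sph E m) (n-1)*h n)" using h(1,3)[of n] S(1)[of n] S(1)[of "n-1"] by (simp del: sph_simps(1))
  show ?thesis unfolding fe[symmetric] using nul_Add[OF nn, of "f n"] h[of n] S(2,3) S(4)[of "n-1"] F(3-5) by (simp del: sph_simps)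
 qed
 thus ?thesis using nhI[of h X "sph E m" f] h by blast
qed

lemma sph_nhD:
 assumes X: "cx X" and E: "obj E" and n: "nh X (sph E m) f"
 obtains x where "arr x" "dom x = ob X (m+1)" "cod x = E" "f m = x*df X m"
proof -
 obtain h where h: "!!n. arr (h n)" "!!n. dom (h n) = ob X n" "!!n. cod (h n) = ob (sph E m) (n-1)"
  "!!n. f n = df (sph E m) (n-1)*h n++h (n+1)*df X n" using nhE[OF n] by blast
 have h1: "arr (h (m+1))" "dom (h (m+1)) = ob X (m+1)" "cod (h (m+1)) = E" using h(1-3)[of "m+1"] by simp_all
 have "f m = h (m+1)*df X m" unfolding h(4)[of m] using h(1-3)[of m] h1 X E by simp
 thus ?thesis using that h1 by blast
qed

lemma nh_cm:
 assumes X: "cx X" and Y: "cx Y" and u: "nh X Y u" shows "cm X Y u"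
proof -
 obtain h where h: "!!n. arr (h n)" "!!n. dom (h n) = ob X n" "!!n. cod (h n) = ob Y (n-1)"
  "!!n. u n = df Y (n-1)*h n++h (n+1)*df X n" using nhE[OF u] by blast
 have h': "cod (h (n+1)) = ob Y n" for n using h(3)[of "n+1"] by simp
 have Y': "cod (df Y (n-1)) = ob Y n" for n using cxD(4)[OF Y, of "n-1"] by simp
 note D = cxD[OF X] cxD[OF Y]
 show ?thesis
 proof (rule cmI[OF X Y])
  fix n
  have 1: "u (n+1)*df X n = df Y n*(h (n+1)*df X n)"
   unfolding h(4)[of "n+1"] using h(1,2) h' h'[of "n+1"] D nul_Add_right[of "h (n+1+1)*(df X (n+1)*df X n)" "df Y n*(h (n+1)*df X n)"]
   by (simp add: Add_Cmp)
  have "nul (df Y n*(df Y (n-1)*h n))" by (rule nul_Cmp_left2[OF cx_dd[OF Y]]) (use h Y' D in auto)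
  thus "u (n+1)*df X n = df Y n*u n"
   unfolding 1 h(4)[of n] using nul_Add[of "df Y n*(df Y (n-1)*h n)" "df Y n*(h (n+1)*df X n)"] h(1-3) h' Y' D by (simp add: Cmp_Add)
 qed (use h h' Y' D in "simp_all")
qed

text \<open>Vanishing of the cohomology in degree \<open>m\<close> of the complex of arrows from
  \<open>X\<close> to \<open>E\<close>.\<close>

definition hexact where
 "hexact X m E <-> (ALL x : Arr C. dom x = ob X m --> cod x = E --> nul (x*df X (m-1)) -->
   (EX x' : Arr C. dom x' = ob X (m+1) & cod x' = E & x = x'*df X m))"

text \<open>The second hypothesis says that the map from zero to \<open>U\<close> has a cone exact
  against the terms of \<open>J\<close>; \<open>cex_null\<close> applies to it.\<close>

lemma hexact_null:
 assumes u: "cm U J u" and h: "!!n k. hexact U n (ob J k)" shows "nh U J u"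
proof -
 let ?z = "sph (zero_object C) 0"
 have z: "cx ?z" by (rule sph_cx) simp
 have zz: "zero (ob ?z n)" for n by (simp add: zero_object)
 note U = cmD[OF u]
 have s: "cm ?z U (%n. zer (ob ?z n) (ob U n))" by (rule cm_Zer[OF z U(1)])
 have "cex (range (ob J)) ?z U (%n. zer (ob ?z n) (ob U n))" unfolding cex_def
 proof (intro ballI allI impI)
  fix E n a b assume E: "E : range (ob J)" and ab: "a : hom (ob ?z (n+1)) E" "b : hom (ob U n) E" "nul (b*df U (n-1))"
  then obtain c where c: "c : hom (ob U (n+1)) E" "b = c*df U n" using h unfolding hexact_def by fastforce
  have "a = c*zer (ob ?z (n+1)) (ob U (n+1))++zer (ob ?z (n+1+1)) E*df ?z (n+1)"
   by (rule zero_eq[OF zz[of "n+1"]]) (use ab c U E cxD[OF z] in "auto simp del: sph_simps")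
  thus "EX c:hom (ob U (n+1)) E. EX h:hom (ob ?z (n+1+1)) E. b = c*df U n & a = c*zer (ob ?z (n+1)) (ob U (n+1))++h*df ?z (n+1)"
   using c E U by (intro bexI[of _ c] bexI[of _ "zer (ob ?z (n+1+1)) E"] conjI) (auto simp del: sph_simps(2))
 qed
 moreover have "nh ?z J (%n. u n*zer (ob ?z n) (ob U n))"
  by (rule nhI[of "%n. zer (ob ?z n) (ob J (n-1))"]) (use U cxD[OF U(2)] cxD(4)[OF U(2), of "n-1" for n] cxD[OF z] in "simp_all del: sph_simps")
 ultimately show ?thesis using cex_null[OF s U(2) _ u] by blast
qed

end

context loc_noetherian begin

definition shD where "shD k = frac_functor KK (qis A) (quot_functor (homotopy_rel A) (CS k))"

lemma Dshift_shD: "Dshift A = shD 1" by (simp add: Dshift_def shD_def shift_sh)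

lemma shD:
 shows "is_functor DD DD (shD k)" "FO (shD k) X = sh k X" "cm X Y f ==> FA (shD k) (dm X Y f) = dm (sh k X) (sh k Y) (%n. f (n + k))"
proof -
 have q: "FA (quot_functor (homotopy_rel A) (CS k)) s : qis A" if s: "s : qis A" for s
  by (rule qisE[OF s]) (simp add: sh_kc coqis_cm coqis_qis sh_coqis)
 show "is_functor DD DD (shD k)" unfolding Dplus_def shD_def by (rule K.frac_functor(1)[OF sh_functor q])
 show "FO (shD k) X = sh k X" by (simp add: shD_def frac_functor_def quot_functor_def CS_def)
 show "FA (shD k) (dm X Y f) = dm (sh k X) (sh k Y) (%n. f (n + k))" if "cm X Y f"
  unfolding shD_def dm_L using K.frac_functor(2)[OF sh_functor q, where f = "kc X Y f"] that by (simp add: sh_kc)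
qed

lemma shD_isomorphic:
 assumes "isomorphic DD X Y" shows "isomorphic DD (sh k X) (sh k Y)"
proof -
 obtain a where a: "D.arr a" "D.dom a = X" "D.cod a = Y" "is_iso DD a" using assms unfolding isomorphic_def by auto
 have "is_iso DD (FA (shD k) a)" by (rule functor_iso[OF D.category_axioms D.category_axioms shD(1) a(4)])
 thus ?thesis unfolding isomorphic_def using is_functor_simps(2-4)[OF shD(1) a(1)] a shD(2) by auto
qed

text \<open>The arrow group is zero, phrased without the addition of the derived category.\<close>

definition dtriv where "dtriv X Y <-> (ALL a : D.hom X Y. ALL b : D.hom X Y. a = b)"

text \<open>For injective \<open>E\<close> the sphere is a complex of injectives, so arrows into it
  are homotopy classes of chain maps, which are the cohomology classes tested by
  \<open>hexact\<close>.\<close>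

lemma dtriv_sph:
 assumes X: "cx X" and E: "inject E" shows "dtriv X (sph E m) <-> hexact X m E"
proof
 have J: "injcx (sph E m)" and EO: "obj E" by (rule sph_injcx[OF E], rule is_injective_Obj[OF E])
 assume t: "dtriv X (sph E m)"
 show "hexact X m E" unfolding hexact_def
 proof (intro ballI impI)
  fix x assume x: "arr x" "dom x = ob X m" "cod x = E" "nul (x*df X (m-1))"
  let ?f = "%n. if n = m then x else zer (ob X n) (zero_object A)" and ?g = "%n. zer (ob X n) (ob (sph E m) n)"
  have f: "cm X (sph E m) ?f" by (rule sph_cm[OF X x])
  have g: "cm X (sph E m) ?g" by (rule cm_Zer[OF X injcxD(1)[OF J]])
  have "dm X (sph E m) ?f = dm X (sph E m) ?g" using t f g unfolding dtriv_def by simp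
  hence "nh X (sph E m) (%n. ?f n++neg (?g n))" by (rule dm_inj[OF J f g])
  then obtain x' where x': "arr x'" "dom x' = ob X (m+1)" "cod x' = E" "?f m++neg (?g m) = x'*df X m"
   by (rule sph_nhD[OF X EO])
  have "x = ?f m++neg (?g m)" using x X EO by simp
  thus "EX x' : Arr A. dom x' = ob X (m+1) & cod x' = E & x = x'*df X m" unfolding x'(4) using x'(1-3) by blast
 qed
next
 have J: "injcx (sph E m)" by (rule sph_injcx[OF E])
 assume h: "hexact X m E"
 show "dtriv X (sph E m)" unfolding dtriv_def
 proof (intro ballI)
  fix a b assume "a : D.hom X (sph E m)" "b : D.hom X (sph E m)"
  hence ab: "D.arr a" "D.dom a = X" "D.cod a = sph E m" "D.arr b" "D.dom b = X" "D.cod b = sph E m" by auto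
  obtain f where f: "cm X (sph E m) f" "a = dm X (sph E m) f" by (rule dm_full[OF J ab(1-3)])
  obtain g where g: "cm X (sph E m) g" "b = dm X (sph E m) g" by (rule dm_full[OF J ab(4-6)])
  let ?u = "%n. f n++neg (g n)"
  have u: "cm X (sph E m) ?u" by (rule cm_Add[OF f(1) cm_Neg[OF g(1)]])
  note U = cmD[OF u]
  have um: "arr (?u m)" "dom (?u m) = ob X m" "cod (?u m) = E" using U(3-5)[of m] by simp_all
  have "nul (df (sph E m) (m-1)*?u (m-1))"
   using U(3,5)[of "m-1"] is_injective_Obj[OF E] sph_ob by (simp del: Add_simps)
  hence "nul (?u m*df X (m-1))" using cmD'[OF u, of m] by simp
  then obtain x where x: "arr x" "dom x = ob X (m+1)" "cod x = E" "?u m = x*df X m" using h um unfolding hexact_def by blast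
  show "a = b" unfolding f(2) g(2) by (rule dm_eq[OF f(1) g(1) sph_nh[OF u x]])
 qed
qed

end

section \<open>Mapping cones and their long exact sequences\<close>

context abelian_category begin

context
 fixes X Y f Z i j p q
 assumes cone: "is_cone C (X, Y, f) Z i j p q"
begin

lemma coneD:
 shows "cm X Y f" "cx Z" "cx X" "cx Y"
  "arr (i n)" "dom (i n) = ob X (n+1)" "cod (i n) = ob Z n" "arr (j n)" "dom (j n) = ob Y n" "cod (j n) = ob Z n"
  "arr (p n)" "dom (p n) = ob Z n" "cod (p n) = ob X (n+1)" "arr (q n)" "dom (q n) = ob Z n" "cod (q n) = ob Y n"
  "p n*i n = idt (ob X (n+1))" "q n*j n = idt (ob Y n)" "q n*i n = zer (ob X (n+1)) (ob Y n)" "p n*j n = zer (ob Y n) (ob X (n+1))"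
  "df Z n*i n = i (n+1)*neg (df X (n+1))++j (n+1)*f (n+1)" "df Z n*j n = j (n+1)*df Y n"
proof -
 have c: "cm X Y f" "cx Z" "is_biproduct C (ob X (n+1)) (ob Y n) (ob Z n) (i n) (j n) (p n) (q n)"
  "df Z n*i n = i (n+1)*neg (df X (n+1))++j (n+1)*f (n+1)" "df Z n*j n = j (n+1)*df Y n" for n
  using cone unfolding is_cone_def by (auto simp: Arr_Ch)
 note x = cmD(1,2)[OF c(1)]
 note b = bip_facts[OF c(3) cxD(1)[OF x(1)] cxD(1)[OF x(2)]]
 show "cm X Y f" "cx Z" "cx X" "cx Y" "df Z n*i n = i (n+1)*neg (df X (n+1))++j (n+1)*f (n+1)" "df Z n*j n = j (n+1)*df Y n"
  using c x by blast+
 show "arr (i n)" "dom (i n) = ob X (n+1)" "cod (i n) = ob Z n" "arr (j n)" "dom (j n) = ob Y n" "cod (j n) = ob Z n"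
  "arr (p n)" "dom (p n) = ob Z n" "cod (p n) = ob X (n+1)" "arr (q n)" "dom (q n) = ob Z n" "cod (q n) = ob Y n"
  "p n*i n = idt (ob X (n+1))" "q n*j n = idt (ob Y n)" "q n*i n = zer (ob X (n+1)) (ob Y n)" "p n*j n = zer (ob Y n) (ob X (n+1))"
  using b by blast+
qed

lemma cone_decomp: "arr z ==> dom z = ob Z n ==> (z*i n)*p n++(z*j n)*q n = z"
 by (rule bip_decomp') (use cone coneD(3,4) in "auto simp: is_cone_def")

lemma cone_eqI:
 assumes "arr z" "arr w" "dom z = ob Z n" "dom w = ob Z n" "z*i n = w*i n" "z*j n = w*j n" shows "z = w"
 using cone_decomp[OF assms(1,3)] cone_decomp[OF assms(2,4)] assms(5,6) by metis

lemma coneR: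
 "arr x ==> cod x = ob X (n+1) ==> p n*(i n*x) = x" "arr x ==> cod x = ob X (n+1) ==> q n*(i n*x) = zer (dom x) (ob Y n)"
 "arr x ==> cod x = ob Y n ==> q n*(j n*x) = x" "arr x ==> cod x = ob Y n ==> p n*(j n*x) = zer (dom x) (ob X (n+1))"
 using bip_facts(18-21)[of "ob X (n+1)" "ob Y n" "ob Z n" "i n" "j n" "p n" "q n"] cone coneD(3,4) by (auto simp: is_cone_def)

lemmas cone_simps = coneD(5-22) coneR Cmp_Add Add_Cmp cxD[OF coneD(2)] cxD[OF coneD(3)] cxD[OF coneD(4)] cmD(3-5)[OF coneD(1)]

lemma cone_p: "cm Z (sh 1 X) p"
proof (rule cmI[OF coneD(2) sh_cx[OF coneD(3)]])
 fix n show "p (n+1)*df Z n = df (sh 1 X) n*p n" by (rule cone_eqI[of _ _ n]) (simp_all add: cone_simps)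
qed (simp_all add: coneD)

text \<open>With \<open>cone_factor\<close> and \<open>cone_null\<close>, the long exact sequence of
  homotopy classes into \<open>S\<close> for a cone. Here the homotopy \<open>l\<close> is the
  component of the extension on the shifted summand \<open>X\<close>.\<close>

lemma cone_extend:
 assumes g: "cm Y S g" and n: "nh X S (%n. g n*f n)" obtains g' where "cm Z S g'" "!!n. g' n*j n = g n"
proof -
 note G = cmD[OF g] note S = cxD[OF G(2)]
 obtain l where l: "!!n. arr (l n)" "!!n. dom (l n) = ob X n" "!!n. cod (l n) = ob S (n-1)"
  "!!n. g n*f n = df S (n-1)*l n++l (n+1)*df X n" using nhE[OF n] by blast
 have l': "cod (l (n+1)) = ob S n" for n using l(3)[of "n+1"] by simp
 define g' where "g' n = l (n+1)*p n++g n*q n" for n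
 have g': "arr (g' n)" "dom (g' n) = ob Z n" "cod (g' n) = ob S n" for n unfolding g'_def using l(1,2) l' G(3-5) by (simp_all add: cone_simps)
 have gi: "g' n*i n = l (n+1)" and gj: "g' n*j n = g n" for n unfolding g'_def using l(1,2) l' G(3-5) S by (simp_all add: cone_simps)
 have "cm Z S g'"
 proof (rule cmI[OF coneD(2) G(2) g'])
  fix n
  show "g' (n+1)*df Z n = df S n*g' n"
  proof (rule cone_eqI[of _ _ n])
   have "(g' (n+1)*df Z n)*i n = (g' (n+1)*i (n+1))*neg (df X (n+1))++(g' (n+1)*j (n+1))*f (n+1)"
    using g' by (simp add: cone_simps)
   also have "... = neg (l (n+1+1)*df X (n+1))++g (n+1)*f (n+1)" unfolding gi gj using l(1,2) by (simp add: cone_simps)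
   also have "g (n+1)*f (n+1) = l (n+1+1)*df X (n+1)++df S n*l (n+1)"
    using l(4)[of "n+1"] Add_commute[of "df S n*l (n+1)" "l (n+1+1)*df X (n+1)"] l(1,2) l' l'[of "n+1"] S by (simp add: cone_simps)
   also have "neg (l (n+1+1)*df X (n+1))++(l (n+1+1)*df X (n+1)++df S n*l (n+1)) = df S n*l (n+1)"
    by (rule Add_Neg_cancel(2)) (use l(1,2) l' l'[of "n+1"] S in "simp_all add: cone_simps")
   also have "... = (df S n*g' n)*i n" unfolding gi[symmetric] using g' S by (simp add: cone_simps)
   finally show "(g' (n+1)*df Z n)*i n = (df S n*g' n)*i n" .
   have "(g' (n+1)*df Z n)*j n = (g' (n+1)*j (n+1))*df Y n" using g' by (simp add: cone_simps)
   also have "... = df S n*(g' n*j n)" unfolding gj by (rule G(6))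
   finally show "(g' (n+1)*df Z n)*j n = (df S n*g' n)*j n" using g' S by (simp add: cone_simps)
  qed (use g' S in "simp_all add: cone_simps")
 qed
 thus ?thesis using that gj by blast
qed

lemma cone_factor:
 assumes g: "cm Z S g" and n: "nh Y S (%n. g n*j n)" obtains k where "cm (sh 1 X) S k" "nh Z S (%n. g n++neg (k n*p n))"
proof -
 note G = cmD[OF g] note S = cxD[OF G(2)]
 obtain h where h: "!!n. arr (h n)" "!!n. dom (h n) = ob Y n" "!!n. cod (h n) = ob S (n-1)"
  "!!n. g n*j n = df S (n-1)*h n++h (n+1)*df Y n" using nhE[OF n] by blast
 have h': "cod (h (n+1)) = ob S n" for n using h(3)[of "n+1"] by simp
 define H where "H n = h n*q n" for n
 have H: "arr (H n)" "dom (H n) = ob Z n" "cod (H n) = ob S (n-1)" for n unfolding H_def using h(1-3) by (simp_all add: cone_simps)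
 \<comment> \<open>The null-homotopic map \<open>b\<close> agrees with \<open>g\<close> on
   \<open>Y\<close>; subtracting it yields \<open>w\<close>, which vanishes on \<open>Y\<close> and
   therefore factors strictly through \<open>p\<close>.\<close>
 define b where "b n = df S (n-1)*H n++H (n+1)*df Z n" for n
 have nb: "nh Z S b" by (rule nhI[of H]) (use H in "auto simp: b_def")
 have cb: "cm Z S b" by (rule nh_cm[OF coneD(2) G(2) nb])
 define w where "w n = g n++neg (b n)" for n
 have cw: "cm Z S w" unfolding w_def by (rule cm_Add[OF g cm_Neg[OF cb]])
 note W = cmD[OF cw] and B = cmD[OF cb]
 have "b n*j n = g n*j n" for n unfolding h(4) b_def H_def using h(1-3) h' S by (simp add: cone_simps S(4)[of "n-1", simplified])
 hence wj: "nul (w n*j n)" for n unfolding w_def using G B by (simp add: cone_simps)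
 have wk: "w n = (w n*i n)*p n" for n
  using cone_decomp[OF W(3,4)[of n]] nul_Add_right[of "(w n*j n)*q n" "(w n*i n)*p n"] nul_Cmp_left[OF wj, of "q n" n] W(3-5) by (simp add: cone_simps)
 have "cm (sh 1 X) S (%n. w n*i n)"
 proof (rule cmI[OF sh_cx[OF coneD(3)] G(2)])
  fix n
  have "df S n*(w n*i n) = w (n+1)*(df Z n*i n)" by (rule Cmp_reassoc[OF W(6)[symmetric]]) (use W S in "simp_all add: cone_simps")
  also have "... = (w (n+1)*i (n+1))*neg (df X (n+1))++(w (n+1)*j (n+1))*f (n+1)" using W(3-5) by (simp add: cone_simps)
  also have "... = (w (n+1)*i (n+1))*neg (df X (n+1))"
   by (rule nul_Add_right) (use nul_Cmp_left[OF wj, of "f (n+1)" "n+1"] W(3-5) in "simp_all add: cone_simps")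
  finally show "w (n+1)*i (n+1)*df (sh 1 X) n = df S n*(w n*i n)" by simp
 qed (use W in "simp_all add: cone_simps")
 moreover have "g n++neg ((w n*i n)*p n) = b n" for n unfolding wk[of n, symmetric] using G(3-5) B(3-5) by (simp add: Neg_distrib w_def)
 hence "nh Z S (%n. g n++neg ((w n*i n)*p n))" using nb by simp
 ultimately show ?thesis using that by blast
qed

lemma cone_null:
 assumes k: "cm (sh 1 X) S k" and n: "nh Z S (%n. k n*p n)"
 obtains l where "cm (sh 1 Y) S l" "nh (sh 1 X) S (%n. k n++neg (l n*f (n+1)))"
proof -
 note K = cmD[OF k] note S = cxD[OF K(2)] note K4 = K(4)[unfolded sh_simps]
 obtain h where h: "!!n. arr (h n)" "!!n. dom (h n) = ob Z n" "!!n. cod (h n) = ob S (n-1)"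
  "!!n. k n*p n = df S (n-1)*h n++h (n+1)*df Z n" using nhE[OF n] by blast
 have h': "cod (h (n+1)) = ob S n" for n using h(3)[of "n+1"] by simp
 have S': "cod (df S (n-1)) = ob S n" for n using S(4)[of "n-1"] by simp
 have e: "(k n*p n)*x = df S (n-1)*(h n*x)++h (n+1)*(df Z n*x)" if "arr x" "cod x = ob Z n" for x n
  unfolding h(4) using that h(1-3) h' S' S(2,3) by (simp add: cone_simps)
 define l where "l n = h (n+1)*j (n+1)" for n
 have l: "arr (l n)" "dom (l n) = ob Y (n+1)" "cod (l n) = ob S n" for n unfolding l_def using h(1,2) h' by (simp_all add: cone_simps)
 have ej: "nul (df S (n-1)*(h n*j n)++h (n+1)*(j (n+1)*df Y n))" for n
  using e[of "j n" n, symmetric] K(3,5) K4 S by (simp add: cone_simps)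
 have "cm (sh 1 Y) S l"
 proof (rule cmI[OF sh_cx[OF coneD(4)] K(2)])
  fix n
  have "nul (df S n*l n++neg (l (n+1)*df (sh 1 Y) n))" using ej[of "n+1"] h(1,2) h' h'[of "n+1"] unfolding l_def by (simp add: cone_simps)
  thus "l (n+1)*df (sh 1 Y) n = df S n*l n" using nul_dif[of "df S n*l n" "l (n+1)*df (sh 1 Y) n"] l l[of "n+1"] S by (simp add: cone_simps)
 qed (use l in simp_all)
 moreover have "nh (sh 1 X) S (%n. k n++neg (l n*f (n+1)))"
 proof (rule nhI[of "%n. h n*i n"])
  fix n
  have "k n = df S (n-1)*(h n*i n)++(h (n+1)*(i (n+1)*neg (df X (n+1)))++h (n+1)*(j (n+1)*f (n+1)))"
   using e[of "i n" n] K(3,5) K4 h(1,2) h' by (simp add: cone_simps)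
  also have "... = l n*f (n+1)++(df S (n-1)*(h n*i n)++h (n+1)*i (n+1)*df (sh 1 X) n)"
   unfolding l_def using h(1-3) h' S' S(2,3) Add_commute[of "l n*f (n+1)" "df S (n-1)*(h n*i n)++h (n+1)*i (n+1)*df (sh 1 X) n", unfolded l_def]
   by (simp add: cone_simps Add_assoc)
  finally show "k n++neg (l n*f (n+1)) = df S (n-1)*(h n*i n)++h (n+1)*i (n+1)*df (sh 1 X) n"
   by (rule Add_eq_iff[THEN iffD1, rotated -1]) (use K(3,5) K4 l h(1-3) h' S' S(2,3) in "simp_all add: cone_simps")
 qed (use h in "simp_all add: cone_simps")
 ultimately show ?thesis using that by blast
qed

end

lemma sph_cm_from:
 assumes Y: "cx Y" and x: "arr x" "dom x = E" "cod x = ob Y m" "nul (df Y m*x)"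
 shows "cm (sph E m) Y (%n. if n = m then x else zer (zero_object C) (ob Y n))" (is "cm _ Y ?f")
proof -
 note Y' = cxD[OF Y]
 have E: "obj E" using x by auto
 have f: "arr (?f n)" "dom (?f n) = ob (sph E m) n" "cod (?f n) = ob Y n" for n using x Y' by simp_all
 show ?thesis
 proof (rule cmI[OF sph_cx[OF E] Y f])
  fix n
  have "nul (df Y n*?f n)" using x(4) Y' by simp
  hence "df Y n*?f n = zer (ob (sph E m) n) (ob Y (n+1))" by (rule nul_eq) (use f[of n] Y' in "simp_all del: sph_simps")
  moreover have "?f (n+1)*df (sph E m) n = zer (ob (sph E m) n) (ob Y (n+1))" unfolding sph_simps(2) using f[of "n+1"] sph_ob[OF E] by (simp del: sph_simps)
  ultimately show "?f (n+1)*df (sph E m) n = df Y n*?f n" by metis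
 qed
qed

lemma hexact_sh:
 assumes U: "cx U" and h: "hexact (sh k U) m E" shows "hexact U (m + k) E"
 unfolding hexact_def
proof (intro ballI impI)
 note D = cxD[OF U]
 fix x assume x: "arr x" "dom x = ob U (m + k)" "cod x = E" "nul (x*df U (m + k-1))"
 have "nul (x*df (sh k U) (m-1))" using x D D(4)[of "m + k-1"] by (simp add: int_ac[of _ k])
 then obtain y where y: "arr y" "dom y = ob (sh k U) (m+1)" "cod y = E" "x = y*df (sh k U) m" using h x(1-3) unfolding hexact_def by auto
 have "x = neg y*df U (m + k)" unfolding y(4) using y(1,2) D by (simp add: int_ac[of _ k])
 thus "EX x' : Arr C. dom x' = ob U (m + k+1) & cod x' = E & x = x'*df U (m + k)"
  using y(1-3) by (intro bexI[of _ "neg y"] conjI) (simp_all add: int_ac[of _ k])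
qed

lemma dif_Zer: "cm X Y f ==> (%n. f n++neg (zer (ob X n) (ob Y n))) = f"
 by (rule ext) (simp add: cmD cxD(1)[OF cmD(1)] cxD(1)[OF cmD(2)])

lemma nh_dif_trans:
 assumes f: "cm X Y f" and g: "cm X Y g" and "nh X Y (%n. f n++neg (g n))" "nh X Y g" shows "nh X Y f"
proof -
 have "(f n++neg (g n))++g n = f n" for n using cmD[OF f] cmD[OF g] by (simp add: Add_assoc)
 thus ?thesis using nh_Add[OF cmD(1,2)[OF f] assms(3,4)] by simp
qed

end

context loc_noetherian begin

lemma dm_nul:
 assumes S: "injcx S" and f: "cm X S f" shows "dm X S f = dm X S (%n. zer (ob X n) (ob S n)) <-> nh X S f"
 using dm_inj[OF S f] dm_eq[OF f] cm_Zer[OF cmD(1,2)[OF f]] dif_Zer[OF f] by metis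

lemma dtriv_nh: "injcx S ==> dtriv X S ==> cm X S f ==> nh X S f"
 using dm_nul[of S X f] cm_Zer[of X S] cmD(1,2)[of X S f] unfolding dtriv_def by simp

lemma dtriv_iso:
 assumes i: "isomorphic DD X X'" and t: "dtriv X S" shows "dtriv X' S"
proof -
 obtain a where a: "D.arr a" "D.dom a = X" "D.cod a = X'" "is_iso DD a" using i unfolding isomorphic_def by auto
 have "f = g" if "f : D.hom X' S" "g : D.hom X' S" for f g
  by (rule D.iso_epi_cancel[OF a(4)]) (use that a t in "auto simp: dtriv_def")
 thus ?thesis unfolding dtriv_def by blast
qed

text \<open>If only zero arrows lead to \<open>S\<close> from the second object and its shift, the
  long exact sequence makes composition with \<open>w\<close> a bijection. As \<open>S\<close>
  consists of injectives, arrows into it are chain maps up to homotopy, and the triangle is replaced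
  by that of a cone.\<close>

lemma dist_outer_trivial:
 assumes t: "is_dist_triangle A u v w" and S: "injcx S" and d: "dtriv (D.cod u) S" "dtriv (sh 1 (D.cod u)) S"
 shows "g : D.hom (D.dom w) S ==> EX k : D.hom (D.cod w) S. k**w = g"
  and "k : D.hom (D.cod w) S ==> k' : D.hom (D.cod w) S ==> k**w = k'**w ==> k = k'"
proof -
 obtain u' v' w' a b c where W: "D.arr w" "D.cod w = sh 1 (D.dom u)" and co: "is_cone_triangle A u' v' w'"
  and a: "D.arr a" "D.dom a = D.dom u" "D.cod a = D.dom u'" "is_iso DD a"
  and b: "D.arr b" "D.dom b = D.cod u" "D.cod b = D.dom v'" "is_iso DD b"
  and c: "D.arr c" "D.dom c = D.dom w" "D.cod c = D.dom w'" "is_iso DD c"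
  and sq: "FA (shD 1) a**w = w'**c"
  using t unfolding is_dist_triangle_def Let_def Dshift_shD shD(2) by auto
 obtain X Y f Z i j p q where cone: "is_cone A (X, Y, f) Z i j p q"
  and tr: "u' = Dmap A (X, Y, f)" "v' = Dmap A (Y, Z, j)" "w' = Dmap A (Z, shift_cplx A X, p)"
  using co unfolding is_cone_triangle_def by blast
 note F = coneD(1)[OF cone] and P = cone_p[OF cone]
 have J: "cm Y Z j" by (rule cmI) (use coneD[OF cone] in auto)
 have tr: "u' = dm X Y f" "v' = dm Y Z j" "w' = dm Z (sh 1 X) p" using tr by (simp_all add: dm_def shift_sh)
 define s where "s = FA (shD 1) a"
 have s: "is_iso DD s" "D.arr s" "D.dom s = D.cod w" "D.cod s = sh 1 X"
  unfolding s_def using functor_iso[OF D.category_axioms D.category_axioms shD(1) a(4)] is_functor_simps(2-4)[OF shD(1) a(1)] a W tr F by (simp_all add: shD(2))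
 have w': "D.arr w'" "D.dom w' = Z" "D.cod w' = sh 1 X" using P tr by simp_all
 have "isomorphic DD (D.cod u) Y" unfolding isomorphic_def using b tr J by auto
 hence d: "dtriv Y S" "dtriv (sh 1 Y) S" using dtriv_iso d shD_isomorphic by blast+
 obtain s' where s': "D.arr s'" "D.dom s' = sh 1 X" "D.cod s' = D.cod w" "s'**s = D.idt (D.cod w)" using D.is_isoE[OF s(1)] s by metis
 obtain c' where c': "D.arr c'" "D.dom c' = Z" "D.cod c' = D.dom w" "c'**c = D.idt (D.dom w)" using D.is_isoE[OF c(4)] c w' by metis
 show "EX k : D.hom (D.cod w) S. k**w = g" if "g : D.hom (D.dom w) S"
 proof -
  have g: "D.arr g" "D.dom g = D.dom w" "D.cod g = S" using that by auto
  have gc: "D.arr (g**c')" "D.dom (g**c') = Z" "D.cod (g**c') = S" using g c' by simp_all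
  obtain g0 where g0: "cm Z S g0" "g**c' = dm Z S g0" by (rule dm_full[OF S gc])
  obtain k where k: "cm (sh 1 X) S k" "nh Z S (%n. g0 n++neg (k n*p n))"
   using cone_factor[OF cone g0(1) dtriv_nh[OF S d(1) cm_Cmp[OF J g0(1)]]] by blast
  have "dm (sh 1 X) S k**w' = g**c'" unfolding tr dm_Cmp[OF P k(1)] g0(2) using dm_eq[OF g0(1) cm_Cmp[OF P k(1)] k(2)] by simp
  hence "(dm (sh 1 X) S k**w')**c = g" using g c' c w' by simp
  hence "(dm (sh 1 X) S k**s)**w = g" using sq[folded s_def] s W w' c k(1) by simp
  thus ?thesis using k(1) s by (intro bexI[of _ "dm (sh 1 X) S k**s"]) simp_all
 qed
 show "k = k'" if k: "k : D.hom (D.cod w) S" "k' : D.hom (D.cod w) S" and e: "k**w = k'**w"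
 proof -
  have kk: "D.arr k" "D.dom k = D.cod w" "D.cod k = S" "D.arr k'" "D.dom k' = D.cod w" "D.cod k' = S" using k by auto
  have q: "x**w = ((x**s')**w')**c" if x: "D.arr x" "D.dom x = D.cod w" for x
  proof -
   have "((x**s')**w')**c = x**(s'**(w'**c))" using x s' w' c by simp
   also have "s'**(w'**c) = (s'**s)**w" unfolding sq[symmetric] s_def[symmetric] by (rule D.Cmp_assoc_simp[symmetric]) (use s s' W in simp_all)
   finally show ?thesis unfolding s'(4) using W by simp
  qed
  have e1: "(k**s')**w' = (k'**s')**w'"
   by (rule D.iso_epi_cancel[OF c(4)]) (use q[OF kk(1,2)] q[OF kk(4,5)] e kk s' w' c in simp_all)
  obtain l where l: "cm (sh 1 X) S l" "k**s' = dm (sh 1 X) S l" by (rule dm_full[OF S, of "k**s'"]) (use kk s' in simp_all)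
  obtain l' where l': "cm (sh 1 X) S l'" "k'**s' = dm (sh 1 X) S l'" by (rule dm_full[OF S, of "k'**s'"]) (use kk s' in simp_all)
  have "dm Z S (%n. l n*p n) = dm Z S (%n. l' n*p n)"
   using e1 unfolding l(2) l'(2) tr dm_Cmp[OF P l(1)] dm_Cmp[OF P l'(1)] .
  hence "nh Z S (%n. l n*p n++neg (l' n*p n))" by (rule dm_inj[OF S cm_Cmp[OF P l(1)] cm_Cmp[OF P l'(1)]])
  hence n: "nh Z S (%n. (l n++neg (l' n))*p n)" using cmD(3-5)[OF l(1)] cmD(3-5)[OF l'(1)] cmD(3-5)[OF P] by (simp add: Add_Cmp)
  have ll: "cm (sh 1 X) S (%n. l n++neg (l' n))" by (rule cm_Add[OF l(1) cm_Neg[OF l'(1)]])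
  obtain y where y: "cm (sh 1 Y) S y" "nh (sh 1 X) S (%n. l n++neg (l' n)++neg (y n*f (n+1)))" by (rule cone_null[OF cone ll n])
  have fs: "cm (sh 1 X) (sh 1 Y) (%n. f (n+1))" by (rule sh_cm[OF F])
  have "nh (sh 1 X) S (%n. y n*f (n+1))"
   using nh_Cmp[OF cm_Idt[OF cmD(2)[OF y(1)]] dtriv_nh[OF S d(2) y(1)] fs] cmD(3-5)[OF y(1)] cmD(3-5)[OF fs] by simp
  hence "nh (sh 1 X) S (%n. l n++neg (l' n))" by (rule nh_dif_trans[OF ll cm_Cmp[OF fs y(1)] y(2)])
  hence "k**s' = k'**s'" unfolding l(2) l'(2) by (rule dm_eq[OF l(1) l'(1)])
  hence "k**(s'**s) = k'**(s'**s)" using D.Cmp_assoc_simp[of s s'] kk s s' by metis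
  thus ?thesis unfolding s'(4) using kk by simp
 qed
qed

end

section \<open>Abstract local cohomology functors\<close>

locale abstract_lc = stable_torsion A \<kappa> \<G> \<J>
 for A :: "('o, 'm, 'z) acat_scheme" (structure) and \<kappa> :: "'u rel" and \<G> :: "'o set" and \<J> :: "'o set" +
 fixes \<delta> :: "('o, 'm) dfunctor"
 assumes alc: "abstract_local_cohomology A \<delta>"
  and J_def: "\<J> = {J. is_injective A J & in_degree_0 A J : Ker_obj A \<delta>}"
begin

abbreviation Im where "Im == Im_obj A \<delta>"

lemma delta_functor: "is_functor DD DD \<delta>"
 using alc unfolding abstract_local_cohomology_def is_triangle_functor_def is_additive_def by blast

lemmas delta = is_functor_simps[OF delta_functor]

lemma theta_ex: "EX \<theta>. is_nat_iso DD DD (\<delta> \<circ>\<^sub>F shD 1) (shD 1 \<circ>\<^sub>F \<delta>) \<theta> &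
     (ALL u v w. is_dist_triangle A u v w --> is_dist_triangle A (FA \<delta> u) (FA \<delta> v) (\<theta> (D.dom u)**FA \<delta> w))"
 using alc unfolding abstract_local_cohomology_def is_triangle_functor_def Dshift_shD by blast

lemma Im_iff: "U : Im <-> (EX X. cx X & isomorphic DD U (FO \<delta> X))"
proof -
 have "cx U" if "isomorphic DD U V" for V
  using that D.Dom_Obj unfolding isomorphic_def by auto
 thus ?thesis unfolding Im_obj_def by auto
qed

lemma Im_cx: "U : Im ==> cx U" unfolding Im_obj_def by simp

lemma Im_delta: "cx X ==> FO \<delta> X : Im" unfolding Im_iff using D.isomorphic_refl delta(1) by auto

lemma Im_iso: "isomorphic DD U V ==> V : Im ==> U : Im" unfolding Im_iff using D.isomorphic_trans by blast

text \<open>The counit of the adjunction, moved along the isomorphism \<open>\<nu>\<close> from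
  \<open>\<delta>\<close> to the coreflection: \<open>\<epsilon> Y\<close> is the arrow whose
  adjunct is \<open>\<nu> Y\<close>.\<close>

lemma eps_ex: "EX \<epsilon>. (ALL Y. cx Y --> \<epsilon> Y : D.hom (FO \<delta> Y) Y) & (ALL f : Arr DD. \<epsilon> (D.cod f)**FA \<delta> f = f**\<epsilon> (D.dom f)) &
  (ALL U : Im. ALL Y. ALL g : D.hom U Y. EX! h. h : D.hom U (FO \<delta> Y) & \<epsilon> Y**h = g)"
proof -
 let ?C = "full_subcat DD Im" and ?I = "fincl :: ('o, 'm) dfunctor"
 obtain \<rho> \<nu> where adj: "is_right_adjoint ?C DD ?I \<rho>" and nu: "is_nat_iso DD DD \<delta> (?I \<circ>\<^sub>F \<rho>) \<nu>"
  using alc unfolding abstract_local_cohomology_def nat_isomorphic_def by blast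
 have C: "f : Arr ?C <-> D.arr f & D.dom f : Im & D.cod f : Im" "Dom ?C = D.dom" "Cod ?C = D.cod" "Obj ?C = Obj DD Int Im" "Idt ?C = D.idt"
  "Cmp ?C = Cmp DD" "FO ?I X = X" "FA ?I f = f" for f and X :: "('o, 'm) cplx"
  by (simp_all add: full_subcat_def fincl_def)
 obtain \<Phi> where R: "is_functor DD ?C \<rho>" and bij: "ALL X : Obj ?C. ALL Y : Obj DD. bij_betw (\<Phi> X Y) (D.hom (FO ?I X) Y) (Hom ?C X (FO \<rho> Y))"
  and nat: "ALL f : Arr ?C. ALL g : Arr DD. ALL h : D.hom (FO ?I (Cod ?C f)) (D.dom g).
   \<Phi> (Dom ?C f) (D.cod g) ((g**h)**FA ?I f) = Cmp ?C (Cmp ?C (FA \<rho> g) (\<Phi> (Cod ?C f) (D.dom g) h)) f"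
  using adj unfolding is_right_adjoint_def by (elim exE conjE) (rule that)
 have bij: "bij_betw (\<Phi> X Y) (D.hom X Y) (Hom ?C X (FO \<rho> Y))" if "X : Im" "cx Y" for X Y
  using bij that Im_cx[OF that(1)] unfolding C by simp
 have nat: "\<Phi> (D.dom f) (D.cod g) ((g**h)**f) = (FA \<rho> g**\<Phi> (D.cod f) (D.dom g) h)**f"
  if "f : Arr ?C" "D.arr g" "h : D.hom (D.cod f) (D.dom g)" for f g h using nat[THEN bspec, OF that(1), THEN bspec, OF that(2), THEN bspec, of h] that(3) unfolding C by blast
 note R = is_functor_simps[OF R, unfolded C]
 have nu: "!!X. cx X ==> \<nu> X : Arr DD" "!!X. cx X ==> D.dom (\<nu> X) = FO \<delta> X" "!!X. cx X ==> D.cod (\<nu> X) = FO \<rho> X" "!!X. cx X ==> is_iso DD (\<nu> X)"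
   "!!f. D.arr f ==> (\<nu> (D.cod f))**FA \<delta> f = FA \<rho> f**(\<nu> (D.dom f))"
  using nu unfolding is_nat_iso_def is_nat_trans_def by (auto simp: fincl_def fcomp_def)
 have "EX e. e : D.hom (FO \<delta> Y) Y & \<Phi> (FO \<delta> Y) Y e = \<nu> Y" if Y: "cx Y" for Y
 proof -
  have "\<nu> Y : Hom ?C (FO \<delta> Y) (FO \<rho> Y)" using nu(1-3)[OF Y] Im_delta[OF Y] R(1)[of Y] Y by (simp add: C)
  hence "\<nu> Y : \<Phi> (FO \<delta> Y) Y ` D.hom (FO \<delta> Y) Y" using bij[OF Im_delta[OF Y] Y] by (simp add: bij_betw_def)
  thus ?thesis by force
 qed
 then obtain \<epsilon> where e: "!!Y. cx Y ==> \<epsilon> Y : D.hom (FO \<delta> Y) Y" "!!Y. cx Y ==> \<Phi> (FO \<delta> Y) Y (\<epsilon> Y) = \<nu> Y" by metis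
 have Phi: "\<Phi> U Y (\<epsilon> Y**h) = (\<nu> Y)**h" if U: "U : Im" and Y: "cx Y" and h: "h : D.hom U (FO \<delta> Y)" for U Y h
 proof -
  have "\<Phi> U Y ((D.idt Y**\<epsilon> Y)**h) = (FA \<rho> (D.idt Y)**(\<nu> Y))**h"
   using nat[of h "D.idt Y" "\<epsilon> Y"] U Y h Im_delta[OF Y] e[OF Y] by (simp add: C)
  thus ?thesis using e(1)[OF Y] nu(1-3)[OF Y] R(5)[of Y] Y R(1)[of Y] by simp
 qed
 have inj: "g = h" if "U : Im" "cx Y" "g : D.hom U Y" "h : D.hom U Y" "\<Phi> U Y g = \<Phi> U Y h" for U Y g h
  using bij[OF that(1,2)] that(3-5) unfolding bij_betw_def by (auto dest: inj_onD)
 show ?thesis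
 proof (intro exI[of _ \<epsilon>] conjI allI impI ballI e(1))
  fix f assume f: "D.arr f"
  hence X: "cx (D.dom f)" and Y: "cx (D.cod f)" using D.Dom_Obj D.Cod_Obj by auto
  note E = e(1)[OF X, unfolded Hom_iff] e(1)[OF Y, unfolded Hom_iff]
  show "\<epsilon> (D.cod f)**FA \<delta> f = f**\<epsilon> (D.dom f)"
  proof (rule inj[OF Im_delta[OF X] Y])
   have i: "D.idt (FO \<delta> (D.dom f)) : Arr ?C" using Im_delta[OF X] Im_cx by (simp add: C)
   have "\<Phi> (FO \<delta> (D.dom f)) (D.cod f) (f**\<epsilon> (D.dom f)) = FA \<rho> f**(\<nu> (D.dom f))"
    using nat[OF i f, of "\<epsilon> (D.dom f)"] E f X delta(1)[of "D.dom f"] e(2)[OF X] nu(1-3)[OF X] R(2-4)[OF f] by simp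
   thus "\<Phi> (FO \<delta> (D.dom f)) (D.cod f) (\<epsilon> (D.cod f)**FA \<delta> f) = \<Phi> (FO \<delta> (D.dom f)) (D.cod f) (f**\<epsilon> (D.dom f))"
    unfolding nu(5)[OF f, symmetric] using Phi[OF Im_delta[OF X] Y, of "FA \<delta> f"] delta(2-4)[OF f] by simp
  qed (use E f delta(2-4)[OF f] in auto)
 next
  fix U Y g assume U: "U : Im" and g: "g : D.hom U Y"
  hence Y: "cx Y" using D.Cod_Obj by auto
  note E = e(1)[OF Y, unfolded Hom_iff]
  have pg: "D.arr (\<Phi> U Y g)" "D.dom (\<Phi> U Y g) = U" "D.cod (\<Phi> U Y g) = FO \<rho> Y" using bij_betwE[OF bij[OF U Y]] g by (auto simp: C)
  obtain n where n: "D.arr n" "D.dom n = FO \<rho> Y" "D.cod n = FO \<delta> Y" "(\<nu> Y)**n = D.idt (FO \<rho> Y)"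
   using D.is_isoE[OF nu(4)[OF Y]] nu(1-3)[OF Y] by metis
  show "EX! h. h : D.hom U (FO \<delta> Y) & \<epsilon> Y**h = g"
  proof (rule ex1I[of _ "n**\<Phi> U Y g"])
   have "((\<nu> Y)**n)**\<Phi> U Y g = \<Phi> U Y g" unfolding n(4) using pg by simp
   hence "\<Phi> U Y (\<epsilon> Y**(n**\<Phi> U Y g)) = \<Phi> U Y g" using Phi[OF U Y, of "n**\<Phi> U Y g"] pg n(1-3) nu(1-3)[OF Y] by simp
   hence "\<epsilon> Y**(n**\<Phi> U Y g) = g" by (rule inj[OF U Y _ g, rotated]) (use pg n E in auto)
   thus "n**\<Phi> U Y g : D.hom U (FO \<delta> Y) & \<epsilon> Y**(n**\<Phi> U Y g) = g" using pg n by simp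
   fix h assume h: "h : D.hom U (FO \<delta> Y) & \<epsilon> Y**h = g"
   show "h = n**\<Phi> U Y g"
    by (rule D.iso_mono_cancel[OF nu(4)[OF Y]]) (use h Phi[OF U Y, of h] pg n nu(1-3)[OF Y] D.Cmp_assoc_simp[of "\<Phi> U Y g" n "\<nu> Y"] in auto)
  qed
 qed
qed

definition eps where "eps = (SOME \<epsilon>. (ALL Y. cx Y --> \<epsilon> Y : D.hom (FO \<delta> Y) Y) & (ALL f : Arr DD. \<epsilon> (D.cod f)**FA \<delta> f = f**\<epsilon> (D.dom f)) &
  (ALL U : Im. ALL Y. ALL g : D.hom U Y. EX! h. h : D.hom U (FO \<delta> Y) & \<epsilon> Y**h = g))"

lemma eps:
 shows "cx Y ==> D.arr (eps Y)" "cx Y ==> D.dom (eps Y) = FO \<delta> Y" "cx Y ==> D.cod (eps Y) = Y"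
  "D.arr f ==> eps (D.cod f)**FA \<delta> f = f**eps (D.dom f)"
  and eps_lift: "U : Im ==> D.arr g ==> D.dom g = U ==> D.cod g = Y ==> EX h : Arr DD. D.dom h = U & D.cod h = FO \<delta> Y & eps Y**h = g"
  and eps_eq: "cx Y ==> D.dom g : Im ==> D.arr g ==> D.arr h ==> D.dom h = D.dom g ==> D.cod h = FO \<delta> Y ==> D.cod g = FO \<delta> Y ==>
   eps Y**g = eps Y**h ==> g = h"
proof -
 have s: "(ALL Y. cx Y --> eps Y : D.hom (FO \<delta> Y) Y) & (ALL f : Arr DD. eps (D.cod f)**FA \<delta> f = f**eps (D.dom f)) &
  (ALL U : Im. ALL Y. ALL g : D.hom U Y. EX! h. h : D.hom U (FO \<delta> Y) & eps Y**h = g)"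
  unfolding eps_def by (rule someI_ex[OF eps_ex])
 thus 1: "cx Y ==> D.arr (eps Y)" "cx Y ==> D.dom (eps Y) = FO \<delta> Y" "cx Y ==> D.cod (eps Y) = Y"
  "D.arr f ==> eps (D.cod f)**FA \<delta> f = f**eps (D.dom f)" by auto
 show "U : Im ==> D.arr g ==> D.dom g = U ==> D.cod g = Y ==> EX h : Arr DD. D.dom h = U & D.cod h = FO \<delta> Y & eps Y**h = g"
  using s[THEN conjunct2, THEN conjunct2, THEN bspec, of U, THEN spec, of Y, THEN bspec, of g] by auto
 assume a: "cx Y" "D.dom g : Im" "D.arr g" "D.arr h" "D.dom h = D.dom g" "D.cod h = FO \<delta> Y" "D.cod g = FO \<delta> Y" "eps Y**g = eps Y**h"
 have "eps Y**h : D.hom (D.dom g) Y" using a(1,4,5,6) 1(1-3)[OF a(1)] by simp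
 hence "EX! k. k : D.hom (D.dom g) (FO \<delta> Y) & eps Y**k = eps Y**h"
  by (rule s[THEN conjunct2, THEN conjunct2, THEN bspec, OF a(2), THEN spec, THEN bspec])
 then obtain k where k: "!!y. y : D.hom (D.dom g) (FO \<delta> Y) ==> eps Y**y = eps Y**h ==> y = k" by (elim ex1E) blast
 have "g = k" by (rule k) (simp add: a(3,7), rule a(8))
 moreover have "h = k" by (rule k) (simp add: a(4-6), rule refl)
 ultimately show "g = h" by simp
qed

text \<open>\<open>t**eps U\<close> and the identity agree after composition with
  \<open>eps U\<close>, so they are equal by the uniqueness of lifts.\<close>

lemma section_iso:
 assumes U: "cx U" and t: "D.arr t" "D.dom t = U" "D.cod t = FO \<delta> U" "eps U**t = D.idt U" shows "is_iso DD (eps U)"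
proof -
 note e = eps(1-3)[OF U] and dU = Im_delta[OF U]
 have cU: "cx (FO \<delta> U)" by (rule Im_cx[OF dU])
 have "eps U**(t**eps U) = (eps U**t)**eps U" by (rule D.Cmp_assoc_simp[symmetric]) (use e t(1-3) in simp_all)
 also have "... = eps U" unfolding t(4) using e by simp
 finally have 1: "eps U**(t**eps U) = eps U" .
 have "t**eps U = D.idt (FO \<delta> U)" by (rule eps_eq[OF U]) (use e t(1-3) dU cU 1 in simp_all)
 thus ?thesis using D.is_isoI[OF e(1) t(1)] e t by simp
qed

lemma Im_section:
 assumes U: "cx U" and t: "D.arr t" "D.dom t = U" "D.cod t = FO \<delta> U" "eps U**t = D.idt U" shows "U : Im"
proof -
 have "isomorphic DD (FO \<delta> U) U" unfolding isomorphic_def using section_iso[OF U t] eps(1-3)[OF U] by auto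
 thus ?thesis unfolding Im_iff using U D.isomorphic_sym by blast
qed

lemma eps_iso:
 assumes U: "U : Im" shows "is_iso DD (eps U)"
proof -
 have cU: "cx U" by (rule Im_cx[OF U])
 obtain t where "D.arr t" "D.dom t = U" "D.cod t = FO \<delta> U" "eps U**t = D.idt U" using eps_lift[OF U, of "D.idt U" U] cU by auto
 thus ?thesis by (rule section_iso[OF cU])
qed

lemma delta_sh: assumes X: "cx X" shows "isomorphic DD (sh 1 (FO \<delta> X)) (FO \<delta> (sh 1 X))"
proof -
 obtain \<theta> where "is_nat_iso DD DD (\<delta> \<circ>\<^sub>F shD 1) (shD 1 \<circ>\<^sub>F \<delta>) \<theta>" using theta_ex by (elim exE conjE)
 hence "\<theta> X : D.hom (FO \<delta> (sh 1 X)) (sh 1 (FO \<delta> X))" "is_iso DD (\<theta> X)"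
  using X unfolding is_nat_iso_def is_nat_trans_def by (auto simp: fcomp_def shD(2))
 hence "isomorphic DD (FO \<delta> (sh 1 X)) (sh 1 (FO \<delta> X))" unfolding isomorphic_def by blast
 thus ?thesis by (rule D.isomorphic_sym)
qed

text \<open>For the negative shift, write \<open>U\<close> as the shift of \<open>V\<close>: then
  \<open>\<delta> U\<close> is the shift of \<open>\<delta> V\<close>, and \<open>U\<close> is
  isomorphic to \<open>\<delta> U\<close>.\<close>

lemma Im_sh:
 assumes U: "U : Im" shows "sh 1 U : Im" "sh (- 1) U : Im"
proof -
 obtain X where X: "cx X" "isomorphic DD U (FO \<delta> X)" using U Im_iff by blast
 have "isomorphic DD (sh 1 U) (FO \<delta> (sh 1 X))" by (rule D.isomorphic_trans[OF shD_isomorphic[OF X(2)] delta_sh[OF X(1)]])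
 thus "sh 1 U : Im" unfolding Im_iff using sh_cx[OF X(1)] by blast
 have cU: "cx U" by (rule Im_cx[OF U])
 define V where "V = sh (- 1) U"
 have V: "cx V" "sh 1 V = U" unfolding V_def using sh_cx[OF cU] sh_sh[OF cU, of "- 1"] by simp_all
 have "isomorphic DD U (FO \<delta> U)" unfolding isomorphic_def using D.is_isoE[OF eps_iso[OF U]] eps(1-3)[OF cU] by (metis Hom_iff)
 hence "isomorphic DD U (sh 1 (FO \<delta> V))" using D.isomorphic_trans D.isomorphic_sym[OF delta_sh[OF V(1)]] V(2) by simp
 hence "isomorphic DD (sh (- 1) U) (sh (- 1) (sh 1 (FO \<delta> V)))" by (rule shD_isomorphic)
 moreover have "sh (- 1) (sh 1 (FO \<delta> V)) = FO \<delta> V" by (rule sh_sh) (use delta(1)[of V] V in simp)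
 ultimately show "sh (- 1) U : Im" unfolding Im_iff using V(1) by auto
qed

lemma Im_sph:
 assumes E: "obj E" and U: "sph E 0 : Im" shows "sph E m : Im"
proof (induction m rule: int_induct[of _ 0])
 case (step1 m) thus ?case using Im_sh(2)[of "sph E m"] sh_sph[OF E] by simp
next
 case (step2 m) thus ?case using Im_sh(1)[of "sph E m"] sh_sph[OF E] by simp
qed (rule U)

text \<open>An arrow from \<open>U\<close> to the sphere of \<open>J\<close> lifts through the
  counit to \<open>\<delta>\<close> of that sphere, which is zero; the other degrees follow by
  shifting \<open>U\<close>.\<close>

lemma Im_hexact:
 assumes J: "J : \<J>" and U: "U : Im" shows "hexact U m J"
 using U
proof (induction m arbitrary: U rule: int_induct[of _ 0])
 case base
 have inj: "inject J" and z: "is_zero DD (FO \<delta> (sph J 0))" using J unfolding J_def Ker_obj_def in_degree_0 by auto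
 have "a = b" if ab: "a : D.hom U (sph J 0)" "b : D.hom U (sph J 0)" for a b
 proof -
  obtain h k where h: "h : D.hom U (FO \<delta> (sph J 0))" "eps (sph J 0)**h = a" and k: "k : D.hom U (FO \<delta> (sph J 0))" "eps (sph J 0)**k = b"
   using eps_lift[OF base] ab by (metis Hom_iff)
  have "U : Obj DD" using Im_cx[OF base] by simp
  hence "EX! f. f : D.hom U (FO \<delta> (sph J 0))" using z unfolding is_zero_def by blast
  hence "h = k" using h(1) k(1) by blast
  thus ?thesis using h k by simp
 qed
 hence "dtriv U (sph J 0)" unfolding dtriv_def by blast
 thus ?case using dtriv_sph[OF Im_cx[OF base] inj] by blast
next
 case (step1 m) thus ?case using hexact_sh[OF Im_cx[OF step1(3)], of 1 m J] Im_sh(1)[OF step1(3)] by blast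
next
 case (step2 m) thus ?case using hexact_sh[OF Im_cx[OF step2(3)], of "- 1" m J] Im_sh(2)[OF step2(3)] by simp
qed

text \<open>\<open>\<delta> X\<close> is replaced by a complex \<open>Y\<close> of injectives, so
  that the counit becomes a chain map \<open>e\<close> whose universal property holds for chain maps
  up to homotopy. The last clause is the criterion for membership in \<open>Im\<close>: a section of
  \<open>e\<close> up to homotopy.\<close>

lemma counit_model:
 assumes X: "injcx X"
 obtains Y e where "injcx Y" "Y : Im" "cm Y X e" "EX r. is_iso DD r & D.arr r & D.dom r = Y & D.cod r = FO \<delta> X & eps X**r = dm Y X e"
  "!!U g. U : Im ==> cm U X g ==> EX h. cm U Y h & nh U X (%n. e n*h n++neg (g n))"
  "!!U h. U : Im ==> cm U Y h ==> nh U X (%n. e n*h n) ==> nh U Y h"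
  "!!t. cm X Y t ==> nh X X (%n. e n*t n++neg (idt (ob X n))) ==> X : Im"
proof -
 have cX: "cx X" by (rule injcxD[OF X])
 note E = eps(1-3)[OF cX]
 have dX: "cx (FO \<delta> X)" using delta(1)[of X] cX by simp
 obtain Y s where Y: "injcx Y" "coqis (FO \<delta> X) Y s" using ex_resolution[OF dX] by blast
 have s: "cm (FO \<delta> X) Y s" by (rule coqis_cm[OF Y(2)])
 obtain r where r: "D.arr r" "D.dom r = Y" "D.cod r = FO \<delta> X" "r**dm (FO \<delta> X) Y s = D.idt (FO \<delta> X)" "dm (FO \<delta> X) Y s**r = D.idt Y" "is_iso DD r"
  using D.is_isoE[OF dm_iso[OF Y(2)]] s by (metis dm(2,3))
 obtain e where e: "cm Y X e" "eps X**r = dm Y X e" by (rule dm_full[OF X, of "eps X**r"]) (use E r in simp_all)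
 have iso: "isomorphic DD Y (FO \<delta> X)" unfolding isomorphic_def using r by auto
 have YI: "Y : Im" using iso cX Im_iff by blast
 have ed: "eps X**(r**a) = dm Y X e**a" if "D.arr a" "D.cod a = Y" for a unfolding e(2)[symmetric] using E r that by simp
 have eh: "eps X**(r**dm U Y h) = dm U X (%n. e n*h n)" if "cm U Y h" for U h
  using ed[of "dm U Y h"] dm_Cmp[OF that e(1)] that by simp
 show ?thesis
 proof (rule that[OF Y(1) YI e(1)])
  show "EX r. is_iso DD r & D.arr r & D.dom r = Y & D.cod r = FO \<delta> X & eps X**r = dm Y X e" using r e(2) by blast
 next
  fix U g assume U: "U : Im" and g: "cm U X g"
  obtain a where a: "D.arr a" "D.dom a = U" "D.cod a = FO \<delta> X" "eps X**a = dm U X g" using eps_lift[OF U, of "dm U X g" X] g by auto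
  obtain h where h: "cm U Y h" "dm (FO \<delta> X) Y s**a = dm U Y h" by (rule dm_full[OF Y(1), of "dm (FO \<delta> X) Y s**a"]) (use a s in simp_all)
  have "r**dm U Y h = (r**dm (FO \<delta> X) Y s)**a" unfolding h(2)[symmetric] using a r(1-3) s by simp
  hence "dm U X (%n. e n*h n) = dm U X g" unfolding eh[OF h(1), symmetric] r(4) using a by simp
  thus "EX h. cm U Y h & nh U X (%n. e n*h n++neg (g n))" using dm_inj[OF X cm_Cmp[OF h(1) e(1)] g] h(1) by blast
 next
  fix U h assume U: "U : Im" and h: "cm U Y h" and n: "nh U X (%n. e n*h n)"
  let ?z = "%n. zer (ob U n) (ob Y n)"
  have z: "cm U Y ?z" by (rule cm_Zer[OF cmD(1,2)[OF h]])
  have ez: "(%n. e n*?z n) = (%n. zer (ob U n) (ob X n))" by (rule ext) (use cmD[OF e(1)] cxD(1)[OF cmD(1)[OF h]] in simp)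
  have "dm U X (%n. e n*h n) = dm U X (%n. e n*?z n)" unfolding ez using dm_nul[OF X cm_Cmp[OF h e(1)]] n by blast
  hence "eps X**(r**dm U Y h) = eps X**(r**dm U Y ?z)" using eh[OF h] eh[OF z] by simp
  hence "r**dm U Y h = r**dm U Y ?z" by (rule eps_eq[OF cX, rotated -1]) (use U h z r in simp_all)
  hence "dm U Y h = dm U Y ?z" by (rule D.iso_mono_cancel[OF r(6), rotated -1]) (use h z r in simp_all)
  thus "nh U Y h" using dm_nul[OF Y(1) h] by blast
 next
  fix t assume t: "cm X Y t" "nh X X (%n. e n*t n++neg (idt (ob X n)))"
  have "eps X**(r**dm X Y t) = D.idt X"
   unfolding eh[OF t(1)] dm_Idt[OF cX, symmetric] by (rule dm_eq[OF cm_Cmp[OF t(1) e(1)] cm_Idt[OF cX] t(2)])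
  thus "X : Im" using Im_section[OF cX, of "r**dm X Y t"] t(1) r by simp
 qed
qed

end

context abelian_category begin

lemma sv_disjoint:
 assumes i: "mono i" "mono j" "cod j = cod i" and d: "sv i Int sv j <= zr (cod i)"
  and x: "arr x" "cod x = dom i" "arr y" "cod y = dom j" "dom y = dom x" and n: "nul (i*x++j*y)"
 shows "nul x" "nul y"
proof -
 have "nul ((i*x)++neg (neg (j*y)))" using n i x by simp
 hence e: "i*x = neg (j*y)" by (subst (asm) nul_dif) (use i x in auto)
 have "i*x : sv i" by (rule svI) (use i x in auto)
 moreover have "i*x : sv j" using svI[of "neg y" j] i x by (simp add: e)
 ultimately have nx: "nul (i*x)" using d by auto
 thus "nul x" by (rule mono_nul[OF i(1)]) (use x in auto)
 have "nul (j*y)" using nx i x by (simp add: e)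
 thus "nul y" by (rule mono_nul[OF i(2)]) (use x in auto)
qed

end

context loc_noetherian begin

text \<open>Monoform objects are uniform, and uniformity passes to essential extensions: of two
  complementary summands one meets the monoform object in zero, hence is zero.\<close>

lemma envelope_indecomposable:
 assumes E: "obj E" and m: "mono m" "cod m = E" "is_monoform A (dom m)"
  and S: "S : Sub E" "ess E (sv m) S"
 shows "is_indecomposable A (dom (inc S))"
proof -
 note u = inc[OF S(1)]
 have H: "obj (dom m)" "~ zero (dom m)" using m(3) unfolding is_monoform_def by auto
 have mS: "sv m <= S" and ess: "!!T. T : Sub E ==> T <= S ==> T Int sv m <= zr E ==> T <= zr E" using S(2) unfolding ess_def by blast+
 have part: "zero (dom k)" if k: "mono k" "cod k = dom (inc S)" and z: "pre m (sv (inc S*k)) <= zr (dom m)" for k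
 proof -
  have uk: "mono (inc S*k)" "cod (inc S*k) = E" "dom (inc S*k) = dom k" using u k by simp_all
  have ukS: "sv (inc S*k) <= S" by (rule sv_le[OF S(1) inc_Cmp_mem[OF S(1)]]) (use k in auto)
  have "sv (inc S*k) Int sv m <= zr E"
  proof
   fix x assume x: "x : sv (inc S*k) Int sv m"
   then obtain y where y: "arr y" "cod y = dom m" "x = m*y" by (auto elim: svE)
   hence "y : pre m (sv (inc S*k))" using x by simp
   hence "nul y" using z by auto
   thus "x : zr E" using y m by simp
  qed
  from ess[OF _ ukS this] have "sv (inc S*k) <= zr E" using sv_Sub[OF uk(1)] uk(2) by simp
  thus ?thesis using zero_sv[OF uk(1)] uk by simp
 qed
 have "~ zero (dom (inc S))"
 proof
  assume "zero (dom (inc S))"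
  hence "sv m <= zr (cod m)" using zero_inc[OF S(1)] mS m by auto
  thus False using zero_sv[OF m(1)] H by simp
 qed
 moreover have "zero X | zero Y" if O: "obj X" "obj Y" and B: "is_biproduct A X Y (dom (inc S)) i j p q" for X Y i j p q
 proof -
  note b = bip_facts[OF B O]
  have ij: "mono i" "mono j" using mono_right[of p i] mono_right[of q j] b(1-15) O by simp_all
  let ?P = "%k. pre m (sv (inc S*k))"
  have P: "?P k : Sub (dom m)" if "mono k" "cod k = dom (inc S)" for k
   by (rule pre_Sub) (use m u that sv_Sub[of "inc S*k"] in auto)
  have "?P i Int ?P j <= zr (dom m)"
  proof
   fix x assume "x : ?P i Int ?P j"
   hence x: "arr x" "cod x = dom m" "m*x : sv (inc S*i)" "m*x : sv (inc S*j)" by auto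
   obtain y where y: "arr y" "cod y = X" "m*x = inc S*(i*y)" using x(3) b(1-13) u by (auto elim: svE)
   obtain z where z: "arr z" "cod z = Y" "m*x = inc S*(j*z)" using x(4) b(1-13) u by (auto elim: svE)
   have "i*y = j*z" by (rule mono_cancel[OF u(1)]) (use y z b(1-13) in auto)
   hence "q*(j*z) = q*(i*y)" by simp
   hence "nul z" using b(19)[OF y(1,2)] b(20)[OF z(1,2)] y(1) O by simp
   hence "nul (j*z)" by (rule nul_Cmp_right) (use z(1,2) b(5-7) in simp_all)
   hence "nul (m*x)" unfolding z(3) by (rule nul_Cmp_right) (use z(1,2) b(5-7) u(2) in simp_all)
   thus "x : zr (dom m)" using mono_nul[OF m(1), of x] x(1,2) by simp
  qed
  from monoform_uniform[OF m(3) P P this] have "?P i <= zr (dom m) | ?P j <= zr (dom m)" using ij b(1-7) by simp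
  thus ?thesis using part[of i] part[of j] ij b(1-7) by auto
 qed
 ultimately show ?thesis unfolding is_indecomposable_def using u by blast
qed

end

context abstract_lc begin

text \<open>Testing against \<open>\<J>\<close> shows that the cohomology of \<open>U\<close> is
  torsion, so it has only zero arrows to any torsion-free \<open>E\<close>.\<close>

lemma Im_hexact_tfree:
 assumes U: "U : Im" and E: "inject E" "tfree E" shows "hexact U m E"
 unfolding hexact_def
proof (intro ballI impI)
 have cU: "cx U" by (rule Im_cx[OF U])
 fix x assume x: "arr x" "dom x = ob U m" "cod x = E" "nul (x*df U (m-1))"
 obtain k q where c: "is_cohomology A U m k q" using coh_ex[OF cU] by blast
 have k: "arr k" "cod k = ob U m" "nul (df U m*k)" "epi q" "arr q" "dom q = dom k" by (rule cohE[OF cU c]; blast)+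
 have "cod q : tors"
 proof (rule torsI)
  fix f assume f: "arr f" "dom f = cod q" "cod f : \<J>"
  obtain y where y: "arr y" "dom y = ob U m" "cod y = cod f" "nul (y*df U (m-1))" "y*k = f*q"
   by (rule coh_down[OF cU c J_injective[OF f(3)] f(1,2) refl])
  obtain y' where y': "arr y'" "dom y' = ob U (m+1)" "y = y'*df U m" using Im_hexact[OF f(3) U, of m] y(1-4) unfolding hexact_def by blast
  have "nul (f*q)" unfolding y(5)[symmetric] y'(3) using y'(1,2) k cxD[OF cU] by simp
  thus "nul f" by (rule epi_nul[OF k(4)]) (use f in auto)
 qed (use k in auto)
 moreover obtain b where b: "arr b" "dom b = cod q" "cod b = cod x" "b*q = x*k" by (rule coh_up[OF cU c x(1,2,4)])
 ultimately have "nul b" using tfreeD[OF E(2)] x by simp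
 hence "nul (x*k)" unfolding b(4)[symmetric] using b(1,2) k by simp
 then obtain y where "arr y" "dom y = ob U (m+1)" "cod y = E" "y*df U m = x" by (rule coh_zero[OF cU c E(1) x(1-3)])
 thus "EX x' : Arr A. dom x' = ob U (m+1) & cod x' = E & x = x'*df U m" by blast
qed

text \<open>The largest injective subobject \<open>M\<close> of the cocycles of \<open>\<delta> E\<close> on which the counit is a monomorphism maps onto \<open>E\<close>:
 otherwise the envelope of a monoform subobject of \<open>E\<close> disjoint from the image of \<open>M\<close> lifts to \<open>\<delta> E\<close> by the second axiom.\<close>

lemma Im_injective:
 assumes E: "inject E" "E : tors" shows "sph E m : Im"
proof (rule Im_sph)
 show EO: "obj E" by (rule is_injective_Obj[OF E(1)])
 let ?S = "sph E 0"
 have S: "injcx ?S" by (rule sph_injcx[OF E(1)])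
 obtain Y e where Y: "injcx Y" and e: "cm Y ?S e"
  and lift: "!!U g. U : Im ==> cm U ?S g ==> EX h. cm U Y h & nh U ?S (%n. e n*h n++neg (g n))"
  and sect: "!!t. cm ?S Y t ==> nh ?S ?S (%n. e n*t n++neg (idt (ob ?S n))) ==> ?S : Im" by (rule counit_model[OF S]) blast
 note cY = injcxD(1)[OF Y] note Yd = cxD[OF cY] and ed = cmD[OF e]
 let ?e = "e 0" and ?d = "df Y 0" and ?X = "ob Y 0"
 have e0: "arr ?e" "dom ?e = ?X" "cod ?e = E" using ed(3-5)[of 0] by simp_all
 \<comment> \<open>\<open>AB5\<close> and \<open>injective_chain\<close> make this family closed
   under directed unions.\<close>
 define \<Z> where "\<Z> = {M : Sub ?X. M <= kr ?d & inject (dom (inc M)) & kr ?e Int M <= zr ?X}"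
 have kd: "kr ?d : Sub ?X" and ke: "kr ?e : Sub ?X" using kr_Sub[of ?d] kr_Sub[of ?e] Yd e0 by simp_all
 obtain M where M: "M : \<Z>" and max: "!!S. S : \<Z> ==> M <= S ==> S = M"
 proof (rule zorn_Sub[of \<Z> ?X "zr ?X"])
  show "\<Z> <= Sub ?X" unfolding \<Z>_def by blast
  have "inject (dom (inc (zr ?X)))" by (rule is_injective_zero) (use zero_inc[OF zr_Sub[OF Yd(1)]] in auto)
  thus "zr ?X : \<Z>" unfolding \<Z>_def using zr_Sub[OF Yd(1)] zr_least[OF kd] by blast
  fix CC assume C: "CC <= \<Z>" "CC ~= {}" and dir: "!!S S'. S : CC ==> S' : CC ==> EX S'' : CC. S <= S'' & S' <= S''"
  have CS: "CC <= Sub ?X" using C unfolding \<Z>_def by blast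
  have "SupS ?X CC <= kr ?d" by (rule SupS(3)[OF CS Yd(1) kd]) (use C \<Z>_def in blast)
  moreover have "inject (dom (inc (SupS ?X CC)))" by (rule injective_chain[OF CS C(2) Yd(1) dir]) (use C \<Z>_def in blast)+
  moreover have "kr ?e Int SupS ?X CC <= zr ?X" by (rule AB5[OF CS C(2) Yd(1) dir ke]) (use C \<Z>_def in blast)+
  ultimately show "SupS ?X CC : \<Z>" unfolding \<Z>_def using SupS(1)[OF CS Yd(1)] by blast
 qed (use Yd in auto)
 have MS: "M : Sub ?X" "M <= kr ?d" and Minj: "inject (dom (inc M))" and Me: "kr ?e Int M <= zr ?X" using M unfolding \<Z>_def by blast+
 note t = inc[OF MS(1)]
 let ?t = "inc M"
 have i: "mono (?e*?t)" unfolding mono_iff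
 proof (intro conjI ballI impI)
  fix x assume x: "arr x" "cod x = dom (?e*?t)" "nul (?e*?t*x)"
  hence "?t*x : kr ?e Int M" using e0 t inc_Cmp_mem[OF MS(1)] by simp
  hence "nul (?t*x)" using Me by auto
  thus "nul x" using mono_nul[OF t(1), of x] x(1,2) e0 t by simp
 qed (use e0 t in simp)
 define i where "i = ?e*?t"
 have ia: "mono i" "arr i" "dom i = dom ?t" "cod i = E" unfolding i_def using \<open>mono (?e*?t)\<close> e0 t by simp_all
 obtain r where r: "arr r" "dom r = E" "cod r = dom ?t" "r*i = idt (dom ?t)"
  by (rule is_injectiveD[OF Minj ia(1), of "idt (dom ?t)"]) (use t ia in auto)
 \<comment> \<open>The kernel of the retraction \<open>r\<close> is a complement of the image of
   \<open>M\<close>; if it were nonzero it would contain a monoform object, whose hull contradicts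
   the maximality of \<open>M\<close>.\<close>
 have "kr r <= zr E"
 proof (rule ccontr)
  assume "~ kr r <= zr E"
  then obtain m where m: "mono m" "cod m = E" "sv m <= kr r" "is_monoform A (dom m)" using monoform_sub[of "kr r" E] kr_Sub[of r] r by auto
  have mS: "sv m : Sub E" using sv_Sub[OF m(1)] m(2) by simp
  obtain S3 where S3: "S3 : Sub E" "ess E (sv m) S3" "inject (dom (inc S3))" using ex_envelope[OF E(1) mS] by blast
  note u = inc[OF S3(1)] let ?u = "inc S3" let ?E3 = "dom (inc S3)"
  have ind: "is_indecomposable A ?E3" by (rule envelope_indecomposable[OF EO m(1,2,4) S3(1,2)])
  have nz: "~ zero ?E3" using ind unfolding is_indecomposable_def by blast
  have "sv i Int sv m <= zr E"
  proof
   fix x assume x: "x : sv i Int sv m"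
   then obtain y where y: "arr y" "cod y = dom i" "x = i*y" by (auto elim: svE)
   have "nul (r*(i*y))" using x m(3) y(3) by auto
   moreover have "r*(i*y) = (r*i)*y" using r(1,2) ia y by simp
   ultimately have "nul y" unfolding r(4) using y ia by simp
   thus "x : zr E" using y ia by simp
  qed
  hence "S3 Int sv i <= zr E" using S3(2) Sub_inter[OF S3(1), of "sv i"] sv_Sub[OF ia(1)] ia(4) unfolding ess_def by blast
  hence dis: "sv i Int sv ?u <= zr (cod i)" using u(4) ia(4) by auto
  \<comment> \<open>The hull \<open>?E3\<close> of a monoform object is indecomposable, so the
    second axiom applies. It is torsion and nonzero, which excludes that \<open>\<delta>\<close>
    kills it.\<close>
  have "in_degree_0 A ?E3 : Im Un Ker_obj A \<delta>" using alc S3(3) ind unfolding abstract_local_cohomology_def by blast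
  moreover have "?E3 ~: \<J>"
  proof
   assume J: "?E3 : \<J>"
   have "?E3 : tors" by (rule tors_mono[OF u(1)]) (use u E in auto)
   hence "nul (idt ?E3)" using tors_nul[of "idt ?E3"] J u by simp
   thus False using nz u is_zero_iff by blast
  qed
  ultimately have U: "sph ?E3 0 : Im" using S3(3) unfolding J_def in_degree_0 by blast
  let ?g = "%n. if n = 0 then ?u else zer (ob (sph ?E3 0) n) (zero_object A)"
  have g: "cm (sph ?E3 0) ?S ?g" by (rule sph_cm) (use sph_cx u in auto)
  obtain h where h: "cm (sph ?E3 0) Y h" "nh (sph ?E3 0) ?S (%n. e n*h n++neg (?g n))" using lift[OF U g] by blast
  have h0: "arr (h 0)" "dom (h 0) = ?E3" "cod (h 0) = ?X" using cmD(3-5)[OF h(1), of 0] by simp_all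
  have dh: "nul (?d*h 0)" using cmD(6)[OF h(1), of 0, symmetric] cmD(3-5)[OF h(1), of 1] u Yd by simp
  obtain l where l: "!!n. arr (l n)" "!!n. dom (l n) = ob (sph ?E3 0) n" "!!n. cod (l n) = ob ?S (n-1)"
   "!!n. e n*h n++neg (?g n) = df ?S (n-1)*l n++l (n+1)*df (sph ?E3 0) n" using nhE[OF h(2)] by blast
  have "?e*h 0++neg ?u = zer ?E3 E" using l(4)[of 0] l(1-3)[of 0] l(1-3)[of 1] u EO by simp
  hence eh: "?e*h 0 = ?u" using nul_dif[of "?e*h 0" ?u] e0 h0 u EO by simp
  obtain B i1 j1 p q where B: "is_biproduct A (dom ?t) ?E3 B i1 j1 p q" using ex_bip[OF t(5) u(5)] by blast
  note b = bip_facts[OF B t(5) u(5)]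
  \<comment> \<open>The lift \<open>h 0\<close> of \<open>?u\<close> is adjoined to
    \<open>M\<close>. Its composite with \<open>?e\<close> is the inclusion of \<open>?E3\<close>,
    which meets \<open>i\<close> trivially, so \<open>?e\<close> stays mono on the sum; by
    maximality \<open>h 0\<close> already lies in \<open>M\<close>, which is absurd.\<close>
  define w where "w = ?t*p++h 0*q"
  have w: "arr w" "dom w = B" "cod w = ?X" unfolding w_def using b(1-13) t h0 by simp_all
  have ew: "nul x" if x: "arr x" "cod x = B" "nul (?e*(w*x))" for x
  proof -
   have a1: "?e*(?t*(p*x)) = i*(p*x)" unfolding i_def using e0 t b(1-13) x by simp
   have a2: "?e*(h 0*(q*x)) = ?u*(q*x)" unfolding eh[symmetric] using e0 h0 b(1-13) x by simp
   have "?e*(w*x) = ?e*(?t*(p*x))++?e*(h 0*(q*x))"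
    unfolding w_def using e0 t h0 b(1-13) x by (simp add: Cmp_Add Add_Cmp)
   hence "nul (i*(p*x)++?u*(q*x))" using x(3) a1 a2 by metis
   hence n: "nul (p*x)" "nul (q*x)" using sv_disjoint[OF ia(1) u(1) _ dis, of "p*x" "q*x"] ia u b(1-13) x by auto
   have "nul (i1*(p*x)++j1*(q*x))" using n b(1-13) x nul_Add[of "i1*(p*x)" "j1*(q*x)"] by simp
   thus "nul x" using bip_decomp[OF B t(5) u(5) x(1,2)] by metis
  qed
  have wm: "mono w" unfolding mono_iff using w ew e0 by simp
  have "sv w : \<Z>" unfolding \<Z>_def
  proof (intro CollectI conjI)
   show wS: "sv w : Sub ?X" using sv_Sub[OF wm] w by simp
   have "nul (?d*?t)" using MS Sub_inc[OF MS(1)] by auto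
   hence "nul (?d*w)" unfolding w_def using dh t h0 b(1-13) Yd nul_Add[of "?d*(?t*p)" "?d*(h 0*q)"] by (simp add: Cmp_Add)
   thus "sv w <= kr ?d" by (intro sv_le[OF kd]) (use w Yd in simp)
   have "inject B" by (rule is_injective_bip[OF B Minj S3(3)])
   moreover obtain s where "is_iso A s" "dom s = dom (inc (sv w))" "cod s = B"
    using sv_Cmp_mono_iso[OF inc(1)[OF wS] wm inc(4)[OF wS]] w by auto
   ultimately show "inject (dom (inc (sv w)))" using is_injective_iso[of B s] by simp
   show "kr ?e Int sv w <= zr ?X"
   proof
    fix x assume x: "x : kr ?e Int sv w"
    then obtain y where y: "arr y" "cod y = dom w" "x = w*y" by (auto elim: svE)
    thus "x : zr ?X" using ew[of y] x w by auto
   qed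
  qed
  moreover have "M <= sv w"
  proof -
   have "w*i1 = ?t" unfolding w_def using t h0 b u(5) by (simp add: Add_Cmp)
   hence "?t : sv w" using svI[of i1 w] w b(1-7) by simp
   hence "sv ?t <= sv w" using sv_le[of "sv w" ?X] sv_Sub[OF wm] w by simp
   thus ?thesis using t(4) by simp
  qed
  ultimately have "sv w = M" using max by blast
  moreover have "w*j1 = h 0" unfolding w_def using t h0 b u(5) by (simp add: Add_Cmp)
  hence "h 0 : sv w" using svI[of j1 w] w b(1-7) by simp
  ultimately obtain y where y: "arr y" "dom y = ?E3" "cod y = dom ?t" "?t*y = h 0" using inc_lift[OF MS(1), of "h 0"] h0 by metis
  have "?u = i*y" unfolding eh[symmetric] y(4)[symmetric] i_def using y(1-3) e0 t by simp
  hence "?u : sv i Int sv ?u" using svI[of y i] y(1-3) ia sv_self[OF u(2)] by simp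
  hence "nul (?u*idt ?E3)" using dis u by auto
  hence "nul (idt ?E3)" by (rule mono_nul[OF u(1)]) (use u in auto)
  thus False using nz u is_zero_iff by blast
 qed
 hence rm: "mono r" using mono_kr r by simp
 have "r*(i*r) = r*idt E"
 proof -
  have "r*(i*r) = (r*i)*r" using r(1-3) ia by simp
  thus ?thesis unfolding r(4) using r(1-3) by simp
 qed
 hence ir: "i*r = idt E" by (rule mono_cancel[OF rm]) (use r(1-3) ia EO in auto)
 \<comment> \<open>\<open>i\<close> is now invertible with inverse \<open>r\<close>, so
   \<open>inc M*r\<close> is a section of the counit in degree 0 with values in the cocycles, that
   is, a chain map from the sphere.\<close>
 define x where "x = ?t*r"
 have x: "arr x" "dom x = E" "cod x = ?X" "nul (?d*x)"
  using t r(1-3) MS Sub_inc[OF MS(1)] Yd unfolding x_def by auto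
 have ex: "?e*x = idt E" unfolding ir[symmetric] i_def x_def using e0 t r(1-3) by simp
 have c: "cm ?S Y (%n. if n = 0 then x else zer (zero_object A) (ob Y n))" (is "cm _ _ ?x") by (rule sph_cm_from[OF cY x])
 have "e n*?x n = idt (ob ?S n)" for n
 proof (cases "n = 0")
  case True thus ?thesis using ex by simp
 next
  case False
  show ?thesis by (rule zero_eq[OF zero_object]) (use False ed(3-5)[of n] Yd EO in auto)
 qed
 hence "(%n. e n*?x n++neg (idt (ob ?S n))) = (%n. zer (ob ?S n) (ob ?S n))" by (rule_tac ext) (use EO in simp)
 moreover have "nh ?S ?S ..." by (rule nhI[of "%n. zer (ob ?S n) (ob ?S (n-1))"]) (use EO in auto)
 ultimately show "?S : Im" using sect[OF c] by metis
qed

end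

section \<open>Truncations, bounded amplitude and complexes of torsion objects\<close>

context abelian_category begin

text \<open>The brutal truncation, for \<open>Q m\<close> of the form \<open>m < n\<close> or
  \<open>n <= m\<close>.\<close>

definition tr where
 "tr Q I = (let X = (%m. if Q m then ob I m else zero_object C) in \<lparr>ob = X, df = %m. if Q m & Q (m+1) then df I m else zer (X m) (X (m+1))\<rparr>)"

lemma tr_simps: "ob (tr Q I) m = (if Q m then ob I m else zero_object C)"
 "df (tr Q I) m = (if Q m & Q (m+1) then df I m else zer (ob (tr Q I) m) (ob (tr Q I) (m+1)))" by (simp_all add: tr_def Let_def)

lemma tr_facts:
 assumes I: "cx I"
 shows "obj (ob (tr Q I) m)" "arr (df (tr Q I) m)" "dom (df (tr Q I) m) = ob (tr Q I) m" "cod (df (tr Q I) m) = ob (tr Q I) (m+1)"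
proof -
 show o: "obj (ob (tr Q I) m)" for m using I by (simp add: tr_simps(1))
 show "arr (df (tr Q I) m)" "dom (df (tr Q I) m) = ob (tr Q I) m" "cod (df (tr Q I) m) = ob (tr Q I) (m+1)"
  using o[of m] o[of "m+1"] I unfolding tr_simps(2) by (simp_all split: if_splits) (simp_all add: tr_simps(1))
qed

lemma tr_cx:
 assumes I: "cx I" shows "cx (tr Q I)"
proof -
 obtain N where N: "!!n. n <= N ==> zero (ob I n)" using cx_bound[OF I] by blast
 note t = tr_facts[OF I]
 show ?thesis
 proof (rule cxI[OF t])
  show "zero (ob (tr Q I) n)" if "n <= N" for n using N[OF that] zero_object by (simp add: tr_simps(1))
  show "nul (df (tr Q I) (n+1)*df (tr Q I) n)" for n
  proof (cases "Q n & Q (n+1) & Q (n+1+1)")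
   case True thus ?thesis using cxD(5)[OF I] by (simp add: tr_simps(2))
  next
   case False
   hence "nul (df (tr Q I) n) | nul (df (tr Q I) (n+1))" using t(1) by (auto simp: tr_simps(2))
   thus ?thesis using nul_Cmp_left[of "df (tr Q I) (n+1)" "df (tr Q I) n"] nul_Cmp_right[of "df (tr Q I) n" "df (tr Q I) (n+1)"] t by auto
  qed
 qed
qed

text \<open>\<open>I\<close> is literally the cone of the differential crossing the cut, viewed as a
  chain map from the lower part shifted by \<open>- 1\<close> to the upper part; the sign of the
  shift cancels that in the cone.\<close>

lemma truncation_cone:
 assumes I: "cx I"
 shows "EX f i j p q. is_cone C (sh (- 1) (tr (%m. m < n) I), tr (%m. n <= m) I, f) I i j p q"
proof -
 let ?T = "tr (%m. m < n) I" and ?Y = "tr (%m. n <= m) I" and ?z = "zero_object C"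
 let ?X = "sh (- 1) ?T"
 note Y = tr_facts[OF I, of "%m. n <= m"] and d = cxD[OF I]
 have cX: "cx ?X" and cY: "cx ?Y" by (rule sh_cx[OF tr_cx[OF I]], rule tr_cx[OF I])
 note X = cxD[OF cX]
 define f where "f m = (if m = n then df I (m-1) else zer (ob ?X m) (ob ?Y m))" for m
 have f: "arr (f m)" "dom (f m) = ob ?X m" "cod (f m) = ob ?Y m" for m
  unfolding f_def using X(1)[of m] Y(1)[of m] d d(4)[of "n-1"] by (auto simp: tr_simps(1))
 have fn: "m ~= n ==> nul (f m)" for m using X(1)[of m] Y(1)[of m] by (simp add: f_def)
 have n1: "nul (f (m+1)*df ?X m)" for m
 proof (cases "m+1 = n")
  case True
  hence m: "m = n-1" by simp
  have "nul (df I (n-1)*df I (n-1 - 1))" using cx_dd[OF I, of "n-1"] by simp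
  thus ?thesis unfolding m using d d(4)[of "n-1 - 1"] by (simp add: f_def tr_simps)
 next
  case False thus ?thesis using nul_Cmp_left[OF fn, of "m+1" "df ?X m"] f X by simp
 qed
 have n2: "nul (df ?Y m*f m)" for m
 proof (cases "m = n")
  case True thus ?thesis using cx_dd[OF I, of n] by (simp add: f_def tr_simps)
 next
  case False thus ?thesis using nul_Cmp_right[OF fn, of m "df ?Y m"] f Y by simp
 qed
 have F: "cm ?X ?Y f"
 proof (rule cmI[OF cX cY f])
  fix m
  have "f (m+1)*df ?X m = zer (ob ?X m) (ob ?Y (m+1))" by (rule nul_eq[OF n1]) (use f X in "simp_all del: sh_simps")
  moreover have "df ?Y m*f m = zer (ob ?X m) (ob ?Y (m+1))" by (rule nul_eq[OF n2]) (use f Y in "simp_all del: sh_simps")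
  ultimately show "f (m+1)*df ?X m = df ?Y m*f m" by metis
 qed
 define i where "i m = (if m < n then idt (ob I m) else zer ?z (ob I m))" for m
 define j where "j m = (if n <= m then idt (ob I m) else zer ?z (ob I m))" for m
 define p where "p m = (if m < n then idt (ob I m) else zer (ob I m) ?z)" for m
 define q where "q m = (if n <= m then idt (ob I m) else zer (ob I m) ?z)" for m
 have zz: "zer ?z ?z = idt ?z" by (rule zero_eq[OF zero_object]) simp_all
 have B: "is_biproduct C (ob ?X (m+1)) (ob ?Y m) (ob I m) (i m) (j m) (p m) (q m)" for m
  unfolding is_biproduct_def using d by (cases "m < n") (auto simp: tr_simps(1) i_def j_def p_def q_def zz)
 have e1: "df I m*i m = i (m+1)*neg (df ?X (m+1))++j (m+1)*f (m+1)" for m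
 proof -
  consider "m+1 < n" | "m+1 = n" | "n <= m" by linarith
  thus ?thesis
  proof cases
   case 1 thus ?thesis using d by (simp add: i_def j_def f_def tr_simps)
  next
   case 2 hence "n = m+1" by simp
   thus ?thesis using d by (simp add: i_def j_def f_def tr_simps)
  next
   case 3 thus ?thesis using d by (simp add: i_def j_def f_def tr_simps)
  qed
 qed
 have e2: "df I m*j m = j (m+1)*df ?Y m" for m
 proof -
  consider "m+1 < n" | "m+1 = n" | "n <= m" by linarith
  thus ?thesis using d by cases (simp_all add: j_def tr_simps)
 qed
 have "is_cone C (?X, ?Y, f) I i j p q" unfolding is_cone_def using F I B e1 e2 by (simp add: Arr_Ch del: sh_simps)
 thus ?thesis by blast
qed

lemma concentrated:
 assumes X: "cx X" and z: "!!n. n ~= m ==> zero (ob X n)"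
 obtains f g where "cm X (sph (ob X m) m) f" "cm (sph (ob X m) m) X g" "(%n. g n*f n) = (%n. idt (ob X n))"
  "(%n. f n*g n) = (%n. idt (ob (sph (ob X m) m) n))"
proof -
 note d = cxD[OF X]
 let ?S = "sph (ob X m) m" and ?i = "idt (ob X m)"
 let ?f = "%n. if n = m then ?i else zer (ob X n) (zero_object C)" and ?g = "%n. if n = m then ?i else zer (zero_object C) (ob X n)"
 have f: "cm X ?S ?f" by (rule sph_cm[OF X]) (use d zero_nul[OF z[of "m-1"], of "df X (m-1)"] d(4)[of "m-1"] in auto)
 have g: "cm ?S X ?g" by (rule sph_cm_from[OF X]) (use d zero_nul[OF z[of "m+1"], of "df X m"] in auto)
 have 1: "?g n*?f n = idt (ob X n)" for n
 proof (cases "n = m")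
  case False show ?thesis by (rule zero_eq[OF z[OF False]]) (use False d in auto)
 qed (use d in simp)
 have 2: "?f n*?g n = idt (ob ?S n)" for n
 proof (cases "n = m")
  case False show ?thesis by (rule zero_eq[OF zero_object]) (use False d in auto)
 qed (use d in simp)
 show ?thesis using that[OF f g] 1 2 by blast
qed

lemma hexact_zero:
 assumes "cx X" "zero (ob X m)" "obj E" shows "hexact X m E"
 unfolding hexact_def
proof (intro ballI impI)
 note d = cxD[OF assms(1)]
 fix x assume x: "arr x" "dom x = ob X m" "cod x = E"
 have "x = zer (ob X (m+1)) E*df X m" by (rule zero_eq[OF assms(2)]) (use x d assms in auto)
 thus "EX x' : Arr C. dom x' = ob X (m+1) & cod x' = E & x = x'*df X m"
  using d assms by (intro bexI[of _ "zer (ob X (m+1)) E"] conjI) auto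
qed

end

context loc_noetherian begin

lemma dtriv_zero: "cx X ==> zero (ob X m) ==> inject E ==> dtriv X (sph E m)"
 using dtriv_sph hexact_zero is_injective_Obj by blast

lemma concentrated_isomorphic:
 assumes X: "cx X" and z: "!!n. n ~= m ==> zero (ob X n)" shows "isomorphic DD X (sph (ob X m) m)"
proof (rule concentrated[OF X z])
 fix f g assume f: "cm X (sph (ob X m) m) f" and g: "cm (sph (ob X m) m) X g" and e: "(%n. g n*f n) = (%n. idt (ob X n))"
  "(%n. f n*g n) = (%n. idt (ob (sph (ob X m) m) n))"
 have "is_iso DD (dm X (sph (ob X m) m) f)"
  by (rule D.is_isoI[of _ "dm (sph (ob X m) m) X g"]) (use f g dm_Cmp[OF f g] dm_Cmp[OF g f] dm_Idt[OF cmD(1)[OF f]] dm_Idt[OF cmD(1)[OF g]] e in simp_all)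
 thus ?thesis unfolding isomorphic_def using f by auto
qed

lemma cone_dist:
 assumes cone: "is_cone A (X, Y, f) Z i j p q" shows "is_dist_triangle A (dm X Y f) (dm Y Z j) (dm Z (sh 1 X) p)"
proof -
 note c = coneD(1-4)[OF cone] and P = cone_p[OF cone]
 have J: "cm Y Z j" by (rule cmI) (use coneD[OF cone] in auto)
 have "is_cone_triangle A (dm X Y f) (dm Y Z j) (dm Z (sh 1 X) p)" unfolding is_cone_triangle_def
  using cone by (intro exI conjI) (assumption, simp_all add: dm_def shift_sh)
 moreover have "FA (shD 1) (D.idt X) = D.idt (sh 1 X)" using is_functor_simps(5)[OF shD(1), of X] c by (simp add: shD(2))
 ultimately show ?thesis unfolding is_dist_triangle_def Let_def Dshift_shD shD(2)
  using c P J sh_cx[OF c(3), of 1] D.is_iso_Idt[of X] D.is_iso_Idt[of Y] D.is_iso_Idt[of Z]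
  by - (intro conjI, simp_all only: dm, rule exI[of _ "dm X Y f"], rule exI[of _ "dm Y Z j"], rule exI[of _ "dm Z (sh 1 X) p"],
   rule exI[of _ "D.idt X"], rule exI[of _ "D.idt Y"], rule exI[of _ "D.idt Z"], simp)
qed

text \<open>For a cocycle \<open>(a, b)\<close> of the cone of \<open>e\<close>, injectivity on
  arrows to the sphere in degree \<open>n\<close> makes \<open>b\<close> a coboundary, and
  surjectivity in degree \<open>n + 1\<close> takes care of the remaining part of
  \<open>a\<close>.\<close>

lemma sph_detect:
 assumes e: "cm Y X e"
  and surj: "!!E m g. inject E ==> g : D.hom Y (sph E m) ==> EX h : D.hom X (sph E m). h**dm Y X e = g"
  and inj: "!!E m h h'. inject E ==> h : D.hom X (sph E m) ==> h' : D.hom X (sph E m) ==> h**dm Y X e = h'**dm Y X e ==> h = h'"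
 shows "coqis Y X e"
 unfolding coqis_def cex_def
proof (intro conjI ballI allI impI e)
 note ed = cmD[OF e] note Y = cxD[OF ed(1)] and X = cxD[OF ed(2)]
 fix E n a b assume "E : {E. inject E}" and ab: "a : hom (ob Y (n+1)) E" "b : hom (ob X n) E" and bd: "nul (b*df X (n-1))" and be: "b*e n = a*df Y n"
 hence E: "inject E" and a: "arr a" "dom a = ob Y (n+1)" "cod a = E" and b: "arr b" "dom b = ob X n" "cod b = E" by auto
 have EO: "obj E" by (rule is_injective_Obj[OF E])
 have S: "injcx (sph E m)" for m by (rule sph_injcx[OF E])
 let ?b = "%m. if m = n then b else zer (ob X m) (zero_object A)"
 let ?o = "%m. zer (ob X m) (ob (sph E n) m)"
 have B: "cm X (sph E n) ?b" by (rule sph_cm[OF ed(2) b bd])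
 have O: "cm X (sph E n) ?o" by (rule cm_Zer[OF ed(2) injcxD(1)[OF S]])
 have 1: "nh Y (sph E n) (%m. ?b m*e m)" by (rule sph_nh[OF cm_Cmp[OF e B] a]) (use be in simp)
 have 2: "(%m. ?o m*e m) = (%m. zer (ob Y m) (ob (sph E n) m))" by (rule ext) (use ed(3-5) sph_ob[OF EO] in simp)
 have "dm X (sph E n) ?b**dm Y X e = dm X (sph E n) ?o**dm Y X e"
  unfolding dm_Cmp[OF e B] dm_Cmp[OF e O] 2 using dm_nul[OF S cm_Cmp[OF e B]] 1 by blast
 hence "dm X (sph E n) ?b = dm X (sph E n) ?o" by - (rule inj[OF E, of _ n], use B O in simp_all)
 hence "nh X (sph E n) ?b" using dm_nul[OF S B] by blast
 then obtain c0 where c0: "arr c0" "dom c0 = ob X (n+1)" "cod c0 = E" "b = c0*df X n" by (rule sph_nhD[OF ed(2) EO]) simp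
 let ?a = "a++neg (c0*e (n+1))"
 have a1: "arr ?a" "dom ?a = ob Y (n+1)" "cod ?a = E" using a c0(1-3) ed(3-5) by simp_all
 have "?a*df Y n = a*df Y n++neg (c0*(df X n*e n))" using a c0(1-3) ed Y by (simp add: Add_Cmp)
 also have "c0*(df X n*e n) = a*df Y n" unfolding be[symmetric] c0(4) using c0(1-3) ed(3-5) X by simp
 finally have "nul (?a*df Y (n+1 - 1))" using a Y EO by simp
 hence a2: "cm Y (sph E (n+1)) (%m. if m = n+1 then ?a else zer (ob Y m) (zero_object A))" (is "cm _ _ ?f") by (rule sph_cm[OF ed(1) a1])
 obtain h where h: "D.arr h" "D.dom h = X" "D.cod h = sph E (n+1)" "h**dm Y X e = dm Y (sph E (n+1)) ?f"
  using surj[OF E, of "dm Y (sph E (n+1)) ?f" "n+1"] a2 by auto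
 obtain g where g: "cm X (sph E (n+1)) g" "h = dm X (sph E (n+1)) g" by (rule dm_full[OF S h(1-3)])
 have "nh Y (sph E (n+1)) (%m. ?f m++neg (g m*e m))"
  by (rule dm_inj[OF S a2 cm_Cmp[OF e g(1)]]) (use h(4) dm_Cmp[OF e g(1)] g(2) in simp)
 then obtain l where l: "arr l" "dom l = ob Y (n+1+1)" "cod l = E" "?f (n+1)++neg (g (n+1)*e (n+1)) = l*df Y (n+1)" by (rule sph_nhD[OF ed(1) EO])
 have g1: "arr (g (n+1))" "dom (g (n+1)) = ob X (n+1)" "cod (g (n+1)) = E" using cmD(3-5)[OF g(1), of "n+1"] by simp_all
 have "dom (g n) = ob X n" "arr (g n)" "cod (g n) = zero_object A" using cmD(3-5)[OF g(1), of n] by simp_all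
 hence gd: "nul (g (n+1)*df X n)" unfolding cmD(6)[OF g(1)] using X EO by simp
 have "?a = g (n+1)*e (n+1)++l*df Y (n+1)" by (subst Add_eq_iff) (use a1 g1 l ed(3-5) Y in auto)
 hence "a = c0*e (n+1)++(g (n+1)*e (n+1)++l*df Y (n+1))" by (subst Add_eq_iff) (use a c0(1-3) g1 l(1-3) ed(3-5) Y in auto)
 hence "a = (c0++g (n+1))*e (n+1)++l*df Y (n+1)" using c0(1-3) g1 l(1-3) ed(3-5) Y by (simp add: Add_Cmp Add_assoc)
 moreover have "b = (c0++g (n+1))*df X n" unfolding c0(4) using c0(1-3) g1 X nul_Add_right[OF gd, of "c0*df X n"] by (simp add: Add_Cmp)
 moreover have "c0++g (n+1) : hom (ob X (n+1)) E" "l : hom (ob Y (n+1+1)) E" using c0(1-3) g1 l(1-3) by auto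
 ultimately show "EX c : hom (ob X (n+1)) E. EX h : hom (ob Y (n+1+1)) E. b = c*df X n & a = c*e (n+1)++h*df Y (n+1)"
  by (intro bexI[of _ "c0++g (n+1)"] bexI[of _ l] conjI)
qed

text \<open>The termwise coproduct; the common lower bound keeps it bounded below. Its use is that
  every \<open>X i\<close> becomes a direct summand of one complex \<open>P\<close>.\<close>

lemma coproduct_complex:
 fixes X :: "nat => ('o, 'm) cplx"
 assumes X: "!!i. cx (X i)" and z: "!!i m. m < 0 ==> zero (ob (X i) m)"
 obtains P io \<pi> where "cx P" "!!i. cm (X i) P (io i)" "!!i. cm P (X i) (\<pi> i)" "!!i n. \<pi> i n*io i n = idt (ob (X i) n)"
proof -
 have "EX P io. is_coproduct A UNIV (%i. ob (X i) n) P io" for n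
  by (rule coproduct[OF small_nat[OF univ]]) (use cxD(1)[OF X] in blast)
 then obtain Q io where Q: "!!n. is_coproduct A UNIV (%i. ob (X i) n) (Q n) (io n)" by metis
 note x = cxD[OF X]
 have qi: "arr (io n i)" "dom (io n i) = ob (X i) n" "cod (io n i) = Q n" "obj (Q n)" for n i using coproduct_facts(1-4)[OF Q[of n]] by simp_all
 have eqI: "g = h" if "arr g" "arr h" "dom g = Q n" "dom h = Q n" "cod g = cod h" "!!i. g*io n i = h*io n i" for g h n
 proof -
  have "nul (g++neg h)" by (rule coproduct_facts(6)[OF Q[of n]]) (use that qi[of n] x(1) Cod_Obj[of h] in "simp_all add: Add_Cmp")
  thus ?thesis using nul_dif that by simp
 qed
 have "EX h. arr h & dom h = Q n & cod h = Q (n+1) & (ALL i : UNIV. h*io n i = io (n+1) i*df (X i) n)" for n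
  by (rule coproduct_facts(5)[OF Q]) (use qi x in auto)
 then obtain d where d: "!!n. arr (d n)" "!!n. dom (d n) = Q n" "!!n. cod (d n) = Q (n+1)" "!!n i. d n*io n i = io (n+1) i*df (X i) n" by (metis UNIV_I)
 define P where "P = \<lparr>ob = Q, df = d\<rparr>"
 have P: "ob P n = Q n" "df P n = d n" for n by (simp_all add: P_def)
 have cP: "cx P"
 proof (rule cxI[of _ "- 1"])
  fix n
  show "nul (df P (n+1)*df P n)" unfolding P
  proof (rule coproduct_facts(6)[OF Q[of n]])
   fix i
   have "d (n+1)*(io (n+1) i*df (X i) n) = io (n+1+1) i*(df (X i) (n+1)*df (X i) n)"
    by (rule Cmp_reassoc[OF d(4)]) (use d(1-3) qi x in auto)
   thus "nul (d (n+1)*d n*io n i)" using d qi x by simp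
  qed (use d(1-3) in auto)
  assume n: "n <= - 1"
  have "nul (io n i)" for i by (rule zero_nul[OF z[of n i]]) (use n qi in auto)
  hence "nul (idt (Q n))" by - (rule coproduct_facts(6)[OF Q[of n]], use qi in simp_all)
  thus "zero (ob P n)" unfolding is_zero_iff P using qi by blast
 qed (use d(1-3) qi in "auto simp: P")
 let ?\<delta> = "%n i k. if k = i then idt (ob (X i) n) else zer (ob (X k) n) (ob (X i) n)"
 have "EX h. arr h & dom h = Q n & cod h = ob (X i) n & (ALL k : UNIV. h*io n k = ?\<delta> n i k)" for n i
  by (rule coproduct_facts(5)[OF Q]) (use x in auto)
 then obtain \<pi> where p: "!!n i. arr (\<pi> n i)" "!!n i. dom (\<pi> n i) = Q n" "!!n i. cod (\<pi> n i) = ob (X i) n" "!!n i k. \<pi> n i*io n k = ?\<delta> n i k" by (metis UNIV_I)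
 show ?thesis
 proof (rule that[OF cP, of "%i n. io n i" "%i n. \<pi> n i"])
  show "cm (X i) P (%n. io n i)" for i by (rule cmI[OF X cP]) (use qi d(4) in "auto simp: P")
  show "cm P (X i) (%n. \<pi> n i)" for i
  proof (rule cmI[OF cP X])
   fix n show "\<pi> (n+1) i*df P n = df (X i) n*\<pi> n i" unfolding P
   proof (rule eqI[of _ _ n])
    fix k
    have "\<pi> (n+1) i*(io (n+1) k*df (X k) n) = ?\<delta> (n+1) i k*df (X k) n"
     unfolding p(4)[symmetric] using p(1-3) qi x by simp
    thus "(\<pi> (n+1) i*d n)*io n k = (df (X i) n*\<pi> n i)*io n k" using p d qi x by simp
   qed (use p d x in auto)
  qed (use p in "auto simp: P")
  show "\<pi> n i*io n i = idt (ob (X i) n)" for i n using p(4) by simp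
 qed
qed

end

context abelian_category begin

lemma nh_pre:
 assumes "nh Y Z u" "cm Y Z u" "cm X Y f" shows "nh X Z (%n. u n*f n)"
 using nh_Cmp[OF cm_Idt[OF cmD(2)[OF assms(2)]] assms(1,3)] cmD[OF assms(2)] cmD[OF assms(3)] by simp

lemma nh_dif_pre:
 assumes "nh Y Z (%n. g n++neg (g' n))" "cm Y Z g" "cm Y Z g'" "cm X Y f" shows "nh X Z (%n. g n*f n++neg (g' n*f n))"
 using nh_pre[OF assms(1) cm_Add[OF assms(2) cm_Neg[OF assms(3)]] assms(4)] cmD(3-5)[OF assms(2)] cmD(3-5)[OF assms(3)] cmD(3-5)[OF assms(4)] by (simp add: Add_Cmp)

lemma Add_shuffle:
 assumes "arr a" "arr b" "arr c" "arr d" "dom a = X" "dom b = X" "dom c = X" "dom d = X" "cod a = Y" "cod b = Y" "cod c = Y" "cod d = Y"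
 shows "(a++neg b++neg c)++neg (d++neg c) = (a++neg d)++neg b"
 using assms by (simp add: Neg_distrib Add_assoc Add_commute Add_left_commute)

end

context abstract_lc begin

text \<open>The counit \<open>e\<close> at \<open>I\<close> is given a section up to homotopy.
  \<open>j\<close> lifts to \<open>v\<close>; uniqueness of lifts from \<open>X\<close> makes
  \<open>v*f\<close> null-homotopic, so \<open>v\<close> extends to \<open>g\<close> on
  \<open>I\<close>. The error \<open>e*g - 1\<close> is null-homotopic on \<open>Y\<close>, factors
  through the shift of \<open>X\<close>, lifts again, and is subtracted.\<close>

lemma Im_cone:
 assumes cone: "is_cone A (X, Y, f) I i j p q" and I: "injcx I" and X: "X : Im" and Y: "Y : Im" shows "I : Im"
proof (rule counit_model[OF I])
 fix S e assume e: "cm S I e" and lift: "!!U g. U : Im ==> cm U I g ==> EX h. cm U S h & nh U I (%n. e n*h n++neg (g n))"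
  and uniq: "!!U h. U : Im ==> cm U S h ==> nh U I (%n. e n*h n) ==> nh U S h"
  and sect: "!!t. cm I S t ==> nh I I (%n. e n*t n++neg (idt (ob I n))) ==> I : Im"
 note c = coneD[OF cone] and P = cone_p[OF cone] and F = coneD(1)[OF cone]
 have J: "cm Y I j" by (rule cmI) (use c in auto)
 have one: "cm I I (%n. idt (ob I n))" by (rule cm_Idt[OF c(2)])
 obtain v where v: "cm Y S v" "nh Y I (%n. e n*v n++neg (j n))" using lift[OF Y J] by blast
 note ev = cm_Cmp[OF v(1) e]
 have "nh X I (%n. j n*f n)"
 proof (rule nhI[of "%n. i (n-1)"])
  fix n
  have a: "arr (i n*df X n)" "arr (j n*f n)" "dom (i n*df X n) = ob X n" "cod (i n*df X n) = ob I n" "dom (j n*f n) = ob X n" "cod (j n*f n) = ob I n"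
   using c(5-10) cxD[OF c(3)] cmD(3-5)[OF F] by simp_all
  have "df I (n-1)*i (n-1) = neg (i n*df X n)++j n*f n" using c(21)[of "n-1"] c(5-7) cxD[OF c(3)] by simp
  hence "df I (n-1)*i (n-1)++i (n+1 - 1)*df X n = (j n*f n++neg (i n*df X n))++i n*df X n"
   using a Add_commute[of "j n*f n" "neg (i n*df X n)"] by simp
  thus "j n*f n = df I (n-1)*i (n-1)++i (n+1 - 1)*df X n" using a by (simp add: Add_assoc)
 qed (use c(5-7) in simp_all)
 hence "nh X I (%n. (e n*v n)*f n)" by (rule nh_dif_trans[OF cm_Cmp[OF F ev] cm_Cmp[OF F J] nh_dif_pre[OF v(2) ev J F]])
 hence "nh X S (%n. v n*f n)" using uniq[OF X cm_Cmp[OF F v(1)]] cmD(3-5)[OF e] cmD(3-5)[OF v(1)] cmD(3-5)[OF F] by simp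
 then obtain g where g: "cm I S g" "!!n. g n*j n = v n" by (rule cone_extend[OF cone v(1)]) blast
 note eg = cm_Cmp[OF g(1) e]
 define w where "w n = e n*g n++neg (idt (ob I n))" for n
 have w: "cm I I w" unfolding w_def by (rule cm_Add[OF eg cm_Neg[OF one]])
 have "w n*j n = e n*v n++neg (j n)" for n unfolding w_def g(2)[symmetric] using cmD(3-5)[OF e] cmD(3-5)[OF g(1)] cmD(3-5)[OF J] cxD(1)[OF c(2)] by (simp add: Add_Cmp)
 hence "nh Y I (%n. w n*j n)" using v(2) by simp
 then obtain k where k: "cm (sh 1 X) I k" "nh I I (%n. w n++neg (k n*p n))" by (rule cone_factor[OF cone w])
 obtain k' where k': "cm (sh 1 X) S k'" "nh (sh 1 X) I (%n. e n*k' n++neg (k n))" using lift[OF Im_sh(1)[OF X] k(1)] by blast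
 note kp = cm_Cmp[OF P k'(1)] and ek = cm_Cmp[OF k'(1) e]
 have n: "nh I I (%n. (w n++neg (k n*p n))++neg ((e n*k' n)*p n++neg (k n*p n)))"
  by (rule nh_Add[OF c(2) c(2) k(2) nh_Neg[OF c(2) c(2) nh_dif_pre[OF k'(2) ek k(1) P]]])
 have "(w n++neg (k n*p n))++neg ((e n*k' n)*p n++neg (k n*p n)) = e n*(g n++neg (k' n*p n))++neg (idt (ob I n))" for n
  unfolding w_def using Add_shuffle[of "e n*g n" "idt (ob I n)" "k n*p n" "(e n*k' n)*p n" "ob I n" "ob I n"]
   cmD(3-5)[OF e] cmD(3-5)[OF g(1)] cmD(3-5)[OF k(1)] cmD(3-5)[OF k'(1)] cmD(3-5)[OF P] cxD(1)[OF c(2)] by (simp add: Cmp_Add)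
 thus ?thesis using sect[OF cm_Add[OF g(1) cm_Neg[OF kp]]] n by simp
qed

lemma tr_injcx:
 assumes I: "injcx I" "!!m. ob I m : tors" shows "injcx (tr Q I)" "ob (tr Q I) m : tors"
 using I tr_cx[of I Q] is_injective_zero[OF zero_object] tors_zero[OF zero_object] by (simp_all add: injcx_def tr_simps(1))

lemma Im_concentrated:
 assumes I: "injcx I" "ob I m : tors" "!!n. n ~= m ==> zero (ob I n)" shows "I : Im"
 by (rule Im_iso[OF concentrated_isomorphic[OF injcxD(1)[OF I(1)] I(3)] Im_injective[OF injcxD(2)[OF I(1)] I(2)]])

text \<open>Induction on the length: the cut splits off the top term, which lies in
  \<open>Im\<close> by \<open>Im_injective\<close>, and \<open>Im_cone\<close> puts the parts
  together.\<close>

lemma Im_bounded: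
 "injcx I ==> (!!m. ob I m : tors) ==> (!!m. m < a | a + int k <= m ==> zero (ob I m)) ==> I : Im"
proof (induction k arbitrary: I)
 case 0
 have "zero (ob I m)" for m by (rule 0(3)) auto
 thus ?case using Im_concentrated[OF 0(1,2)] by blast
next
 case (Suc k)
 let ?n = "a + int k"
 note t = tr_injcx[OF Suc(2,3)]
 obtain f i j p q where c: "is_cone A (sh (- 1) (tr (%m. m < ?n) I), tr (%m. ?n <= m) I, f) I i j p q" using truncation_cone[OF injcxD(1)[OF Suc(2)]] by blast
 have "tr (%m. m < ?n) I : Im" by (rule Suc(1)[OF t]) (use Suc(4) zero_object in "auto simp: tr_simps(1)")
 moreover have "zero (ob (tr (%m. ?n <= m) I) m)" if "m ~= ?n" for m using Suc(4)[of m] zero_object that by (simp add: tr_simps(1))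
 hence "tr (%m. ?n <= m) I : Im" using Im_concentrated[OF t] by blast
 ultimately show ?case using Im_cone[OF c Suc(2)] Im_sh(2) by blast
qed

text \<open>Otherwise the coproduct of countably many complexes violating ever larger bounds has an unbounded image.\<close>

lemma way_out_0:
 "EX c. ALL X E m. cx X --> (ALL k < 0. zero (ob X k)) --> inject E --> m < c --> dtriv (FO \<delta> X) (sph E m)"
proof (rule ccontr)
 assume "~ ?thesis"
 hence "ALL i::nat. EX X E m. cx X & (ALL k < 0. zero (ob X k)) & inject E & m < - int i & ~ dtriv (FO \<delta> X) (sph E m)" by blast
 then obtain X E m where X: "!!i::nat. cx (X i)" "!!i k. k < 0 ==> zero (ob (X i) k)" and E: "!!i::nat. inject (E i)"
  and m: "!!i. m i < - int i" and nt: "!!i. ~ dtriv (FO \<delta> (X i)) (sph (E i) (m i))" by metis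
 obtain P io \<pi> where P: "cx P" "!!i. cm (X i) P (io i)" "!!i. cm P (X i) (\<pi> i)" "!!i n. \<pi> i n*io i n = idt (ob (X i) n)"
  by (rule coproduct_complex[of X, OF X]) blast+
 have dP: "cx (FO \<delta> P)" using delta(1)[of P] P(1) by simp
 obtain N where N: "!!n. n <= N ==> zero (ob (FO \<delta> P) n)" using cx_bound[OF dP] by blast
 \<comment> \<open>The index is chosen so that the test degree \<open>m ?i\<close> lies below
   \<open>N\<close>, where \<open>\<delta> P\<close> has zero terms; as \<open>?X\<close> is a
   direct summand of \<open>P\<close>, the arrows from its image to the sphere vanish as
   well.\<close>
 let ?i = "nat (- N)" let ?X = "X ?i" and ?S = "sph (E ?i) (m ?i)"
 let ?p = "dm P ?X (\<pi> ?i)" and ?q = "dm ?X P (io ?i)"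
 have t: "dtriv (FO \<delta> P) ?S" by (rule dtriv_zero[OF dP N E]) (use m[of ?i] in "simp split: if_splits")
 have "?p**?q = D.idt ?X" using dm_Cmp[OF P(2,3)] P(4) dm_Idt[OF X(1)] by simp
 hence pq: "FA \<delta> ?p**FA \<delta> ?q = D.idt (FO \<delta> ?X)" using delta(6)[of ?q ?p] delta(5)[of ?X] P X(1) by simp
 note d = delta(2-4)[of ?p] delta(2-4)[of ?q]
 have "a = b" if ab: "a : D.hom (FO \<delta> ?X) ?S" "b : D.hom (FO \<delta> ?X) ?S" for a b
 proof -
  have "a**FA \<delta> ?p = b**FA \<delta> ?p" using t ab d P unfolding dtriv_def by simp
  hence "(a**FA \<delta> ?p)**FA \<delta> ?q = (b**FA \<delta> ?p)**FA \<delta> ?q" by simp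
  thus ?thesis using ab d P pq by simp
 qed
 thus False using nt[of ?i] unfolding dtriv_def by blast
qed

text \<open>Shifting turns a complex starting in degree \<open>N\<close> into one starting in degree
  0, so a single constant \<open>c\<close> serves all \<open>N\<close>.\<close>

lemma way_out:
 "EX c. ALL N::nat. ALL X E m. cx X --> (ALL k < int N. zero (ob X k)) --> inject E --> m < int N + c --> dtriv (FO \<delta> X) (sph E m)"
proof -
 obtain c where c: "!!X E m. cx X ==> (ALL k < 0. zero (ob X k)) ==> inject E ==> m < c ==> dtriv (FO \<delta> X) (sph E m)" using way_out_0 by blast
 have "dtriv (FO \<delta> X) (sph E m)" if "cx X" "ALL k < int N. zero (ob X k)" "inject E" "m < int N + c" for N X E m
  using that
 proof (induction N arbitrary: X m)
  case 0 thus ?case using c by simp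
 next
  case (Suc N)
  have X: "cx (sh 1 X)" and dX: "cx (FO \<delta> X)" using sh_cx[OF Suc(2)] delta(1)[of X] Suc(2) by simp_all
  have "dtriv (FO \<delta> (sh 1 X)) (sph E (m-1))" by (rule Suc(1)[OF X]) (use Suc in auto)
  hence "dtriv (sh 1 (FO \<delta> X)) (sph E (m-1))" by (rule dtriv_iso[OF D.isomorphic_sym[OF delta_sh[OF Suc(2)]]])
  hence "hexact (FO \<delta> X) (m-1 + 1) E" using dtriv_sph[OF sh_cx[OF dX] Suc(4)] hexact_sh[OF dX] by blast
  thus ?case using dtriv_sph[OF dX Suc(4), of m] by simp
 qed
 thus ?thesis by blast
qed

text \<open>Whether the counit at \<open>I\<close> is an isomorphism is tested on spheres. For a
  sphere in degree \<open>m\<close> the complex is cut far above \<open>m\<close>: the upper part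
  \<open>V\<close> and, by \<open>way_out\<close>, also \<open>\<delta> V\<close> have only zero
  arrows to the sphere, and on the bounded lower part \<open>T\<close> the counit is
  invertible.\<close>

lemma Im_complex:
 assumes I: "injcx I" "!!m. ob I m : tors" shows "I : Im"
proof -
 note cI = injcxD(1)[OF I(1)] note E1 = eps(1-3)[OF cI]
 obtain c where wo: "!!N X E m. cx X ==> (ALL k < int N. zero (ob X k)) ==> inject E ==> m < int N + c ==> dtriv (FO \<delta> X) (sph E m)" using way_out by blast
 obtain N0 where N0: "!!n. n <= N0 ==> zero (ob I n)" using cx_bound[OF cI] by blast
 have key: "(ALL g : D.hom (FO \<delta> I) (sph E m). EX h : D.hom I (sph E m). h**eps I = g) &
  (ALL h : D.hom I (sph E m). ALL h' : D.hom I (sph E m). h**eps I = h'**eps I --> h = h')" if E: "inject E" for E m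
 proof -
  let ?S = "sph E m"
  have S: "injcx ?S" by (rule sph_injcx[OF E])
  \<comment> \<open>Large enough for \<open>V\<close> itself and for \<open>\<delta> V\<close>. The
    cut is at \<open>N + 1\<close> because the shift of \<open>V\<close> starts one degree lower and
    has to be invisible too.\<close>
  define N where "N = nat (max (m+1) (m - c + 1))"
  have N: "m < int N" "m < int N + c" unfolding N_def by auto
  let ?n = "int (Suc N)"
  define T where "T = tr (%m. m < ?n) I"
  define V where "V = tr (%m. ?n <= m) I"
  define X where "X = sh (- 1) T"
  obtain f i j p q where cone: "is_cone A (X, V, f) I i j p q" using truncation_cone[OF cI] unfolding T_def V_def X_def by blast
  have cT: "cx T" and cV: "cx V" unfolding T_def V_def by (rule tr_cx[OF cI])+
  have XT: "sh 1 X = T" unfolding X_def using sh_sh[OF cT, of "- 1"] by simp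
  have cX: "cx X" unfolding X_def by (rule sh_cx[OF cT])
  note P = cone_p[OF cone, unfolded XT] and F = coneD(1)[OF cone]
  let ?u = "dm X V f" and ?v = "dm V I j" and ?w = "dm I T p"
  have t1: "is_dist_triangle A ?u ?v ?w" using cone_dist[OF cone] XT by simp
  obtain \<theta> where th: "is_nat_iso DD DD (\<delta> \<circ>\<^sub>F shD 1) (shD 1 \<circ>\<^sub>F \<delta>) \<theta>"
   and td: "ALL u v w. is_dist_triangle A u v w --> is_dist_triangle A (FA \<delta> u) (FA \<delta> v) (\<theta> (D.dom u)**FA \<delta> w)" using theta_ex by (elim exE conjE)
  have t2: "is_dist_triangle A (FA \<delta> ?u) (FA \<delta> ?v) (\<theta> X**FA \<delta> ?w)" using td[THEN spec, THEN spec, THEN spec, THEN mp, OF t1] F by simp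
  have th: "D.arr (\<theta> X)" "D.dom (\<theta> X) = FO \<delta> T" "D.cod (\<theta> X) = sh 1 (FO \<delta> X)" "is_iso DD (\<theta> X)"
   using th cX unfolding is_nat_iso_def is_nat_trans_def by (auto simp: fcomp_def shD(2) XT)
  have zV: "zero (ob V k)" if "k < ?n" for k unfolding V_def using that zero_object by (simp add: tr_simps(1))
  have d1: "dtriv V ?S" "dtriv (sh 1 V) ?S" by (rule dtriv_zero[OF cV zV E] dtriv_zero[OF sh_cx[OF cV] _ E]; use N zV in simp)+
  have d2: "dtriv (FO \<delta> V) ?S" by (rule wo[OF cV, of "Suc N"]) (use E N zV in auto)
  have "dtriv (FO \<delta> (sh 1 V)) ?S" by (rule wo[OF sh_cx[OF cV], of N]) (use E N zV in auto)
  hence d3: "dtriv (sh 1 (FO \<delta> V)) ?S" by (rule dtriv_iso[OF D.isomorphic_sym[OF delta_sh[OF cV]]])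
  have u: "D.cod ?u = V" "D.cod (FA \<delta> ?u) = FO \<delta> V" using F delta(4)[of ?u] by simp_all
  have w: "D.arr ?w" "D.dom ?w = I" "D.cod ?w = T" using P by simp_all
  note dw = delta(2-4)[OF w(1), unfolded w(2,3)]
  \<comment> \<open>Arrows to the sphere from \<open>I\<close> and from \<open>\<delta> I\<close>
    are thereby arrows from \<open>T\<close> and from the shift of \<open>\<delta> X\<close>, which
    \<open>\<theta>\<close> identifies with \<open>\<delta> T\<close>.\<close>
  note O1 = dist_outer_trivial[OF t1 S, unfolded u, OF d1] and O2 = dist_outer_trivial[OF t2 S, unfolded u, OF d2 d3]
  have "T : Im"
  proof (rule Im_bounded[of T "min N0 ?n" "nat (?n - min N0 ?n)"])
   show "injcx T" "!!m. ob T m : tors" unfolding T_def by (rule tr_injcx[OF I])+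
   show "zero (ob T m)" if "m < min N0 ?n | min N0 ?n + int (nat (?n - min N0 ?n)) <= m" for m
    unfolding T_def using that N0[of m] zero_object by (auto simp: tr_simps(1))
  qed
  note eT = eps(1-3)[OF cT] eps_iso[OF this]
  have nat: "eps T**FA \<delta> ?w = ?w**eps I" using eps(4)[OF w(1)] w by simp
  obtain e' where e': "D.arr e'" "D.dom e' = T" "D.cod e' = FO \<delta> T" "e'**eps T = D.idt (FO \<delta> T)" using D.is_isoE[OF eT(4)] eT by metis
  obtain t' where t': "D.arr t'" "D.dom t' = sh 1 (FO \<delta> X)" "D.cod t' = FO \<delta> T" "t'**\<theta> X = D.idt (FO \<delta> T)" "is_iso DD t'"
   using D.is_isoE[OF th(4)] th by metis
  have 1: "EX h : D.hom I ?S. h**eps I = g" if g: "g : D.hom (FO \<delta> I) ?S" for g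
  proof -
   obtain k where k: "D.arr k" "D.dom k = sh 1 (FO \<delta> X)" "D.cod k = ?S" "k**(\<theta> X**FA \<delta> ?w) = g"
    using O2(1)[of g] g th dw by auto
   let ?k = "(k**\<theta> X)**e'"
   have k1: "D.arr ?k" "D.dom ?k = T" "D.cod ?k = ?S" using k(1-3) th e' by simp_all
   have "(?k**?w)**eps I = ?k**(eps T**FA \<delta> ?w)" unfolding nat using k1 w E1 by (simp del: D.Cmp_assoc_simp add: D.Cmp_assoc_simp[of "eps I" ?w ?k])
   also have "... = (k**\<theta> X)**((e'**eps T)**FA \<delta> ?w)" using k(1-3) th e'(1-3) eT dw by simp
   also have "... = g" unfolding e'(4) using k th dw by simp
   finally show ?thesis using k1 w by (intro bexI[of _ "?k**?w"]) simp_all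
  qed
  have 2: "h = h'" if h: "h : D.hom I ?S" "h' : D.hom I ?S" and e: "h**eps I = h'**eps I" for h h'
  proof -
   obtain l where l: "D.arr l" "D.dom l = T" "D.cod l = ?S" "l**?w = h" using O1(1)[of h] h w by auto
   obtain l' where l': "D.arr l'" "D.dom l' = T" "D.cod l' = ?S" "l'**?w = h'" using O1(1)[of h'] h w by auto
   have r: "((x**eps T)**t')**(\<theta> X**FA \<delta> ?w) = (x**?w)**eps I" if x: "D.arr x" "D.dom x = T" for x
   proof -
    have "((x**eps T)**t')**(\<theta> X**FA \<delta> ?w) = (x**eps T)**((t'**\<theta> X)**FA \<delta> ?w)"
     using x eT(1-3) t'(1-3) th dw by simp
    also have "... = x**(eps T**FA \<delta> ?w)" unfolding t'(4) using x eT(1-3) dw by simp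
    finally show ?thesis unfolding nat using x w E1 by simp
   qed
   have "(l**eps T)**t' = (l'**eps T)**t'"
    by (rule O2(2)) (use r[OF l(1,2)] r[OF l'(1,2)] l(4) l'(4) e l(1-3) l'(1-3) eT(1-3) t'(1-3) th dw in simp_all)
   hence "l**eps T = l'**eps T" by (rule D.iso_epi_cancel[OF t'(5), rotated -1]) (use l(1-3) l'(1-3) eT(1-3) t'(1-3) in simp_all)
   hence "l = l'" by (rule D.iso_epi_cancel[OF eT(4), rotated -1]) (use l(1-3) l'(1-3) eT(1-3) in simp_all)
   thus ?thesis using l(4) l'(4) by simp
  qed
  show ?thesis using 1 2 by blast
 qed
 obtain Y e r where Y: "cm Y I e" and r: "is_iso DD r" "D.arr r" "D.dom r = Y" "D.cod r = FO \<delta> I" "eps I**r = dm Y I e"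
  by (rule counit_model[OF I(1)]) blast
 obtain r' where r': "D.arr r'" "D.dom r' = FO \<delta> I" "D.cod r' = Y" "r'**r = D.idt Y" using D.is_isoE[OF r(1)] r by metis
 have "coqis Y I e"
 proof (rule sph_detect[OF Y])
  fix E m assume E: "inject E"
  show "EX h : D.hom I (sph E m). h**dm Y I e = g" if g: "g : D.hom Y (sph E m)" for g
  proof -
   obtain h where h: "D.arr h" "D.dom h = I" "D.cod h = sph E m" "h**eps I = g**r'" using key[OF E, THEN conjunct1, THEN bspec, of "g**r'" m] g r' by auto
   have "h**(eps I**r) = (h**eps I)**r" using h(1,2) E1 r(2-4) by simp
   also have "... = g**(r'**r)" unfolding h(4) using g r' r(2-4) by simp
   finally have "h**dm Y I e = g" unfolding r(5) r'(4) using g by simp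
   thus ?thesis using h by auto
  qed
  show "h = h'" if h: "h : D.hom I (sph E m)" "h' : D.hom I (sph E m)" "h**dm Y I e = h'**dm Y I e" for h h'
  proof -
   have "(h**eps I)**r = (h'**eps I)**r" using h E1 r(2-5) by simp
   hence "h**eps I = h'**eps I" by (rule D.iso_epi_cancel[OF r(1), rotated -1]) (use h E1 r(2-4) in simp_all)
   thus ?thesis using key[OF E] h(1,2) by blast
  qed
 qed
 hence "isomorphic DD Y I" unfolding isomorphic_def using dm_iso[of Y I e] dm(1-3)[OF Y] by (intro bexI[of _ "dm Y I e"]) simp_all
 moreover have "isomorphic DD Y (FO \<delta> I)" unfolding isomorphic_def using r by auto
 ultimately show ?thesis unfolding Im_iff using D.isomorphic_sym D.isomorphic_trans cI by blast
qed

text \<open>Local stability supplies resolutions by torsion injectives, which reduces the claim to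
  \<open>Im_complex\<close>.\<close>

lemma Im_tors:
 assumes X: "cx X" and t: "!!n. ob X n : tors" shows "X : Im"
proof (rule resolution[OF X t tors_zero[OF zero_object]])
 fix M M' B i j p q e assume M: "M : tors" "M' : tors" and B: "is_biproduct A M M' B i j p q" and e: "epi e" "dom e = B"
 note b = bip_facts[OF B tors_Obj[OF M(1)] tors_Obj[OF M(2)]]
 have "mono i" "epi q" using mono_right[of p i] epi_left[of q j] b(1-15) tors_Obj M by simp_all
 moreover have "kr q <= sv i"
 proof
  fix x assume x: "x : kr q"
  hence "x = i*(p*x)++j*(q*x)" using bip_decomp[OF B tors_Obj[OF M(1)] tors_Obj[OF M(2)]] b(12) by simp
  also have "... = i*(p*x)" using x b(1-13) by (intro nul_Add_right) simp_all
  finally show "x : sv i" using svI[of "p*x" i] x b(1-13) by simp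
 qed
 ultimately have "B : tors" using tors_ext[of i q] M b(1-13) by simp
 thus "EX m. mono m & dom m = cod e & inject (cod m) & cod m : tors" using tors_embed[OF tors_epi[OF e(1)]] e(2) by simp
next
 fix I s assume I: "injcx I" "!!n. ob I n : tors" and s: "coqis X I s"
 have "isomorphic DD X I" unfolding isomorphic_def using dm_iso[OF s] coqis_cm[OF s] by (intro bexI[of _ "dm X I s"]) simp_all
 thus "X : Im" by (rule Im_iso[OF _ Im_complex[OF I]])
qed

section \<open>Comparison of the abstract functor with termwise torsion parts\<close>

definition gx :: "('o, 'm) cplx => ('o, 'm) cplx" where "gx X = \<lparr>ob = FO \<Gamma> \<circ> ob X, df = FA \<Gamma> \<circ> df X\<rparr>"

abbreviation gc where "gc X == %n. gam (ob X n)"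

lemma gx_simps [simp]: "ob (gx X) n = FO \<Gamma> (ob X n)" "df (gx X) n = FA \<Gamma> (df X n)" by (simp_all add: gx_def)

lemma gc: "cx X ==> mono (gc X n)" "cx X ==> arr (gc X n)" "cx X ==> cod (gc X n) = ob X n" "cx X ==> dom (gc X n) = FO \<Gamma> (ob X n)"
 using gam(1,2,3,6) by simp_all

lemma gx_cx:
 assumes X: "cx X" shows "cx (gx X)"
proof -
 note x = cxD[OF X] and g = gc[OF X] and G = Gamma_arr[OF cxD(2)[OF X]]
 obtain N where N: "!!n. n <= N ==> zero (ob X n)" using cx_bound[OF X] by blast
 show ?thesis
 proof (rule cxI[of _ N])
  fix n
  have "gc X (n+1+1)*(FA \<Gamma> (df X (n+1))*FA \<Gamma> (df X n)) = df X (n+1)*(gc X (n+1)*FA \<Gamma> (df X n))"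
   by (rule Cmp_reassoc) (use G(4)[of "n+1"] G(1-3) x g in simp_all)
  also have "... = df X (n+1)*(df X n*gc X n)" using G(4)[of n] x by simp
  also have "nul ..." by (rule nul_Cmp_left2) (use x g in simp_all)
  finally show "nul (df (gx X) (n+1)*df (gx X) n)" unfolding gx_simps by (rule mono_nul[OF g(1)]) (use G(1-3) x g in simp_all)
  assume n: "n <= N"
  have "nul (gc X n*idt (FO \<Gamma> (ob X n)))" by (rule zero_nul[OF N[OF n]]) (use g Gamma_Obj(1)[OF x(1)] in simp_all)
  hence "nul (idt (FO \<Gamma> (ob X n)))" by (rule mono_nul[OF g(1)]) (use g Gamma_Obj(1)[OF x(1)] in simp_all)
  thus "zero (ob (gx X) n)" using Gamma_Obj(1)[OF x(1)] by (simp add: is_zero_iff)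
 qed (use G(1-3) x Gamma_Obj(1) in simp_all)
qed

lemma gc_cm: assumes X: "cx X" shows "cm (gx X) X (gc X)"
 by (rule cmI[OF gx_cx[OF X] X]) (use gc[OF X] Gamma_arr(4)[OF cxD(2)[OF X]] cxD[OF X] in simp_all)

lemma gx_cm:
 assumes f: "cm X Y f" shows "cm (gx X) (gx Y) (%n. FA \<Gamma> (f n))"
proof -
 note F = cmD[OF f] note x = cxD[OF F(1)] and y = cxD[OF F(2)] and g = gc[OF F(2)] gc[OF F(1)]
 note G = Gamma_arr[OF F(3), unfolded F(4,5)] and dx = Gamma_arr[OF x(2), unfolded x(3,4)] and dy = Gamma_arr[OF y(2), unfolded y(3,4)]
 show ?thesis
 proof (rule cmI[OF gx_cx[OF F(1)] gx_cx[OF F(2)]])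
  fix n
  have "gc Y (n+1)*(FA \<Gamma> (f (n+1))*FA \<Gamma> (df X n)) = f (n+1)*(gc X (n+1)*FA \<Gamma> (df X n))"
   by (rule Cmp_reassoc[OF G(4)]) (use F G(1-3) dx(1-3) g in simp_all)
  also have "... = (f (n+1)*df X n)*gc X n" unfolding dx(4) using F(3-5) x g by simp
  also have "... = df Y n*(f n*gc X n)" unfolding F(6) using F(3-5) y g by simp
  also have "... = (df Y n*gc Y n)*FA \<Gamma> (f n)" unfolding G(4)[symmetric] using G(1-3) y g by simp
  also have "... = gc Y (n+1)*(FA \<Gamma> (df Y n)*FA \<Gamma> (f n))" unfolding dy(4)[symmetric] using G(1-3) dy(1-3) g by simp
  finally have "FA \<Gamma> (f (n+1))*FA \<Gamma> (df X n) = FA \<Gamma> (df Y n)*FA \<Gamma> (f n)" by (rule mono_cancel[OF g(1)]) (use G(1-3) dx(1-3) dy(1-3) g in simp_all)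
  thus "FA \<Gamma> (f (n+1))*df (gx X) n = df (gx Y) n*FA \<Gamma> (f n)" by simp
 qed (use G in simp_all)
qed

lemma Gamma_functor: "is_functor A A \<Gamma>"
 using additive_Gamma unfolding is_additive_def by blast

lemma Gamma_Add:
 assumes "arr f" "arr g" "dom g = dom f" "cod g = cod f" shows "FA \<Gamma> (f++g) = FA \<Gamma> f++FA \<Gamma> g"
proof -
 have "f : hom (dom f) (cod f)" "g : hom (dom f) (cod f)" using assms by simp_all
 thus ?thesis using additive_Gamma Dom_Obj[OF assms(1)] Cod_Obj[OF assms(1)] unfolding is_additive_def by blast
qed

lemma gx_nh:
 assumes f: "cm X Y f" and g: "cm X Y g" and n: "nh X Y (%n. f n++neg (g n))"
 shows "nh (gx X) (gx Y) (%n. FA \<Gamma> (f n)++neg (FA \<Gamma> (g n)))"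
proof -
 note F = cmD[OF f] and G = cmD[OF g] note x = cxD[OF F(1)] and y = cxD[OF F(2)]
 obtain h where h: "!!n. arr (h n)" "!!n. dom (h n) = ob X n" "!!n. cod (h n) = ob Y (n-1)"
  "!!n. f n++neg (g n) = df Y (n-1)*h n++h (n+1)*df X n" using nhE[OF n] by blast
 have h': "cod (h (n+1)) = ob Y n" for n using h(3)[of "n+1"] by simp
 have y': "cod (df Y (n-1)) = ob Y n" for n using y(4)[of "n-1"] by simp
 note Gf = Gamma_arr(1-3)[OF F(3), unfolded F(4,5)] and Gg = Gamma_arr(1-3)[OF G(3), unfolded G(4,5)] and Gh = Gamma_arr(1-3)[OF h(1), unfolded h(2,3)]
 show ?thesis
 proof (rule nhI[of "%n. FA \<Gamma> (h n)"])
  fix n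
  have e: "f n = g n++(df Y (n-1)*h n++h (n+1)*df X n)" by (subst Add_eq_iff) (use F G h h' x y y' in auto)
  have "FA \<Gamma> (f n) = FA \<Gamma> (g n)++FA \<Gamma> (df Y (n-1)*h n++h (n+1)*df X n)"
   by (subst e, rule Gamma_Add) (use G h(1-3) h' x y y' in simp_all)
  also have "FA \<Gamma> (df Y (n-1)*h n++h (n+1)*df X n) = FA \<Gamma> (df Y (n-1)*h n)++FA \<Gamma> (h (n+1)*df X n)"
   by (rule Gamma_Add) (use h(1-3) h' x y y' in simp_all)
  also have "... = df (gx Y) (n-1)*FA \<Gamma> (h n)++FA \<Gamma> (h (n+1))*df (gx X) n"
   using is_functor_simps(6)[OF Gamma_functor] h(1-3) h' x y y' by simp
  finally show "FA \<Gamma> (f n)++neg (FA \<Gamma> (g n)) = df (gx Y) (n-1)*FA \<Gamma> (h n)++FA \<Gamma> (h (n+1))*df (gx X) n"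
   by (rule Add_eq_iff[THEN iffD1, rotated -1]) (use Gf Gg Gh Gh[of "n+1"] h' Gamma_arr(1-3)[OF x(2)] Gamma_arr(1-3)[OF y(2)] x y y' in simp_all)
 qed (use Gh in simp_all)
qed

lemma gx_Im: "cx X ==> gx X : Im"
 by (rule Im_tors[OF gx_cx]) (simp_all add: Gamma_Obj(2))

text \<open>The transformation required of a derived functor: the inclusion of the termwise torsion
  part, lifted through the counit. The lift exists because \<open>gx X\<close> lies in
  \<open>Im\<close>.\<close>

definition xi where "xi X = (SOME h. D.arr h & D.dom h = gx X & D.cod h = FO \<delta> X & eps X**h = dm (gx X) X (gc X))"

lemma xi:
 assumes X: "cx X" shows "D.arr (xi X)" "D.dom (xi X) = gx X" "D.cod (xi X) = FO \<delta> X" "eps X**xi X = dm (gx X) X (gc X)"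
proof -
 have "EX h. D.arr h & D.dom h = gx X & D.cod h = FO \<delta> X & eps X**h = dm (gx X) X (gc X)"
  using eps_lift[OF gx_Im[OF X], of "dm (gx X) X (gc X)" X] gc_cm[OF X] by auto
 from someI_ex[OF this] show "D.arr (xi X)" "D.dom (xi X) = gx X" "D.cod (xi X) = FO \<delta> X" "eps X**xi X = dm (gx X) X (gc X)"
  unfolding xi_def by blast+
qed

text \<open>Both sides start in \<open>Im\<close>, so they may be compared after composition with
  the counit at \<open>Y\<close>.\<close>

lemma xi_natural:
 assumes f: "cm X Y f" shows "xi Y**dm (gx X) (gx Y) (%n. FA \<Gamma> (f n)) = FA \<delta> (dm X Y f)**xi X"
proof -
 note F = cmD[OF f] note x = xi[OF F(1)] and y = xi[OF F(2)] and ex = eps(1-3)[OF F(1)] and ey = eps(1-3)[OF F(2)] and g = gx_cm[OF f]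
 note d = delta(2-4)[of "dm X Y f"]
 have gf: "(%n. gc Y n*FA \<Gamma> (f n)) = (%n. f n*gc X n)" using Gamma_arr(4)[OF F(3), unfolded F(4,5)] by simp
 show ?thesis
 proof (rule eps_eq[OF F(2)])
  have "eps Y**(xi Y**dm (gx X) (gx Y) (%n. FA \<Gamma> (f n))) = (eps Y**xi Y)**dm (gx X) (gx Y) (%n. FA \<Gamma> (f n))"
   using y(1-3) ey g by simp
  also have "... = dm (gx X) Y (%n. f n*gc X n)" unfolding y(4) dm_Cmp[OF g gc_cm[OF F(2)]] gf ..
  also have "... = dm X Y f**(eps X**xi X)" unfolding x(4) dm_Cmp[OF gc_cm[OF F(1)] f] ..
  also have "... = (eps Y**FA \<delta> (dm X Y f))**xi X" using eps(4)[of "dm X Y f"] x(1-3) ex f by simp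
  also have "... = eps Y**(FA \<delta> (dm X Y f)**xi X)" using x(1-3) ey d f by simp
  finally show "eps Y**(xi Y**dm (gx X) (gx Y) (%n. FA \<Gamma> (f n))) = eps Y**(FA \<delta> (dm X Y f)**xi X)" .
 qed (use gx_Im[OF F(1)] x(1-3) y(1-3) g d f in simp_all)
qed

text \<open>A chain map from an object of the image of \<open>\<delta>\<close> to a complex \<open>X\<close> of injectives becomes null-homotopic in \<open>X / \<Gamma> X\<close>,
 whose terms are torsion-free and injective; as the sequence splits in each degree, the homotopy lifts to \<open>X\<close>.\<close>

lemma factor_gc:
 assumes X: "injcx X" and Y: "Y : Im" and e: "cm Y X e"
 obtains \<phi> where "cm Y (gx X) \<phi>" "nh Y X (%n. e n++neg (gc X n*\<phi> n))"
proof -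
 note cX = injcxD(1)[OF X] note x = cxD[OF cX] and g = gc[OF cX] and E = cmD[OF e]
 note y = cxD[OF E(1)]
 define \<pi> where "\<pi> n = qt (tsub (ob X n))" for n
 note p = qt[OF tsub_Sub[OF x(1)], folded \<pi>_def]
 have krp: "kr (\<pi> n) = sv (gc X n)" for n using p(4) gam(5)[OF x(1)] by simp
 have pg: "nul (\<pi> n*gc X n)" for n using krp[of n] sv_self[OF g(2)] by auto
 have tf: "tfree (cod (\<pi> n))" for n unfolding \<pi>_def by (rule tfree_quot[OF x(1)])
 \<comment> \<open>The torsion part of an injective is injective, so its inclusion has a retraction
   \<open>r\<close>; the complementary idempotent \<open>?u\<close> induces the section
   \<open>s\<close> of the projection.\<close>
 have "EX s. arr s & dom s = cod (\<pi> n) & cod s = ob X n & \<pi> n*s = idt (cod (\<pi> n))" for n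
 proof -
  obtain r where r: "arr r" "dom r = ob X n" "cod r = FO \<Gamma> (ob X n)" "r*gc X n = idt (FO \<Gamma> (ob X n))"
   by (rule is_injectiveD[OF injective_Gamma[OF injcxD(2)[OF X]] g(1), of "idt (FO \<Gamma> (ob X n))" n n]) (use Gamma_Obj(1)[OF x(1)] g in auto)
  let ?u = "idt (ob X n)++neg (gc X n*r)"
  have u: "arr ?u" "dom ?u = ob X n" "cod ?u = ob X n" using x g r by simp_all
  have kru: "kr (\<pi> n) <= kr ?u" unfolding krp
  proof
   fix z assume "z : sv (gc X n)"
   then obtain w where w: "arr w" "cod w = FO \<Gamma> (ob X n)" "z = gc X n*w" using g by (auto elim: svE)
   have "r*(gc X n*w) = (r*gc X n)*w" using r(1-3) g w by simp
   hence "?u*(gc X n*w) = zer (dom w) (ob X n)" unfolding r(4) using r(1-3) g w x by (simp add: Add_Cmp)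
   thus "z : kr ?u" using w g u x by simp
  qed
  have du: "dom ?u = dom (\<pi> n)" by (simp only: u(2) p(3))
  obtain s where s: "arr s" "dom s = cod (\<pi> n)" "cod s = ob X n" "s*\<pi> n = ?u" using epi_factor[OF p(1) u(1) du kru] u(3) by metis
  have "(\<pi> n*s)*\<pi> n = \<pi> n*?u" unfolding s(4)[symmetric] using s(1-3) p by simp
  also have "... = \<pi> n++neg (\<pi> n*(gc X n*r))" using p(1-3) x(1) g r(1-3) by (simp add: Cmp_Add)
  also have "nul (\<pi> n*(gc X n*r))" by (rule nul_Cmp_left2[OF pg]) (use p(1-3) g r(1-3) in simp_all)
  hence "\<pi> n++neg (\<pi> n*(gc X n*r)) = \<pi> n" by (intro nul_Add_right) (use p(1-3) g r(1-3) in simp_all)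
  finally have "(\<pi> n*s)*\<pi> n = idt (cod (\<pi> n))*\<pi> n" using p(2) by simp
  hence "\<pi> n*s = idt (cod (\<pi> n))" by (rule epi_cancel[OF p(1)]) (use s(1-3) p in simp_all)
  thus ?thesis using s by blast
 qed
 then obtain s where s: "!!n. arr (s n)" "!!n. dom (s n) = cod (\<pi> n)" "!!n. cod (s n) = ob X n" "!!n. \<pi> n*s n = idt (cod (\<pi> n))" by metis
 have "EX D. arr D & dom D = cod (\<pi> n) & cod D = cod (\<pi> (n+1)) & D*\<pi> n = \<pi> (n+1)*df X n" for n
 proof -
  have "kr (\<pi> n) <= kr (\<pi> (n+1)*df X n)" using tsub_kill[of "\<pi> (n+1)*df X n"] tf p x Sub_el[OF tsub_Sub[OF x(1)]] unfolding p(4) by auto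
  thus ?thesis using epi_factor[OF p(1), of "\<pi> (n+1)*df X n" n] p x by simp
 qed
 then obtain D where D: "!!n. arr (D n)" "!!n. dom (D n) = cod (\<pi> n)" "!!n. cod (D n) = cod (\<pi> (n+1))" "!!n. D n*\<pi> n = \<pi> (n+1)*df X n" by metis
 define Z where "Z = \<lparr>ob = %n. cod (\<pi> n), df = D\<rparr>"
 have Z: "ob Z n = cod (\<pi> n)" "df Z n = D n" for n by (simp_all add: Z_def)
 obtain N where N: "!!n. n <= N ==> zero (ob X n)" using cx_bound[OF cX] by blast
 have cZ: "cx Z"
 proof (rule cxI[of _ N])
  fix n
  have "D (n+1)*(D n*\<pi> n) = \<pi> (n+1+1)*(df X (n+1)*df X n)" unfolding D(4)[of n] by (rule Cmp_reassoc[OF D(4)]) (use D(1-3) p x in simp_all)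
  hence "nul ((D (n+1)*D n)*\<pi> n)" using D(1-3) p x by simp
  thus "nul (df Z (n+1)*df Z n)" unfolding Z by (rule epi_nul[OF p(1)]) (use D(1-3) p in simp_all)
  assume n: "n <= N"
  have "nul (idt (cod (\<pi> n))*\<pi> n)" by (rule zero_nul[OF N[OF n]]) (use p in simp_all)
  hence "nul (idt (cod (\<pi> n)))" by (rule epi_nul[OF p(1)]) (use p in simp_all)
  thus "zero (ob Z n)" using p by (simp add: is_zero_iff Z)
 qed (use D p in "simp_all add: Z")
 have P: "cm X Z \<pi>" by (rule cmI[OF cX cZ]) (simp_all only: Z p(2,3) D(4))
 have "inject (dom (s n))" for n by (rule is_injective_retract[OF injcxD(2)[OF X] s(1,3) p(2,3)]) (simp_all only: s)
 hence "inject (cod (\<pi> n))" for n by (simp only: s(2))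
 hence "nh Y Z (%n. \<pi> n*e n)" by (intro hexact_null[OF cm_Cmp[OF e P]]) (simp add: Z Im_hexact_tfree[OF Y] tf)
 then obtain h where "!!n. arr (h n)" "!!n. dom (h n) = ob Y n" "!!n. cod (h n) = ob Z (n-1)"
  "!!n. \<pi> n*e n = df Z (n-1)*h n++h (n+1)*df Y n" using nhE by blast
 note h = this[unfolded Z]
 have D1: "cod (D (n-1)) = cod (\<pi> n)" "D (n-1)*\<pi> (n-1) = \<pi> n*df X (n-1)" "cod (df X (n-1)) = ob X n" for n using D(3,4)[of "n-1"] x(4)[of "n-1"] by simp_all
 \<comment> \<open>The sections turn the homotopy \<open>h\<close> in the quotient into a homotopy
   \<open>k\<close> in \<open>X\<close>; after subtracting the resulting null-homotopic map
   \<open>b\<close>, what remains of \<open>e\<close> has values in the torsion part.\<close>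
 define k where "k n = s (n-1)*h n" for n
 have k: "arr (k n)" "dom (k n) = ob Y n" "cod (k n) = ob X (n-1)" for n unfolding k_def using s(1-3) h(1-3) by simp_all
 have pk: "\<pi> (n-1)*k n = h n" for n
 proof -
  have "\<pi> (n-1)*k n = (\<pi> (n-1)*s (n-1))*h n" unfolding k_def using s(1-3) h(1-3) p by simp
  thus ?thesis unfolding s(4) using h(1-3) by simp
 qed
 have k1: "cod (k (n+1)) = ob X n" "\<pi> n*k (n+1) = h (n+1)" for n using k(3)[of "n+1"] pk[of "n+1"] by simp_all
 define b where "b n = df X (n-1)*k n++k (n+1)*df Y n" for n
 have nb: "nh Y X b" by (rule nhI[of k]) (use k in "simp_all add: b_def")
 have B: "cm Y X b" by (rule nh_cm[OF E(1) cX nb])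
 define c where "c n = e n++neg (b n)" for n
 have C: "cm Y X c" unfolding c_def by (rule cm_Add[OF e cm_Neg[OF B]])
 have "\<pi> n*b n = \<pi> n*e n" for n
 proof -
  have "\<pi> n*b n = \<pi> n*(df X (n-1)*k n)++(\<pi> n*k (n+1))*df Y n" unfolding b_def using p x D1 k k1(1) y by (simp add: Cmp_Add)
  also have "\<pi> n*(df X (n-1)*k n) = D (n-1)*(\<pi> (n-1)*k n)" by (rule Cmp_reassoc[OF D1(2)[symmetric]]) (use p x D(1-3) D1(1,3) k in simp_all)
  finally show ?thesis unfolding h(4) pk k1(2) .
 qed
 hence "nul (\<pi> n* c n)" for n unfolding c_def using cmD(3-5)[OF B] E(3-5) p nul_dif[of "\<pi> n*e n" "\<pi> n*b n"] by (simp add: Cmp_Add)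
 hence "c n : sv (gc X n)" for n unfolding krp[symmetric] using cmD(3-5)[OF C] p(2,3) by simp
 hence "EX f. arr f & dom f = ob Y n & cod f = FO \<Gamma> (ob X n) & gc X n*f = c n" for n
  using gam_lift[OF x(1), of "c n" n] gam(5)[OF x(1)] cmD(4)[OF C] by metis
 then obtain \<phi> where f: "!!n. arr (\<phi> n)" "!!n. dom (\<phi> n) = ob Y n" "!!n. cod (\<phi> n) = FO \<Gamma> (ob X n)" "!!n. gc X n*\<phi> n = c n" by metis
 note G = Gamma_arr[OF x(2), unfolded x(3,4)]
 have "cm Y (gx X) \<phi>"
 proof (rule cmI[OF E(1) gx_cx[OF cX]])
  fix n
  have "gc X (n+1)*(\<phi> (n+1)*df Y n) = (gc X (n+1)*\<phi> (n+1))*df Y n" using f(1-3) g y by simp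
  also have "... = df X n*(gc X n*\<phi> n)" unfolding f(4) by (rule cmD(6)[OF C])
  also have "... = gc X (n+1)*(FA \<Gamma> (df X n)*\<phi> n)" by (rule Cmp_reassoc[OF G(4)[symmetric]]) (use G(1-3) f(1-3) g x in simp_all)
  finally show "\<phi> (n+1)*df Y n = df (gx X) n*\<phi> n" unfolding gx_simps by (rule mono_cancel[OF g(1)]) (use G(1-3) f(1-3) g y in simp_all)
 qed (use f in simp_all)
 moreover have "e n++neg (gc X n*\<phi> n) = b n" for n unfolding f(4) c_def using E(3-5) cmD(3-5)[OF B] by (simp add: Neg_distrib)
 hence "nh Y X (%n. e n++neg (gc X n*\<phi> n))" using nb by simp
 ultimately show ?thesis using that by blast
qed

text \<open>The homotopy starts at torsion objects, so its values lie in the torsion part and it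
  lifts along the monomorphism \<open>gc X\<close>.\<close>

lemma gc_homotopy_cancel:
 assumes X: "cx X" and z: "cm (gx X) (gx X) z" and n: "nh (gx X) X (%n. gc X n*z n++neg (gc X n))"
 shows "nh (gx X) (gx X) (%n. z n++neg (idt (ob (gx X) n)))"
proof -
 note x = cxD[OF X] and g = gc[OF X] and Zd = cmD[OF z] and G = Gamma_arr[OF cxD(2)[OF X], unfolded cxD(3,4)[OF X]] note GO = Gamma_Obj(1)[OF x(1)]
 obtain h where h: "!!n. arr (h n)" "!!n. dom (h n) = ob (gx X) n" "!!n. cod (h n) = ob X (n-1)"
  "!!n. gc X n*z n++neg (gc X n) = df X (n-1)*h n++h (n+1)*df (gx X) n" using nhE[OF n] by blast
 have "EX k. arr k & dom k = ob (gx X) n & cod k = ob (gx X) (n-1) & gc X (n-1)*k = h n" for n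
 proof -
  have "h n : tsub (ob X (n-1))" using tors_mem[OF h(1), of n] h(2,3) Gamma_Obj(2)[OF x(1)] by simp
  thus ?thesis using gam_lift[OF x(1)] h(2) gx_simps by metis
 qed
 then obtain k where k: "!!n. arr (k n)" "!!n. dom (k n) = ob (gx X) n" "!!n. cod (k n) = ob (gx X) (n-1)" "!!n. gc X (n-1)*k n = h n" by metis
 have k1: "cod (k (n+1)) = ob (gx X) n" "gc X n*k (n+1) = h (n+1)" for n using k(3,4)[of "n+1"] by simp_all
 have G1: "cod (FA \<Gamma> (df X (n-1))) = FO \<Gamma> (ob X n)" "gc X n*FA \<Gamma> (df X (n-1)) = df X (n-1)*gc X (n-1)" for n using G(3,4)[of "n-1"] by simp_all
 show ?thesis
 proof (rule nhI[of k])
  fix n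
  let ?r = "df (gx X) (n-1)*k n++k (n+1)*df (gx X) n"
  have "gc X n*?r = gc X n*(FA \<Gamma> (df X (n-1))*k n)++(gc X n*k (n+1))*df (gx X) n"
   using g G(1-3) G1(1) k(1-3) k1(1) by (simp add: Cmp_Add)
  also have "gc X n*(FA \<Gamma> (df X (n-1))*k n) = df X (n-1)*(gc X (n-1)*k n)"
   by (rule Cmp_reassoc[OF G1(2)]) (use g G(1-3) G1(1) k(1-3) x in simp_all)
  also have "df X (n-1)*(gc X (n-1)*k n)++(gc X n*k (n+1))*df (gx X) n = gc X n*z n++neg (gc X n)" unfolding k(4) k1(2) h(4) ..
  also have "... = gc X n*(z n++neg (idt (ob (gx X) n)))" using g Zd(3-5) GO by (simp add: Cmp_Add)
  finally show "z n++neg (idt (ob (gx X) n)) = ?r" by - (rule mono_cancel[OF g(1)], use g Zd(3-5) G(1-3) G1(1) k(1-3) k1(1) GO in simp_all)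
 qed (use k in simp_all)
qed

text \<open>A right inverse comes from \<open>factor_gc\<close>, applied to the chain map that
  models the counit. It is also a left inverse because \<open>gc X\<close> can be cancelled up to
  homotopy.\<close>

lemma xi_iso:
 assumes X: "injcx X" shows "is_iso DD (xi X)"
proof -
 note cX = injcxD(1)[OF X] note E = eps(1-3)[OF cX] and x = xi[OF cX] and GC = gc_cm[OF cX]
 let ?c = "dm (gx X) X (gc X)"
 obtain Y e r where Y: "Y : Im" "cm Y X e" and r: "is_iso DD r" "D.arr r" "D.dom r = Y" "D.cod r = FO \<delta> X" "eps X**r = dm Y X e"
  by (rule counit_model[OF X]) blast
 obtain r' where r': "D.arr r'" "D.dom r' = FO \<delta> X" "D.cod r' = Y" "r**r' = D.idt (FO \<delta> X)" using D.is_isoE[OF r(1)] r by metis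
 obtain \<phi> where f: "cm Y (gx X) \<phi>" "nh Y X (%n. e n++neg (gc X n*\<phi> n))" by (rule factor_gc[OF X Y])
 let ?f = "dm Y (gx X) \<phi>"
 have "eps X**(xi X**?f) = (eps X**xi X)**?f" using E x(1-3) f(1) by simp
 also have "... = eps X**r" unfolding x(4) r(5) dm_Cmp[OF f(1) GC] by (rule dm_eq[OF Y(2) cm_Cmp[OF f(1) GC] f(2), symmetric])
 finally have "xi X**?f = r" by - (rule eps_eq[OF cX], use Y(1) x(1-3) f(1) r(2-4) in simp_all)
 define t where "t = ?f**r'"
 have t: "D.arr t" "D.dom t = FO \<delta> X" "D.cod t = gx X" unfolding t_def using f(1) r' by simp_all
 have xt: "xi X**t = D.idt (FO \<delta> X)"
 proof -
  have "xi X**t = (xi X**?f)**r'" unfolding t_def using x(1-3) f(1) r' by simp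
  thus ?thesis unfolding \<open>xi X**?f = r\<close> r'(4) .
 qed
 have J: "injcx (gx X)" unfolding injcx_def using gx_cx[OF cX] injective_Gamma[OF injcxD(2)[OF X]] by simp
 obtain z where z: "cm (gx X) (gx X) z" "t**xi X = dm (gx X) (gx X) z" by (rule dm_full[OF J, of "t**xi X"]) (use t x(1-3) in simp_all)
 have "?c**(t**xi X) = eps X**((xi X**t)**xi X)" unfolding x(4)[symmetric] using E x(1-3) t by simp
 also have "... = ?c" unfolding xt using x by simp
 finally have "dm (gx X) X (%n. gc X n*z n) = ?c" unfolding z(2) dm_Cmp[OF z(1) GC] .
 hence "nh (gx X) X (%n. gc X n*z n++neg (gc X n))" by (rule dm_inj[OF X cm_Cmp[OF z(1) GC] GC])
 from gc_homotopy_cancel[OF cX z(1) this] have "t**xi X = D.idt (gx X)"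
  unfolding z(2) dm_Idt[OF gx_cx[OF cX], symmetric] by (rule dm_eq[OF z(1) cm_Idt[OF gx_cx[OF cX]]])
 thus ?thesis using D.is_isoI[OF x(1) t(1)] x t xt by simp
qed

lemma loc_Gamma:
 assumes f: "cm X Y f"
 shows "FA (Dloc A \<circ>\<^sub>F Kplus_functor A \<Gamma>) (kc X Y f) = dm (gx X) (gx Y) (%n. FA \<Gamma> (f n))" "FA (F \<circ>\<^sub>F Dloc A) (kc X Y f) = FA F (dm X Y f)"
proof -
 have "FA (Kplus_functor A \<Gamma>) (kc X Y f) = kc (gx X) (gx Y) (%n. FA \<Gamma> (f n))"
  unfolding Kplus_functor_def
  by (rule quot_functor_kc[OF f]) (use gx_cm gx_nh[OF f] in "auto simp: Ch_functor_def Let_def gx_def o_def")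
 thus "FA (Dloc A \<circ>\<^sub>F Kplus_functor A \<Gamma>) (kc X Y f) = dm (gx X) (gx Y) (%n. FA \<Gamma> (f n))" by (simp add: fcomp_def Dloc_def dm_L)
 show "FA (F \<circ>\<^sub>F Dloc A) (kc X Y f) = FA F (dm X Y f)" by (simp add: fcomp_def Dloc_def dm_L)
qed

lemma loc_Gamma_ob: "FO (Dloc A \<circ>\<^sub>F Kplus_functor A \<Gamma>) X = gx X" "FO (F \<circ>\<^sub>F Dloc A) X = FO F X"
 by (simp_all add: fcomp_def Dloc_def frac_loc_def Kplus_functor_def quot_functor_def Ch_functor_def Let_def gx_def)

lemma nat_trans_K:
 "is_nat_trans KK DD (Dloc A \<circ>\<^sub>F Kplus_functor A \<Gamma>) (F \<circ>\<^sub>F Dloc A) \<zeta> <->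
  (ALL X. cx X --> \<zeta> X : D.hom (gx X) (FO F X)) &
  (ALL X Y f. cm X Y f --> (\<zeta> Y)**dm (gx X) (gx Y) (%n. FA \<Gamma> (f n)) = FA F (dm X Y f)**(\<zeta> X))" (is "?L <-> ?O & ?N")
proof -
 let ?Q = "%a. (\<zeta> (Cod KK a))**FA (Dloc A \<circ>\<^sub>F Kplus_functor A \<Gamma>) a = FA (F \<circ>\<^sub>F Dloc A) a**(\<zeta> (Dom KK a))"
 have "(ALL a : Arr KK. ?Q a) <-> ?N"
 proof (intro iffI allI impI ballI)
  fix X Y f assume q: "ALL a : Arr KK. ?Q a" and f: "cm X Y f"
  have "?Q (kc X Y f)" by (rule q[THEN bspec]) (use f in simp)
  thus "(\<zeta> Y)**dm (gx X) (gx Y) (%n. FA \<Gamma> (f n)) = FA F (dm X Y f)**(\<zeta> X)" using f by (simp add: loc_Gamma)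
 next
  fix a assume N: ?N and a: "a : Arr KK"
  obtain X Y f where f: "a = kc X Y f" "cm X Y f" by (rule K_ArrE[OF a refl refl], rule that)
  show "?Q a" using N f by (simp add: loc_Gamma)
 qed
 thus ?thesis unfolding is_nat_trans_def loc_Gamma_ob by simp
qed

text \<open>On complexes of injectives \<open>xi\<close> is invertible, which forces the value of
  \<open>\<eta>\<close>; on other complexes the value is forced by naturality along a resolution
  \<open>S X\<close>, which both functors map to isomorphisms.\<close>

lemma right_derived_universal:
 assumes G: "is_functor DD DD G" and z: "is_nat_trans KK DD (Dloc A \<circ>\<^sub>F Kplus_functor A \<Gamma>) (G \<circ>\<^sub>F Dloc A) \<zeta>"
 shows "EX \<eta>. is_nat_trans DD DD \<delta> G \<eta> & (ALL X : Obj KK. \<zeta> X = \<eta> X**xi X) &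
  (ALL \<eta>'. is_nat_trans DD DD \<delta> G \<eta>' & (ALL X : Obj KK. \<zeta> X = \<eta>' X**xi X) --> (ALL X : Obj DD. \<eta>' X = \<eta> X))"
proof -
 note G = is_functor_simps[OF G] functor_iso[OF D.category_axioms D.category_axioms G]
 have zO: "\<zeta> X : Arr DD" "D.dom (\<zeta> X) = gx X" "D.cod (\<zeta> X) = FO G X" if "cx X" for X using z that unfolding nat_trans_K by auto
 have zN: "(\<zeta> Y)**dm (gx X) (gx Y) (%n. FA \<Gamma> (f n)) = FA G (dm X Y f)**(\<zeta> X)" if "cm X Y f" for X Y f using z that unfolding nat_trans_K by blast
 have "ALL X. EX q. cx X --> injcx (fst q) & D.arr (snd q) & D.dom (snd q) = X & D.cod (snd q) = fst q & is_iso DD (snd q) & (EX s. cm X (fst q) s & snd q = dm X (fst q) s)"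
 proof
  fix X show "EX q. cx X --> injcx (fst q) & D.arr (snd q) & D.dom (snd q) = X & D.cod (snd q) = fst q & is_iso DD (snd q) & (EX s. cm X (fst q) s & snd q = dm X (fst q) s)"
  proof (cases "cx X")
   case True
   obtain I s where I: "injcx I" "coqis X I s" by (rule ex_resolution[OF True])
   show ?thesis by (rule exI[of _ "(I, dm X I s)"]) (use I coqis_cm[OF I(2)] dm_iso[OF I(2)] in auto)
  qed simp
 qed
 from choice[OF this] obtain q where q: "!!X. cx X ==> injcx (fst (q X)) & D.arr (snd (q X)) & D.dom (snd (q X)) = X & D.cod (snd (q X)) = fst (q X) & is_iso DD (snd (q X)) &
  (EX s. cm X (fst (q X)) s & snd (q X) = dm X (fst (q X)) s)" by blast
 define I where "I X = fst (q X)" for X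
 define S where "S X = snd (q X)" for X
 have I: "!!X. cx X ==> injcx (I X)" and S: "!!X. cx X ==> D.arr (S X)" "!!X. cx X ==> D.dom (S X) = X" "!!X. cx X ==> D.cod (S X) = I X"
  "!!X. cx X ==> is_iso DD (S X)" "!!X. cx X ==> EX s. cm X (I X) s & S X = dm X (I X) s" using q unfolding I_def S_def by blast+
 \<comment> \<open>\<open>w J\<close> is the composite of \<open>\<zeta> J\<close> with the inverse
   of \<open>xi J\<close>, the only candidate on complexes of injectives.\<close>
 have "EX w. D.arr w & D.dom w = FO \<delta> J & D.cod w = FO G J & w**xi J = \<zeta> J" if J: "injcx J" for J
 proof -
  note c = injcxD(1)[OF J]
  obtain t where t: "D.arr t" "D.dom t = FO \<delta> J" "D.cod t = gx J" "t**xi J = D.idt (gx J)" using D.is_isoE[OF xi_iso[OF J]] xi[OF c] by metis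
  have "((\<zeta> J)**t)**xi J = \<zeta> J" using t xi[OF c] zO[OF c] by simp
  thus ?thesis using t zO[OF c] by (intro exI[of _ "(\<zeta> J)**t"]) simp
 qed
 then obtain w where w: "!!J. injcx J ==> D.arr (w J)" "!!J. injcx J ==> D.dom (w J) = FO \<delta> J" "!!J. injcx J ==> D.cod (w J) = FO G J" "!!J. injcx J ==> w J**xi J = \<zeta> J" by metis
 have "EX e. D.arr e & D.dom e = FO \<delta> X & D.cod e = FO G X & FA G (S X)**e = w (I X)**FA \<delta> (S X)" if X: "cx X" for X
 proof -
  note s = S[OF X] note gs = G(2-4)[OF s(1), unfolded s] and ds = delta(2-4)[OF s(1), unfolded s] and wi = w[OF I[OF X]]
  obtain t where t: "D.arr t" "D.dom t = FO G (I X)" "D.cod t = FO G X" "FA G (S X)**t = D.idt (FO G (I X))" using D.is_isoE[OF G(7)[OF s(4)]] gs by metis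
  have "FA G (S X)**(t**(w (I X)**FA \<delta> (S X))) = (FA G (S X)**t)**(w (I X)**FA \<delta> (S X))" using t(1-3) gs ds wi by simp
  also have "... = w (I X)**FA \<delta> (S X)" unfolding t(4) using ds wi by simp
  finally show ?thesis using t(1-3) ds wi by (intro exI[of _ "t**(w (I X)**FA \<delta> (S X))"]) simp
 qed
 then obtain \<eta> where e: "!!X. cx X ==> D.arr (\<eta> X)" "!!X. cx X ==> D.dom (\<eta> X) = FO \<delta> X" "!!X. cx X ==> D.cod (\<eta> X) = FO G X"
  "!!X. cx X ==> FA G (S X)**\<eta> X = w (I X)**FA \<delta> (S X)" by metis
 have cancel: "p = q" if X: "cx X" and pq: "D.arr p" "D.arr q" "D.cod p = FO G X" "D.cod q = FO G X" "FA G (S X)**p = FA G (S X)**q" for X p q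
  by (rule D.iso_mono_cancel[OF G(7)[OF S(4)[OF X]]]) (use pq G(3)[OF S(1)[OF X]] S(2)[OF X] in simp_all)
 have wN: "w J**FA \<delta> (dm J' J f) = FA G (dm J' J f)**w J'" if J: "injcx J'" "injcx J" and f: "cm J' J f" for J J' f
 proof (rule D.iso_epi_cancel[OF xi_iso[OF J(1)]])
  note c = injcxD(1)[OF J(1)] injcxD(1)[OF J(2)]
  note d = delta(2-4)[of "dm J' J f"] G(2-4)[of "dm J' J f"] and wJ = w(1-3)[OF J(1)] w(1-3)[OF J(2)] and x = xi(1-3)[OF c(1)] xi(1-3)[OF c(2)]
  have "(w J**FA \<delta> (dm J' J f))**xi J' = w J**(xi J**dm (gx J') (gx J) (%n. FA \<Gamma> (f n)))" unfolding xi_natural[OF f] using d wJ x f by simp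
  also have "... = (w J**xi J)**dm (gx J') (gx J) (%n. FA \<Gamma> (f n))" using wJ x gx_cm[OF f] by simp
  also have "... = FA G (dm J' J f)**(w J'**xi J')" unfolding w(4)[OF J(2)] w(4)[OF J(1)] by (rule zN[OF f])
  also have "... = (FA G (dm J' J f)**w J')**xi J'" using d wJ x f by simp
  finally show "(w J**FA \<delta> (dm J' J f))**xi J' = (FA G (dm J' J f)**w J')**xi J'" .
 qed (use delta(2-4)[of "dm J' J f"] G(2-4)[of "dm J' J f"] w(1-3)[OF J(1)] w(1-3)[OF J(2)] xi(1-3)[OF injcxD(1)[OF J(1)]] f in simp_all)
 \<comment> \<open>Naturality for an arbitrary arrow \<open>a\<close> is reduced to
   \<open>wN\<close>: between the chosen resolutions \<open>a\<close> becomes a chain map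
   \<open>f\<close>.\<close>
 have eN: "\<eta> (D.cod a)**FA \<delta> a = FA G a**\<eta> (D.dom a)" if a: "D.arr a" for a
 proof -
  let ?X = "D.dom a" and ?Y = "D.cod a"
  have X: "cx ?X" and Y: "cx ?Y" using D.Dom_Obj[OF a] D.Cod_Obj[OF a] by simp_all
  note sx = S(1-3)[OF X] and sy = S(1-3)[OF Y]
  obtain t where t: "D.arr t" "D.dom t = I ?X" "D.cod t = ?X" "t**S ?X = D.idt ?X" using D.is_isoE[OF S(4)[OF X]] sx by metis
  obtain f where f: "cm (I ?X) (I ?Y) f" "(S ?Y**a)**t = dm (I ?X) (I ?Y) f" by (rule dm_full[OF I[OF Y], of "(S ?Y**a)**t"]) (use sy a t in simp_all)
  let ?b = "dm (I ?X) (I ?Y) f"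
  have bs: "?b**S ?X = S ?Y**a" unfolding f(2)[symmetric] using sx sy a t by simp
  have b: "D.arr ?b" "D.dom ?b = I ?X" "D.cod ?b = I ?Y" using f(1) by simp_all
  note Gb = G(2-4)[OF b(1), unfolded b] and db = delta(2-4)[OF b(1), unfolded b] and Ga = G(2-4)[OF a] and da = delta(2-4)[OF a]
  note Gx = G(2-4)[OF sx(1), unfolded sx] and Gy = G(2-4)[OF sy(1), unfolded sy] and dx = delta(2-4)[OF sx(1), unfolded sx] and dy = delta(2-4)[OF sy(1), unfolded sy]
  note ex = e(1-3)[OF X] and ey = e(1-3)[OF Y] and wx = w(1-3)[OF I[OF X]] and wy = w(1-3)[OF I[OF Y]]
  have db': "FA \<delta> (S ?Y)**FA \<delta> a = FA \<delta> ?b**FA \<delta> (S ?X)" using delta(6)[OF a sy(1)] delta(6)[OF sx(1) b(1)] bs sx sy b a by simp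
  have Gb': "FA G (S ?Y)**FA G a = FA G ?b**FA G (S ?X)" using G(6)[OF a sy(1)] G(6)[OF sx(1) b(1)] bs sx sy b a by simp
  show ?thesis
  proof (rule cancel[OF Y])
   have "FA G (S ?Y)**(\<eta> ?Y**FA \<delta> a) = (FA G (S ?Y)**\<eta> ?Y)**FA \<delta> a" using Gy ey da by simp
   also have "... = w (I ?Y)**(FA \<delta> (S ?Y)**FA \<delta> a)" unfolding e(4)[OF Y] using wy dy da by simp
   also have "... = (w (I ?Y)**FA \<delta> ?b)**FA \<delta> (S ?X)" unfolding db' using wy db dx by simp
   also have "... = FA G ?b**(w (I ?X)**FA \<delta> (S ?X))" unfolding wN[OF I[OF X] I[OF Y] f(1)] using wx Gb dx by simp
   also have "... = (FA G ?b**FA G (S ?X))**\<eta> ?X" unfolding e(4)[OF X, symmetric] using Gb Gx ex by simp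
   also have "... = FA G (S ?Y)**(FA G a**\<eta> ?X)" unfolding Gb'[symmetric] using Gy Ga ex by simp
   finally show "FA G (S ?Y)**(\<eta> ?Y**FA \<delta> a) = FA G (S ?Y)**(FA G a**\<eta> ?X)" .
  qed (use ey da Ga ex in simp_all)
 qed
 have xS: "FA \<delta> (S X)**xi X = xi (I X)**T & FA G (S X)**(\<zeta> X) = (\<zeta> (I X))**T & D.arr T & D.dom T = gx X & D.cod T = gx (I X)"
  if X: "cx X" and s: "cm X (I X) s" "S X = dm X (I X) s" and T: "T = dm (gx X) (gx (I X)) (%n. FA \<Gamma> (s n))" for X s T
  unfolding s(2) T using xi_natural[OF s(1)] zN[OF s(1)] gx_cm[OF s(1)] by simp
 have ez: "\<zeta> X = \<eta> X**xi X" if X: "cx X" for X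
 proof -
  obtain s where s: "cm X (I X) s" "S X = dm X (I X) s" using S(5)[OF X] by blast
  define T where "T = dm (gx X) (gx (I X)) (%n. FA \<Gamma> (s n))"
  note t = xS[OF X s T_def] and cI = injcxD(1)[OF I[OF X]]
  note gs = G(2-4)[OF S(1)[OF X], unfolded S(2,3)[OF X]] and ds = delta(2-4)[OF S(1)[OF X], unfolded S(2,3)[OF X]]
  show ?thesis
  proof (rule cancel[OF X])
   have "FA G (S X)**(\<eta> X**xi X) = (FA G (S X)**\<eta> X)**xi X" using gs e(1-3)[OF X] xi(1-3)[OF X] by simp
   also have "... = w (I X)**(FA \<delta> (S X)**xi X)" unfolding e(4)[OF X] using w(1-3)[OF I[OF X]] ds xi(1-3)[OF X] by simp
   also have "... = (w (I X)**xi (I X))**T" using t w(1-3)[OF I[OF X]] xi(1-3)[OF cI] by simp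
   also have "... = FA G (S X)**(\<zeta> X)" unfolding w(4)[OF I[OF X]] using t by simp
   finally show "FA G (S X)**(\<zeta> X) = FA G (S X)**(\<eta> X**xi X)" by simp
  qed (use zO[OF X] e(1-3)[OF X] xi(1-3)[OF X] in simp_all)
 qed
 have eu: "\<eta>' X = \<eta> X" if n: "is_nat_trans DD DD \<delta> G \<eta>'" and u: "ALL X : Obj KK. \<zeta> X = \<eta>' X**xi X" and X: "cx X" for \<eta>' X
 proof -
  have e': "D.arr (\<eta>' X)" "D.dom (\<eta>' X) = FO \<delta> X" "D.cod (\<eta>' X) = FO G X" if "cx X" for X using n that unfolding is_nat_trans_def by simp_all
  note J = I[OF X] note cJ = injcxD(1)[OF J]
  have "\<eta>' (I X) = w (I X)" by (rule D.iso_epi_cancel[OF xi_iso[OF J]]) (use e'[OF cJ] w[OF J] u cJ xi(1-3)[OF cJ] in simp_all)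
  moreover have "\<eta>' (I X)**FA \<delta> (S X) = FA G (S X)**\<eta>' X" using n S(1-3)[OF X] unfolding is_nat_trans_def by metis
  ultimately have "FA G (S X)**\<eta>' X = FA G (S X)**\<eta> X" unfolding e(4)[OF X] by simp
  thus ?thesis by (rule cancel[OF X e'(1)[OF X] e(1)[OF X] e'(3)[OF X] e(3)[OF X]])
 qed
 have "is_nat_trans DD DD \<delta> G \<eta>" unfolding is_nat_trans_def using e(1-3) eN by simp
 thus ?thesis
 proof (intro exI[of _ \<eta>] conjI allI impI ballI)
  show "\<zeta> X = \<eta> X**xi X" if "X : Obj KK" for X using ez that by simp
  show "\<eta>' X = \<eta> X" if "is_nat_trans DD DD \<delta> G \<eta>' & (ALL X : Obj KK. \<zeta> X = \<eta>' X**xi X)" "X : Obj DD" for \<eta>' X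
   by (rule eu) (use that in auto)
 qed
qed

lemma right_derived: "is_right_derived A \<Gamma> \<delta>"
proof -
 have "is_nat_trans KK DD (Dloc A \<circ>\<^sub>F Kplus_functor A \<Gamma>) (\<delta> \<circ>\<^sub>F Dloc A) xi" unfolding nat_trans_K using xi xi_natural by simp
 moreover have "is_triangle_functor A \<delta>" using alc unfolding abstract_local_cohomology_def by blast
 moreover have "is_functor DD DD G" if "is_triangle_functor A G" for G using that unfolding is_triangle_functor_def is_additive_def by blast
 ultimately show ?thesis unfolding is_right_derived_def Let_def using additive_Gamma right_derived_universal by blast
qed

end

theorem theorem5p7:
  fixes \<kappa> :: "'u rel"
    and A :: "('o, 'm) acat"
    and \<delta> :: "('o, 'm) dfunctor"
  assumes "universe_cardinal \<kappa>"
    and "grothendieck_category \<kappa> A"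
    and "locally_noetherian \<kappa> A"
    and "locally_stable A"
    and "abstract_local_cohomology A \<delta>"
  shows "\<exists>W. is_open_atoms A W \<and>
           (\<exists>R. is_right_derived A (Gamma A W) R \<and>
                nat_isomorphic (Dplus A) (Dplus A) \<delta> R)"
proof -
 have ab: "abelian_category A" using assms(2) unfolding grothendieck_category_def by blast
 obtain \<G> where G: "small \<kappa> \<G>" "is_generating_set A \<G>" "ALL G : \<G>. is_noetherian A G" using assms(3) unfolding locally_noetherian_def by blast
 define \<J> where "\<J> = {J. is_injective A J & in_degree_0 A J : Ker_obj A \<delta>}"
 interpret abelian_category A by (rule ab)
 interpret abstract_lc A \<kappa> \<G> \<J> \<delta> by unfold_locales (use assms G noethI \<J>_def in auto)
 \<comment> \<open>The derived functor that is exhibited is \<open>\<delta>\<close> itself, so the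
   identity transformation is the required isomorphism.\<close>
 have "is_nat_iso DD DD \<delta> \<delta> (%X. Idt DD (FO \<delta> X))"
  unfolding is_nat_iso_def is_nat_trans_def using delta D.is_iso_Idt by simp
 thus ?thesis using open_atoms right_derived unfolding nat_isomorphic_def by blast
qed

end
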